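(* Let $1<p<\infty$ and assume conditions (H1)–(H6) listed in the context. Suppose that $u\in QW^{1,p}(\Omega)$ is a weak solution (in the sense of the context) of $$-\mathrm{div}\left(h\,|\sqrt{Q}\nabla u|^{p-2}Q\nabla u\right)=m|f|^{p-2}f ,$$ where $|f|^{p-1}\in M_p'(\Omega)$ and $f\in L^{p-\frac{p(k-1)}{pk-1}}_{\mathrm{loc}}(\Omega,d\nu)$, with $k>1$ the constant in (H5). Then there exists a constant $C>0$ such that for every metric ball $B_r$ of radius $r$ with $8B_r\Subset\Omega$ one has $$\|u\|_{L^\infty(B_{\tau r})}\leq C\, e^{\frac{\gamma k}{k-1}M_1}\left(r^{p(1-\gamma)}\frac{\nu(B_{r})}{\mu(B_{r})}\right)^{\frac{k}{p(k-1)}}\left(\left(\frac{1}{\nu(B_r)}\int_{B_r}|u|^p\,d\nu\right)^{\frac1p}+\left(\Phi_{|f|^{p-1}}(r)\right)^{\frac{1}{p-1}}\right),$$ where $B_{\tau r}=\tau B_r$, $\gamma$ and $\tau$ are the constants in (H6), and $M_1>0$ is any constant satisfying $$\int_0^{r}\frac{\left(\Phi_{|f|^{p-1}}(s)\right)^{\frac{1}{p-1}}}{s}\,ds\leq M_1\left(\Phi_{|f|^{p-1}}(r)\right)^{\frac{1}{p-1}}.$$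
   Context: **Setting.** $\Omega\subset\mathbb R^n$ is a bounded domain endowed with a metric $\rho$ generating a topology equivalent to the Euclidean one. $B(x,r)=B_r(x)=\{y\in\Omega:\rho(x,y)<r\}$ is the metric ball; a ball $B$ comes with a centre and radius $r(B)$, and for $c>0$, $cB$ is the ball with the same centre and radius $c\,r(B)$. $A\Subset\Omega$ means that the Euclidean closure of $A$ is a compact subset of $\Omega$. $h,m$ are non negative weights in $L^1_{\mathrm{loc}}(\mathbb R^n)$, $d\mu=h\,dx$, $d\nu=m\,dx$. $Q:\Omega\to S_n$ is a $\mu$-measurable map into the set $S_n$ of non negative definite symmetric $n\times n$ matrices, and $v=\|Q(x)\|_{op}^{p/2}\in L^1_{\mathrm{loc}}(\Omega;\mu)$, where $\|Q(x)\|_{op}=\sup_{|\xi|=1}\langle\xi,Q(x)\xi\rangle$. $Lip_{\mathrm{loc}}(\Omega)$ is the set of locally Lipschitz functions on $\Omega$, and $Lip_0(A)$ the set of Lipschitz functions compactly supported in $A$. For a ball $B$, $u_B=\frac1{\nu(B)}\int_B u\,d\nu$. **Assumptions.** - (H1) For all $x,y\in\Omega$ there is a continuous curve $\gamma:I\subset\mathbb R\to\Omega$ connecting $x$ and $y$ with $\rho(\gamma(s),\gamma(t))=|s-t|$ for all $s,t\in I$. - (H2) There are constants $A_\nu,A_\mu>0$ such that $\nu(2B)\le A_\nu\nu(B)$ and $\mu(2B)\le A_\mu\mu(B)$ for all balls with $2B\Subset\Omega$. Moreover there is $C>0$ such that $\mu(B)\ge C\frac{r(B)}{r(\tilde B)}\mu(\tilde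 B)$ for all balls $\tilde B\subset B\Subset\Omega$. - (H3) $\mu\ll\nu$; $\nu(E)>0$ for every Lebesgue measurable $E\subset\Omega$ of positive Lebesgue measure; and there is $C>0$ with $\int_E v\,d\mu\le C\int_E d\nu$ for every compact $E\subset\Omega$. - (H4) There is $C_0>0$ such that for every ball $B\Subset\Omega$ and every $u\in Lip_{\mathrm{loc}}(\Omega)$, $\frac1{\nu(B)}\int_B|u-u_B|\,d\nu\le C_0\frac{r(B)}{\mu(B)}\int_B|\sqrt Q\nabla u|\,d\mu$. - (H5) For any $p\ge1$ there are constants $C_1>0$, $k>1$ such that for every ball $B\Subset\Omega$ and every $u\in Lip_0(B)$, $\left(\frac1{\nu(B)}\int_B|u|^{kp}d\nu\right)^{\frac1{kp}}\le C_1r(B)\left(\frac1{\mu(B)}\int_B|\sqrt Q\nabla u|^pd\mu\right)^{\frac1p}$. ($k$ denotes the constant corresponding to the fixed $p$.) - (H6) There are constants $\gamma,\tilde C>0$, $T\ge1$, $0<\tau<1$ such that for every ball $B=B(x,r)\Subset\Omega$ there is a sequence $\varphi_j\in Lip_0(B)$ with, for all $j\in\mathbb N$: (1) $0\le\varphi_j\le1$; (2) $\varphi_j=1$ on $\tau B$; (3) $\operatorname{supp}\varphi_{j+1}\subset\{y\in B:\varphi_j(y)=1\}$; (4) $\left\|\,|\sqrt Q\nabla\varphi_j|/v^{1/p}\right\|_\infty\le\tilde CT^j/r^\gamma$. **Degenerate Sobolev spaces.** $QW^{1,p}(\Omega)$ and $QW^{1,p}_0(\Omega)$ are the completions of $Lip_{\mathrm{loc}}(\Omega)$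 (its elements of finite norm) and $Lip_0(\Omega)$ with respect to $\|u\|_{QW^{1,p}(\Omega)}=\left(\int_\Omega|u|^pd\nu\right)^{1/p}+\left(\int_\Omega|\sqrt Q\nabla u|^pd\mu\right)^{1/p}$. Elements are identified with pairs $(u,\vec g)\in L^p_\nu(\Omega)\times\mathcal L^p_\mu(Q;\Omega)$, where $\mathcal L^p_\mu(Q;\Omega)$ is the space of measurable vector functions with $\int_\Omega|\sqrt Q\,\vec g|^pd\mu<\infty$ (identified when $\sqrt Q\,\vec g$ agree $\mu$-a.e.); the pair is often written $u$, and $\vec g$ is written $\nabla u$. **Weak solution.** $(u,\vec g)\in QW^{1,p}(\Omega)$ is a solution if for every $\phi\in Lip_0(\Omega)$, $\int_\Omega|\sqrt Q\,\vec g|^{p-2}\nabla\phi\cdot Q\,\vec g\;h\,dx+\int_\Omega|f|^{p-2}f\phi\;m\,dx=0$. **Stummel–Kato classes.** For $V\in L^1_{\mathrm{loc}}(\Omega)$, $p>1$, $r>0$ put $$\Phi_V(r)=\sup_{x\in\Omega}\left(\int_{B(x,r)}\frac{\rho(x,y)}{\mu(B(x,\rho(x,y)))}\left(\int_{B(x,r)}|V(z)|\frac{\rho(z,y)}{\mu(B(z,\rho(z,y)))}\,d\nu(z)\right)^{\frac1{p-1}}d\mu(y)\right)^{p-1}.$$ $V\in\tilde M_p(\Omega)$ if $\Phi_V(r)<\infty$ for every $r>0$; $V\in M_p(\Omega)$ if moreover $\lim_{r\to0^+}\Phi_V(r)=0$; $V\in M_p'(\Omega)$ if moreover $\int_0^{R}\frac{(\Phi_V(r))^{1/(p-1)}}{r}\,dr<\infty$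 for some $R>0$. *)

theory Defs
  imports "HOL-Analysis.Analysis" "HOL-Probability.Essential_Supremum"
begin

text \<open>
  Conventions. Functions on \<open>\<Omega>\<close> are total functions of which only the values on \<open>\<Omega>\<close> matter, and
  the metric \<open>\<rho>\<close> is only evaluated on \<open>\<Omega>\<close>. Quantities that are nonnegative and possibly infinite
  are kept in \<^typ>\<open>ennreal\<close>, so that no integral is silently replaced by \<open>0\<close>.
\<close>

subsection \<open>Extended nonnegative reals, matrices, gradients\<close>

text \<open>Only used with exponents \<open>a > 0\<close>, where \<open>\<infinity>\<^sup>a = \<infinity>\<close> and \<open>0\<^sup>a = 0\<close>.\<close>

definition enn_powr :: "ennreal \<Rightarrow> real \<Rightarrow> ennreal" where
  "enn_powr x a = (if x = top then top else ennreal (enn2real x powr a))"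

definition psd_matrix :: "real^'n^'n \<Rightarrow> bool" where
  "psd_matrix A \<longleftrightarrow> transpose A = A \<and> (\<forall>\<xi>. 0 \<le> \<xi> \<bullet> (A *v \<xi>))"

definition matrix_sqrt :: "real^'n^'n \<Rightarrow> real^'n^'n" where
  "matrix_sqrt A = (THE S. psd_matrix S \<and> S ** S = A)"

definition op_norm :: "real^'n^'n \<Rightarrow> real" where
  "op_norm A = (SUP \<xi>\<in>{\<xi>. norm \<xi> = 1}. \<xi> \<bullet> (A *v \<xi>))"

definition grad :: "(real^'n \<Rightarrow> real) \<Rightarrow> real^'n \<Rightarrow> real^'n" where
  "grad u x = (THE D. GDERIV u x :> D)"

definition degen_weight :: "real \<Rightarrow> (real^'n \<Rightarrow> real^'n^'n) \<Rightarrow> real^'n \<Rightarrow> real" where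
  "degen_weight p Q x = op_norm (Q x) powr (p / 2)"

subsection \<open>Measures and function classes\<close>

text \<open>
  The measure \<open>w dx\<close> on \<open>\<Omega>\<close>. It is completed because a function that is arbitrary on the set
  \<open>{w = 0}\<close> still counts as measurable with respect to \<open>w dx\<close>.
\<close>

definition weighted_measure :: "(real^'n) set \<Rightarrow> (real^'n \<Rightarrow> real) \<Rightarrow> (real^'n) measure" where
  "weighted_measure \<Omega> w = completion (density (lebesgue_on \<Omega>) (\<lambda>x. ennreal (w x)))"

definition L1_loc :: "(real^'n) measure \<Rightarrow> (real^'n) set \<Rightarrow> (real^'n \<Rightarrow> real) \<Rightarrow> bool" where
  "L1_loc M \<Omega> f \<longleftrightarrow> (\<forall>K. compact K \<and> K \<subseteq> \<Omega> \<longrightarrow> set_integrable M K f)"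

definition Lp_loc :: "(real^'n) measure \<Rightarrow> (real^'n) set \<Rightarrow> real \<Rightarrow> (real^'n \<Rightarrow> real) \<Rightarrow> bool" where
  "Lp_loc M \<Omega> s f \<longleftrightarrow> f \<in> borel_measurable M \<and>
     (\<forall>K. compact K \<and> K \<subseteq> \<Omega> \<longrightarrow> set_integrable M K (\<lambda>x. \<bar>f x\<bar> powr s))"

definition compactly_in :: "(real^'n) set \<Rightarrow> (real^'n) set \<Rightarrow> bool" (infix \<open>\<Subset>\<close> 50) where
  "A \<Subset> \<Omega> \<longleftrightarrow> compact (closure A) \<and> closure A \<subseteq> \<Omega>"

text \<open>Lipschitz continuity refers to the Euclidean distance (as needed for gradients to exist a.e.).\<close>

definition Lip_loc :: "(real^'n) set \<Rightarrow> (real^'n \<Rightarrow> real) set" where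
  "Lip_loc \<Omega> = {u. \<forall>x\<in>\<Omega>. \<exists>d>0. \<exists>L. L-lipschitz_on (ball x d \<inter> \<Omega>) u}"

definition support_in :: "(real^'n) set \<Rightarrow> (real^'n \<Rightarrow> real) \<Rightarrow> (real^'n) set" where
  "support_in \<Omega> u = closure {x\<in>\<Omega>. u x \<noteq> 0}"

definition Lip_0 :: "(real^'n) set \<Rightarrow> (real^'n) set \<Rightarrow> (real^'n \<Rightarrow> real) set" where
  "Lip_0 \<Omega> A = {u. (\<exists>L. L-lipschitz_on \<Omega> u) \<and> compact (support_in \<Omega> u) \<and> support_in \<Omega> u \<subseteq> A}"

subsection \<open>Structural hypotheses\<close>

abbreviation mB :: "(real^'n) set \<Rightarrow> (real^'n \<Rightarrow> real^'n \<Rightarrow> real) \<Rightarrow> real^'n \<Rightarrow> real \<Rightarrow> (real^'n) set" where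
  "mB \<Omega> \<rho> x r \<equiv> Metric_space.mball \<Omega> \<rho> x r"

definition geodesic_hyp :: "(real^'n) set \<Rightarrow> (real^'n \<Rightarrow> real^'n \<Rightarrow> real) \<Rightarrow> bool" where
  "geodesic_hyp \<Omega> \<rho> \<longleftrightarrow>
     (\<forall>x\<in>\<Omega>. \<forall>y\<in>\<Omega>. \<exists>a b. \<exists>c :: real \<Rightarrow> real^'n. a \<le> b \<and> continuous_on {a..b} c \<and> c ` {a..b} \<subseteq> \<Omega> \<and>
        c a = x \<and> c b = y \<and> (\<forall>s\<in>{a..b}. \<forall>t\<in>{a..b}. \<rho> (c s) (c t) = \<bar>s - t\<bar>))"

definition doubling_hyp ::
  "(real^'n) set \<Rightarrow> (real^'n \<Rightarrow> real^'n \<Rightarrow> real) \<Rightarrow> (real^'n) measure \<Rightarrow> (real^'n) measure \<Rightarrow> bool" where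
  "doubling_hyp \<Omega> \<rho> \<mu> \<nu> \<longleftrightarrow>
     (\<exists>A\<^sub>\<nu>>0. \<exists>A\<^sub>\<mu>>0. \<forall>x\<in>\<Omega>. \<forall>r>0. mB \<Omega> \<rho> x (2 * r) \<Subset> \<Omega> \<longrightarrow>
        emeasure \<nu> (mB \<Omega> \<rho> x (2 * r)) \<le> ennreal A\<^sub>\<nu> * emeasure \<nu> (mB \<Omega> \<rho> x r) \<and>
        emeasure \<mu> (mB \<Omega> \<rho> x (2 * r)) \<le> ennreal A\<^sub>\<mu> * emeasure \<mu> (mB \<Omega> \<rho> x r)) \<and>
     (\<exists>C>0. \<forall>x\<in>\<Omega>. \<forall>r>0. \<forall>x'\<in>\<Omega>. \<forall>r'>0.
        mB \<Omega> \<rho> x' r' \<subseteq> mB \<Omega> \<rho> x r \<and> mB \<Omega> \<rho> x r \<Subset> \<Omega> \<longrightarrow>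
        emeasure \<mu> (mB \<Omega> \<rho> x r) \<ge> ennreal (C * (r / r')) * emeasure \<mu> (mB \<Omega> \<rho> x' r'))"

definition weights_hyp ::
  "(real^'n) set \<Rightarrow> (real^'n) measure \<Rightarrow> (real^'n) measure \<Rightarrow> (real^'n \<Rightarrow> real^'n^'n) \<Rightarrow> real \<Rightarrow> bool" where
  "weights_hyp \<Omega> \<mu> \<nu> Q p \<longleftrightarrow>
     absolutely_continuous \<nu> \<mu> \<and>
     (\<forall>E. E \<in> sets lebesgue \<and> E \<subseteq> \<Omega> \<and> emeasure lebesgue E > 0 \<longrightarrow> emeasure \<nu> E > 0) \<and>
     (\<exists>C>0. \<forall>E. compact E \<and> E \<subseteq> \<Omega> \<longrightarrow>
        (\<integral>\<^sup>+x\<in>E. ennreal (degen_weight p Q x) \<partial>\<mu>) \<le> ennreal C * emeasure \<nu> E)"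

definition average :: "(real^'n) measure \<Rightarrow> (real^'n) set \<Rightarrow> (real^'n \<Rightarrow> real) \<Rightarrow> real" where
  "average \<nu> B u = (1 / measure \<nu> B) * (LINT x:B|\<nu>. u x)"

definition poincare_hyp ::
  "(real^'n) set \<Rightarrow> (real^'n \<Rightarrow> real^'n \<Rightarrow> real) \<Rightarrow> (real^'n) measure \<Rightarrow> (real^'n) measure \<Rightarrow>
   (real^'n \<Rightarrow> real^'n^'n) \<Rightarrow> bool" where
  "poincare_hyp \<Omega> \<rho> \<mu> \<nu> Q \<longleftrightarrow>
     (\<exists>C0>0. \<forall>x\<in>\<Omega>. \<forall>r>0. mB \<Omega> \<rho> x r \<Subset> \<Omega> \<longrightarrow> (\<forall>u\<in>Lip_loc \<Omega>.
        (\<integral>\<^sup>+y\<in>mB \<Omega> \<rho> x r. ennreal \<bar>u y - average \<nu> (mB \<Omega> \<rho> x r) u\<bar> \<partial>\<nu>) / emeasure \<nu> (mB \<Omega> \<rho> x r)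
        \<le> ennreal C0 * (ennreal r / emeasure \<mu> (mB \<Omega> \<rho> x r)) *
           (\<integral>\<^sup>+y\<in>mB \<Omega> \<rho> x r. ennreal (norm (matrix_sqrt (Q y) *v grad u y)) \<partial>\<mu>)))"

definition sobolev_ineq ::
  "(real^'n) set \<Rightarrow> (real^'n \<Rightarrow> real^'n \<Rightarrow> real) \<Rightarrow> (real^'n) measure \<Rightarrow> (real^'n) measure \<Rightarrow>
   (real^'n \<Rightarrow> real^'n^'n) \<Rightarrow> real \<Rightarrow> real \<Rightarrow> real \<Rightarrow> bool" where
  "sobolev_ineq \<Omega> \<rho> \<mu> \<nu> Q q k C1 \<longleftrightarrow>
     (\<forall>x\<in>\<Omega>. \<forall>r>0. mB \<Omega> \<rho> x r \<Subset> \<Omega> \<longrightarrow> (\<forall>u\<in>Lip_0 \<Omega> (mB \<Omega> \<rho> x r).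
        enn_powr ((\<integral>\<^sup>+y\<in>mB \<Omega> \<rho> x r. ennreal (\<bar>u y\<bar> powr (k * q)) \<partial>\<nu>) / emeasure \<nu> (mB \<Omega> \<rho> x r)) (1 / (k * q))
        \<le> ennreal (C1 * r) *
           enn_powr ((\<integral>\<^sup>+y\<in>mB \<Omega> \<rho> x r. ennreal (norm (matrix_sqrt (Q y) *v grad u y) powr q) \<partial>\<mu>)
                       / emeasure \<mu> (mB \<Omega> \<rho> x r)) (1 / q)))"

definition sobolev_hyp ::
  "(real^'n) set \<Rightarrow> (real^'n \<Rightarrow> real^'n \<Rightarrow> real) \<Rightarrow> (real^'n) measure \<Rightarrow> (real^'n) measure \<Rightarrow>
   (real^'n \<Rightarrow> real^'n^'n) \<Rightarrow> bool" where
  "sobolev_hyp \<Omega> \<rho> \<mu> \<nu> Q \<longleftrightarrow> (\<forall>q\<ge>1. \<exists>C1>0. \<exists>k>1. sobolev_ineq \<Omega> \<rho> \<mu> \<nu> Q q k C1)"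

text \<open>
  The \<open>L\<^sup>\<infinity>\<close> norm below is taken with respect to \<open>\<mu>\<close>. Where the weight in the denominator vanishes,
  so does \<open>Q\<close>, and the quotient is read as \<open>0\<close>.
\<close>

definition cutoff_hyp ::
  "(real^'n) set \<Rightarrow> (real^'n \<Rightarrow> real^'n \<Rightarrow> real) \<Rightarrow> (real^'n) measure \<Rightarrow>
   (real^'n \<Rightarrow> real^'n^'n) \<Rightarrow> real \<Rightarrow> real \<Rightarrow> real \<Rightarrow> bool" where
  "cutoff_hyp \<Omega> \<rho> \<mu> Q p \<gamma> \<tau> \<longleftrightarrow>
     \<gamma> > 0 \<and> 0 < \<tau> \<and> \<tau> < 1 \<and>
     (\<exists>C>0. \<exists>T\<ge>1. \<forall>x\<in>\<Omega>. \<forall>r>0. mB \<Omega> \<rho> x r \<Subset> \<Omega> \<longrightarrow>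
        (\<exists>\<phi> :: nat \<Rightarrow> real^'n \<Rightarrow> real. \<forall>j.
           \<phi> j \<in> Lip_0 \<Omega> (mB \<Omega> \<rho> x r) \<and>
           (\<forall>y\<in>\<Omega>. 0 \<le> \<phi> j y \<and> \<phi> j y \<le> 1) \<and>
           (\<forall>y\<in>mB \<Omega> \<rho> x (\<tau> * r). \<phi> j y = 1) \<and>
           support_in \<Omega> (\<phi> (Suc j)) \<subseteq> {y\<in>mB \<Omega> \<rho> x r. \<phi> j y = 1} \<and>
           esssup \<mu> (\<lambda>y. ennreal (norm (matrix_sqrt (Q y) *v grad (\<phi> j) y)
                                      / degen_weight p Q y powr (1 / p)))
             \<le> ennreal (C * T ^ j / r powr \<gamma>)))"

subsection \<open>Degenerate Sobolev space and weak solutions\<close>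

definition QW_norm ::
  "(real^'n) measure \<Rightarrow> (real^'n) measure \<Rightarrow> (real^'n \<Rightarrow> real^'n^'n) \<Rightarrow> real \<Rightarrow>
   (real^'n \<Rightarrow> real) \<Rightarrow> (real^'n \<Rightarrow> real^'n) \<Rightarrow> ennreal" where
  "QW_norm \<mu> \<nu> Q p u g =
     enn_powr (\<integral>\<^sup>+x. ennreal (\<bar>u x\<bar> powr p) \<partial>\<nu>) (1 / p) +
     enn_powr (\<integral>\<^sup>+x. ennreal (norm (matrix_sqrt (Q x) *v g x) powr p) \<partial>\<mu>) (1 / p)"

text \<open>
  The completion is realised inside the Banach space of pairs \<open>(u, g)\<close>, as the set of limits of
  pairs \<open>(w, grad w)\<close> with \<open>w\<close> locally Lipschitz and of finite norm.
\<close>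

definition QW :: "(real^'n) set \<Rightarrow> (real^'n) measure \<Rightarrow> (real^'n) measure \<Rightarrow>
   (real^'n \<Rightarrow> real^'n^'n) \<Rightarrow> real \<Rightarrow> ((real^'n \<Rightarrow> real) \<times> (real^'n \<Rightarrow> real^'n)) set" where
  "QW \<Omega> \<mu> \<nu> Q p = {(u, g).
     u \<in> borel_measurable \<nu> \<and> g \<in> borel_measurable \<mu> \<and> QW_norm \<mu> \<nu> Q p u g < top \<and>
     (\<exists>w :: nat \<Rightarrow> real^'n \<Rightarrow> real.
        (\<forall>j. w j \<in> Lip_loc \<Omega> \<and> QW_norm \<mu> \<nu> Q p (w j) (grad (w j)) < top) \<and>
        (\<lambda>j. QW_norm \<mu> \<nu> Q p (\<lambda>x. w j x - u x) (\<lambda>x. grad (w j) x - g x)) \<longlonglongrightarrow> 0)}"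

text \<open>
  The integrability clauses make explicit that both integrals exist; a Bochner integral of a
  nonintegrable function would be \<open>0\<close> by convention.
\<close>

definition weak_solution ::
  "(real^'n) set \<Rightarrow> (real^'n) measure \<Rightarrow> (real^'n) measure \<Rightarrow> (real^'n \<Rightarrow> real^'n^'n) \<Rightarrow> real \<Rightarrow>
   (real^'n \<Rightarrow> real) \<Rightarrow> (real^'n \<Rightarrow> real) \<Rightarrow> (real^'n \<Rightarrow> real^'n) \<Rightarrow> bool" where
  "weak_solution \<Omega> \<mu> \<nu> Q p f u g \<longleftrightarrow>
     (u, g) \<in> QW \<Omega> \<mu> \<nu> Q p \<and>
     (\<forall>\<phi>\<in>Lip_0 \<Omega> \<Omega>.
        integrable \<mu> (\<lambda>x. norm (matrix_sqrt (Q x) *v g x) powr (p - 2) * (grad \<phi> x \<bullet> (Q x *v g x))) \<and>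
        integrable \<nu> (\<lambda>x. \<bar>f x\<bar> powr (p - 2) * f x * \<phi> x) \<and>
        (LINT x|\<mu>. norm (matrix_sqrt (Q x) *v g x) powr (p - 2) * (grad \<phi> x \<bullet> (Q x *v g x))) +
        (LINT x|\<nu>. \<bar>f x\<bar> powr (p - 2) * f x * \<phi> x) = 0)"

subsection \<open>Stummel--Kato classes\<close>

text \<open>At \<open>x = y\<close> the kernel is \<open>0 / 0 = 0\<close>; this only concerns a null set.\<close>

definition SK_kernel ::
  "(real^'n) set \<Rightarrow> (real^'n \<Rightarrow> real^'n \<Rightarrow> real) \<Rightarrow> (real^'n) measure \<Rightarrow> real^'n \<Rightarrow> real^'n \<Rightarrow> ennreal" where
  "SK_kernel \<Omega> \<rho> \<mu> x y = ennreal (\<rho> x y) / emeasure \<mu> (mB \<Omega> \<rho> x (\<rho> x y))"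

definition SK_Phi ::
  "(real^'n) set \<Rightarrow> (real^'n \<Rightarrow> real^'n \<Rightarrow> real) \<Rightarrow> (real^'n) measure \<Rightarrow> (real^'n) measure \<Rightarrow> real \<Rightarrow>
   (real^'n \<Rightarrow> real) \<Rightarrow> real \<Rightarrow> ennreal" where
  "SK_Phi \<Omega> \<rho> \<mu> \<nu> p V r =
     (SUP x\<in>\<Omega>. enn_powr
        (\<integral>\<^sup>+y\<in>mB \<Omega> \<rho> x r. SK_kernel \<Omega> \<rho> \<mu> x y *
            enn_powr (\<integral>\<^sup>+z\<in>mB \<Omega> \<rho> x r. ennreal \<bar>V z\<bar> * SK_kernel \<Omega> \<rho> \<mu> z y \<partial>\<nu>) (1 / (p - 1)) \<partial>\<mu>)
        (p - 1))"

definition SK_M_tilde ::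
  "(real^'n) set \<Rightarrow> (real^'n \<Rightarrow> real^'n \<Rightarrow> real) \<Rightarrow> (real^'n) measure \<Rightarrow> (real^'n) measure \<Rightarrow> real \<Rightarrow>
   (real^'n \<Rightarrow> real) set" where
  "SK_M_tilde \<Omega> \<rho> \<mu> \<nu> p = {V. L1_loc lebesgue \<Omega> V \<and> (\<forall>r>0. SK_Phi \<Omega> \<rho> \<mu> \<nu> p V r < top)}"

definition SK_M ::
  "(real^'n) set \<Rightarrow> (real^'n \<Rightarrow> real^'n \<Rightarrow> real) \<Rightarrow> (real^'n) measure \<Rightarrow> (real^'n) measure \<Rightarrow> real \<Rightarrow>
   (real^'n \<Rightarrow> real) set" where
  "SK_M \<Omega> \<rho> \<mu> \<nu> p = {V \<in> SK_M_tilde \<Omega> \<rho> \<mu> \<nu> p. (SK_Phi \<Omega> \<rho> \<mu> \<nu> p V \<longlongrightarrow> 0) (at_right 0)}"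

definition SK_Dini ::
  "(real^'n) set \<Rightarrow> (real^'n \<Rightarrow> real^'n \<Rightarrow> real) \<Rightarrow> (real^'n) measure \<Rightarrow> (real^'n) measure \<Rightarrow> real \<Rightarrow>
   (real^'n \<Rightarrow> real) \<Rightarrow> real \<Rightarrow> ennreal" where
  "SK_Dini \<Omega> \<rho> \<mu> \<nu> p V r =
     (\<integral>\<^sup>+s\<in>{0<..<r}. enn_powr (SK_Phi \<Omega> \<rho> \<mu> \<nu> p V s) (1 / (p - 1)) / ennreal s \<partial>lborel)"

definition SK_M' ::
  "(real^'n) set \<Rightarrow> (real^'n \<Rightarrow> real^'n \<Rightarrow> real) \<Rightarrow> (real^'n) measure \<Rightarrow> (real^'n) measure \<Rightarrow> real \<Rightarrow>
   (real^'n \<Rightarrow> real) set" where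
  "SK_M' \<Omega> \<rho> \<mu> \<nu> p = {V \<in> SK_M \<Omega> \<rho> \<mu> \<nu> p. \<exists>R>0. SK_Dini \<Omega> \<rho> \<mu> \<nu> p V R < top}"

end

theory Submission
  imports Defs
begin

text \<open>
  Write \<open>V = \<bar>f\<bar>\<^sup>p\<^sup>-\<^sup>1\<close> and let \<open>\<Phi>(s)\<close> be the root of order \<open>p - 1\<close> of the Stummel modulus of
  \<open>V\<close> at scale \<open>s\<close>. The bound comes from Moser's iteration applied to powers of \<open>\<bar>u\<bar> + \<kappa>\<close>, where \<open>\<kappa>\<close> is
  a multiple of \<open>\<Phi>(r)\<close> (plus a positive number that tends to \<open>0\<close> at the end). What has to be
  explained is why the right hand side of the equation does not destroy the iteration, and where the
  exponential factor comes from.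

  The right hand side is controlled by an inequality of Fefferman type. If \<open>w\<close> is a Lipschitz function supported
  in a ball of radius \<open>\<epsilon>\<close>, the Poincare inequality along a chain of balls that shrink towards a point
  \<open>z\<close> bounds \<open>\<bar>w z\<bar>\<close> by the potential of \<open>\<bar>\<surd>Q \<nabla>w\<bar>\<close> for exactly the kernel that occurs in the
  modulus (lemma \<open>subrepresentation\<close>). Inserting this into \<open>\<integral> V \<bar>w\<bar>\<^sup>p d\<nu>\<close> and exchanging the integrals
  gives \<open>\<integral> V \<bar>w\<bar>\<^sup>p d\<nu> \<le> C \<Phi>(2\<epsilon>)\<^sup>p\<^sup>-\<^sup>1 \<integral> \<bar>\<surd>Q \<nabla>w\<bar>\<^sup>p d\<mu>\<close> (lemma \<open>fefferman\<close>). Cutting a function on a large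
  ball into pieces of size \<open>\<epsilon>\<close> with the cutoff functions adds the lower order term
  \<open>\<epsilon>\<close> to the power \<open>-\<gamma>p\<close> times \<open>\<integral> \<bar>w\<bar>\<^sup>p d\<nu>\<close> (lemma \<open>fefferman_error\<close>). So the energy term has a small factor as soon as
  \<open>\<epsilon>\<close> is small, and the price is a power of \<open>1/\<epsilon>\<close>.

  The test functions of the iteration are not Lipschitz, because \<open>u\<close> is only a limit of Lipschitz
  functions. They are limits in the same sense, and the Sobolev inequality, the inequality above and
  the weak formulation all pass to such limits (lemmas \<open>limit_seq_compose\<close>, \<open>sobolev_limit\<close>,
  \<open>fefferman_limit\<close>, \<open>weak_limit\<close>). Testing the equation with \<open>\<eta>\<^sup>p G(u)\<close>, where \<open>G\<close> belongs to a truncated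
  power, and applying the Sobolev inequality to \<open>\<eta> F(u)\<close> yields a reverse Hoelder inequality between
  the exponents \<open>\<alpha> p\<close> and \<open>\<alpha> p k\<close> (lemma \<open>moser_step\<close>), provided that \<open>\<alpha> \<Phi>(2\<epsilon>) / \<kappa>\<close> is small.

  For \<open>\<alpha> = k\<^sup>j\<close> this forces a scale \<open>\<epsilon>\<^sub>j\<close> with \<open>\<Phi>(2\<epsilon>\<^sub>j) \<le> k\<^sup>-\<^sup>j \<Phi>(r)\<close>. The resulting factor is the product over \<open>j\<close> of the
  numbers \<open>r / \<epsilon>\<^sub>j\<close> to the powers \<open>\<gamma> k\<^sup>-\<^sup>j\<close>, and the Dini integral of \<open>\<Phi>\<close> bounds
  \<open>\<Sum>\<^sub>j k\<^sup>-\<^sup>j ln (r / \<epsilon>\<^sub>j)\<close> by \<open>k/(k - 1) M\<^sub>1\<close> up to an additive constant (lemma \<open>dini_scales\<close>). This is the exponential factor.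
  The factor \<open>r\<^sup>p\<^sup>(\<^sup>1\<^sup>-\<^sup>\<gamma>\<^sup>) \<nu>(B)/\<mu>(B)\<close> occurs in step \<open>j\<close> with the exponent \<open>k\<^sup>-\<^sup>j / p\<close>, and these exponents add up to
  \<open>k/(p (k - 1))\<close>. Letting the exponents tend to infinity gives the supremum (lemmas
  \<open>ball_estimate\<close> and \<open>local_bound\<close>).

  Two facts of independent interest are used throughout. Lipschitz functions are differentiable
  almost everywhere (theorem \<open>rademacher_grad\<close>), so that gradients make sense; and non-negative
  definite matrices have unique non-negative definite square roots (lemma \<open>matrix_sqrt\<close>), so that
  \<open>\<bar>\<surd>Q \<xi>\<bar>\<^sup>2 = \<xi> \<bullet> Q \<xi>\<close>.
\<close>

section \<open>Directional derivatives of Lipschitz functions\<close>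

text \<open>
  The Stieltjes measures of \<open>g\<close> and of \<open>L x - g x\<close> add up to
  \<open>L\<close> times Lebesgue measure, since the sum has the right values on intervals.
\<close>

lemma interval_measure_le_lborel:
  fixes g :: "real \<Rightarrow> real"
  assumes mono: "\<And>x y. x \<le> y \<Longrightarrow> g x \<le> g y"
    and lip: "\<And>x y. x \<le> y \<Longrightarrow> g y - g x \<le> L * (y - x)" and "A \<in> sets borel"
  shows "emeasure (interval_measure g) A \<le> ennreal L * emeasure lborel A"
proof -
  have L: "L \<ge> 0" using mono[of 0 1] lip[of 0 1] by simp
  have lip': "\<bar>g y - g x\<bar> \<le> L * \<bar>y - x\<bar>" for x y
    using lip[of x y] lip[of y x] mono[of x y] mono[of y x] by (cases "x \<le> y") auto
  have cont: "isCont g x" for x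
  proof -
    have "L-lipschitz_on UNIV g" by (rule lipschitz_onI) (use lip' L in \<open>auto simp: dist_real_def\<close>)
    then show ?thesis
      using lipschitz_on_continuous_on continuous_on_eq_continuous_at by blast
  qed
  define g2 where "g2 x = L * x - g x" for x
  have cont2: "isCont g2 x" for x unfolding g2_def by (intro continuous_intros cont)
  let ?P = "interval_measure g" and ?P2 = "interval_measure g2"
  have P: "emeasure ?P {a<..b} = (if a \<le> b then g b - g a else 0)" for a b
    by (intro emeasure_interval_measure_Ioc_eq) (auto intro: mono continuous_at_imp_continuous_at_within cont)
  have P2: "emeasure ?P2 {a<..b} = (if a \<le> b then g2 b - g2 a else 0)" for a b
    by (intro emeasure_interval_measure_Ioc_eq)
      (auto intro: continuous_at_imp_continuous_at_within cont2 dest: lip simp: g2_def algebra_simps)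
  define Q where "Q = measure_of UNIV (sets borel) (\<lambda>A. emeasure ?P A + emeasure ?P2 A)"
  have sQ: "sets Q = sets borel" unfolding Q_def
    using sets.sigma_sets_eq[of "borel::real measure"] by (simp add: sets_measure_of_conv)
  have eQ: "emeasure Q A = emeasure ?P A + emeasure ?P2 A" if "A \<in> sets borel" for A
  proof (rule emeasure_measure_of[OF Q_def])
    show "countably_additive (sets Q) (\<lambda>A. emeasure ?P A + emeasure ?P2 A)"
      unfolding countably_additive_def sQ
      by (auto simp: suminf_add[symmetric] suminf_emeasure)
  qed (use that sQ in \<open>auto simp: positive_def\<close>)
  have "density lborel (\<lambda>_. ennreal L) = Q"
  proof (rule measure_eqI_generator_eq)
    let ?E = "range (\<lambda>(a, b). {a<..b::real})"
    show "Int_stable ?E" by (auto simp: Int_stable_def)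
    show "?E \<subseteq> Pow UNIV" by auto
    show "sets (density lborel (\<lambda>_. ennreal L)) = sigma_sets UNIV ?E" "sets Q = sigma_sets UNIV ?E"
      by (simp_all add: sQ borel_sigma_sets_Ioc)
    show "range (\<lambda>n::nat. {- real n<..real n}) \<subseteq> ?E" by auto
    show "(\<Union>i::nat. {- real i<..real i}) = UNIV"
    proof safe
      fix x :: real
      obtain n where "\<bar>x\<bar> < real n" using reals_Archimedean2 by blast
      then show "x \<in> (\<Union>i::nat. {- real i<..real i})" by (auto intro!: exI[of _ n])
    qed auto
    show "emeasure (density lborel (\<lambda>_. ennreal L)) {- real i<..real i} \<noteq> \<infinity>" for i :: nat
      by (simp add: emeasure_density_const ennreal_mult_eq_top_iff)
    fix X assume "X \<in> ?E"
    then obtain a b where X: "X = {a<..b::real}" by auto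
    show "emeasure (density lborel (\<lambda>_. ennreal L)) X = emeasure Q X"
    proof (cases "a \<le> b")
      case True
      then have "emeasure Q X = ennreal (L * (b - a))"
        using lip[of a b] mono[of a b]
        by (simp add: X eQ P P2 g2_def algebra_simps flip: ennreal_plus)
      then show ?thesis using True L by (simp add: X emeasure_density_const ennreal_mult)
    qed (auto simp: X)
  qed
  then have "emeasure ?P A \<le> emeasure (density lborel (\<lambda>_. ennreal L)) A"
    using eQ[OF \<open>A \<in> sets borel\<close>] by simp
  then show ?thesis using \<open>A \<in> sets borel\<close> by (simp add: emeasure_density_const)
qed

text \<open>
  The closed interval spanned by \<open>x\<close> and \<open>x + h\<close>, for either sign of
  \<open>h\<close>, in the form of a ball that the Vitali covering theorem expects.
\<close>

definition slope_intv :: "real \<times> real \<Rightarrow> real set" where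
  "slope_intv = (\<lambda>(x, h). cball (x + h / 2) (\<bar>h\<bar> / 2))"

lemma slope_intv_eq: "slope_intv (x, h) = {min x (x + h)..max x (x + h)}"
  by (auto simp: slope_intv_def cball_eq_atLeastAtMost min_def max_def abs_if field_simps)

lemma emeasure_slope_intv:
  fixes g :: "real \<Rightarrow> real"
  assumes mono: "\<And>x y. x \<le> y \<Longrightarrow> g x \<le> g y"
    and lip: "\<And>x y. x \<le> y \<Longrightarrow> g y - g x \<le> L * (y - x)"
  shows "emeasure (interval_measure g) (slope_intv (x, h)) = ennreal \<bar>g (x + h) - g x\<bar>"
    and "emeasure lborel (slope_intv (x, h)) = ennreal \<bar>h\<bar>"
proof -
  have L: "L \<ge> 0" using mono[of 0 1] lip[of 0 1] by simp
  have lip': "\<bar>g y - g x\<bar> \<le> L * \<bar>y - x\<bar>" for x y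
    using lip[of x y] lip[of y x] mono[of x y] mono[of y x] by (cases "x \<le> y") auto
  have "L-lipschitz_on UNIV g" by (rule lipschitz_onI) (use lip' L in \<open>auto simp: dist_real_def\<close>)
  then have cont: "continuous_on UNIV g" using lipschitz_on_continuous_on by blast
  have "emeasure (interval_measure g) {a..b} = ennreal (g b - g a)" if "a \<le> b" for a b
    by (intro emeasure_interval_measure_Icc that mono cont)
  then show "emeasure (interval_measure g) (slope_intv (x, h)) = ennreal \<bar>g (x + h) - g x\<bar>"
    using mono[of x "x + h"] mono[of "x + h" x]
    by (cases "h \<ge> 0") (auto simp: slope_intv_eq)
  show "emeasure lborel (slope_intv (x, h)) = ennreal \<bar>h\<bar>"
    by (cases "h \<ge> 0") (auto simp: slope_intv_eq)
qed

text \<open>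
  If every point of \<open>E\<close> is an end point of arbitrarily short intervals with property
  \<open>R\<close>, then disjoint intervals of this kind inside any given neighbourhood already
  exhaust \<open>E\<close> up to a null set.
\<close>

lemma vitali_slope_intervals:
  assumes E: "E \<in> sets borel" and U: "open U" "E \<subseteq> U"
    and R: "\<And>x d. x \<in> E \<Longrightarrow> d > 0 \<Longrightarrow> \<exists>h. h \<noteq> 0 \<and> \<bar>h\<bar> < d \<and> R x h"
  obtains C where "countable C" "\<And>x h. (x, h) \<in> C \<Longrightarrow> h \<noteq> 0 \<and> R x h \<and> slope_intv (x, h) \<subseteq> U"
    "disjoint_family_on slope_intv C" "emeasure lborel (E - \<Union>(slope_intv ` C)) = 0"
proof -
  let ?K = "{(x, h). h \<noteq> 0 \<and> R x h \<and> slope_intv (x, h) \<subseteq> U}"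
  let ?a = "\<lambda>(x, h). x + h / 2 :: real" and ?r = "\<lambda>(x::real, h). \<bar>h\<bar> / 2 :: real"
  have 1: "0 < ?r i" if "i \<in> ?K" for i using that by auto
  have 2: "\<exists>i. i \<in> ?K \<and> x \<in> cball (?a i) (?r i) \<and> ?r i < d" if xE: "x \<in> E" and d0: "0 < d" for x d
  proof -
    obtain e where e: "e > 0" "ball x e \<subseteq> U" using U xE by (meson open_contains_ball subsetD)
    have "min d e > 0" using d0 e by simp
    then obtain h where h: "h \<noteq> 0" "\<bar>h\<bar> < min d e" "R x h" using R[OF \<open>x \<in> E\<close>, of "min d e"] by blast
    have "slope_intv (x, h) \<subseteq> ball x e" using h by (auto simp: slope_intv_eq dist_real_def)
    then show ?thesis using h e by (intro exI[of _ "(x, h)"]) (auto simp: dist_real_def)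
  qed
  have eq: "cball (?a i) (?r i) = slope_intv i" for i by (auto simp: slope_intv_def split: prod.split)
  show ?thesis
  proof (rule Vitali_covering_theorem_cballs[where K = "?K" and r = "?r" and S = E and a = "?a", OF 1 2])
    fix C assume C: "countable C" "C \<subseteq> ?K"
     "pairwise (\<lambda>i j. disjnt (cball (?a i) (?r i)) (cball (?a j) (?r j))) C"
     "negligible(E - (\<Union>i \<in> C. cball (?a i) (?r i)))"
  show ?thesis
    proof (rule that[of C])
      have "E - \<Union>(slope_intv ` C) \<in> sets borel"
        by (intro sets.Diff E sets.countable_UN') (use C in \<open>auto simp: slope_intv_def split: prod.split\<close>)
      moreover have "negligible (E - \<Union>(slope_intv ` C))" using C(4) unfolding eq .
      ultimately show "emeasure lborel (E - \<Union>(slope_intv ` C)) = 0"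
        by (simp add: negligible_iff_null_sets null_sets_def)
    qed (use C in \<open>auto simp: eq disjoint_family_on_def pairwise_def disjnt_def\<close>)
  qed
qed

lemma slope_covering_measures:
  fixes g :: "real \<Rightarrow> real"
  assumes mono: "\<And>x y. x \<le> y \<Longrightarrow> g x \<le> g y"
    and lip: "\<And>x y. x \<le> y \<Longrightarrow> g y - g x \<le> L * (y - x)"
    and C: "countable C" "disjoint_family_on slope_intv C" and ab: "a \<ge> 0" "b \<ge> 0"
    and le: "\<And>x h. (x, h) \<in> C \<Longrightarrow> a * \<bar>h\<bar> \<le> b * \<bar>g (x + h) - g x\<bar>"
  shows "ennreal a * emeasure lborel (\<Union>(slope_intv ` C)) \<le> ennreal b * emeasure (interval_measure g) (\<Union>(slope_intv ` C))"
proof -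
  have m: "slope_intv i \<in> sets borel" for i by (auto simp: slope_intv_def split: prod.split)
  have "ennreal a * emeasure lborel (\<Union>(slope_intv ` C)) = (\<integral>\<^sup>+i. ennreal a * emeasure lborel (slope_intv i) \<partial>count_space C)"
    using C m by (subst emeasure_UN_countable) (auto simp: nn_integral_cmult)
  also have "\<dots> \<le> (\<integral>\<^sup>+i. ennreal b * emeasure (interval_measure g) (slope_intv i) \<partial>count_space C)"
  proof (rule nn_integral_mono)
    fix i assume "i \<in> space (count_space C)"
    then obtain x h where i: "i = (x, h)" "(x, h) \<in> C" by (cases i) auto
    show "ennreal a * emeasure lborel (slope_intv i) \<le> ennreal b * emeasure (interval_measure g) (slope_intv i)"
      using le[OF i(2)] ab unfolding i emeasure_slope_intv[OF mono lip, simplified]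
      by (simp flip: ennreal_mult)
  qed
  also have "\<dots> = ennreal b * emeasure (interval_measure g) (\<Union>(slope_intv ` C))"
    using C m by (subst emeasure_UN_countable) (auto simp: nn_integral_cmult)
  finally show ?thesis .
qed

text \<open>
  Covering \<open>E\<close> by intervals of steep slope shows that the increment of
  \<open>g\<close> over \<open>E\<close> is at least \<open>q\<close> times the measure of
  \<open>E\<close>; covering it by intervals of gentle slope shows that it is at most
  \<open>p\<close> times the measure. Both are compatible only if \<open>E\<close> is null.
\<close>

lemma slopes_oscillating_null:
  fixes g :: "real \<Rightarrow> real"
  assumes mono: "\<And>x y. x \<le> y \<Longrightarrow> g x \<le> g y"
    and lip: "\<And>x y. x \<le> y \<Longrightarrow> g y - g x \<le> L * (y - x)"
    and E: "E \<in> sets borel" "bounded E" and pq: "0 \<le> p" "p < q"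
    and lo: "\<And>x d. x \<in> E \<Longrightarrow> d > 0 \<Longrightarrow> \<exists>h. h \<noteq> 0 \<and> \<bar>h\<bar> < d \<and> \<bar>g (x + h) - g x\<bar> \<le> p * \<bar>h\<bar>"
    and up: "\<And>x d. x \<in> E \<Longrightarrow> d > 0 \<Longrightarrow> \<exists>h. h \<noteq> 0 \<and> \<bar>h\<bar> < d \<and> q * \<bar>h\<bar> \<le> \<bar>g (x + h) - g x\<bar>"
  shows "emeasure lborel E = 0"
proof -
  let ?P = "interval_measure g"
  have L: "L \<ge> 0" using mono[of 0 1] lip[of 0 1] by simp
  note Ple = interval_measure_le_lborel[OF mono lip, simplified]
  have fin: "emeasure lborel E < \<infinity>" using emeasure_bounded_finite[OF E(2)] .
  have m: "\<Union>(slope_intv ` C) \<in> sets borel" if "countable C" for C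
    using that by (intro sets.countable_UN') (auto simp: slope_intv_def split: prod.split)
  have main: "ennreal q * emeasure lborel E \<le> ennreal p * emeasure lborel E + ennreal e" if e: "e > 0" for e
  proof -
    \<comment> \<open>The open set \<open>U\<close> exceeds \<open>E\<close> by a set of measure
        \<open>d\<close>. It enters the chain below once with the factor \<open>L\<close> and once
        with the factor \<open>p\<close>, which must cost at most \<open>e\<close> together.\<close>
    define d where "d = e / (p + L + 1)"
    have d: "d > 0" using e L pq by (auto simp: d_def)
    obtain U where U: "open U" "E \<subseteq> U" "emeasure lborel (U - E) < ennreal d"
      using outer_regular_lborel[of E d] E d by (auto simp: less_top)
    have Ub: "U \<in> sets borel" using U by auto
    have UE: "emeasure lborel U \<le> emeasure lborel E + ennreal d"
    proof -
      have "emeasure lborel U = emeasure lborel E + emeasure lborel (U - E)"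
        using E Ub U by (subst plus_emeasure) (auto simp: Un_absorb1)
      then show ?thesis using U(3) by (simp add: add_left_mono)
    qed
    obtain C where C: "countable C" "\<And>x h. (x, h) \<in> C \<Longrightarrow> h \<noteq> 0 \<and> q * \<bar>h\<bar> \<le> \<bar>g (x + h) - g x\<bar> \<and> slope_intv (x, h) \<subseteq> U"
      "disjoint_family_on slope_intv C" "emeasure lborel (E - \<Union>(slope_intv ` C)) = 0"
      using vitali_slope_intervals[OF E(1) U(1,2), of "\<lambda>x h. q * \<bar>h\<bar> \<le> \<bar>g (x + h) - g x\<bar>"] up by metis
    obtain D where D: "countable D" "\<And>x h. (x, h) \<in> D \<Longrightarrow> h \<noteq> 0 \<and> \<bar>g (x + h) - g x\<bar> \<le> p * \<bar>h\<bar> \<and> slope_intv (x, h) \<subseteq> U"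
      "disjoint_family_on slope_intv D" "emeasure lborel (E - \<Union>(slope_intv ` D)) = 0"
      using vitali_slope_intervals[OF E(1) U(1,2), of "\<lambda>x h. \<bar>g (x + h) - g x\<bar> \<le> p * \<bar>h\<bar>"] lo by metis
    have CU: "\<Union>(slope_intv ` C) \<subseteq> U" "\<Union>(slope_intv ` D) \<subseteq> U" using C(2) D(2) by (intro UN_least; metis surj_pair)+
    have split: "emeasure M E \<le> emeasure M X + emeasure M (E - X)" if "sets M = sets borel" "X \<in> sets borel" for M X
    proof -
      have "emeasure M E \<le> emeasure M (X \<union> (E - X))" using that E by (intro emeasure_mono) auto
      also have "\<dots> \<le> emeasure M X + emeasure M (E - X)" using that E by (intro emeasure_subadditive) auto
      finally show ?thesis .
    qed
    have "ennreal q * emeasure lborel E \<le> ennreal q * emeasure lborel (\<Union>(slope_intv ` C))"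
      using split[of lborel "\<Union>(slope_intv ` C)"] m[OF C(1)] C(4) by (simp add: mult_left_mono)
    also have "\<dots> \<le> ennreal 1 * emeasure ?P (\<Union>(slope_intv ` C))"
      by (rule slope_covering_measures[OF mono lip C(1,3)]) (use pq C in auto)
    also have "\<dots> \<le> emeasure ?P U" using CU Ub by (simp add: emeasure_mono)
    also have "\<dots> \<le> emeasure ?P E + emeasure ?P (U - E)"
      using E Ub U by (subst plus_emeasure) (auto simp: Un_absorb1)
    also have "\<dots> \<le> emeasure ?P E + ennreal L * ennreal d"
      using Ple[of "U - E"] Ub E U(3) by (intro add_left_mono) (meson mult_left_mono order.trans less_imp_le sets.Diff zero_le)
    also have "emeasure ?P E \<le> emeasure ?P (\<Union>(slope_intv ` D)) + emeasure ?P (E - \<Union>(slope_intv ` D))"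
      using split[of ?P] m[OF D(1)] by simp
    also have "emeasure ?P (E - \<Union>(slope_intv ` D)) \<le> 0"
      using Ple[of "E - \<Union>(slope_intv ` D)"] m[OF D(1)] E D(4) by simp
    also have "emeasure ?P (\<Union>(slope_intv ` D)) \<le> ennreal p * emeasure lborel (\<Union>(slope_intv ` D))"
    proof -
      have m': "slope_intv i \<in> sets borel" for i by (auto simp: slope_intv_def split: prod.split)
      have "emeasure ?P (\<Union>(slope_intv ` D)) = (\<integral>\<^sup>+i. emeasure ?P (slope_intv i) \<partial>count_space D)"
        using D m' by (subst emeasure_UN_countable) auto
      also have "\<dots> \<le> (\<integral>\<^sup>+i. ennreal p * emeasure lborel (slope_intv i) \<partial>count_space D)"
      proof (rule nn_integral_mono)
        fix i assume "i \<in> space (count_space D)"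
        then obtain x h where i: "i = (x, h)" "(x, h) \<in> D" by (cases i) auto
        show "emeasure ?P (slope_intv i) \<le> ennreal p * emeasure lborel (slope_intv i)"
          using D(2)[OF i(2)] pq unfolding i emeasure_slope_intv[OF mono lip, simplified]
          by (simp flip: ennreal_mult)
      qed
      also have "\<dots> = ennreal p * emeasure lborel (\<Union>(slope_intv ` D))"
        using D m' by (subst emeasure_UN_countable) (auto simp: nn_integral_cmult)
      finally show ?thesis .
    qed
    also have "emeasure lborel (\<Union>(slope_intv ` D)) \<le> emeasure lborel U"
      using CU Ub by (simp add: emeasure_mono)
    also note UE
    also have "ennreal p * (emeasure lborel E + ennreal d) + 0 + ennreal L * ennreal d
        = ennreal p * emeasure lborel E + ennreal ((p + L) * d)"
      using pq L d by (simp add: distrib_left distrib_right ennreal_mult ennreal_plus add.assoc)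
    also have "(p + L) * d \<le> e" using pq L e by (auto simp: d_def field_simps)
    finally show ?thesis by (simp add: add_left_mono mult_left_mono ennreal_leI)
  qed
  obtain s where s: "emeasure lborel E = ennreal s" "s \<ge> 0" using fin by (cases "emeasure lborel E") auto
  have "q * s \<le> p * s + e" if "e > 0" for e
    using main[OF that] that pq s by (simp add: s ennreal_plus[symmetric] ennreal_mult[symmetric] del: ennreal_plus)
  then have "q * s \<le> p * s" by (rule field_le_epsilon)
  then have "s \<le> 0" using pq by (simp add: mult_le_cancel_right)
  then show ?thesis using s by simp
qed

lemma slopes_converge:
  fixes s :: "real \<Rightarrow> real"
  assumes bnd: "\<And>h. h \<noteq> 0 \<Longrightarrow> \<bar>s h\<bar> \<le> B"
    and osc: "\<And>p q. p \<in> \<rat> \<Longrightarrow> q \<in> \<rat> \<Longrightarrow> p < q \<Longrightarrow>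
      \<not> ((\<forall>n::nat. \<exists>h. h \<noteq> 0 \<and> \<bar>h\<bar> < 1 / Suc n \<and> s h < p) \<and> (\<forall>n::nat. \<exists>h. h \<noteq> 0 \<and> \<bar>h\<bar> < 1 / Suc n \<and> s h > q))"
  shows "\<exists>l. (s \<longlongrightarrow> l) (at 0)"
proof -
  let ?s = "\<lambda>h. ereal (s h)"
  have ev: "\<forall>\<^sub>F h in at 0. P h" if "\<And>h. h \<noteq> 0 \<Longrightarrow> \<bar>h\<bar> < 1 / Suc n \<Longrightarrow> P h" for n :: nat and P
    unfolding eventually_at using that by (intro exI[of _ "1 / Suc n"]) (auto simp: dist_real_def)
  have evb: "\<forall>\<^sub>F h in at 0. P (?s h)" if "\<And>y. \<bar>y\<bar> \<le> B \<Longrightarrow> P (ereal y)" for P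
    by (rule ev) (use bnd that in auto)
  have le: "Liminf (at 0) ?s \<le> Limsup (at 0) ?s" by (rule Liminf_le_Limsup) simp
  have eq: "Liminf (at 0) ?s = Limsup (at 0) ?s"
  proof (rule ccontr)
    assume "Liminf (at 0) ?s \<noteq> Limsup (at 0) ?s"
    with le have "Liminf (at 0) ?s < Limsup (at 0) ?s" by simp
    then obtain y where y: "Liminf (at 0) ?s < ereal y" "ereal y < Limsup (at 0) ?s" using ereal_dense2 by blast
    then obtain y' where y': "ereal y < ereal y'" "ereal y' < Limsup (at 0) ?s" using ereal_dense2 by blast
    obtain p where p: "p \<in> \<rat>" "y < p" "p < y'" using y' Rats_dense_in_real by auto
    obtain q where q: "q \<in> \<rat>" "p < q" "q < y'" using p Rats_dense_in_real by auto
    have lp: "Liminf (at 0) ?s < ereal p" using y(1) p(2) by (meson ereal_less_eq(3) less_imp_le order_less_le_trans)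
    have lq: "ereal q < Limsup (at 0) ?s" using y'(2) q(3) by (meson ereal_less_eq(3) less_imp_le order_le_less_trans)
    have "\<exists>h. h \<noteq> 0 \<and> \<bar>h\<bar> < 1 / Suc n \<and> s h < p" for n :: nat
    proof (rule ccontr)
      assume "\<not> ?thesis"
      then have "\<forall>\<^sub>F h in at 0. ereal p \<le> ?s h" by (intro ev[of n]) (auto simp: not_less)
      then show False using Liminf_bounded[of "ereal p" ?s "at 0"] lp by simp
    qed
    moreover have "\<exists>h. h \<noteq> 0 \<and> \<bar>h\<bar> < 1 / Suc n \<and> s h > q" for n :: nat
    proof (rule ccontr)
      assume "\<not> ?thesis"
      then have "\<forall>\<^sub>F h in at 0. ?s h \<le> ereal q" by (intro ev[of n]) (auto simp: not_less)
      then show False using Limsup_bounded[of ?s "ereal q" "at 0"] lq by simp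
    qed
    ultimately show False using osc[OF p(1) q(1,2)] by blast
  qed
  have "ereal (- B) \<le> Liminf (at 0) ?s" by (intro Liminf_bounded evb) auto
  moreover have "Limsup (at 0) ?s \<le> ereal B" by (intro Limsup_bounded evb) auto
  ultimately obtain l where l: "Limsup (at 0) ?s = ereal l"
    using eq by (cases "Limsup (at 0) ?s") auto
  then have "(?s \<longlongrightarrow> ereal l) (at 0)" using eq by (subst tendsto_iff_Liminf_eq_Limsup) auto
  then show ?thesis by auto
qed

text \<open>
  The points where the difference quotients in direction \<open>e\<close> keep falling below
  \<open>p\<close> and rising above \<open>q\<close>. Failure of directional differentiability is
  a countable union of such sets.
\<close>

definition slope_osc :: "('a::real_normed_vector \<Rightarrow> real) \<Rightarrow> 'a \<Rightarrow> real \<Rightarrow> real \<Rightarrow> 'a set" where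
  "slope_osc f e p q = {x. (\<forall>n::nat. \<exists>h. h \<noteq> 0 \<and> \<bar>h\<bar> < 1 / Suc n \<and> (f (x + h *\<^sub>R e) - f x) / h < p) \<and>
     (\<forall>n::nat. \<exists>h. h \<noteq> 0 \<and> \<bar>h\<bar> < 1 / Suc n \<and> (f (x + h *\<^sub>R e) - f x) / h > q)}"

lemma slope_osc_borel:
  assumes "continuous_on UNIV f" shows "slope_osc f e p q \<in> sets borel"
proof -
  have c: "continuous_on UNIV (\<lambda>x. (f (x + h *\<^sub>R e) - f x) / h)" if "h \<noteq> 0" for h
    using that by (intro continuous_intros continuous_on_compose2[OF assms]) (auto intro!: continuous_intros assms)
  have eq: "slope_osc f e p q =
     (\<Inter>n::nat. \<Union>h\<in>{h. h \<noteq> 0 \<and> \<bar>h\<bar> < 1 / Suc n}. {x. (f (x + h *\<^sub>R e) - f x) / h < p}) \<inter>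
     (\<Inter>n::nat. \<Union>h\<in>{h. h \<noteq> 0 \<and> \<bar>h\<bar> < 1 / Suc n}. {x. q < (f (x + h *\<^sub>R e) - f x) / h})"
    unfolding slope_osc_def by blast
  have "open (\<Union>h\<in>{h. h \<noteq> 0 \<and> \<bar>h\<bar> < 1 / Suc n}. {x. (f (x + h *\<^sub>R e) - f x) / h < p})" for n
    by (intro open_UN ballI open_Collect_less c continuous_intros) auto
  moreover have "open (\<Union>h\<in>{h. h \<noteq> 0 \<and> \<bar>h\<bar> < 1 / Suc n}. {x. q < (f (x + h *\<^sub>R e) - f x) / h})" for n
    by (intro open_UN ballI open_Collect_less c continuous_intros) auto
  ultimately show ?thesis unfolding eq by (intro sets.Int sets.countable_INT'') (auto intro: borel_open)
qed

text \<open>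
  Adding a multiple of the identity makes a Lipschitz function increasing and shifts all slopes by
  the same amount.
\<close>

lemma slope_osc_null_real:
  fixes f :: "real \<Rightarrow> real"
  assumes lip: "L-lipschitz_on UNIV f" and pq: "p < q"
  shows "emeasure lborel (slope_osc f 1 p q) = 0"
proof -
  define g where "g x = f x + L * x" for x
  have L: "L \<ge> 0" using lipschitz_on_nonneg[OF lip] .
  have l: "\<bar>f y - f x\<bar> \<le> L * \<bar>y - x\<bar>" for x y
    using lipschitz_onD[OF lip, of y x] by (simp add: dist_real_def)
  have mono: "g x \<le> g y" if "x \<le> y" for x y
    using l[of y x] that by (auto simp: g_def algebra_simps)
  have lipg: "g y - g x \<le> (2 * L) * (y - x)" if "x \<le> y" for x y
    using l[of y x] that by (auto simp: g_def algebra_simps)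
  have ab: "\<bar>g (x + h) - g x\<bar> = ((f (x + h) - f x) / h + L) * \<bar>h\<bar>" if "h \<noteq> 0" for x h
    using mono[of x "x + h"] mono[of "x + h" x] that
    by (cases "h > 0") (auto simp: g_def field_simps)
  let ?E = "slope_osc f 1 p q"
  have E: "?E \<in> sets borel" by (intro slope_osc_borel lipschitz_on_continuous_on[OF lip])
  show ?thesis
  proof (cases "?E = {}")
    case False
    then obtain x where x: "x \<in> ?E" by auto
    then obtain h where h: "h \<noteq> 0" "(f (x + h *\<^sub>R 1) - f x) / h < p" unfolding slope_osc_def by blast
    have "0 \<le> ((f (x + h) - f x) / h + L) * \<bar>h\<bar>" using ab[OF h(1), of x, symmetric] by simp
    then have p: "p + L \<ge> 0" using h by (simp add: zero_le_mult_iff)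
    have "emeasure lborel (?E \<inter> ball 0 (real n)) = 0" for n
    proof (rule slopes_oscillating_null[OF mono lipg, where p="p + L" and q = "q + L"])
      fix x d :: real assume x: "x \<in> ?E \<inter> ball 0 (real n)" and "d > 0"
      then obtain k :: nat where k: "1 / Suc k < d" using nat_approx_posE by auto
      from x obtain h where "h \<noteq> 0" "\<bar>h\<bar> < 1 / Suc k" "(f (x + h *\<^sub>R 1) - f x) / h < p"
        unfolding slope_osc_def by blast
      then show "\<exists>h. h \<noteq> 0 \<and> \<bar>h\<bar> < d \<and> \<bar>g (x + h) - g x\<bar> \<le> (p + L) * \<bar>h\<bar>"
        using k by (intro exI[of _ h]) (auto simp: ab intro!: mult_right_mono)
      from x obtain h where "h \<noteq> 0" "\<bar>h\<bar> < 1 / Suc k" "(f (x + h *\<^sub>R 1) - f x) / h > q"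
        unfolding slope_osc_def by blast
      then show "\<exists>h. h \<noteq> 0 \<and> \<bar>h\<bar> < d \<and> (q + L) * \<bar>h\<bar> \<le> \<bar>g (x + h) - g x\<bar>"
        using k by (intro exI[of _ h]) (auto simp: ab intro!: mult_right_mono)
    qed (use E p pq in auto)
    then have "emeasure lborel (\<Union>n. ?E \<inter> ball 0 (real n)) = 0"
      using E by (intro emeasure_UN_eq_0) auto
    moreover have "(\<Union>n. ?E \<inter> ball 0 (real n)) = ?E"
      using reals_Archimedean2 by auto
    ultimately show ?thesis by simp
  qed auto
qed

text \<open>
  Tonelli: every translate of the set along \<open>e\<close> has the same measure, and its slices
  in direction \<open>e\<close> are null by the one-dimensional case.
\<close>

lemma slope_osc_null:
  fixes f :: "'a::euclidean_space \<Rightarrow> real"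
  assumes lip: "L-lipschitz_on UNIV f" and pq: "p < q"
  shows "emeasure lborel (slope_osc f e p q) = 0"
proof -
  let ?N = "slope_osc f e p q"
  have N[measurable]: "?N \<in> sets borel" by (intro slope_osc_borel lipschitz_on_continuous_on[OF lip])
  have slice: "(\<lambda>s::real. x + s *\<^sub>R e) -` ?N = slope_osc (\<lambda>s. f (x + s *\<^sub>R e)) 1 p q" for x
    by (auto simp: slope_osc_def algebra_simps)
  have Ls: "(L * norm e)-lipschitz_on UNIV (\<lambda>s::real. f (x + s *\<^sub>R e))" for x
  proof (rule lipschitz_onI)
    fix s t :: real
    have "dist (f (x + s *\<^sub>R e)) (f (x + t *\<^sub>R e)) \<le> L * dist (x + s *\<^sub>R e) (x + t *\<^sub>R e)"
      by (rule lipschitz_onD[OF lip]) auto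
    also have "dist (x + s *\<^sub>R e) (x + t *\<^sub>R e) = norm e * dist s t"
      by (simp add: dist_norm algebra_simps flip: scaleR_diff_left)
    finally show "dist (f (x + s *\<^sub>R e)) (f (x + t *\<^sub>R e)) \<le> L * norm e * dist s t" by (simp add: mult.assoc)
  qed (use lipschitz_on_nonneg[OF lip] in auto)
  have "emeasure lborel ?N = (\<integral>\<^sup>+s\<in>{0..1::real}. emeasure lborel ?N \<partial>lborel)"
    by (simp add: nn_integral_cmult)
  also have "\<dots> = (\<integral>\<^sup>+s. (\<integral>\<^sup>+x. indicator ?N (x + s *\<^sub>R e) * indicator {0..1} s \<partial>lborel) \<partial>(lborel::real measure))"
  proof (intro nn_integral_cong)
    fix s :: real
    have "emeasure lborel ?N = (\<integral>\<^sup>+x. indicator ?N x \<partial>lborel)" by simp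
    also have "\<dots> = (\<integral>\<^sup>+x. indicator ?N x \<partial>distr lborel borel ((+) (s *\<^sub>R e)))"
      by (simp add: lborel_distr_plus)
    also have "\<dots> = (\<integral>\<^sup>+x. indicator ?N (x + s *\<^sub>R e) \<partial>lborel)"
      by (subst nn_integral_distr) (auto simp: add.commute)
    finally show "emeasure lborel ?N * indicator {0..1} s = (\<integral>\<^sup>+x. indicator ?N (x + s *\<^sub>R e) * indicator {0..1} s \<partial>lborel)"
      by (subst nn_integral_multc) auto
  qed
  also have "\<dots> = (\<integral>\<^sup>+x. (\<integral>\<^sup>+s. indicator ?N (x + s *\<^sub>R e) * indicator {0..1} s \<partial>(lborel::real measure)) \<partial>lborel)"
    by (rule lborel_pair.Fubini') measurable
  also have "\<dots> \<le> (\<integral>\<^sup>+x. 0 \<partial>(lborel::'a measure))"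
  proof (rule nn_integral_mono)
    fix x :: 'a
    have "(\<integral>\<^sup>+s. indicator ?N (x + s *\<^sub>R e) * indicator {0..1} s \<partial>(lborel::real measure))
      \<le> (\<integral>\<^sup>+s. indicator ((\<lambda>s::real. x + s *\<^sub>R e) -` ?N) s \<partial>lborel)"
      by (intro nn_integral_mono) (auto simp: indicator_def)
    also have "\<dots> = 0" unfolding slice
      using slope_osc_null_real[OF Ls pq, of x] slope_osc_borel[OF lipschitz_on_continuous_on[OF Ls]] by simp
    finally show "(\<integral>\<^sup>+s. indicator ?N (x + s *\<^sub>R e) * indicator {0..1} s \<partial>(lborel::real measure)) \<le> 0" .
  qed
  finally show ?thesis by simp
qed

lemma lipschitz_AE_directional:
  fixes f :: "'a::euclidean_space \<Rightarrow> real"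
  assumes lip: "L-lipschitz_on UNIV f"
  shows "AE x in lborel. \<exists>l. ((\<lambda>h. (f (x + h *\<^sub>R e) - f x) / h) \<longlongrightarrow> l) (at 0)"
proof -
  have "AE x in lborel. \<forall>p\<in>\<rat>. \<forall>q\<in>\<rat>. p < q \<longrightarrow> x \<notin> slope_osc f e p q"
  proof (intro AE_ball_countable[THEN iffD2] ballI countable_rat)
    fix p q :: real
    show "AE x in lborel. p < q \<longrightarrow> x \<notin> slope_osc f e p q"
    proof (cases "p < q")
      case True
      have "slope_osc f e p q \<in> null_sets lborel"
        using slope_osc_null[OF lip True] slope_osc_borel[OF lipschitz_on_continuous_on[OF lip]] by auto
      then show ?thesis using AE_not_in by auto
    qed auto
  qed
  then show ?thesis
  proof (rule AE_mp[OF _ AE_I2], intro impI)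
    fix x assume x: "\<forall>p\<in>\<rat>. \<forall>q\<in>\<rat>. p < q \<longrightarrow> x \<notin> slope_osc f e p q"
    have b: "\<bar>(f (x + h *\<^sub>R e) - f x) / h\<bar> \<le> L * norm e" if "h \<noteq> 0" for h
      using lipschitz_onD[OF lip, of "x + h *\<^sub>R e" x] that by (simp add: dist_norm field_simps abs_mult)
    show "\<exists>l. ((\<lambda>h. (f (x + h *\<^sub>R e) - f x) / h) \<longlongrightarrow> l) (at 0)"
      by (rule slopes_converge[OF b]) (use x in \<open>auto simp: slope_osc_def\<close>)
  qed
qed

section \<open>Rademacher's theorem\<close>

lemma integrable_indicator_box: "integrable lborel (\<lambda>x. indicator (box l u :: 'a::euclidean_space set) x * (K::real))"
  by (intro integrable_mult_left integrable_real_indicator emeasure_bounded_finite bounded_box) auto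

text \<open>
  The densities \<open>F + B\<close> and \<open>B\<close> define measures that agree on boxes,
  hence everywhere.
\<close>

lemma AE_zero_if_box_integrals_zero:
  fixes F :: "'a::euclidean_space \<Rightarrow> real"
  assumes F[measurable]: "F \<in> borel_measurable borel" and B: "\<And>x. \<bar>F x\<bar> \<le> B"
    and zero: "\<And>l u. (\<integral>x. indicator (box l u) x * F x \<partial>lborel) = 0"
  shows "AE x in lborel. F x = 0"
proof -
  have B0: "B \<ge> 0" using B[of 0] by simp
  let ?M1 = "density lborel (\<lambda>x. ennreal (F x + B))" and ?M2 = "density lborel (\<lambda>x::'a. ennreal B)"
  have "?M1 = ?M2"
  proof (rule measure_eqI_generator_eq)
    let ?E = "range (\<lambda>(a, b). box a b::'a set)"
    show "Int_stable ?E" by (auto simp: Int_stable_def box_Int_box)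
    show "?E \<subseteq> Pow UNIV" "sets ?M1 = sigma_sets UNIV ?E" "sets ?M2 = sigma_sets UNIV ?E"
      by (simp_all add: borel_eq_box)
    let ?A = "\<lambda>n::nat. box (- (real n *\<^sub>R One)) (real n *\<^sub>R One) :: 'a set"
    show "range ?A \<subseteq> ?E" "(\<Union>i. ?A i) = UNIV" unfolding UN_box_eq_UNIV by auto
    have *: "emeasure ?M1 (box l u) = emeasure ?M2 (box l u)" for l u :: 'a
    proof -
      have int: "integrable lborel (\<lambda>x. indicator (box l u) x * F x)"
        by (rule Bochner_Integration.integrable_bound[OF integrable_indicator_box[of l u B]])
          (use B B0 in \<open>auto split: split_indicator\<close>)
      have intB: "integrable lborel (\<lambda>x. indicator (box l u) x * B)"
        by (rule integrable_indicator_box)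
      have "emeasure ?M1 (box l u) = (\<integral>\<^sup>+x. ennreal (indicator (box l u) x * F x + indicator (box l u) x * B) \<partial>lborel)"
        by (subst emeasure_density) (auto intro!: nn_integral_cong simp: indicator_def)
      also have "\<dots> = ennreal (\<integral>x. indicator (box l u) x * F x + indicator (box l u) x * B \<partial>lborel)"
      proof (rule nn_integral_eq_integral)
        show "AE x in lborel. 0 \<le> indicator (box l u) x * F x + indicator (box l u) x * B"
        proof (rule AE_I2)
          fix x show "0 \<le> indicator (box l u) x * F x + indicator (box l u) x * B"
            using B[of x] by (auto simp: indicator_def)
        qed
      qed (intro Bochner_Integration.integrable_add int intB)
      also have "\<dots> = ennreal (\<integral>x. indicator (box l u) x * B \<partial>lborel)"
        using zero int intB by (subst Bochner_Integration.integral_add) auto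
      also have "\<dots> = (\<integral>\<^sup>+x. ennreal (indicator (box l u) x * B) \<partial>lborel)"
        using B0 intB by (intro nn_integral_eq_integral[symmetric]) auto
      also have "\<dots> = emeasure ?M2 (box l u)"
        by (subst emeasure_density) (auto intro!: nn_integral_cong simp: indicator_def)
      finally show ?thesis .
    qed
    show "emeasure ?M1 X = emeasure ?M2 X" if "X \<in> ?E" for X using that * by auto
    show "emeasure ?M1 (?A i) \<noteq> \<infinity>" for i
      unfolding * by (simp add: emeasure_density_const ennreal_mult_eq_top_iff)
  qed
  then have "AE x in lborel. ennreal (F x + B) = ennreal B"
    by (intro sigma_finite_measure.density_unique[OF sigma_finite_lborel]) auto
  then show ?thesis
  proof (rule AE_mp[OF _ AE_I2], intro impI)
    fix x assume "ennreal (F x + B) = ennreal B"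
    then show "F x = 0" using B[of x] B0 by (subst (asm) ennreal_inj) auto
  qed
qed

text \<open>
  Difference quotients along the sequence \<open>1 / (n + 1)\<close>: a countable family, so that
  limits stay measurable.
\<close>

definition diff_quot :: "('a::real_normed_vector \<Rightarrow> real) \<Rightarrow> 'a \<Rightarrow> nat \<Rightarrow> 'a \<Rightarrow> real" where
  "diff_quot f e n x = (f (x + (1 / Suc n) *\<^sub>R e) - f x) / (1 / Suc n)"

definition dir_deriv :: "('a::real_normed_vector \<Rightarrow> real) \<Rightarrow> 'a \<Rightarrow> 'a \<Rightarrow> real" where
  "dir_deriv f e x = lim (\<lambda>n. diff_quot f e n x)"

context
  fixes f :: "'a::euclidean_space \<Rightarrow> real" and L :: real
  assumes lip: "L-lipschitz_on UNIV f"
begin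

lemma lipschitz_borel_measurable[measurable]: "f \<in> borel_measurable borel"
  using lipschitz_on_continuous_on[OF lip] borel_measurable_continuous_onI by blast

lemma diff_quot_measurable[measurable]: "diff_quot f e n \<in> borel_measurable borel"
  unfolding diff_quot_def[abs_def] by measurable

lemma dir_deriv_measurable[measurable]: "dir_deriv f e \<in> borel_measurable borel"
  unfolding dir_deriv_def[abs_def] by measurable

lemma diff_quot_bound: "\<bar>diff_quot f e n x\<bar> \<le> L * norm e"
  using lipschitz_onD[OF lip, of "x + (1 / Suc n) *\<^sub>R e" x]
  unfolding diff_quot_def abs_divide by (simp add: dist_norm field_simps del: of_nat_Suc)

lemma slope_imp_dir_deriv:
  assumes "((\<lambda>h. (f (x + h *\<^sub>R e) - f x) / h) \<longlongrightarrow> l) (at 0)"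
  shows "(\<lambda>n. diff_quot f e n x) \<longlonglongrightarrow> l" "dir_deriv f e x = l"
proof -
  have "filterlim (\<lambda>n. 1 / real (Suc n)) (at 0) sequentially"
    unfolding filterlim_at using LIMSEQ_inverse_real_of_nat by (auto simp: inverse_eq_divide)
  from filterlim_compose[OF assms this] show "(\<lambda>n. diff_quot f e n x) \<longlonglongrightarrow> l"
    by (simp add: diff_quot_def)
  then show "dir_deriv f e x = l" unfolding dir_deriv_def by (rule limI)
qed

lemma AE_slope_dir_deriv: "AE x in lborel. ((\<lambda>h. (f (x + h *\<^sub>R e) - f x) / h) \<longlongrightarrow> dir_deriv f e x) (at 0)"
  using lipschitz_AE_directional[OF lip, of e]
  by (rule AE_mp[OF _ AE_I2]) (use slope_imp_dir_deriv in blast)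

lemma AE_diff_quot_dir_deriv: "AE x in lborel. (\<lambda>n. diff_quot f e n x) \<longlonglongrightarrow> dir_deriv f e x"
  using AE_slope_dir_deriv[of e] by (rule AE_mp[OF _ AE_I2]) (use slope_imp_dir_deriv in blast)

lemma dir_deriv_bound: "AE x in lborel. \<bar>dir_deriv f e x\<bar> \<le> L * norm e"
  using AE_diff_quot_dir_deriv[of e]
  by (rule AE_mp[OF _ AE_I2]) (auto intro!: LIMSEQ_le_const2[OF tendsto_rabs] diff_quot_bound)

text \<open>
  The box may be translated by a vector that tends to \<open>0\<close>, because only its boundary,
  a null set, is affected in the limit. This is what makes the translation in the proof of
  additivity harmless.
\<close>

lemma box_integral_dir_deriv:
  "(\<lambda>n. \<integral>x. indicator (box l u) (x - (1 / Suc n) *\<^sub>R a) * diff_quot f e n x \<partial>lborel)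
     \<longlonglongrightarrow> (\<integral>x. indicator (box l u) x * dir_deriv f e x \<partial>lborel)"
proof -
  obtain R where "\<forall>x\<in>box l u. norm x \<le> R" using bounded_box[of l u] unfolding bounded_iff by blast
  then have R: "box l u \<subseteq> cball 0 R" by auto
  let ?w = "\<lambda>x. indicator (cball 0 (R + norm a) :: 'a set) x * (L * norm e)"
  show ?thesis
  proof (rule integral_dominated_convergence[where w = ?w])
  show "integrable lborel ?w"
    by (intro integrable_mult_left integrable_real_indicator emeasure_bounded_finite bounded_cball) auto
  show "AE x in lborel. norm (indicator (box l u) (x - (1 / Suc n) *\<^sub>R a) * diff_quot f e n x) \<le> ?w x" for n
  proof (rule AE_I2)
    fix x
    have "norm x \<le> R + norm a" if "x - (1 / Suc n) *\<^sub>R a \<in> box l u"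
    proof -
      have "norm (x - (1 / Suc n) *\<^sub>R a) \<le> R" using that R by auto
      moreover have "norm ((1 / Suc n) *\<^sub>R a) \<le> 1 * norm a" unfolding norm_scaleR by (intro mult_right_mono) auto
      ultimately show ?thesis using norm_triangle_ineq[of "x - (1 / Suc n) *\<^sub>R a" "(1 / Suc n) *\<^sub>R a"] by simp
    qed
    then show "norm (indicator (box l u) (x - (1 / Suc n) *\<^sub>R a) * diff_quot f e n x) \<le> ?w x"
      using diff_quot_bound[of e n x] by (auto simp: indicator_def)
  qed
  have "frontier (box l u) \<in> null_sets lborel"
    using negligible_convex_frontier[OF convex_box(2), of l u] by (simp add: negligible_iff_null_sets null_sets_def)
  then have "AE x in lborel. x \<notin> frontier (box l u)" by (rule AE_not_in)
  with AE_diff_quot_dir_deriv[of e]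
  show "AE x in lborel. (\<lambda>n. indicator (box l u) (x - (1 / Suc n) *\<^sub>R a) * diff_quot f e n x)
      \<longlonglongrightarrow> indicator (box l u) x * dir_deriv f e x"
  proof eventually_elim
    case (elim x)
    have t: "(\<lambda>n. x - (1 / Suc n) *\<^sub>R a) \<longlonglongrightarrow> x - 0 *\<^sub>R a"
      by (intro tendsto_intros) (use LIMSEQ_inverse_real_of_nat in \<open>simp add: inverse_eq_divide\<close>)
    have "(\<lambda>n. indicator (box l u) (x - (1 / Suc n) *\<^sub>R a) :: real) \<longlonglongrightarrow> indicator (box l u) x"
    proof (cases "x \<in> box l u")
      case True
      then have "\<forall>\<^sub>F n in sequentially. x - (1 / Suc n) *\<^sub>R a \<in> box l u"
        using topological_tendstoD[OF t, of "box l u"] by (auto simp: open_box)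
      then show ?thesis using True by (intro tendsto_eventually) (auto elim!: eventually_mono)
    next
      case False
      then have "x \<notin> closure (box l u)" using elim by (auto simp: frontier_def interior_open open_box)
      then have "\<forall>\<^sub>F n in sequentially. x - (1 / Suc n) *\<^sub>R a \<in> - closure (box l u)"
        using topological_tendstoD[OF t, of "- closure (box l u)"] by auto
      then show ?thesis using False
        by (intro tendsto_eventually) (auto elim!: eventually_mono dest: contra_subsetD[OF closure_subset])
    qed
    then show ?case using elim(1) by (rule tendsto_mult)
  qed
  qed measurable
qed

text \<open>
  The increment in direction \<open>a + b\<close> is the increment in direction \<open>a\<close>
  plus the increment in direction \<open>b\<close> at a translated base point. After integration
  over a box the translation moves to the box and disappears in the limit.
\<close>

lemma dir_deriv_add: "AE x in lborel. dir_deriv f (a + b) x = dir_deriv f a x + dir_deriv f b x"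
proof -
  define B where "B = L * norm (a + b) + L * norm a + L * norm b"
  have L0: "L \<ge> 0" using lipschitz_on_nonneg[OF lip] .
  then have B0: "B \<ge> 0" by (simp add: B_def)
  let ?d = "\<lambda>x. dir_deriv f (a + b) x - dir_deriv f a x - dir_deriv f b x"
  \<comment> \<open>A version of the defect that is bounded everywhere, as the uniqueness lemma for box
      integrals requires.\<close>
  define F where "F x = (if \<bar>?d x\<bar> \<le> B then ?d x else 0)" for x
  have F[measurable]: "F \<in> borel_measurable borel" unfolding F_def[abs_def] by measurable
  have AE_F: "AE x in lborel. F x = ?d x"
    using dir_deriv_bound[of "a + b"] dir_deriv_bound[of a] dir_deriv_bound[of b]
    by eventually_elim (auto simp: F_def B_def)
  have bb: "bounded (box l u)" for l u :: 'a by (rule bounded_box)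
  have dom: "integrable lborel (\<lambda>x. indicator (box l u) x * g x)"
    if [measurable]: "g \<in> borel_measurable borel" and "AE x in lborel. \<bar>g x\<bar> \<le> K" for l u :: 'a and g :: "'a \<Rightarrow> real" and K
  proof (rule Bochner_Integration.integrable_bound[of _ "\<lambda>x. indicator (box l u) x * K"])
    show "integrable lborel (\<lambda>x. indicator (box l u) x * K)" by (rule integrable_indicator_box)
    show "AE x in lborel. norm (indicator (box l u) x * g x) \<le> norm (indicator (box l u) x * K)"
      using that(2) by eventually_elim (auto simp: indicator_def)
  qed auto
  have "AE x in lborel. F x = 0"
  proof (rule AE_zero_if_box_integrals_zero[OF F, of B])
    show "\<bar>F x\<bar> \<le> B" for x using B0 by (simp add: F_def)
    fix l u :: 'a
    let ?I = "\<lambda>e. \<integral>x. indicator (box l u) x * dir_deriv f e x \<partial>lborel"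
    have intd: "integrable lborel (\<lambda>x. indicator (box l u) x * dir_deriv f e x)" for e
      by (rule dom[OF _ dir_deriv_bound]) measurable
    have key: "(\<integral>x. indicator (box l u) (x - (1 / Suc n) *\<^sub>R 0) * diff_quot f (a + b) n x \<partial>lborel)
       = (\<integral>x. indicator (box l u) (x - (1 / Suc n) *\<^sub>R a) * diff_quot f b n x \<partial>lborel)
         + (\<integral>x. indicator (box l u) (x - (1 / Suc n) *\<^sub>R 0) * diff_quot f a n x \<partial>lborel)" for n
    proof -
      let ?t = "(1 / Suc n) *\<^sub>R a"
      have sp: "diff_quot f (a + b) n x = diff_quot f b n (x + ?t) + diff_quot f a n x" for x
        by (simp add: diff_quot_def scaleR_add_right add.assoc[symmetric]) (simp add: left_diff_distrib)
      have i1: "integrable lborel (\<lambda>x. indicator (box l u) x * diff_quot f b n (x + ?t))"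
        by (rule dom[of _ "L * norm b"]) (use diff_quot_bound in auto)
      have i2: "integrable lborel (\<lambda>x. indicator (box l u) x * diff_quot f a n x)"
        by (rule dom[of _ "L * norm a"]) (use diff_quot_bound in auto)
      have "(\<integral>x. indicator (box l u) (x - ?t) * diff_quot f b n x \<partial>lborel)
        = (\<integral>x. indicator (box l u) (x - ?t) * diff_quot f b n x \<partial>distr lborel borel ((+) ?t))"
        by (simp add: lborel_distr_plus)
      also have "\<dots> = (\<integral>x. indicator (box l u) x * diff_quot f b n (x + ?t) \<partial>lborel)"
        by (subst integral_distr) (auto simp: add.commute)
      finally show ?thesis using i1 i2 by (simp add: sp distrib_left)
    qed
    have "?I (a + b) = ?I b + ?I a"
    proof (rule LIMSEQ_unique)
      show "(\<lambda>n. \<integral>x. indicator (box l u) (x - (1 / Suc n) *\<^sub>R 0) * diff_quot f (a + b) n x \<partial>lborel) \<longlonglongrightarrow> ?I (a + b)"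
        by (rule box_integral_dir_deriv)
      show "(\<lambda>n. \<integral>x. indicator (box l u) (x - (1 / Suc n) *\<^sub>R 0) * diff_quot f (a + b) n x \<partial>lborel) \<longlonglongrightarrow> ?I b + ?I a"
        unfolding key by (intro tendsto_add box_integral_dir_deriv)
    qed
    moreover have "(\<integral>x. indicator (box l u) x * F x \<partial>lborel) =
       (\<integral>x. indicator (box l u) x * dir_deriv f (a + b) x - indicator (box l u) x * dir_deriv f a x - indicator (box l u) x * dir_deriv f b x \<partial>lborel)"
    proof (rule integral_cong_AE)
      show "AE x in lborel. indicator (box l u) x * F x = indicator (box l u) x * dir_deriv f (a + b) x - indicator (box l u) x * dir_deriv f a x - indicator (box l u) x * dir_deriv f b x"
        using AE_F by eventually_elim (simp add: right_diff_distrib)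
    qed measurable
    ultimately show "(\<integral>x. indicator (box l u) x * F x \<partial>lborel) = 0"
      using intd by simp
  qed
  with AE_F show ?thesis by eventually_elim simp
qed

lemma dir_deriv_scale: "AE x in lborel. dir_deriv f (c *\<^sub>R e) x = c * dir_deriv f e x"
proof (cases "c = 0")
  case True
  have "dir_deriv f 0 x = 0" for x by (rule slope_imp_dir_deriv(2)) simp
  then show ?thesis using True by simp
next
  case False
  show ?thesis using AE_slope_dir_deriv[of e]
  proof eventually_elim
    case (elim x)
    have "filterlim (\<lambda>h. h * c) (at 0) (at 0)"
      unfolding filterlim_at using False by (auto intro!: tendsto_eq_intros simp: eventually_at_filter)
    from filterlim_compose[OF elim this]
    have "((\<lambda>h. c * ((f (x + (h * c) *\<^sub>R e) - f x) / (h * c))) \<longlongrightarrow> c * dir_deriv f e x) (at 0)"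
      by (rule tendsto_mult_left)
    then show ?case using False by (intro slope_imp_dir_deriv(2)) simp
  qed
qed

text \<open>
  The candidate for the gradient. It is assembled from directional derivatives and is linear in
  the direction almost everywhere.
\<close>

definition dir_grad :: "'a \<Rightarrow> 'a" where "dir_grad x = (\<Sum>b\<in>Basis. dir_deriv f b x *\<^sub>R b)"

lemma AE_dir_deriv_eq_inner: "AE x in lborel. dir_deriv f e x = e \<bullet> dir_grad x"
proof -
  have "AE x in lborel. dir_deriv f (\<Sum>b\<in>S. (e \<bullet> b) *\<^sub>R b) x = (\<Sum>b\<in>S. (e \<bullet> b) * dir_deriv f b x)" if "finite S" for S :: "'a set"
    using that
  proof (induction S rule: finite_induct)
    case empty
    have "dir_deriv f 0 x = 0" for x by (rule slope_imp_dir_deriv(2)) simp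
    then show ?case by simp
  next
    case (insert b S)
    show ?case
      using insert.IH dir_deriv_add[of "(e \<bullet> b) *\<^sub>R b" "\<Sum>b\<in>S. (e \<bullet> b) *\<^sub>R b"] dir_deriv_scale[of "e \<bullet> b" b]
      by eventually_elim (use insert.hyps in simp)
  qed
  from this[OF finite_Basis] show ?thesis
    by eventually_elim (simp add: euclidean_representation dir_grad_def inner_sum_right mult.commute)
qed

text \<open>
  By compactness finitely many of the dense directions approximate all unit vectors, and the
  Lipschitz condition transfers their difference quotients to all directions uniformly.
\<close>

lemma differentiable_if_dense_slopes:
  assumes D: "\<And>X. open X \<Longrightarrow> X \<noteq> {} \<Longrightarrow> \<exists>d\<in>D. d \<in> X"
    and sl: "\<And>e. e \<in> D \<Longrightarrow> ((\<lambda>h. (f (x + h *\<^sub>R e) - f x) / h) \<longlongrightarrow> e \<bullet> G) (at 0)"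
  shows "GDERIV f x :> G"
  unfolding gderiv_def has_derivative_at_alt
proof (intro conjI allI impI bounded_linear_inner_left)
  fix e :: real assume e: "0 < e"
  have L0: "L \<ge> 0" using lipschitz_on_nonneg[OF lip] .
  define \<epsilon> where "\<epsilon> = e / (L + 1 + norm G)"
  have den: "L + 1 + norm G > 0" using L0 by (simp add: add_nonneg_pos add_pos_nonneg)
  have eps: "\<epsilon> > 0" using e den by (simp add: \<epsilon>_def)
  have "sphere (0::'a) 1 \<subseteq> (\<Union>d\<in>D. ball d \<epsilon>)"
  proof
    fix v :: 'a assume "v \<in> sphere 0 1"
    obtain d where "d \<in> D" "d \<in> ball v \<epsilon>" using D[of "ball v \<epsilon>"] eps by auto
    then show "v \<in> (\<Union>d\<in>D. ball d \<epsilon>)" by (auto simp: dist_commute)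
  qed
  then obtain F where F: "F \<subseteq> D" "finite F" "sphere (0::'a) 1 \<subseteq> (\<Union>d\<in>F. ball d \<epsilon>)"
    using compactE_image[OF compact_sphere[of "0::'a" 1], of D "\<lambda>d. ball d \<epsilon>"] by auto
  have "\<forall>d\<in>F. \<exists>\<delta>>0. \<forall>h. h \<noteq> 0 \<and> \<bar>h\<bar> < \<delta> \<longrightarrow> \<bar>(f (x + h *\<^sub>R d) - f x) / h - d \<bullet> G\<bar> < \<epsilon>"
  proof
    fix d assume "d \<in> F"
    then have "\<forall>\<^sub>F h in at 0. dist ((f (x + h *\<^sub>R d) - f x) / h) (d \<bullet> G) < \<epsilon>"
      using sl F eps by (intro tendstoD) auto
    then show "\<exists>\<delta>>0. \<forall>h. h \<noteq> 0 \<and> \<bar>h\<bar> < \<delta> \<longrightarrow> \<bar>(f (x + h *\<^sub>R d) - f x) / h - d \<bullet> G\<bar> < \<epsilon>"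
      unfolding eventually_at by (auto simp: dist_real_def)
  qed
  then obtain \<delta> where \<delta>: "\<And>d. d \<in> F \<Longrightarrow> \<delta> d > 0"
    "\<And>d h. d \<in> F \<Longrightarrow> h \<noteq> 0 \<Longrightarrow> \<bar>h\<bar> < \<delta> d \<Longrightarrow> \<bar>(f (x + h *\<^sub>R d) - f x) / h - d \<bullet> G\<bar> < \<epsilon>" by metis
  define \<delta>0 where "\<delta>0 = Min (insert 1 (\<delta> ` F))"
  have \<delta>0: "\<delta>0 > 0" "\<And>d. d \<in> F \<Longrightarrow> \<delta>0 \<le> \<delta> d" using F(2) \<delta>(1) by (auto simp: \<delta>0_def)
  have "norm (f y - f x - (y - x) \<bullet> G) \<le> e * norm (y - x)" if "norm (y - x) < \<delta>0" for y
  proof (cases "y = x")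
    case False
    define t where "t = norm (y - x)"
    define v where "v = (1 / t) *\<^sub>R (y - x)"
    have t: "t > 0" using False by (simp add: t_def)
    have v: "norm v = 1" "y = x + t *\<^sub>R v" using t by (auto simp: v_def t_def)
    then obtain d where d: "d \<in> F" "dist d v < \<epsilon>" using F(3) by (auto simp: subset_iff)
    have "\<bar>(f (x + t *\<^sub>R d) - f x) / t - d \<bullet> G\<bar> < \<epsilon>"
      using \<delta>(2)[OF d(1), of t] \<delta>0(2)[OF d(1)] that t by (simp add: t_def)
    moreover have "f (x + t *\<^sub>R d) - f x - t * (d \<bullet> G) = t * ((f (x + t *\<^sub>R d) - f x) / t - d \<bullet> G)"
      using t by (simp add: field_simps)
    ultimately have 1: "\<bar>f (x + t *\<^sub>R d) - f x - t * (d \<bullet> G)\<bar> \<le> t * \<epsilon>" using t by (simp add: abs_mult)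
    have "dist (f (x + t *\<^sub>R v)) (f (x + t *\<^sub>R d)) \<le> L * dist (x + t *\<^sub>R v) (x + t *\<^sub>R d)"
      by (rule lipschitz_onD[OF lip]) auto
    also have "dist (x + t *\<^sub>R v) (x + t *\<^sub>R d) = t * dist d v"
      using t by (simp add: dist_norm norm_minus_commute flip: scaleR_diff_right)
    also have "L * \<dots> \<le> L * (t * \<epsilon>)" using d t L0 by (intro mult_left_mono) auto
    finally have 2: "\<bar>f (x + t *\<^sub>R v) - f (x + t *\<^sub>R d)\<bar> \<le> L * (t * \<epsilon>)" by (simp add: dist_real_def)
    have "\<bar>(d - v) \<bullet> G\<bar> \<le> norm (d - v) * norm G" by (rule Cauchy_Schwarz_ineq2)
    also have "\<dots> \<le> \<epsilon> * norm G" using d by (intro mult_right_mono) (auto simp: dist_norm)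
    finally have "t * \<bar>(d - v) \<bullet> G\<bar> \<le> t * (\<epsilon> * norm G)" using t by simp
    then have 3: "\<bar>t * (d \<bullet> G) - t * (v \<bullet> G)\<bar> \<le> t * (\<epsilon> * norm G)"
      using t by (simp add: inner_diff_left abs_mult flip: right_diff_distrib)
    have "\<bar>f y - f x - (y - x) \<bullet> G\<bar> \<le> L * (t * \<epsilon>) + t * \<epsilon> + t * (\<epsilon> * norm G)"
      using 1 2 3 v(2) by simp
    also have "\<dots> = \<epsilon> * (L + 1 + norm G) * t" by (simp add: algebra_simps)
    also have "\<dots> = e * t" using den by (simp add: \<epsilon>_def)
    finally show ?thesis by (simp add: t_def)
  qed auto
  then show "\<exists>d>0. \<forall>y. norm (y - x) < d \<longrightarrow> norm (f y - f x - (y - x) \<bullet> G) \<le> e * norm (y - x)"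
    using \<delta>0(1) by blast
qed

lemma rademacher_UNIV: "AE x in lborel. \<exists>G. GDERIV f x :> G"
proof -
  obtain D :: "'a set" where D: "countable D" "\<And>X. open X \<Longrightarrow> X \<noteq> {} \<Longrightarrow> \<exists>d\<in>D. d \<in> X"
    using countable_dense_setE by metis
  have "AE x in lborel. \<forall>e\<in>D. ((\<lambda>h. (f (x + h *\<^sub>R e) - f x) / h) \<longlongrightarrow> e \<bullet> dir_grad x) (at 0)"
  proof (rule AE_ball_countable[THEN iffD2, OF D(1)], rule ballI)
    fix e
    show "AE x in lborel. ((\<lambda>h. (f (x + h *\<^sub>R e) - f x) / h) \<longlongrightarrow> e \<bullet> dir_grad x) (at 0)"
      using AE_slope_dir_deriv[of e] AE_dir_deriv_eq_inner[of e] by eventually_elim simp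
  qed
  then show ?thesis
    by eventually_elim (use differentiable_if_dense_slopes D(2) in blast)
qed

end

lemma GDERIV_unique: "GDERIV u x :> D \<Longrightarrow> GDERIV u x :> E \<Longrightarrow> D = E"
  using has_derivative_unique[of u "\<lambda>h. h \<bullet> D" x "\<lambda>h. h \<bullet> E"]
  by (metis gderiv_def vector_eq_ldot)

lemma grad_eq: "GDERIV u x :> D \<Longrightarrow> grad u x = D"
  unfolding grad_def using GDERIV_unique by blast

text \<open>
  Locally a Lipschitz function is extended to the whole space by composition with the projection
  onto a closed ball; countably many balls suffice.
\<close>

theorem rademacher_grad:
  fixes u :: "real^'n \<Rightarrow> real"
  assumes \<Omega>: "open \<Omega>" and u: "u \<in> Lip_loc \<Omega>"
  shows "AE x in lebesgue. x \<in> \<Omega> \<longrightarrow> GDERIV u x :> grad u x"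
proof -
  have "\<exists>d>0. AE y in lborel. y \<in> ball x d \<longrightarrow> GDERIV u y :> grad u y" if x: "x \<in> \<Omega>" for x
  proof -
    obtain d L where d: "d > 0" "L-lipschitz_on (ball x d \<inter> \<Omega>) u" using u x unfolding Lip_loc_def by blast
    obtain e where e: "e > 0" "ball x e \<subseteq> \<Omega>" using \<Omega> x by (meson open_contains_ball)
    define c where "c = min d e / 2"
    have c: "c > 0" "cball x c \<subseteq> ball x d \<inter> \<Omega>" using d e by (auto simp: c_def subset_iff)
    define U where "U = (\<lambda>y. u (closest_point (cball x c) y))"
    have cp: "closest_point (cball x c) y \<in> cball x c" for y using c by (intro closest_point_in_set) auto
    have "L-lipschitz_on UNIV U"
    proof (rule lipschitz_onI)
      show "0 \<le> L" using lipschitz_on_nonneg[OF d(2)] .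
      fix y z
      have "dist (U y) (U z) \<le> L * dist (closest_point (cball x c) y) (closest_point (cball x c) z)"
        unfolding U_def by (rule lipschitz_onD[OF d(2)]) (use subsetD[OF c(2) cp] in blast)+
      also have "\<dots> \<le> L * dist y z"
        using lipschitz_on_nonneg[OF d(2)] c by (intro mult_left_mono closest_point_lipschitz) auto
      finally show "dist (U y) (U z) \<le> L * dist y z" .
    qed
    then have "AE y in lborel. \<exists>G. GDERIV U y :> G" by (rule rademacher_UNIV)
    then have "AE y in lborel. y \<in> ball x c \<longrightarrow> GDERIV u y :> grad u y"
    proof (eventually_elim, intro impI)
      fix y assume "\<exists>G. GDERIV U y :> G" and y: "y \<in> ball x c"
      then obtain G where G: "GDERIV U y :> G" by blast
      have "GDERIV u y :> G"
        using G unfolding gderiv_def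
        by (rule has_derivative_transform_within_open[OF _ open_ball y]) (auto simp: U_def closest_point_self)
      then show "GDERIV u y :> grad u y" using grad_eq by metis
    qed
    then show ?thesis using c by blast
  qed
  then obtain d where d: "\<And>x. x \<in> \<Omega> \<Longrightarrow> d x > 0"
    "\<And>x. x \<in> \<Omega> \<Longrightarrow> AE y in lborel. y \<in> ball x (d x) \<longrightarrow> GDERIV u y :> grad u y" by metis
  obtain F where F: "F \<subseteq> (\<lambda>x. ball x (d x)) ` \<Omega>" "countable F" "\<Union>F = \<Union>((\<lambda>x. ball x (d x)) ` \<Omega>)"
    using Lindelof[of "(\<lambda>x. ball x (d x)) ` \<Omega>"] by auto
  have "AE y in lborel. \<forall>X\<in>F. y \<in> X \<longrightarrow> GDERIV u y :> grad u y"
    by (rule AE_ball_countable[THEN iffD2, OF F(2)]) (use F(1) d in auto)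
  then have "AE y in lborel. y \<in> \<Omega> \<longrightarrow> GDERIV u y :> grad u y"
  proof (eventually_elim, intro impI)
    fix y assume *: "\<forall>X\<in>F. y \<in> X \<longrightarrow> GDERIV u y :> grad u y" "y \<in> \<Omega>"
    then have "y \<in> \<Union>F" unfolding F(3) using d(1) by (auto intro!: bexI[of _ y])
    then show "GDERIV u y :> grad u y" using * by auto
  qed
  then show ?thesis by (rule AE_completion)
qed

section \<open>Square roots of non-negative definite matrices\<close>

lemma symmetric_dot:
  fixes A :: "real^'n^'n"
  assumes "transpose A = A" shows "(A *v x) \<bullet> y = x \<bullet> (A *v y)"
  by (metis assms dot_lmul_matrix transpose_matrix_vector)

lemma symmetricI:
  fixes A :: "real^'n^'n"
  assumes "\<And>x y. (A *v x) \<bullet> y = x \<bullet> (A *v y)" shows "transpose A = A"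
proof -
  have "transpose A *v x = A *v x" for x
    by (metis assms dot_lmul_matrix transpose_matrix_vector vector_eq_rdot)
  then show ?thesis by (simp add: matrix_eq)
qed

text \<open>
  A maximiser of the quadratic form on the unit sphere of \<open>S\<close> is an eigenvector: the
  first variation in every direction of \<open>S\<close> vanishes.
\<close>

lemma symmetric_eigenvector:
  fixes A :: "real^'n^'n"
  assumes A: "transpose A = A" and S: "subspace S" "\<And>x. x \<in> S \<Longrightarrow> A *v x \<in> S" and ne: "S \<noteq> {0}"
  obtains e l where "e \<in> S" "norm e = 1" "A *v e = l *\<^sub>R e" "\<And>x. x \<in> S \<Longrightarrow> x \<bullet> (A *v x) \<le> l * (norm x)\<^sup>2"
proof -
  let ?K = "S \<inter> sphere 0 1"
  let ?q = "\<lambda>x. x \<bullet> (A *v x)"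
  obtain z where z: "z \<in> S" "z \<noteq> 0" using ne S(1) subspace_0 by blast
  have "(1 / norm z) *\<^sub>R z \<in> ?K" using z S(1) by (simp add: subspace_scale)
  then have "?K \<noteq> {}" by blast
  moreover have "compact ?K" using closed_subspace[OF S(1)] by (intro closed_Int_compact) auto
  moreover have "continuous_on ?K ?q" by (intro continuous_intros)
  ultimately obtain e where e: "e \<in> ?K" "\<And>y. y \<in> ?K \<Longrightarrow> ?q y \<le> ?q e"
    using continuous_attains_sup[of ?K ?q] by blast
  have eS: "e \<in> S" and ne1: "norm e = 1" using e(1) by auto
  define l where "l = ?q e"
  have le: "?q x \<le> l * (norm x)\<^sup>2" if x: "x \<in> S" for x
  proof (cases "x = 0")
    case False
    have "(1 / norm x) *\<^sub>R x \<in> ?K" using x False S(1) by (simp add: subspace_scale)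
    from e(2)[OF this] have "(1 / norm x) * ((1 / norm x) * ?q x) \<le> l"
      by (simp add: l_def matrix_vector_mult_scaleR)
    then show ?thesis using False by (simp add: field_simps power2_eq_square)
  qed simp
  have ort: "(A *v e - l *\<^sub>R e) \<bullet> y = 0" if y: "y \<in> S" for y
  proof -
    define c where "c = (A *v e) \<bullet> y - l * (e \<bullet> y)"
    define d where "d = ?q y - l * (norm y)\<^sup>2"
    have q: "2 * t * c + t\<^sup>2 * d \<le> 0" for t
    proof -
      have "e + t *\<^sub>R y \<in> S" using eS y S(1) by (simp add: subspace_add subspace_scale)
      from le[OF this] have "?q (e + t *\<^sub>R y) \<le> l * (norm (e + t *\<^sub>R y))\<^sup>2" .
      moreover have "?q (e + t *\<^sub>R y) = l + 2 * t * ((A *v e) \<bullet> y) + t\<^sup>2 * ?q y"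
        using symmetric_dot[OF A, of e y] symmetric_dot[OF A, of y e]
        by (simp add: matrix_vector_right_distrib matrix_vector_mult_scaleR inner_add_left inner_add_right l_def
            power2_eq_square algebra_simps inner_commute)
      moreover have "(norm (e + t *\<^sub>R y))\<^sup>2 = 1 + 2 * t * (e \<bullet> y) + t\<^sup>2 * (norm y)\<^sup>2"
        using ne1 unfolding power2_norm_eq_inner
        by (simp add: inner_add_left inner_add_right power2_eq_square algebra_simps inner_commute norm_eq_1)
      ultimately show ?thesis by (simp add: c_def d_def algebra_simps)
    qed
    have "c = 0"
    proof (rule ccontr)
      assume c: "c \<noteq> 0"
      \<comment> \<open>So small that the quadratic term cannot compensate the linear one.\<close>
      define t where "t = c / (\<bar>d\<bar> + 1)"
      have dp: "\<bar>d\<bar> + 1 > 0" by simp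
      have "2 * t * c = 2 * (c\<^sup>2 / (\<bar>d\<bar> + 1))" by (simp add: t_def power2_eq_square)
      moreover have "t\<^sup>2 * d \<ge> - (c\<^sup>2 / (\<bar>d\<bar> + 1))"
      proof -
        have "t\<^sup>2 * \<bar>d\<bar> \<le> t\<^sup>2 * (\<bar>d\<bar> + 1)" by (intro mult_left_mono) auto
        also have "\<dots> = c\<^sup>2 / (\<bar>d\<bar> + 1)" using dp by (simp add: t_def power2_eq_square)
        finally have "t\<^sup>2 * \<bar>d\<bar> \<le> c\<^sup>2 / (\<bar>d\<bar> + 1)" .
        moreover have "t\<^sup>2 * d \<ge> - (t\<^sup>2 * \<bar>d\<bar>)"
          by (metis abs_ge_minus_self abs_mult abs_power2 minus_le_iff)
        ultimately show ?thesis by linarith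
      qed
      moreover have "c\<^sup>2 / (\<bar>d\<bar> + 1) > 0" using c dp by simp
      ultimately show False using q[of t] by linarith
    qed
    then show ?thesis by (simp add: c_def inner_diff_left)
  qed
  have "A *v e - l *\<^sub>R e \<in> S" using eS S by (simp add: subspace_diff subspace_scale)
  from ort[OF this] have "A *v e = l *\<^sub>R e" by simp
  then show ?thesis using that eS ne1 le by blast
qed

text \<open>
  Split off one eigenvector and continue in its orthogonal complement, which is invariant by
  symmetry.
\<close>

lemma spectral_basis:
  fixes A :: "real^'n^'n"
  assumes A: "transpose A = A" and "subspace S" "\<And>x. x \<in> S \<Longrightarrow> A *v x \<in> S"
  shows "\<exists>B l. finite B \<and> (\<forall>b\<in>B. \<forall>c\<in>B. b \<bullet> c = (if b = c then 1 else 0)) \<and> (\<forall>b\<in>B. A *v b = l b *\<^sub>R b)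
     \<and> B \<subseteq> S \<and> (\<forall>x\<in>S. x = (\<Sum>b\<in>B. (b \<bullet> x) *\<^sub>R b))"
  using assms(2,3)
proof (induction "dim S" arbitrary: S rule: less_induct)
  case less
  note S = less.prems
  show ?case
  proof (cases "S = {0}")
    case True
    then show ?thesis by (intro exI[of _ "{}"]) auto
  next
    case False
    obtain e l0 where e: "e \<in> S" "norm e = 1" "A *v e = l0 *\<^sub>R e"
      using symmetric_eigenvector[OF A S False] by metis
    define S' where "S' = {x \<in> S. e \<bullet> x = 0}"
    have sub: "subspace S'" using S(1) unfolding S'_def subspace_def by (auto simp: inner_add_right)
    have inv: "A *v x \<in> S'" if "x \<in> S'" for x
      using that S(2) symmetric_dot[OF A, of e x] by (auto simp: S'_def e(3))
    have "e \<notin> S'" using e(2) by (simp add: S'_def norm_eq_1)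
    moreover have "S' \<subseteq> S" by (auto simp: S'_def)
    ultimately have "S' \<subset> S" using e(1) by blast
    then have "dim S' < dim S" using sub S(1) by (metis dim_psubset span_eq_iff)
    from less.hyps[OF this sub inv] obtain B l where B: "finite B"
      "\<forall>b\<in>B. \<forall>c\<in>B. b \<bullet> c = (if b = c then 1 else 0)" "\<forall>b\<in>B. A *v b = l b *\<^sub>R b"
      "B \<subseteq> S'" "\<forall>x\<in>S'. x = (\<Sum>b\<in>B. (b \<bullet> x) *\<^sub>R b)" by blast
    have eB: "e \<notin> B" using B(4) e by (auto simp: S'_def norm_eq_1)
    have eb: "e \<bullet> b = 0" "b \<bullet> e = 0" if "b \<in> B" for b using B(4) that by (auto simp: S'_def inner_commute)
    have rep: "x = (\<Sum>b\<in>insert e B. (b \<bullet> x) *\<^sub>R b)" if x: "x \<in> S" for x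
    proof -
      have "x - (e \<bullet> x) *\<^sub>R e \<in> S'" using x e S(1)
        by (auto simp: S'_def subspace_diff subspace_scale inner_diff_right norm_eq_1)
      then have "x - (e \<bullet> x) *\<^sub>R e = (\<Sum>b\<in>B. (b \<bullet> (x - (e \<bullet> x) *\<^sub>R e)) *\<^sub>R b)" using B(5) by blast
      also have "\<dots> = (\<Sum>b\<in>B. (b \<bullet> x) *\<^sub>R b)" by (intro sum.cong) (auto simp: inner_diff_right eb)
      finally show ?thesis using B(1) eB by (simp add: algebra_simps)
    qed
    show ?thesis
      by (rule exI[of _ "insert e B"], rule exI[of _ "l(e := l0)"])
        (use B e eB eb rep in \<open>auto simp: S'_def norm_eq_1\<close>)
  qed
qed

lemma psd_sqrt_exists:
  fixes A :: "real^'n^'n"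
  assumes "psd_matrix A" shows "\<exists>S. psd_matrix S \<and> S ** S = A"
proof -
  have A: "transpose A = A" "\<And>x. 0 \<le> x \<bullet> (A *v x)" using assms by (auto simp: psd_matrix_def)
  obtain B l where B: "finite B" "\<forall>b\<in>B. \<forall>c\<in>B. b \<bullet> c = (if b = c then 1 else 0)"
     "\<forall>b\<in>B. A *v b = l b *\<^sub>R b" "\<forall>x. x = (\<Sum>b\<in>B. (b \<bullet> x) *\<^sub>R b)"
    using spectral_basis[OF A(1), of UNIV] by auto
  have l: "0 \<le> l b" if "b \<in> B" for b using A(2)[of b] B(2,3) that by auto
  define f where "f x = (\<Sum>b\<in>B. (sqrt (l b) * (b \<bullet> x)) *\<^sub>R b)" for x
  have lin: "linear f" unfolding f_def
    by (rule linearI) (simp_all add: inner_add_right distrib_left scaleR_add_left sum.distrib scaleR_sum_right mult.left_commute)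
  have mf: "matrix f *v x = f x" for x by (simp add: matrix_works lin)
  have dot: "f x \<bullet> y = (\<Sum>b\<in>B. sqrt (l b) * (b \<bullet> x) * (b \<bullet> y))" for x y
    by (simp add: f_def inner_sum_left)
  have bf: "b \<bullet> f x = sqrt (l b) * (b \<bullet> x)" if "b \<in> B" for b x
  proof -
    have "b \<bullet> f x = (\<Sum>c\<in>B. sqrt (l c) * (c \<bullet> x) * (if b = c then 1 else 0))"
      unfolding f_def inner_sum_right inner_scaleR_right using B(2) that by (intro sum.cong) auto
    also have "\<dots> = sqrt (l b) * (b \<bullet> x)" using B(1) that by (simp add: if_distrib[of "\<lambda>x. _ * x"] sum.delta' cong: if_cong)
    finally show ?thesis .
  qed
  have "psd_matrix (matrix f)"
    unfolding psd_matrix_def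
  proof (intro conjI allI)
    show "transpose (matrix f) = matrix f"
      by (rule symmetricI) (simp add: mf dot inner_commute[of _ "f _"] mult.commute mult.left_commute)
    show "0 \<le> \<xi> \<bullet> (matrix f *v \<xi>)" for \<xi>
      using l by (simp add: mf inner_commute[of \<xi>] dot mult.assoc sum_nonneg)
  qed
  moreover have "matrix f ** matrix f = A"
  proof -
    have "(matrix f ** matrix f) *v x = A *v x" for x
    proof -
      have "(matrix f ** matrix f) *v x = f (f x)" by (simp add: mf flip: matrix_vector_mul_assoc)
      also have "\<dots> = (\<Sum>b\<in>B. (l b * (b \<bullet> x)) *\<^sub>R b)"
        unfolding f_def[of "f x"] using l by (intro sum.cong) (auto simp: bf)
      also have "\<dots> = (\<Sum>b\<in>B. (b \<bullet> x) *\<^sub>R (A *v b))" using B(3) by (intro sum.cong) (auto simp: mult.commute)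
      also have "\<dots> = A *v (\<Sum>b\<in>B. (b \<bullet> x) *\<^sub>R b)"
        by (simp add: linear_sum[OF matrix_vector_mul_linear] matrix_vector_mult_scaleR)
      also have "(\<Sum>b\<in>B. (b \<bullet> x) *\<^sub>R b) = x" using B(4) by metis
      finally show ?thesis .
    qed
    then show ?thesis by (simp add: matrix_eq)
  qed
  ultimately show ?thesis by blast
qed

lemma psd_kernel:
  fixes S :: "real^'n^'n"
  assumes S: "psd_matrix S" and x: "x \<bullet> (S *v x) = 0" shows "S *v x = 0"
proof -
  obtain R where R: "psd_matrix R" "R ** R = S" using psd_sqrt_exists[OF S] by blast
  have "(R *v x) \<bullet> (R *v x) = x \<bullet> (R *v (R *v x))"
    using R(1) by (auto simp: psd_matrix_def symmetric_dot)
  also have "\<dots> = 0" using x R(2) by (simp add: matrix_vector_mul_assoc)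
  finally have "R *v x = 0" by simp
  then show ?thesis using R(2) by (metis matrix_vector_mul_assoc matrix_vector_mult_0_right)
qed

text \<open>
  If \<open>(S - T) e = l e\<close>, then \<open>l e \<bullet> (S e + T e) = e \<bullet>
  (S\<^sup>2 - T\<^sup>2) e = 0\<close>. For \<open>l \<noteq> 0\<close> both \<open>e \<bullet> S
  e\<close> and \<open>e \<bullet> T e\<close> vanish, hence \<open>S e = T e = 0\<close>, a
  contradiction. So all eigenvalues of the symmetric matrix \<open>S - T\<close> are
  \<open>0\<close>.
\<close>

lemma psd_sqrt_unique:
  fixes S T :: "real^'n^'n"
  assumes S: "psd_matrix S" and T: "psd_matrix T" and eq: "S ** S = T ** T"
  shows "S = T"
proof -
  have sS: "transpose S = S" and sT: "transpose T = T" using S T by (auto simp: psd_matrix_def)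
  define D where "D = S - T"
  have Dx: "D *v x = S *v x - T *v x" for x by (simp add: D_def matrix_vector_mult_diff_rdistrib)
  have sD: "transpose D = D"
    by (rule symmetricI) (simp add: Dx inner_diff_left inner_diff_right symmetric_dot[OF sS] symmetric_dot[OF sT])
  have ev0: "l = 0" if "D *v e = l *\<^sub>R e" "norm e = 1" for e l
  proof (rule ccontr)
    assume l: "l \<noteq> 0"
    have "e \<bullet> (S *v (S *v e)) - e \<bullet> (T *v (T *v e)) = 0"
      by (simp add: matrix_vector_mul_assoc eq)
    moreover have "e \<bullet> (S *v (S *v e)) = (S *v e) \<bullet> (S *v e)" "e \<bullet> (T *v (T *v e)) = (T *v e) \<bullet> (T *v e)"
      by (simp_all add: symmetric_dot sS sT)
    moreover have "l * (e \<bullet> (S *v e)) + l * (e \<bullet> (T *v e)) = (l *\<^sub>R e) \<bullet> (S *v e + T *v e)"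
      by (simp add: inner_add_right distrib_left)
    moreover have "\<dots> = (S *v e) \<bullet> (S *v e) - (T *v e) \<bullet> (T *v e)"
      unfolding that(1)[symmetric] Dx by (simp add: inner_diff_left inner_add_right) (simp add: inner_commute)
    ultimately have "l * (e \<bullet> (S *v e)) + l * (e \<bullet> (T *v e)) = 0" by simp
    then have "e \<bullet> (S *v e) + e \<bullet> (T *v e) = 0" using l by (simp flip: distrib_left)
    moreover have "0 \<le> e \<bullet> (S *v e)" "0 \<le> e \<bullet> (T *v e)" using S T by (auto simp: psd_matrix_def)
    ultimately have "e \<bullet> (S *v e) = 0" "e \<bullet> (T *v e) = 0" by linarith+
    then have "S *v e = 0" "T *v e = 0" using psd_kernel S T by blast+
    then have "l *\<^sub>R e = 0" using that(1) by (simp add: Dx)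
    then show False using l that(2) by auto
  qed
  obtain B l where B: "finite B" "\<forall>b\<in>B. \<forall>c\<in>B. b \<bullet> c = (if b = c then 1 else 0)"
     "\<forall>b\<in>B. D *v b = l b *\<^sub>R b" "\<forall>x. x = (\<Sum>b\<in>B. (b \<bullet> x) *\<^sub>R b)"
    using spectral_basis[OF sD, of UNIV] by auto
  have Db: "D *v b = 0" if "b \<in> B" for b
    using ev0[of b "l b"] B(2,3) that by (auto simp: norm_eq_1)
  have "D *v x = 0" for x
  proof -
    have "D *v (\<Sum>b\<in>B. (b \<bullet> x) *\<^sub>R b) = (\<Sum>b\<in>B. (b \<bullet> x) *\<^sub>R (D *v b))"
      by (simp add: linear_sum[OF matrix_vector_mul_linear] matrix_vector_mult_scaleR)
    also have "\<dots> = 0" using Db by simp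
    finally show ?thesis using B(4) by metis
  qed
  then have "S *v x = T *v x" for x using Dx[of x] by simp
  then show ?thesis by (simp add: matrix_eq)
qed

lemma matrix_sqrt:
  assumes "psd_matrix A" shows "psd_matrix (matrix_sqrt A)" "matrix_sqrt A ** matrix_sqrt A = A"
proof -
  have "\<exists>!S. psd_matrix S \<and> S ** S = A"
    using psd_sqrt_exists[OF assms] psd_sqrt_unique by blast
  from theI'[OF this] show "psd_matrix (matrix_sqrt A)" "matrix_sqrt A ** matrix_sqrt A = A"
    unfolding matrix_sqrt_def by auto
qed

lemma sqrt_dot:
  assumes "psd_matrix A" shows "(matrix_sqrt A *v x) \<bullet> (matrix_sqrt A *v y) = x \<bullet> (A *v y)"
proof -
  have "transpose (matrix_sqrt A) = matrix_sqrt A" using matrix_sqrt(1)[OF assms] by (simp add: psd_matrix_def)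
  then show ?thesis using matrix_sqrt(2)[OF assms] by (simp add: symmetric_dot matrix_vector_mul_assoc)
qed

lemma norm_sqrt: "psd_matrix A \<Longrightarrow> norm (matrix_sqrt A *v x) = sqrt (x \<bullet> (A *v x))"
  by (simp add: norm_eq_sqrt_inner sqrt_dot)

lemma dot_le_op_norm:
  fixes A :: "real^'n^'n"
  assumes "psd_matrix A" shows "x \<bullet> (A *v x) \<le> op_norm A * (norm x)\<^sup>2" "0 \<le> op_norm A"
proof -
  let ?K = "{\<xi>::real^'n. norm \<xi> = 1}"
  have "compact ((\<lambda>\<xi>. \<xi> \<bullet> (A *v \<xi>)) ` ?K)"
    using compact_sphere[of "0::real^'n" 1] by (intro compact_continuous_image continuous_intros) (simp add: sphere_def)
  then have bdd: "bdd_above ((\<lambda>\<xi>. \<xi> \<bullet> (A *v \<xi>)) ` ?K)" by (intro bounded_imp_bdd_above compact_imp_bounded)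
  have le: "\<xi> \<bullet> (A *v \<xi>) \<le> op_norm A" if "norm \<xi> = 1" for \<xi>
    unfolding op_norm_def by (rule cSUP_upper[OF _ bdd]) (use that in auto)
  show "0 \<le> op_norm A"
    using le[of "axis undefined 1"] assms by (auto simp: psd_matrix_def norm_axis_1 intro: order.trans)
  show "x \<bullet> (A *v x) \<le> op_norm A * (norm x)\<^sup>2"
  proof (cases "x = 0")
    case False
    have "norm ((1 / norm x) *\<^sub>R x) = 1" using False by simp
    from le[OF this] have "(1 / norm x) * ((1 / norm x) * (x \<bullet> (A *v x))) \<le> op_norm A"
      by (simp add: matrix_vector_mult_scaleR)
    then show ?thesis using False by (simp add: field_simps power2_eq_square)
  qed simp
qed

section \<open>Weighted measures and metric balls\<close>

lemma compactly_in_mono: "A \<subseteq> B \<Longrightarrow> B \<Subset> \<Omega> \<Longrightarrow> A \<Subset> \<Omega>"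
  unfolding compactly_in_def
  by (metis closed_closure closure_mono compact_Int_closed inf.absorb_iff2 subset_trans)

text \<open>
  Boundedness of the domain turns local integrability of the weight on the whole space into
  finiteness of the measure.
\<close>

lemma weighted_measure_properties:
  fixes \<Omega> :: "(real^'n) set"
  assumes \<Omega>: "open \<Omega>" "bounded \<Omega>" and w: "\<And>x. 0 \<le> w x" "L1_loc lebesgue UNIV w"
    and M: "M = weighted_measure \<Omega> w"
  shows "space M = \<Omega>" "w \<in> borel_measurable (lebesgue_on \<Omega>)" "finite_measure M"
    "\<And>E. E \<in> sets lebesgue \<Longrightarrow> E \<subseteq> \<Omega> \<Longrightarrow> E \<in> sets M"
    "\<And>P. (AE x in lebesgue. x \<in> \<Omega> \<longrightarrow> P x) \<Longrightarrow> AE x in M. P x"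
    "\<And>E. E \<in> null_sets lebesgue \<Longrightarrow> E \<subseteq> \<Omega> \<Longrightarrow> E \<in> null_sets M"
proof -
  have \<Omega>l: "\<Omega> \<in> sets lebesgue" using \<Omega>(1) by (simp add: borel_open)
  let ?D = "density (lebesgue_on \<Omega>) (\<lambda>x. ennreal (w x))"
  have Md: "M = completion ?D" using M by (simp add: weighted_measure_def)
  show sp: "space M = \<Omega>" by (simp add: Md)
  have si: "set_integrable lebesgue (closure \<Omega>) w"
    using w(2) \<Omega>(2) by (auto simp: L1_loc_def)
  then have "integrable lebesgue (\<lambda>x. indicator (closure \<Omega>) x *\<^sub>R w x)" by (simp add: set_integrable_def)
  then have "(\<lambda>x. indicator (closure \<Omega>) x *\<^sub>R w x) \<in> borel_measurable lebesgue" by simp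
  then have "(\<lambda>x. indicator (closure \<Omega>) x *\<^sub>R w x) \<in> borel_measurable (lebesgue_on \<Omega>)"
    by (rule measurable_restrict_space1)
  then show wm[measurable]: "w \<in> borel_measurable (lebesgue_on \<Omega>)"
    by (subst (asm) measurable_cong[where g = w]) (use closure_subset in \<open>auto simp: indicator_def\<close>)
  have setsM: "E \<in> sets M" if "E \<in> sets lebesgue" "E \<subseteq> \<Omega>" for E
  proof -
    have "E \<in> sets (lebesgue_on \<Omega>)" using that \<Omega>l by (auto simp: sets_restrict_space_iff)
    then show ?thesis unfolding Md by (intro sets_completionI_sets) simp
  qed
  then show "\<And>E. E \<in> sets lebesgue \<Longrightarrow> E \<subseteq> \<Omega> \<Longrightarrow> E \<in> sets M" .
  have fin: "emeasure M \<Omega> < \<infinity>"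
  proof -
    have "emeasure M \<Omega> = emeasure ?D \<Omega>" unfolding Md
      by (subst emeasure_completion) (use \<Omega>l in \<open>auto simp: sets_restrict_space_iff\<close>)
    also have "\<dots> = (\<integral>\<^sup>+x. ennreal (w x) * indicator \<Omega> x \<partial>lebesgue_on \<Omega>)"
      by (subst emeasure_density) (use \<Omega>l in \<open>auto simp: sets_restrict_space_iff\<close>)
    also have "\<dots> = (\<integral>\<^sup>+x. ennreal (w x) * indicator \<Omega> x * indicator \<Omega> x \<partial>lebesgue)"
      using \<Omega>l by (subst nn_integral_restrict_space) auto
    also have "\<dots> \<le> (\<integral>\<^sup>+x. ennreal (norm (indicator (closure \<Omega>) x *\<^sub>R w x)) \<partial>lebesgue)"
      using closure_subset[of \<Omega>] w(1) by (intro nn_integral_mono) (auto simp: indicator_def)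
    also have "\<dots> < \<infinity>" using si by (simp add: set_integrable_def integrable_iff_bounded)
    finally show ?thesis .
  qed
  then show "finite_measure M" by (intro finite_measureI) (auto simp: sp)
  have AEM: "AE x in M. P x" if "AE x in lebesgue. x \<in> \<Omega> \<longrightarrow> P x" for P
  proof -
    have "AE x in lebesgue_on \<Omega>. P x" using that \<Omega>l by (subst AE_restrict_space_iff) auto
    then have "AE x in ?D. P x" by (subst AE_density) auto
    then show ?thesis unfolding Md by (rule AE_completion)
  qed
  then show "\<And>P. (AE x in lebesgue. x \<in> \<Omega> \<longrightarrow> P x) \<Longrightarrow> AE x in M. P x" .
  show "E \<in> null_sets M" if "E \<in> null_sets lebesgue" "E \<subseteq> \<Omega>" for E
  proof -
    have "AE x in M. x \<notin> E" using AE_not_in[OF that(1)] by (intro AEM) auto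
    moreover have "E \<in> sets M" using that by (intro setsM) auto
    ultimately show ?thesis by (simp add: AE_iff_null_sets)
  qed
qed

text \<open>
  The hypotheses on domain, metric, weights and matrix, with one doubling constant
  \<open>A\<close> for both measures and with \<open>Cv\<close> the constant that compares
  \<open>v d\<mu>\<close> with \<open>d\<nu>\<close>. The further hypotheses are added in three
  extensions of this locale, each where it is first needed.
\<close>

locale setting =
  fixes \<Omega> :: "(real^'n) set"
    and \<rho> :: "real^'n \<Rightarrow> real^'n \<Rightarrow> real"
    and h m :: "real^'n \<Rightarrow> real"
    and Q :: "real^'n \<Rightarrow> real^'n^'n"
    and \<mu> \<nu> :: "(real^'n) measure"
    and p A Cv :: real
  assumes p: "1 < p"
    and domain: "open \<Omega>" "connected \<Omega>" "bounded \<Omega>" "\<Omega> \<noteq> {}"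
    and metric: "Metric_space \<Omega> \<rho>" "Metric_space.mtopology \<Omega> \<rho> = top_of_set \<Omega>"
    and weights: "\<And>x. 0 \<le> h x" "\<And>x. 0 \<le> m x" "L1_loc lebesgue UNIV h" "L1_loc lebesgue UNIV m"
    and measures: "\<mu> = weighted_measure \<Omega> h" "\<nu> = weighted_measure \<Omega> m"
    and Q: "Q \<in> borel_measurable \<mu>" "\<And>x. x \<in> \<Omega> \<Longrightarrow> psd_matrix (Q x)"
    and v: "L1_loc \<mu> \<Omega> (degen_weight p Q)"
    and A: "A \<ge> 1" and Cv: "Cv > 0"
    and doubling: "\<And>x r. x \<in> \<Omega> \<Longrightarrow> r > 0 \<Longrightarrow> mB \<Omega> \<rho> x (2 * r) \<Subset> \<Omega> \<Longrightarrow>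
        emeasure \<nu> (mB \<Omega> \<rho> x (2 * r)) \<le> ennreal A * emeasure \<nu> (mB \<Omega> \<rho> x r)"
       "\<And>x r. x \<in> \<Omega> \<Longrightarrow> r > 0 \<Longrightarrow> mB \<Omega> \<rho> x (2 * r) \<Subset> \<Omega> \<Longrightarrow>
        emeasure \<mu> (mB \<Omega> \<rho> x (2 * r)) \<le> ennreal A * emeasure \<mu> (mB \<Omega> \<rho> x r)"
    and ac: "absolutely_continuous \<nu> \<mu>"
    and pos: "\<And>E. E \<in> sets lebesgue \<Longrightarrow> E \<subseteq> \<Omega> \<Longrightarrow> emeasure lebesgue E > 0 \<Longrightarrow> emeasure \<nu> E > 0"
    and vle: "\<And>E. compact E \<Longrightarrow> E \<subseteq> \<Omega> \<Longrightarrow>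
        (\<integral>\<^sup>+x\<in>E. ennreal (degen_weight p Q x) \<partial>\<mu>) \<le> ennreal Cv * emeasure \<nu> E"
begin

sublocale Metric_space \<Omega> \<rho> by (rule metric(1))

lemmas mu = weighted_measure_properties[OF domain(1,3) weights(1,3) measures(1)]
lemmas nu = weighted_measure_properties[OF domain(1,3) weights(2,4) measures(2)]

lemma space_mu[simp]: "space \<mu> = \<Omega>" and space_nu[simp]: "space \<nu> = \<Omega>"
  using mu(1) nu(1) by auto

sublocale mu: finite_measure \<mu> by (rule mu(3))
sublocale nu: finite_measure \<nu> by (rule nu(3))

lemma complete_mu: "complete_measure \<mu>" and complete_nu: "complete_measure \<nu>"
  unfolding measures weighted_measure_def by (rule completion.complete_measure_axioms)+

lemma AE_nu_mu: "(AE x in \<nu>. P x) \<Longrightarrow> AE x in \<mu>. P x"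
proof -
  assume "AE x in \<nu>. P x"
  then obtain N where N: "N \<in> null_sets \<nu>" "{x\<in>space \<nu>. \<not> P x} \<subseteq> N" by (metis AE_E null_setsI)
  then have "N \<in> null_sets \<mu>" using ac by (auto simp: absolutely_continuous_def)
  with N(2) show "AE x in \<mu>. P x" by (intro AE_I'[of N]) auto
qed

text \<open>
  A set measurable for the completed measure \<open>\<nu>\<close> is a Lebesgue measurable set up
  to a subset of a \<open>\<nu>\<close>-null set, and the latter is \<open>\<mu>\<close>-null by
  absolute continuity. So every \<open>\<nu>\<close>-measurable function, in particular a
  solution, can be integrated against \<open>\<mu>\<close>.
\<close>

lemma sets_nu_mu: "E \<in> sets \<nu> \<Longrightarrow> E \<in> sets \<mu>"
proof -
  assume "E \<in> sets \<nu>"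
  then obtain S N N' where E: "E = S \<union> N" "S \<in> sets (density (lebesgue_on \<Omega>) (\<lambda>x. ennreal (m x)))"
     "N \<subseteq> N'" "N' \<in> null_sets (density (lebesgue_on \<Omega>) (\<lambda>x. ennreal (m x)))"
    unfolding measures weighted_measure_def by (auto elim!: sets_completionE)
  have "N' \<in> null_sets \<nu>" unfolding measures weighted_measure_def using E(4) by (rule null_sets_completionI)
  then have "N' \<in> null_sets \<mu>" using ac by (auto simp: absolutely_continuous_def)
  then have "N \<in> sets \<mu>" using complete_measure.complete[OF complete_mu E(3)] by auto
  moreover have "S \<in> sets lebesgue" "S \<subseteq> \<Omega>" using E(2) domain(1) by (auto simp: sets_restrict_space_iff borel_open)
  ultimately show "E \<in> sets \<mu>" using E(1) mu(4) by auto
qed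

lemma measurable_nu_mu: "w \<in> measurable \<nu> M \<Longrightarrow> w \<in> measurable \<mu> M"
  by (auto simp: measurable_def intro: sets_nu_mu)

lemma borel_subset_sets:
  assumes "E \<in> sets borel" "E \<subseteq> \<Omega>" shows "E \<in> sets \<nu>" "E \<in> sets \<mu>"
  using assms nu(4)[of E] mu(4)[of E] by auto

lemma continuous_measurable:
  fixes w :: "real^'n \<Rightarrow> 'b::topological_space"
  assumes "continuous_on \<Omega> w" shows "w \<in> borel_measurable \<nu>" "w \<in> borel_measurable \<mu>"
proof -
  show *: "w \<in> borel_measurable \<nu>"
  proof (rule borel_measurableI)
    fix S :: "'b set" assume "open S"
    then have "open (w -` S \<inter> \<Omega>)" using assms domain(1) continuous_on_open_vimage by blast
    then show "w -` S \<inter> space \<nu> \<in> sets \<nu>" by (intro borel_subset_sets) auto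
  qed
  then show "w \<in> borel_measurable \<mu>" by (rule measurable_nu_mu)
qed

lemma mball_open: "open (mball x r)"
  using openin_mball[of x r] unfolding metric(2) using domain(1) by (simp add: openin_open_eq)

lemma mball_sub: "mball x r \<subseteq> \<Omega>" by (rule mball_subset_mspace)

lemma mball_sets[measurable, simp]: "mball x r \<in> sets \<nu>" "mball x r \<in> sets \<mu>"
  using borel_subset_sets[OF borel_open[OF mball_open] mball_sub] by auto

lemma rho_continuous: "continuous_on (\<Omega> \<times> \<Omega>) (\<lambda>z. \<rho> (fst z) (snd z))"
  unfolding continuous_on_def
proof (rule ballI, rule tendstoI)
  fix z and e :: real assume z: "z \<in> \<Omega> \<times> \<Omega>" and e: "e > 0"
  let ?U = "mball (fst z) (e / 2) \<times> mball (snd z) (e / 2)"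
  have "open ?U" by (intro open_Times mball_open)
  moreover have "z \<in> ?U" using z e by (auto simp: mem_Times_iff)
  ultimately have "\<forall>\<^sub>F y in at z within \<Omega> \<times> \<Omega>. y \<in> ?U"
    by (metis eventually_at_topological)
  then show "\<forall>\<^sub>F y in at z within \<Omega> \<times> \<Omega>. dist (\<rho> (fst y) (snd y)) (\<rho> (fst z) (snd z)) < e"
  proof eventually_elim
    case (elim y)
    then have "\<rho> (fst z) (fst y) < e / 2" "\<rho> (snd z) (snd y) < e / 2" "fst y \<in> \<Omega>" "snd y \<in> \<Omega>" by (auto simp: mem_Times_iff)
    then show ?case using z triangle[of "fst y" "fst z" "snd y"] triangle[of "fst z" "snd z" "snd y"]
       triangle[of "fst z" "fst y" "snd z"] triangle[of "fst y" "snd y" "snd z"]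
      by (auto simp: dist_real_def commute mem_Times_iff)
  qed
qed

lemma rho_continuous1: "x \<in> \<Omega> \<Longrightarrow> continuous_on \<Omega> (\<rho> x)"
proof -
  assume x: "x \<in> \<Omega>"
  have "continuous_on \<Omega> (\<lambda>y. (x, y))" by (intro continuous_intros)
  from continuous_on_compose2[OF rho_continuous this] x show ?thesis by auto
qed

lemma mball_in_open:
  assumes "open U" "z \<in> U" "z \<in> \<Omega>" obtains s where "s > 0" "mball z s \<subseteq> U"
proof -
  have "openin mtopology (\<Omega> \<inter> U)" unfolding metric(2) using assms(1) by auto
  then have "\<forall>x. x \<in> \<Omega> \<inter> U \<longrightarrow> (\<exists>r>0. mball x r \<subseteq> \<Omega> \<inter> U)" unfolding openin_mtopology by simp
  then obtain s where "s > 0" "mball z s \<subseteq> \<Omega> \<inter> U" using assms(2,3) by (meson IntI)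
  then show ?thesis using that by simp
qed

lemma mball_compactly_mono: "mball x R \<Subset> \<Omega> \<Longrightarrow> mball y s \<subseteq> mball x R \<Longrightarrow> mball y s \<Subset> \<Omega>"
  by (rule compactly_in_mono)

lemma mball_sub_mball: "\<rho> x y + s \<le> R \<Longrightarrow> x \<in> \<Omega> \<Longrightarrow> mball y s \<subseteq> mball x R"
  using mball_subset[of y x s R] commute[of x y] by simp

lemma nu_ball_pos: "x \<in> \<Omega> \<Longrightarrow> r > 0 \<Longrightarrow> emeasure \<nu> (mball x r) > 0"
proof (rule pos)
  assume x: "x \<in> \<Omega>" "r > 0"
  have "mball x r \<noteq> {}" using x by (simp add: mball_eq_empty)
  then have "\<not> negligible (mball x r)" by (rule open_not_negligible[OF mball_open])
  moreover have "mball x r \<in> sets lebesgue" by (simp add: mball_open borel_open)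
  ultimately show "emeasure lebesgue (mball x r) > 0" by (simp add: negligible_iff_null_sets null_sets_def zero_less_iff_neq_zero)
qed (auto simp: mball_open borel_open)

lemma doubling_iterate:
  assumes "x \<in> \<Omega>" "s > 0" "mball x (2 ^ n * s) \<Subset> \<Omega>"
  shows "emeasure \<nu> (mball x (2 ^ n * s)) \<le> ennreal (A ^ n) * emeasure \<nu> (mball x s)"
    "emeasure \<mu> (mball x (2 ^ n * s)) \<le> ennreal (A ^ n) * emeasure \<mu> (mball x s)"
proof -
  have "emeasure \<nu> (mball x (2 ^ n * s)) \<le> ennreal (A ^ n) * emeasure \<nu> (mball x s) \<and>
    emeasure \<mu> (mball x (2 ^ n * s)) \<le> ennreal (A ^ n) * emeasure \<mu> (mball x s)"
    using assms(3)
  proof (induction n)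
    case (Suc n)
    have c: "mball x (2 * (2 ^ n * s)) \<Subset> \<Omega>" using Suc.prems by (simp add: mult.assoc)
    have "mball x (2 ^ n * s) \<subseteq> mball x (2 ^ Suc n * s)" using assms(2) by (intro mball_subset_concentric) auto
    then have IH: "emeasure \<nu> (mball x (2 ^ n * s)) \<le> ennreal (A ^ n) * emeasure \<nu> (mball x s)"
      "emeasure \<mu> (mball x (2 ^ n * s)) \<le> ennreal (A ^ n) * emeasure \<mu> (mball x s)"
      using Suc.IH mball_compactly_mono[OF Suc.prems] by auto
    have e: "ennreal A * (ennreal (A ^ n) * z) = ennreal (A ^ Suc n) * z" for z
      using A by (simp add: ennreal_mult mult.assoc)
    show ?case
      using order.trans[OF doubling(1)[OF assms(1) _ c] mult_left_mono[OF IH(1), of "ennreal A"]]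
        order.trans[OF doubling(2)[OF assms(1) _ c] mult_left_mono[OF IH(2), of "ennreal A"]] assms(2)
      unfolding e by (simp add: mult.assoc)
  qed simp
  then show "emeasure \<nu> (mball x (2 ^ n * s)) \<le> ennreal (A ^ n) * emeasure \<nu> (mball x s)"
    "emeasure \<mu> (mball x (2 ^ n * s)) \<le> ennreal (A ^ n) * emeasure \<mu> (mball x s)" by auto
qed

lemma ball_comparison:
  assumes "x \<in> \<Omega>" "y \<in> \<Omega>" "s > 0" "mball x t \<subseteq> mball y (2 ^ n * s)" "mball y (2 ^ n * s) \<Subset> \<Omega>"
  shows "emeasure \<nu> (mball x t) \<le> ennreal (A ^ n) * emeasure \<nu> (mball y s)"
    "emeasure \<mu> (mball x t) \<le> ennreal (A ^ n) * emeasure \<mu> (mball y s)"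
  by (rule order.trans[OF emeasure_mono[OF assms(4)] doubling_iterate(1)[OF assms(2,3,5)]], simp)
    (rule order.trans[OF emeasure_mono[OF assms(4)] doubling_iterate(2)[OF assms(2,3,5)]], simp)

text \<open>
  Otherwise the ball would be open and closed in the connected domain, hence the whole domain,
  which would then be compact.
\<close>

lemma sphere_point:
  assumes x: "x \<in> \<Omega>" and R: "mball x R \<Subset> \<Omega>" and t: "0 < t" "t \<le> R"
  shows "\<exists>y\<in>\<Omega>. \<rho> x y = t"
proof (rule ccontr)
  assume no: "\<not> ?thesis"
  let ?U = "{y \<in> \<Omega>. \<rho> x y < t}" and ?V = "{y \<in> \<Omega>. t < \<rho> x y}"
  have U: "open ?U" using mball_open[of x t] x by (simp add: mball_def)
  have "?V = \<rho> x -` {t<..} \<inter> \<Omega>" by auto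
  then have V: "open ?V"
    using rho_continuous1[OF x] domain(1) continuous_on_open_vimage[of \<Omega> "\<rho> x"] by (metis open_greaterThan)
  have "?U \<inter> \<Omega> = {} \<or> ?V \<inter> \<Omega> = {}"
    using connectedD[OF domain(2) U V] no by fastforce
  moreover have "x \<in> ?U" using x t by auto
  ultimately have "?V = {}" by auto
  then have "\<Omega> \<subseteq> mball x R" using no t x by (fastforce simp: not_less)
  then have "closure \<Omega> \<subseteq> \<Omega>" using R closure_mono[of \<Omega> "mball x R"] unfolding compactly_in_def by blast
  then have "closed \<Omega>" using closure_subset_eq by auto
  then have "\<Omega> = UNIV" using domain by (metis clopen)
  then show False using domain(3) not_bounded_UNIV by auto
qed

subsection \<open>The norm of the degenerate gradient\<close>

text \<open>
  The length \<open>\<bar>\<surd>Q \<xi>\<bar>\<close>, a seminorm in \<open>\<xi>\<close> at each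
  point.
\<close>

definition nq :: "real^'n \<Rightarrow> real^'n \<Rightarrow> real" where "nq x \<xi> = norm (matrix_sqrt (Q x) *v \<xi>)"

abbreviation energy :: "(real^'n \<Rightarrow> real^'n) \<Rightarrow> ennreal" where
  "energy G \<equiv> \<integral>\<^sup>+x. ennreal (nq x (G x) powr p) \<partial>\<mu>"

abbreviation mass :: "(real^'n \<Rightarrow> real) \<Rightarrow> ennreal" where
  "mass w \<equiv> \<integral>\<^sup>+x. ennreal (\<bar>w x\<bar> powr p) \<partial>\<nu>"

lemma nq_nonneg[simp]: "0 \<le> nq x \<xi>" by (simp add: nq_def)
lemma nq_zero[simp]: "nq x 0 = 0" by (simp add: nq_def)
lemma nq_add: "nq x (\<xi> + \<eta>) \<le> nq x \<xi> + nq x \<eta>"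
  unfolding nq_def by (simp add: matrix_vector_right_distrib norm_triangle_ineq)
lemma nq_scale: "nq x (c *\<^sub>R \<xi>) = \<bar>c\<bar> * nq x \<xi>"
  unfolding nq_def by (simp add: matrix_vector_mult_scaleR)
lemma nq_minus: "nq x (- \<xi>) = nq x \<xi>"
  using nq_scale[of x "-1" \<xi>] by simp
lemma nq_sq: "x \<in> \<Omega> \<Longrightarrow> nq x \<xi> = sqrt (\<xi> \<bullet> (Q x *v \<xi>))"
  unfolding nq_def using norm_sqrt Q(2) by blast

lemma nq_inner: "x \<in> \<Omega> \<Longrightarrow> \<bar>\<xi> \<bullet> (Q x *v \<eta>)\<bar> \<le> nq x \<xi> * nq x \<eta>"
  unfolding nq_def using sqrt_dot[OF Q(2), of x \<xi> \<eta>, symmetric] Cauchy_Schwarz_ineq2 by simp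

lemma nq_self: "x \<in> \<Omega> \<Longrightarrow> \<xi> \<bullet> (Q x *v \<xi>) = (nq x \<xi>)\<^sup>2"
  unfolding nq_def using sqrt_dot[OF Q(2), of x \<xi> \<xi>] by (simp add: power2_norm_eq_inner)

lemma nq_le: "x \<in> \<Omega> \<Longrightarrow> nq x \<xi> \<le> sqrt (op_norm (Q x)) * norm \<xi>"
  using dot_le_op_norm(1)[OF Q(2), of x \<xi>] real_sqrt_le_mono[of "\<xi> \<bullet> (Q x *v \<xi>)" "op_norm (Q x) * (norm \<xi>)\<^sup>2"]
  by (simp add: nq_sq real_sqrt_mult)

lemma op_norm_nonneg: "x \<in> \<Omega> \<Longrightarrow> 0 \<le> op_norm (Q x)"
  using dot_le_op_norm(2) Q(2) by blast

lemma degen_weight_nonneg: "0 \<le> degen_weight p Q x" by (simp add: degen_weight_def)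

lemma nq_powr_le: "x \<in> \<Omega> \<Longrightarrow> nq x \<xi> powr p \<le> degen_weight p Q x * norm \<xi> powr p"
proof -
  assume x: "x \<in> \<Omega>"
  have "nq x \<xi> powr p \<le> (sqrt (op_norm (Q x)) * norm \<xi>) powr p"
    using nq_le[OF x] p by (intro powr_mono2) auto
  also have "\<dots> = sqrt (op_norm (Q x)) powr p * norm \<xi> powr p"
    using op_norm_nonneg[OF x] by (intro powr_mult)
  also have "sqrt (op_norm (Q x)) powr p = degen_weight p Q x"
    using op_norm_nonneg[OF x] by (simp add: degen_weight_def powr_half_sqrt[symmetric] powr_powr)
  finally show ?thesis .
qed

lemma Qmult_measurable:
  assumes [measurable]: "\<xi> \<in> borel_measurable \<mu>" shows "(\<lambda>x. Q x *v \<xi> x) \<in> borel_measurable \<mu>"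
proof (rule borel_measurable_continuous_Pair[OF Q(1) assms])
  show "continuous_on UNIV (\<lambda>x::(real^'n^'n) \<times> (real^'n). fst x *v snd x)"
    unfolding matrix_vector_mult_def by (intro continuous_intros)
qed

lemma nq_measurable:
  assumes \<xi>[measurable]: "\<xi> \<in> borel_measurable \<mu>" shows "(\<lambda>x. nq x (\<xi> x)) \<in> borel_measurable \<mu>"
proof -
  note [measurable] = Qmult_measurable[OF \<xi>]
  have "(\<lambda>x. sqrt (\<xi> x \<bullet> (Q x *v \<xi> x))) \<in> borel_measurable \<mu>" by measurable
  then show ?thesis by (subst measurable_cong[where g = "\<lambda>x. sqrt (\<xi> x \<bullet> (Q x *v \<xi> x))"]) (auto simp: nq_sq)
qed

lemma degen_weight_measurable[measurable]: "degen_weight p Q \<in> borel_measurable \<mu>"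
proof -
  obtain C :: "nat \<Rightarrow> (real^'n) set" where C: "\<And>n. compact (C n)" "\<And>n. C n \<subseteq> \<Omega>" "\<And>n. C n \<subseteq> interior (C (Suc n))"
     "\<Union>(range C) = \<Omega>" using open_Union_compact_subsets[OF domain(1)] by metis
  have "(\<lambda>x. indicator (C n) x *\<^sub>R degen_weight p Q x) \<in> borel_measurable \<mu>" for n
    using v C(1,2)[of n] by (auto simp: L1_loc_def set_integrable_def)
  moreover have "(\<lambda>n. indicator (C n) x *\<^sub>R degen_weight p Q x) \<longlonglongrightarrow> degen_weight p Q x" if x: "x \<in> space \<mu>" for x
  proof -
    obtain n0 where n0: "x \<in> C n0" using C(4) x by auto
    have "C n \<subseteq> C (Suc n)" for n using C(3) interior_subset by blast
    then have "x \<in> C n" if "n \<ge> n0" for n using lift_Suc_mono_le[of C n0 n] n0 that by blast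
    then have "\<forall>\<^sub>F n in sequentially. indicator (C n) x *\<^sub>R degen_weight p Q x = degen_weight p Q x"
      by (intro eventually_sequentiallyI[of n0]) auto
    then show ?thesis by (rule tendsto_eventually)
  qed
  ultimately show ?thesis by (rule borel_measurable_LIMSEQ_metric)
qed

text \<open>
  From compact sets to measurable sets by inner regularity: a Lebesgue measurable set is a
  countable union of compact sets up to a null set.
\<close>

lemma weight_domination_sets:
  assumes E: "E \<in> sets \<nu>"
  shows "(\<integral>\<^sup>+x\<in>E. ennreal (degen_weight p Q x) \<partial>\<mu>) \<le> ennreal Cv * emeasure \<nu> E"
proof -
  let ?N = "density \<mu> (\<lambda>x. ennreal (degen_weight p Q x))"
  have eN: "emeasure ?N X = (\<integral>\<^sup>+x\<in>X. ennreal (degen_weight p Q x) \<partial>\<mu>)" if "X \<in> sets \<mu>" for X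
    using that by (subst emeasure_density) auto
  have nullN: "X \<in> null_sets ?N" if "X \<in> null_sets \<mu>" for X
    using that by (auto simp: null_sets_density_iff dest: AE_not_in)
  have leb: "emeasure ?N X \<le> ennreal Cv * emeasure \<nu> X" if X: "X \<in> sets lebesgue" "X \<subseteq> \<Omega>" for X
  proof -
    obtain C T where C: "fsigma C" "T \<in> null_sets lebesgue" "C \<union> T = X" "disjnt C T"
      using lebesgue_set_almost_fsigma[OF X(1)] .
    obtain F :: "nat \<Rightarrow> (real^'n) set" where F: "range F \<subseteq> Collect compact" "C = \<Union>(range F)"
      using C(1) fsigma_Union_compact by metis
    define G where "G n = (\<Union>i<n. F i)" for n
    have G: "compact (G n)" for n unfolding G_def using F by (intro compact_UN) auto
    have G\<Omega>: "G n \<subseteq> \<Omega>" "G n \<subseteq> C" for n using F(2) C(3) X(2) unfolding G_def by auto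
    have Gs: "G n \<in> sets \<mu>" "G n \<in> sets \<nu>" for n
      using borel_subset_sets[of "G n"] G\<Omega> G compact_imp_closed borel_closed by blast+
    have T: "T \<in> null_sets \<mu>" using mu(6)[OF C(2)] C(3) X(2) by auto
    have UG: "(\<Union>n. G n) = C" using F(2) unfolding G_def by auto
    have Cs: "C \<in> sets \<mu>" using Gs UG by (metis sets.countable_UN UNIV_I image_subset_iff)
    have "emeasure ?N X = emeasure ?N (C \<union> T)" using C(3) by simp
    also have "\<dots> = emeasure ?N C" using nullN[OF T] Cs by (intro emeasure_Un_null_set) auto
    also have "\<dots> \<le> ennreal Cv * emeasure \<nu> X"
    proof (rule LIMSEQ_le_const2)
      show "(\<lambda>n. emeasure ?N (G n)) \<longlonglongrightarrow> emeasure ?N C"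
        unfolding UG[symmetric] using Gs by (intro Lim_emeasure_incseq incseq_SucI) (auto simp: G_def less_Suc_eq)
      have "emeasure ?N (G n) \<le> ennreal Cv * emeasure \<nu> X" for n
      proof -
        have "emeasure ?N (G n) \<le> ennreal Cv * emeasure \<nu> (G n)" using vle[OF G G\<Omega>(1)] eN[OF Gs(1)] by simp
        also have "\<dots> \<le> ennreal Cv * emeasure \<nu> X"
          using C(3) G\<Omega>(2)[of n] nu(4)[OF X] by (intro mult_left_mono emeasure_mono) auto
        finally show ?thesis .
      qed
      then show "\<exists>N. \<forall>n\<ge>N. emeasure ?N (G n) \<le> ennreal Cv * emeasure \<nu> X" by blast
    qed
    finally show ?thesis .
  qed
  obtain S N N' where SN: "E = S \<union> N" "S \<in> sets (density (lebesgue_on \<Omega>) (\<lambda>x. ennreal (m x)))"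
     "N \<subseteq> N'" "N' \<in> null_sets (density (lebesgue_on \<Omega>) (\<lambda>x. ennreal (m x)))"
    using E unfolding measures weighted_measure_def by (auto elim!: sets_completionE)
  have "N' \<in> null_sets \<nu>" unfolding measures weighted_measure_def using SN(4) by (rule null_sets_completionI)
  then have "N' \<in> null_sets \<mu>" using ac by (auto simp: absolutely_continuous_def)
  then have "N \<in> null_sets \<mu>" using complete_measure.complete2[OF complete_mu SN(3)] by auto
  then have N: "N \<in> null_sets ?N" by (rule nullN)
  have S: "S \<in> sets lebesgue" "S \<subseteq> \<Omega>" using SN(2) domain(1) by (auto simp: sets_restrict_space_iff borel_open)
  have "emeasure ?N E = emeasure ?N S" unfolding SN(1) using N mu(4)[OF S] by (intro emeasure_Un_null_set) auto
  also have "\<dots> \<le> ennreal Cv * emeasure \<nu> S" by (rule leb[OF S])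
  also have "\<dots> \<le> ennreal Cv * emeasure \<nu> E" using SN(1) E by (intro mult_left_mono emeasure_mono) auto
  finally show ?thesis using eN[OF sets_nu_mu[OF E]] by simp
qed

lemma weight_domination:
  assumes w: "w \<in> borel_measurable \<nu>"
  shows "(\<integral>\<^sup>+x. ennreal (degen_weight p Q x) * w x \<partial>\<mu>) \<le> ennreal Cv * (\<integral>\<^sup>+x. w x \<partial>\<nu>)"
  using w
proof (induction w rule: borel_measurable_induct)
  case (cong f g)
  then have "(\<integral>\<^sup>+x. ennreal (degen_weight p Q x) * f x \<partial>\<mu>) = (\<integral>\<^sup>+x. ennreal (degen_weight p Q x) * g x \<partial>\<mu>)"
    "(\<integral>\<^sup>+x. f x \<partial>\<nu>) = (\<integral>\<^sup>+x. g x \<partial>\<nu>)" by (auto intro!: nn_integral_cong)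
  then show ?case using cong by simp
next
  case (set B)
  then show ?case using weight_domination_sets[OF set] by simp
next
  case (mult u c)
  have [measurable]: "u \<in> borel_measurable \<mu>" using mult(2) by (rule measurable_nu_mu)
  have "(\<integral>\<^sup>+x. ennreal (degen_weight p Q x) * (c * u x) \<partial>\<mu>) = c * (\<integral>\<^sup>+x. ennreal (degen_weight p Q x) * u x \<partial>\<mu>)"
    by (subst nn_integral_cmult[symmetric]) (auto intro!: nn_integral_cong simp: mult.left_commute)
  also have "\<dots> \<le> c * (ennreal Cv * (\<integral>\<^sup>+x. u x \<partial>\<nu>))" using mult by (intro mult_left_mono) auto
  finally show ?case using mult by (simp add: nn_integral_cmult mult.left_commute)
next
  case (add u v)
  have [measurable]: "u \<in> borel_measurable \<mu>" "v \<in> borel_measurable \<mu>" using add measurable_nu_mu by blast+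
  show ?case using add by (simp add: nn_integral_add distrib_left add_mono)
next
  case (seq U)
  have [measurable]: "U i \<in> borel_measurable \<mu>" for i using seq(1) measurable_nu_mu by auto
  have inc: "incseq U" using seq by blast
  have U: "U i x \<le> U j x" if "i \<le> j" for i j x using le_funD[OF incseqD[OF inc that]] .
  have "(\<integral>\<^sup>+x. ennreal (degen_weight p Q x) * (SUP i. U i x) \<partial>\<mu>) = (\<integral>\<^sup>+x. (SUP i. ennreal (degen_weight p Q x) * U i x) \<partial>\<mu>)"
    by (simp add: SUP_mult_left_ennreal)
  also have "\<dots> = (SUP i. \<integral>\<^sup>+x. ennreal (degen_weight p Q x) * U i x \<partial>\<mu>)"
    by (intro nn_integral_monotone_convergence_SUP) (auto simp: incseq_def le_fun_def intro!: mult_left_mono U)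
  also have "\<dots> \<le> (SUP i. ennreal Cv * (\<integral>\<^sup>+x. U i x \<partial>\<nu>))" using seq by (intro SUP_mono) blast
  also have "\<dots> = ennreal Cv * (\<integral>\<^sup>+x. (SUP i. U i x) \<partial>\<nu>)"
    using seq by (subst nn_integral_monotone_convergence_SUP) (auto simp: SUP_mult_left_ennreal)
  finally show ?case by (simp add: image_comp)
qed

end

section \<open>Gradients, kernels and powers of extended reals\<close>

subsection \<open>Powers of extended nonnegative reals\<close>

lemma enn_powr_ennreal[simp]: "x \<ge> 0 \<Longrightarrow> enn_powr (ennreal x) a = ennreal (x powr a)"
  by (simp add: enn_powr_def)

lemma enn_powr_top[simp]: "enn_powr top a = top" by (simp add: enn_powr_def)

lemma enn_powr_0[simp]: "enn_powr 0 a = 0" by (simp add: enn_powr_def)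

lemma enn_powr_mono:
  assumes "x \<le> y" "a > 0" shows "enn_powr x a \<le> enn_powr y a"
proof (cases y rule: ennreal_cases)
  case (real r)
  then obtain q where "x = ennreal q" "0 \<le> q" "q \<le> r" using assms(1) by (cases x) (auto simp: top_unique)
  then show ?thesis using real assms by (auto intro!: ennreal_leI powr_mono2)
qed simp

lemma enn_powr_powr: "enn_powr (enn_powr x a) b = enn_powr x (a * b)"
  by (cases x rule: ennreal_cases) (auto simp: powr_powr)

lemma enn_powr_one[simp]: "enn_powr x 1 = x"
  by (cases x rule: ennreal_cases) auto

lemma enn_powr_mult:
  assumes "a > 0" shows "enn_powr (x * y) a = enn_powr x a * enn_powr y a"
proof (cases x rule: ennreal_cases)
  case x: (real r)
  show ?thesis
  proof (cases y rule: ennreal_cases)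
    case (real s)
    then show ?thesis using x by (simp add: powr_mult flip: ennreal_mult)
  next
    case top
    then show ?thesis using x assms by (cases "r = 0") (auto simp: ennreal_mult_top)
  qed
next
  case top
  then show ?thesis using assms by (cases y rule: ennreal_cases) (auto simp: ennreal_top_mult)
qed

lemma enn_powr_measurable[measurable]:
  assumes [measurable]: "f \<in> borel_measurable M" shows "(\<lambda>x. enn_powr (f x) a) \<in> borel_measurable M"
  unfolding enn_powr_def by measurable

lemma enn_powr_lt_top: "x < top \<Longrightarrow> enn_powr x a < top"
  by (auto simp: enn_powr_def less_top)

text \<open>
  Division is antitone in the denominator also for the values \<open>0\<close> and
  \<open>\<infinity>\<close> of measures of balls.
\<close>

lemma ennreal_divide_compare:
  assumes "x \<le> ennreal k * y" "k > 0" shows "a / y \<le> ennreal k * (a / x)"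
proof (cases y rule: ennreal_cases)
  case y: (real s)
  then obtain r where x: "x = ennreal r" "0 \<le> r" using assms(1) by (cases x rule: ennreal_cases) (auto simp: ennreal_mult_eq_top_iff top_unique)
  have rs: "r \<le> k * s" using assms y x by (simp flip: ennreal_mult)
  show ?thesis
  proof (cases "r = 0")
    case True
    then show ?thesis using x assms(2) by (cases "a = 0") (auto simp: ennreal_divide_zero ennreal_mult_top)
  next
    case False
    then have r: "r > 0" and s: "s > 0" using x y rs assms(2) by (auto simp: zero_less_mult_iff intro: ccontr dest: order.trans)
    show ?thesis
    proof (cases a rule: ennreal_cases)
      case (real b)
      have "b / s \<le> k * (b / r)" using rs r s real by (simp add: field_simps mult_left_mono)
      then show ?thesis using real x y r s assms(2) by (simp add: divide_ennreal flip: ennreal_mult)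
    next
      case top
      then show ?thesis using x y r s assms(2) by (simp add: ennreal_top_divide ennreal_mult_top)
    qed
  qed
next
  case top
  then show ?thesis by simp
qed

text \<open>
  Young's inequality with a weight \<open>s\<close>, in the form in which all terms are absorbed
  below.
\<close>

lemma young_split:
  fixes n W s p :: real
  assumes "n \<ge> 0" "W \<ge> 0" "s > 0" "p > 1"
  shows "n * W powr (p - 1) \<le> s powr (1 - p) * n powr p + s * W powr p"
proof (cases "n \<le> s * W")
  case True
  then have "n * W powr (p - 1) \<le> s * W * W powr (p - 1)" by (intro mult_right_mono) auto
  also have "s * W * W powr (p - 1) = s * W powr p" using assms by (cases "W = 0") (auto simp: powr_mult_base mult.assoc)
  finally show ?thesis using assms by (simp add: add_increasing)
next
  case False
  then have n: "n > 0" using assms by (smt (verit) mult_nonneg_nonneg)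
  have "W \<le> n / s" using False assms by (simp add: field_simps)
  then have "n * W powr (p - 1) \<le> n * (n / s) powr (p - 1)" using assms by (intro mult_left_mono powr_mono2) auto
  also have "\<dots> = n * n powr (p - 1) * s powr (1 - p)"
    using assms n powr_minus_divide[of s "p - 1"] by (simp add: powr_divide)
  also have "n * n powr (p - 1) = n powr p" using n by (simp add: powr_mult_base)
  finally show ?thesis using assms by (simp add: mult.commute add_increasing2)
qed

subsection \<open>Lipschitz functions in the setting\<close>

lemma lipschitz_on_imp_Lip_loc: "L-lipschitz_on \<Omega> u \<Longrightarrow> u \<in> Lip_loc \<Omega>"
proof -
  assume L: "L-lipschitz_on \<Omega> u"
  have "\<exists>d>0. \<exists>L. L-lipschitz_on (ball x d \<inter> \<Omega>) u" for x
    using lipschitz_on_subset[OF L, of "ball x 1 \<inter> \<Omega>"] by (intro exI[of _ 1]) auto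
  then show ?thesis unfolding Lip_loc_def by blast
qed

lemma Lip_loc_continuous:
  assumes "open \<Omega>" "u \<in> Lip_loc \<Omega>" shows "continuous_on \<Omega> u"
proof -
  have "isCont u x" if x: "x \<in> \<Omega>" for x
  proof -
    obtain d L where d: "d > 0" "L-lipschitz_on (ball x d \<inter> \<Omega>) u" using assms(2) x unfolding Lip_loc_def by blast
    have "continuous_on (ball x d \<inter> \<Omega>) u" using lipschitz_on_continuous_on[OF d(2)] .
    then show ?thesis using assms(1) x d(1) by (subst (asm) continuous_on_eq_continuous_at) (auto simp: open_Int)
  qed
  then show ?thesis by (simp add: continuous_at_imp_continuous_on)
qed

context setting
begin

lemma Lip_0_D:
  assumes w: "w \<in> Lip_0 \<Omega> S"
  shows "w \<in> Lip_loc \<Omega>" "continuous_on \<Omega> w" "w \<in> borel_measurable \<nu>" "w \<in> borel_measurable \<mu>"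
    "\<And>x. x \<in> \<Omega> \<Longrightarrow> x \<notin> S \<Longrightarrow> w x = 0" "\<exists>b\<ge>0. \<forall>x\<in>\<Omega>. \<bar>w x\<bar> \<le> b"
proof -
  obtain L where L: "L-lipschitz_on \<Omega> w" using w by (auto simp: Lip_0_def)
  show 1: "w \<in> Lip_loc \<Omega>" by (rule lipschitz_on_imp_Lip_loc[OF L])
  show 2: "continuous_on \<Omega> w" by (rule Lip_loc_continuous[OF domain(1) 1])
  show "w \<in> borel_measurable \<nu>" "w \<in> borel_measurable \<mu>" using continuous_measurable[OF 2] by auto
  show "w x = 0" if "x \<in> \<Omega>" "x \<notin> S" for x
  proof (rule ccontr)
    assume "w x \<noteq> 0"
    then have "x \<in> support_in \<Omega> w" using that closure_subset by (fastforce simp: support_in_def)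
    then show False using w that by (auto simp: Lip_0_def)
  qed
  obtain x0 where x0: "x0 \<in> \<Omega>" using domain(4) by blast
  obtain D where D: "\<And>x. x \<in> \<Omega> \<Longrightarrow> dist x0 x \<le> D" using domain(3) bounded_any_center[of \<Omega> x0] by (auto simp: bounded_def)
  have "\<bar>w x\<bar> \<le> \<bar>w x0\<bar> + L * D" if x: "x \<in> \<Omega>" for x
  proof -
    have "dist (w x) (w x0) \<le> L * dist x x0" by (rule lipschitz_onD[OF L x x0])
    also have "\<dots> \<le> L * D" using D[OF x] lipschitz_on_nonneg[OF L] by (intro mult_left_mono) (auto simp: dist_commute)
    finally show ?thesis by (simp add: dist_real_def)
  qed
  moreover have "0 \<le> \<bar>w x0\<bar> + L * D" using D[OF x0] lipschitz_on_nonneg[OF L] by simp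
  ultimately show "\<exists>b\<ge>0. \<forall>x\<in>\<Omega>. \<bar>w x\<bar> \<le> b" by blast
qed

lemma grad_zero_outside:
  assumes w: "w \<in> Lip_0 \<Omega> S" and x: "x \<in> \<Omega>" "x \<notin> support_in \<Omega> w"
  shows "grad w x = 0"
proof -
  let ?U = "\<Omega> - support_in \<Omega> w"
  have U: "open ?U" using domain(1) by (intro open_Diff) (auto simp: support_in_def)
  have "w y = 0" if y: "y \<in> ?U" for y
  proof (rule ccontr)
    assume "w y \<noteq> 0"
    then have "y \<in> {x \<in> \<Omega>. w x \<noteq> 0}" using y by auto
    then have "y \<in> support_in \<Omega> w" unfolding support_in_def by (rule subsetD[OF closure_subset])
    then show False using y by auto
  qed
  note w0 = this
  have "((\<lambda>_. 0::real) has_derivative (\<lambda>h. h \<bullet> 0)) (at x)" by simp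
  then have "(w has_derivative (\<lambda>h. h \<bullet> 0)) (at x)"
    by (rule has_derivative_transform_within_open[OF _ U]) (use x in \<open>simp_all add: w0\<close>)
  then have "GDERIV w x :> 0" unfolding gderiv_def .
  then show ?thesis by (rule grad_eq)
qed

lemma grad_zero_outside_ball: "w \<in> Lip_0 \<Omega> S \<Longrightarrow> x \<in> \<Omega> \<Longrightarrow> x \<notin> S \<Longrightarrow> grad w x = 0"
  using grad_zero_outside by (auto simp: Lip_0_def)

lemma Lip_0_mono: "S \<subseteq> T \<Longrightarrow> w \<in> Lip_0 \<Omega> S \<Longrightarrow> w \<in> Lip_0 \<Omega> T"
  by (auto simp: Lip_0_def)

lemma AE_grad:
  assumes "u \<in> Lip_loc \<Omega>"
  shows "AE x in \<mu>. GDERIV u x :> grad u x"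
  using rademacher_grad[OF domain(1) assms] by (rule mu(5))

lemma measurable_AE_mu:
  fixes f g :: "real^'n \<Rightarrow> 'b::topological_space"
  assumes f: "f \<in> borel_measurable \<mu>" and eq: "AE x in \<mu>. f x = g x"
  shows "g \<in> borel_measurable \<mu>"
proof (rule borel_measurableI)
  fix S :: "'b set" assume S: "open S"
  have "f -` S \<inter> space \<mu> \<in> sets \<mu>" using f S by (intro measurable_sets) auto
  then show "g -` S \<inter> space \<mu> \<in> sets \<mu>"
  proof (rule complete_measure.in_sets_AE[OF complete_mu, rotated])
    show "AE x in \<mu>. (x \<in> f -` S \<inter> space \<mu>) = (x \<in> g -` S \<inter> space \<mu>)"
      using eq by eventually_elim auto
  qed auto
qed

lemma borel_measurable_on_domain:
  assumes f: "f \<in> measurable borel M" shows "f \<in> measurable \<mu> M" "f \<in> measurable \<nu> M"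
proof -
  show *: "f \<in> measurable \<nu> M"
  proof (rule measurableI)
    fix S assume "S \<in> sets M"
    then have "f -` S \<in> sets borel" using measurable_sets[OF f] by simp
    then show "f -` S \<inter> space \<nu> \<in> sets \<nu>" using domain(1) by (intro borel_subset_sets) (auto intro: borel_open)
  qed (use measurable_space[OF f] in auto)
  then show "f \<in> measurable \<mu> M" by (rule measurable_nu_mu)
qed

text \<open>
  The gradient is almost everywhere a limit of difference quotients, after extension of the
  function by \<open>0\<close> outside the domain.
\<close>

lemma grad_measurable[measurable (raw)]:
  assumes u: "u \<in> Lip_loc \<Omega>" shows "grad u \<in> borel_measurable \<mu>"
proof (subst borel_measurable_euclidean_space, rule ballI)
  fix b :: "real^'n" assume "b \<in> Basis"
  define w where "w x = indicator \<Omega> x *\<^sub>R u x" for x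
  have w[measurable]: "w \<in> borel_measurable borel" unfolding w_def[abs_def]
    using domain(1) by (intro borel_measurable_continuous_on_indicator Lip_loc_continuous u) (auto intro: borel_open)
  have q: "diff_quot w b n \<in> borel_measurable \<mu>" for n
    unfolding diff_quot_def[abs_def] by (intro borel_measurable_on_domain) measurable
  have "(\<lambda>x. lim (\<lambda>n. diff_quot w b n x)) \<in> borel_measurable \<mu>" by (intro borel_measurable_lim_metric q)
  then show "(\<lambda>x. grad u x \<bullet> b) \<in> borel_measurable \<mu>"
  proof (rule measurable_AE_mu)
    show "AE x in \<mu>. lim (\<lambda>n. diff_quot w b n x) = grad u x \<bullet> b"
      using AE_grad[OF u] AE_space[of \<mu>]
    proof eventually_elim
      case (elim x)
      then have x: "x \<in> \<Omega>" by simp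
      have "(w has_derivative (\<lambda>y. y \<bullet> grad u x)) (at x)"
        using elim(1) unfolding gderiv_def
        by (rule has_derivative_transform_within_open[OF _ domain(1) x]) (simp add: w_def)
      then have "((\<lambda>t. w (x + t *\<^sub>R b)) has_derivative (\<lambda>t. (t *\<^sub>R b) \<bullet> grad u x)) (at 0)"
        by (intro has_derivative_compose[of "\<lambda>t. x + t *\<^sub>R b" "\<lambda>t. t *\<^sub>R b" 0 UNIV w]) (auto intro!: derivative_eq_intros)
      then have "((\<lambda>t. w (x + t *\<^sub>R b)) has_field_derivative (grad u x \<bullet> b)) (at 0)"
        unfolding has_field_derivative_def by (simp add: inner_commute mult_commute_abs)
      then have "((\<lambda>t. (w (x + t *\<^sub>R b) - w x) / t) \<longlongrightarrow> grad u x \<bullet> b) (at 0)"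
        unfolding has_field_derivative_iff by simp
      moreover have "filterlim (\<lambda>n. 1 / real (Suc n)) (at 0) sequentially"
        unfolding filterlim_at using LIMSEQ_inverse_real_of_nat by (auto simp: inverse_eq_divide)
      ultimately have "(\<lambda>n. diff_quot w b n x) \<longlonglongrightarrow> grad u x \<bullet> b"
        unfolding diff_quot_def by (rule filterlim_compose)
      then show ?case by (rule limI)
    qed
  qed
qed

lemma nq_grad_measurable[measurable (raw)]:
  "u \<in> Lip_loc \<Omega> \<Longrightarrow> (\<lambda>x. nq x (grad u x)) \<in> borel_measurable \<mu>"
  by (intro nq_measurable grad_measurable)

lemma rho_measurable: "(\<lambda>z. \<rho> (fst z) (snd z)) \<in> borel_measurable (\<nu> \<Otimes>\<^sub>M \<mu>)"
proof -
  have b: "(\<lambda>z. indicator (\<Omega> \<times> \<Omega>) z *\<^sub>R \<rho> (fst z) (snd z)) \<in> borel_measurable borel"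
    using domain(1) by (intro borel_measurable_continuous_on_indicator rho_continuous) (auto intro!: borel_open open_Times)
  have i: "(\<lambda>x. x) \<in> measurable \<mu> borel" "(\<lambda>x. x) \<in> measurable \<nu> borel" by (rule borel_measurable_on_domain; simp)+
  have "(\<lambda>z. (fst z, snd z)) \<in> measurable (\<nu> \<Otimes>\<^sub>M \<mu>) (borel \<Otimes>\<^sub>M borel)"
    using measurable_compose[OF measurable_fst i(2)] measurable_compose[OF measurable_snd i(1)] by (intro measurable_Pair)
  then have "(\<lambda>z. z) \<in> measurable (\<nu> \<Otimes>\<^sub>M \<mu>) borel" by (simp add: borel_prod)
  from measurable_compose[OF this b]
  show ?thesis by (subst (asm) measurable_cong[where g = "\<lambda>z. \<rho> (fst z) (snd z)"]) (auto simp: space_pair_measure)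
qed

text \<open>
  The measure of the ball with centre \<open>z\<close> through \<open>y\<close> is the integral of
  a jointly measurable indicator.
\<close>

lemma SK_kernel_measurable: "(\<lambda>z. SK_kernel \<Omega> \<rho> \<mu> (fst z) (snd z)) \<in> borel_measurable (\<nu> \<Otimes>\<^sub>M \<mu>)"
proof -
  note [measurable] = rho_measurable
  have r2: "(\<lambda>q. \<rho> (fst (fst q)) (snd q)) \<in> borel_measurable ((\<nu> \<Otimes>\<^sub>M \<mu>) \<Otimes>\<^sub>M \<mu>)"
    using measurable_compose[OF _ rho_measurable, of "\<lambda>q. (fst (fst q), snd q)" "(\<nu> \<Otimes>\<^sub>M \<mu>) \<Otimes>\<^sub>M \<mu>"] by simp
  have r1: "(\<lambda>q. \<rho> (fst (fst q)) (snd (fst q))) \<in> borel_measurable ((\<nu> \<Otimes>\<^sub>M \<mu>) \<Otimes>\<^sub>M \<mu>)"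
    using measurable_compose[OF _ rho_measurable, of fst "(\<nu> \<Otimes>\<^sub>M \<mu>) \<Otimes>\<^sub>M \<mu>"] by simp
  note [measurable] = r1 r2
  have "(\<lambda>q. if \<rho> (fst (fst q)) (snd q) < \<rho> (fst (fst q)) (snd (fst q)) then 1 else 0 :: ennreal)
     \<in> borel_measurable ((\<nu> \<Otimes>\<^sub>M \<mu>) \<Otimes>\<^sub>M \<mu>)" by measurable
  then have "(\<lambda>z. \<integral>\<^sup>+w. (if \<rho> (fst z) w < \<rho> (fst z) (snd z) then 1 else 0) \<partial>\<mu>) \<in> borel_measurable (\<nu> \<Otimes>\<^sub>M \<mu>)"
    by (intro mu.borel_measurable_nn_integral) (simp add: case_prod_beta')
  also have "?this \<longleftrightarrow> (\<lambda>z. emeasure \<mu> (mball (fst z) (\<rho> (fst z) (snd z)))) \<in> borel_measurable (\<nu> \<Otimes>\<^sub>M \<mu>)"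
  proof (rule measurable_cong)
    fix z assume "z \<in> space (\<nu> \<Otimes>\<^sub>M \<mu>)"
    then have z: "fst z \<in> \<Omega>" "snd z \<in> \<Omega>" by (auto simp: space_pair_measure)
    have "emeasure \<mu> (mball (fst z) (\<rho> (fst z) (snd z))) = (\<integral>\<^sup>+w. indicator (mball (fst z) (\<rho> (fst z) (snd z))) w \<partial>\<mu>)"
      by simp
    also have "\<dots> = (\<integral>\<^sup>+w. (if \<rho> (fst z) w < \<rho> (fst z) (snd z) then 1 else 0) \<partial>\<mu>)"
      using z by (intro nn_integral_cong) (auto simp: indicator_def)
    finally show "(\<integral>\<^sup>+w. (if \<rho> (fst z) w < \<rho> (fst z) (snd z) then 1 else 0) \<partial>\<mu>) = emeasure \<mu> (mball (fst z) (\<rho> (fst z) (snd z)))" ..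
  qed
  finally show ?thesis unfolding SK_kernel_def by measurable
qed

lemma SK_kernel_measurable_snd[measurable]: "z \<in> \<Omega> \<Longrightarrow> (\<lambda>y. SK_kernel \<Omega> \<rho> \<mu> z y) \<in> borel_measurable \<mu>"
  using measurable_compose[OF measurable_Pair1' SK_kernel_measurable, of z] by simp

end

section \<open>Chains of balls and Fefferman's inequality\<close>

lemma ennreal_divide_mult_cancel: "y \<noteq> 0 \<Longrightarrow> y \<noteq> top \<Longrightarrow> x / y * y = (x::ennreal)"
  by (metis ennreal_divide_self ennreal_divide_times less_top mult.right_neutral)

text \<open>
  For a point \<open>y\<close> the terms of the series below live on balls of the chain that
  contain \<open>y\<close>, and at most two consecutive balls do.
\<close>

lemma suminf_two_consecutive_le:
  fixes c :: ennreal
  assumes le: "\<And>i. f i \<le> c" and near: "\<And>i j. f i \<noteq> 0 \<Longrightarrow> f j \<noteq> 0 \<Longrightarrow> i < j \<Longrightarrow> j = Suc i"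
  shows "(\<Sum>i. f i) \<le> 2 * c"
proof (cases "\<exists>i. f i \<noteq> 0")
  case True
  define i0 where "i0 = (LEAST i. f i \<noteq> 0)"
  have i0: "f i0 \<noteq> 0" unfolding i0_def using True by (rule LeastI_ex)
  have zero: "f i = 0" if i: "i \<notin> {i0, Suc i0}" for i
  proof (rule ccontr)
    assume fi: "f i \<noteq> 0"
    then have "i0 \<le> i" unfolding i0_def by (rule Least_le)
    with i near[OF i0 fi] show False by auto
  qed
  have "(\<Sum>i. f i) = (\<Sum>i\<in>{i0, Suc i0}. f i)" by (rule suminf_finite) (use zero in auto)
  also have "\<dots> \<le> 2 * c" using add_mono[OF le[of i0] le[of "Suc i0"]] by (simp add: mult_2)
  finally show ?thesis .
qed simp

context setting
begin

lemma average_close: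
  assumes w: "w \<in> borel_measurable \<nu>" "\<And>x. x \<in> \<Omega> \<Longrightarrow> \<bar>w x\<bar> \<le> b" and B: "B \<in> sets \<nu>" "measure \<nu> B > 0"
    and e: "\<And>x. x \<in> B \<Longrightarrow> \<bar>w x - c\<bar> \<le> e"
  shows "\<bar>average \<nu> B w - c\<bar> \<le> e"
proof -
  note [measurable] = w(1) B(1)
  have B\<Omega>: "B \<subseteq> \<Omega>" using sets.sets_into_space[OF B(1)] by simp
  have i1: "integrable \<nu> (\<lambda>x. indicator B x * w x)"
    by (rule nu.integrable_const_bound[of _ "\<bar>b\<bar>"])
      (use w(2) B\<Omega> in \<open>auto simp: indicator_def intro!: AE_I2 intro: order.trans[OF _ abs_ge_self]\<close>)
  have i2: "integrable \<nu> (\<lambda>x. indicator B x * k)" for k :: real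
    by (rule nu.integrable_const_bound[of _ "\<bar>k\<bar>"]) (auto simp: indicator_def)
  have eq: "average \<nu> B w - c = (1 / measure \<nu> B) * (\<integral>x. indicator B x * w x - indicator B x * c \<partial>\<nu>)"
    using B(2) i1 i2[of c] by (simp add: average_def set_lebesgue_integral_def right_diff_distrib Int_absorb2[OF B\<Omega>])
  have bound: "\<bar>\<integral>x. indicator B x * w x - indicator B x * c \<partial>\<nu>\<bar> \<le> measure \<nu> B * e"
  proof -
    have "\<bar>\<integral>x. indicator B x * w x - indicator B x * c \<partial>\<nu>\<bar> \<le> (\<integral>x. \<bar>indicator B x * w x - indicator B x * c\<bar> \<partial>\<nu>)"
      using integral_norm_bound[of \<nu> "\<lambda>x. indicator B x * w x - indicator B x * c"] by simp
    also have "\<dots> \<le> (\<integral>x. indicator B x * e \<partial>\<nu>)"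
      by (intro integral_mono integrable_abs Bochner_Integration.integrable_diff i1 i2) (use e in \<open>auto simp: indicator_def\<close>)
    also have "(\<integral>x. indicator B x * e \<partial>\<nu>) = measure \<nu> B * e" by (simp add: Int_absorb2[OF B\<Omega>])
    finally show ?thesis .
  qed
  show ?thesis unfolding eq using B(2) bound by (simp add: abs_mult pos_divide_le_eq mult.commute)
qed

end

locale setting_poincare = setting \<Omega> \<rho> h m Q \<mu> \<nu> p A Cv
  for \<Omega> :: "(real^'n) set" and \<rho> h m Q \<mu> \<nu> p A Cv +
  fixes C0 :: real
  assumes H1: "geodesic_hyp \<Omega> \<rho>" and C0: "C0 > 0"
    and poincare: "\<And>x r u. x \<in> \<Omega> \<Longrightarrow> r > 0 \<Longrightarrow> mB \<Omega> \<rho> x r \<Subset> \<Omega> \<Longrightarrow> u \<in> Lip_loc \<Omega> \<Longrightarrow>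
        (\<integral>\<^sup>+y\<in>mB \<Omega> \<rho> x r. ennreal \<bar>u y - average \<nu> (mB \<Omega> \<rho> x r) u\<bar> \<partial>\<nu>) / emeasure \<nu> (mB \<Omega> \<rho> x r)
        \<le> ennreal C0 * (ennreal r / emeasure \<mu> (mB \<Omega> \<rho> x r)) *
           (\<integral>\<^sup>+y\<in>mB \<Omega> \<rho> x r. ennreal (norm (matrix_sqrt (Q y) *v grad u y)) \<partial>\<mu>)"
begin

text \<open>
  The averages over two balls are compared on a common subset \<open>D\<close> that fills a fixed
  portion of both. For the average only the mean oscillation matters, so \<open>a\<close> and
  \<open>b\<close> may be any numbers.
\<close>

lemma adjacent_averages:
  assumes w: "w \<in> borel_measurable \<nu>" and D: "D \<in> sets \<nu>" "emeasure \<nu> D > 0"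
    and B: "B \<in> sets \<nu>" "B' \<in> sets \<nu>" "D \<subseteq> B" "D \<subseteq> B'"
    and le: "emeasure \<nu> B \<le> ennreal K * emeasure \<nu> D" "emeasure \<nu> B' \<le> ennreal K * emeasure \<nu> D"
  shows "ennreal \<bar>a - b\<bar> \<le> ennreal K * ((\<integral>\<^sup>+y\<in>B. ennreal \<bar>w y - a\<bar> \<partial>\<nu>) / emeasure \<nu> B + (\<integral>\<^sup>+y\<in>B'. ennreal \<bar>w y - b\<bar> \<partial>\<nu>) / emeasure \<nu> B')"
    (is "_ \<le> ennreal K * (?P + ?P')")
proof -
  note [measurable] = w D(1) B(1,2)
  have fin: "emeasure \<nu> D \<noteq> top" "emeasure \<nu> B \<noteq> top" "emeasure \<nu> B' \<noteq> top" by (auto simp: nu.emeasure_eq_measure)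
  have posB: "emeasure \<nu> B \<noteq> 0" "emeasure \<nu> B' \<noteq> 0"
    using emeasure_mono[OF B(3,1)] emeasure_mono[OF B(4,2)] D(2) by auto
  have "emeasure \<nu> D * ennreal \<bar>a - b\<bar> = (\<integral>\<^sup>+y\<in>D. ennreal \<bar>a - b\<bar> \<partial>\<nu>)"
    by (subst nn_integral_cmult_indicator) (auto simp: mult.commute)
  also have "\<dots> \<le> (\<integral>\<^sup>+y. ennreal \<bar>w y - a\<bar> * indicator B y + ennreal \<bar>w y - b\<bar> * indicator B' y \<partial>\<nu>)"
  proof (rule nn_integral_mono)
    fix y
    show "ennreal \<bar>a - b\<bar> * indicator D y \<le> ennreal \<bar>w y - a\<bar> * indicator B y + ennreal \<bar>w y - b\<bar> * indicator B' y"
    proof (cases "y \<in> D")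
      case True
      then have "y \<in> B" "y \<in> B'" using B(3,4) by auto
      moreover have "ennreal \<bar>a - b\<bar> \<le> ennreal (\<bar>w y - a\<bar> + \<bar>w y - b\<bar>)" by (rule ennreal_leI) simp
      ultimately show ?thesis using True by (simp add: ennreal_plus)
    qed simp
  qed
  also have "\<dots> = ?P * emeasure \<nu> B + ?P' * emeasure \<nu> B'"
    using posB fin by (subst nn_integral_add) (auto simp: ennreal_divide_mult_cancel)
  also have "\<dots> \<le> ?P * (ennreal K * emeasure \<nu> D) + ?P' * (ennreal K * emeasure \<nu> D)"
    by (intro add_mono mult_left_mono le) auto
  also have "\<dots> = emeasure \<nu> D * (ennreal K * (?P + ?P'))"
    by (simp add: distrib_left mult.commute mult.left_commute mult.assoc)
  finally show ?thesis using fin D(2) by (subst (asm) ennreal_mult_le_mult_iff) auto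
qed

text \<open>
  Along a geodesic from \<open>z\<close> to a point outside the support, take balls \<open>B
  i\<close> with centre at distance \<open>s i = R / 2\<^sup>i\<close> from \<open>z\<close> and
  radius \<open>s i / 2\<close>. On the first one \<open>w\<close> vanishes, and the averages over
  \<open>B i\<close> tend to \<open>w z\<close>; so \<open>\<bar>w z\<bar>\<close> is bounded by
  the sum of the mean oscillations, which the Poincare inequality estimates. The radius of
  \<open>B i\<close> is comparable to the distance of its points from \<open>z\<close>, so the sum
  of the resulting factors is comparable to the kernel.
\<close>

lemma subrepresentation:
  assumes x0: "x0 \<in> \<Omega>" and \<epsilon>: "\<epsilon> > 0" and comp: "mball x0 (32 * \<epsilon>) \<Subset> \<Omega>"
    and w: "w \<in> Lip_0 \<Omega> (mball x0 \<epsilon>)" and z: "z \<in> mball x0 \<epsilon>"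
  shows "ennreal \<bar>w z\<bar> \<le> ennreal (4 * C0 * A ^ 6) *
     (\<integral>\<^sup>+y\<in>mball x0 \<epsilon>. ennreal (nq y (grad w y)) * SK_kernel \<Omega> \<rho> \<mu> z y \<partial>\<mu>)"
proof -
  note wD = Lip_0_D[OF w]
  note [measurable] = wD(3) nq_grad_measurable[OF wD(1)]
  obtain b where b: "\<And>x. x \<in> \<Omega> \<Longrightarrow> \<bar>w x\<bar> \<le> b" using wD(6) by blast
  have z\<Omega>: "z \<in> \<Omega>" and zd: "\<rho> x0 z < \<epsilon>" using z by auto
  \<comment> \<open>At distance \<open>3\<epsilon>\<close> from the centre, the whole ball of radius \<open>R /
      2 < 2\<epsilon>\<close> around this point lies outside the support.\<close>
  obtain x1 where x1: "x1 \<in> \<Omega>" "\<rho> x0 x1 = 3 * \<epsilon>" using sphere_point[OF x0 comp, of "3 * \<epsilon>"] \<epsilon> by auto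
  obtain \<alpha> \<beta> and c :: "real \<Rightarrow> real^'n" where c: "\<alpha> \<le> \<beta>" "c ` {\<alpha>..\<beta>} \<subseteq> \<Omega>" "c \<alpha> = z" "c \<beta> = x1"
      "\<And>s t. s \<in> {\<alpha>..\<beta>} \<Longrightarrow> t \<in> {\<alpha>..\<beta>} \<Longrightarrow> \<rho> (c s) (c t) = \<bar>s - t\<bar>"
    using H1[unfolded geodesic_hyp_def, rule_format, OF z\<Omega> x1(1)] by metis
  define R where "R = \<beta> - \<alpha>"
  define g where "g t = c (\<alpha> + t)" for t
  have g\<Omega>: "g t \<in> \<Omega>" if "0 \<le> t" "t \<le> R" for t using c(2) that by (auto simp: g_def R_def)
  have gd: "\<rho> (g s) (g t) = \<bar>s - t\<bar>" if "0 \<le> s" "s \<le> R" "0 \<le> t" "t \<le> R" for s t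
    using c(5)[of "\<alpha> + s" "\<alpha> + t"] that by (auto simp: g_def R_def)
  have R0: "R \<ge> 0" using c(1) by (simp add: R_def)
  have g0: "g 0 = z" and gR: "g R = x1" using c by (auto simp: g_def R_def)
  have "\<rho> z x1 = R" using gd[of 0 R] R0 by (simp add: g0 gR)
  then have R: "2 * \<epsilon> < R" "R < 4 * \<epsilon>"
    using triangle[OF x0 z\<Omega> x1(1)] triangle[OF z\<Omega> x0 x1(1)] x1(2) zd by (auto simp: commute)
  have gz: "\<rho> z (g t) = t" if "0 \<le> t" "t \<le> R" for t using gd[of 0 t] that R0 by (simp add: g0)
  define s where "s i = R / 2 ^ i" for i :: nat
  have s: "s i > 0" "s i \<le> R" "s (Suc i) = s i / 2" for i
    using R \<epsilon> by (auto simp: s_def field_simps)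
  define B where "B i = mball (g (s i)) (s i / 2)" for i
  \<comment> \<open>A ball around the point of the geodesic between the centres of \<open>B i\<close> and
      \<open>B (Suc i)\<close>, contained in both.\<close>
  define D where "D i = mball (g (5 * s i / 8)) (s i / 8)" for i
  have gs: "g (s i) \<in> \<Omega>" "g (5 * s i / 8) \<in> \<Omega>" "\<rho> z (g (s i)) = s i" "\<rho> z (g (5 * s i / 8)) = 5 * s i / 8" for i
    using g\<Omega>[of "s i"] g\<Omega>[of "5 * s i / 8"] gz[of "s i"] gz[of "5 * s i / 8"] s[of i] by auto
  have cz: "mball z t \<Subset> \<Omega>" "mball z t \<subseteq> mball x0 (32 * \<epsilon>)" if "t \<le> 31 * \<epsilon>" for t
  proof -
    show "mball z t \<subseteq> mball x0 (32 * \<epsilon>)" by (rule mball_sub_mball) (use zd x0 that in auto)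
    then show "mball z t \<Subset> \<Omega>" using comp by (rule compactly_in_mono)
  qed
  have inz: "mball y t \<subseteq> mball z (31 * \<epsilon>)" if "\<rho> z y + t \<le> 31 * \<epsilon>" for y t
    by (rule mball_sub_mball) (use z\<Omega> that in auto)
  have cy: "mball y t \<Subset> \<Omega>" if "\<rho> z y + t \<le> 31 * \<epsilon>" for y t
    using cz(1)[of "31 * \<epsilon>"] inz[OF that] compactly_in_mono by simp
  have DB: "D i \<subseteq> B i" "D i \<subseteq> B (Suc i)" for i
  proof -
    show "D i \<subseteq> B i" unfolding D_def B_def
      by (rule mball_sub_mball) (use gs gd[of "s i" "5 * s i / 8"] s[of i] in auto)
    show "D i \<subseteq> B (Suc i)" unfolding D_def B_def s(3)
      by (rule mball_sub_mball) (use gs(1)[of "Suc i", unfolded s(3)] gd[of "s i / 2" "5 * s i / 8"] s(1,2)[of i] in auto)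
  qed
  have nuBD: "emeasure \<nu> (B i) \<le> ennreal (A ^ 3) * emeasure \<nu> (D i)"
     "emeasure \<nu> (B (Suc i)) \<le> ennreal (A ^ 3) * emeasure \<nu> (D i)" for i
  proof -
    have c8: "mball (g (5 * s i / 8)) (2 ^ 3 * (s i / 8)) \<Subset> \<Omega>"
      by (rule cy) (use gs(4)[of i] s[of i] R in auto)
    have sub: "mball (g (s i)) (s i / 2) \<subseteq> mball (g (5 * s i / 8)) (2 ^ 3 * (s i / 8))"
      "mball (g (s i / 2)) (s i / 2 / 2) \<subseteq> mball (g (5 * s i / 8)) (2 ^ 3 * (s i / 8))"
      using gd[of "5 * s i / 8" "s i"] gd[of "5 * s i / 8" "s i / 2"] s(1,2)[of i]
      by (intro mball_sub_mball gs(2); simp)+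
    show "emeasure \<nu> (B i) \<le> ennreal (A ^ 3) * emeasure \<nu> (D i)" unfolding B_def D_def
      by (rule ball_comparison(1)[OF gs(1) gs(2) _ sub(1) c8]) (use s(1)[of i] in simp)
    show "emeasure \<nu> (B (Suc i)) \<le> ennreal (A ^ 3) * emeasure \<nu> (D i)" unfolding B_def D_def s(3)
      by (rule ball_comparison(1)[OF gs(1)[of "Suc i", unfolded s(3)] gs(2) _ sub(2) c8]) (use s(1)[of i] in simp)
  qed
  have Bsets[measurable]: "B i \<in> sets \<nu>" "B i \<in> sets \<mu>" "D i \<in> sets \<nu>" for i by (auto simp: B_def D_def)
  have posD: "emeasure \<nu> (D i) > 0" and posB: "emeasure \<nu> (B i) > 0" for i
    unfolding B_def D_def using nu_ball_pos gs s[of i] by auto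
  define a where "a i = average \<nu> (B i) w" for i
  define P where "P i = (\<integral>\<^sup>+y\<in>B i. ennreal \<bar>w y - a i\<bar> \<partial>\<nu>) / emeasure \<nu> (B i)" for i
  have step: "ennreal \<bar>a i - a (Suc i)\<bar> \<le> ennreal (A ^ 3) * (P i + P (Suc i))" for i
    unfolding P_def by (rule adjacent_averages[OF wD(3) _ posD _ _ DB nuBD]) measurable
  have mpos: "measure \<nu> (B i) > 0" for i using posB[of i] by (simp add: nu.emeasure_eq_measure)
  have a0: "a 0 = 0"
  proof -
    have "w y = 0" if "y \<in> B 0" for y
    proof (rule wD(5))
      have y: "y \<in> \<Omega>" "\<rho> x1 y < R / 2" using that by (auto simp: B_def s_def gR)
      then show "y \<in> \<Omega>" by simp
      show "y \<notin> mball x0 \<epsilon>" using triangle[OF x0 y(1) x1(1)] y R x1(2) by (auto simp: commute)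
    qed
    then have "\<bar>average \<nu> (B 0) w - 0\<bar> \<le> 0"
      by (intro average_close[OF wD(3) b]) (use mpos in auto)
    then show ?thesis by (simp add: a_def)
  qed
  have sum_a: "ennreal \<bar>a n\<bar> \<le> (\<Sum>i<n. ennreal \<bar>a i - a (Suc i)\<bar>)" for n
  proof (induction n)
    case (Suc n)
    have "ennreal \<bar>a (Suc n)\<bar> \<le> ennreal \<bar>a n\<bar> + ennreal \<bar>a n - a (Suc n)\<bar>"
    proof -
      have "ennreal \<bar>a (Suc n)\<bar> \<le> ennreal (\<bar>a n\<bar> + \<bar>a n - a (Suc n)\<bar>)" by (rule ennreal_leI) simp
      then show ?thesis by (simp add: ennreal_plus)
    qed
    also have "\<dots> \<le> (\<Sum>i<Suc n. ennreal \<bar>a i - a (Suc i)\<bar>)" using Suc by (simp add: add_right_mono)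
    finally show ?case .
  qed (simp add: a0)
  have abound: "ennreal \<bar>a n\<bar> \<le> ennreal (2 * A ^ 3) * (\<Sum>i. P i)" for n
  proof -
    have "ennreal \<bar>a n\<bar> \<le> (\<Sum>i<n. ennreal (A ^ 3) * (P i + P (Suc i)))"
      by (rule order.trans[OF sum_a]) (intro sum_mono step)
    also have "\<dots> = ennreal (A ^ 3) * ((\<Sum>i<n. P i) + (\<Sum>i<n. P (Suc i)))"
      by (simp add: sum.distrib flip: sum_distrib_left)
    also have "\<dots> \<le> ennreal (A ^ 3) * ((\<Sum>i. P i) + (\<Sum>i. P i))"
    proof (intro mult_left_mono add_mono)
      show "(\<Sum>i<n. P i) \<le> (\<Sum>i. P i)" by (rule sum_le_suminf) auto
      have "(\<Sum>i<n. P (Suc i)) = (\<Sum>i\<in>Suc ` {..<n}. P i)" by (subst sum.reindex) auto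
      also have "\<dots> \<le> (\<Sum>i. P i)" by (rule sum_le_suminf) auto
      finally show "(\<Sum>i<n. P (Suc i)) \<le> (\<Sum>i. P i)" .
    qed auto
    also have "\<dots> = ennreal (2 * A ^ 3) * (\<Sum>i. P i)"
      using A by (simp add: ennreal_mult flip: mult_2) (simp add: ac_simps)
    finally show ?thesis .
  qed
  \<comment> \<open>The balls \<open>B n\<close> shrink to \<open>z\<close>, where \<open>w\<close> is
      continuous.\<close>
  have wz: "ennreal \<bar>w z\<bar> \<le> ennreal (2 * A ^ 3) * (\<Sum>i. P i)"
  proof (rule ennreal_le_epsilon)
    fix e :: real assume e: "0 < e"
    let ?U = "w -` {w z - e<..<w z + e} \<inter> \<Omega>"
    have oU: "open ?U" by (rule continuous_on_open_vimage[THEN iffD1, rule_format, OF domain(1) wD(2)]) simp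
    have zU: "z \<in> ?U" using z\<Omega> e by simp
    obtain t where t: "t > 0" "mball z t \<subseteq> ?U" by (rule mball_in_open[OF oU zU z\<Omega>])
    obtain n where n: "2 * R / t < 2 ^ n" using real_arch_pow[of 2 "2 * R / t"] by auto
    have "3 * s n / 2 \<le> t"
      using n t R \<epsilon> by (simp add: s_def field_simps)
    then have "B n \<subseteq> mball z t" unfolding B_def
      by (intro mball_sub_mball) (use gs(3)[of n] z\<Omega> in auto)
    then have "\<bar>w y - w z\<bar> \<le> e" if "y \<in> B n" for y using that t(2) by (force simp: abs_le_iff)
    then have "\<bar>a n - w z\<bar> \<le> e" unfolding a_def
      by (intro average_close[OF wD(3) b]) (use mpos in auto)
    then have "ennreal \<bar>w z\<bar> \<le> ennreal (\<bar>a n\<bar> + e)" by (intro ennreal_leI) auto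
    also have "\<dots> = ennreal \<bar>a n\<bar> + ennreal e" using e by (simp add: ennreal_plus)
    also have "\<dots> \<le> ennreal (2 * A ^ 3) * (\<Sum>i. P i) + ennreal e" by (intro add_right_mono abound)
    finally show "ennreal \<bar>w z\<bar> \<le> ennreal (2 * A ^ 3) * (\<Sum>i. P i) + ennreal e" .
  qed
  let ?K = "SK_kernel \<Omega> \<rho> \<mu> z"
  define k where "k i = ennreal (s i / 2) / emeasure \<mu> (B i)" for i
  have Ple: "P i \<le> ennreal C0 * (\<integral>\<^sup>+y. ennreal (nq y (grad w y)) * (k i * indicator (B i) y) \<partial>\<mu>)" for i
  proof -
    have "P i \<le> ennreal C0 * k i * (\<integral>\<^sup>+y\<in>B i. ennreal (nq y (grad w y)) \<partial>\<mu>)"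
      unfolding P_def k_def B_def a_def nq_def
      by (rule poincare) (use gs s[of i] wD(1) cy[of "g (s i)" "s i / 2"] R in auto)
    also have "\<dots> = ennreal C0 * (\<integral>\<^sup>+y. ennreal (nq y (grad w y)) * (k i * indicator (B i) y) \<partial>\<mu>)"
      by (simp add: nn_integral_cmult[symmetric] mult.assoc mult.left_commute)
    finally show ?thesis .
  qed
  have ker: "(\<Sum>i. k i * indicator (B i) y) \<le> ennreal (2 * A ^ 3) * ?K y" if y: "y \<in> mball x0 \<epsilon>" for y
  proof -
    have y\<Omega>: "y \<in> \<Omega>" and yd: "\<rho> x0 y < \<epsilon>" using y by auto
    have zy: "\<rho> z y < 2 * \<epsilon>" using triangle[OF z\<Omega> x0 y\<Omega>] zd yd by (simp add: commute)
    have rng: "s i / 2 < \<rho> z y" "\<rho> z y < 3 * s i / 2" if "y \<in> B i" for i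
      using that gs[of i] triangle[OF z\<Omega> y\<Omega> gs(1)[of i]] triangle[OF z\<Omega> gs(1)[of i] y\<Omega>]
      by (auto simp: B_def commute)
    have "(\<Sum>i. k i * indicator (B i) y) \<le> 2 * (ennreal (A ^ 3) * ?K y)"
    proof (rule suminf_two_consecutive_le)
      fix i
      show "k i * indicator (B i) y \<le> ennreal (A ^ 3) * ?K y"
      proof (cases "y \<in> B i")
        case True
        have "mball z (\<rho> z y) \<subseteq> mball (g (s i)) (2 ^ 3 * (s i / 2))"
          using rng[OF True] gs[of i] by (intro mball_sub_mball) (auto simp: commute)
        moreover have "mball (g (s i)) (2 ^ 3 * (s i / 2)) \<Subset> \<Omega>"
          by (rule cy) (use gs(3)[of i] s[of i] R in auto)
        ultimately have "emeasure \<mu> (mball z (\<rho> z y)) \<le> ennreal (A ^ 3) * emeasure \<mu> (B i)"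
          unfolding B_def using ball_comparison(2)[OF z\<Omega> gs(1)] s[of i] by simp
        then have "ennreal (\<rho> z y) / emeasure \<mu> (B i) \<le> ennreal (A ^ 3) * ?K y"
          unfolding SK_kernel_def using A by (intro ennreal_divide_compare) auto
        moreover have "k i \<le> ennreal (\<rho> z y) / emeasure \<mu> (B i)"
          unfolding k_def using rng[OF True] by (intro divide_right_mono_ennreal ennreal_leI) auto
        ultimately show ?thesis using True by simp
      qed simp
      fix j assume ij: "k i * indicator (B i) y \<noteq> 0" "k j * indicator (B j) y \<noteq> 0" "i < j"
      then have yi: "y \<in> B i" and yj: "y \<in> B j" by (auto simp: indicator_def split: if_splits)
      show "j = Suc i"
      proof (rule ccontr)
        assume "j \<noteq> Suc i"
        then obtain l where j: "j = Suc (Suc (i + l))" using ij(3) by (metis Suc_lessI add_Suc less_imp_Suc_add)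
        have "s j \<le> s i / 4"
        proof -
          have "(1::real) \<le> 2 ^ l" by simp
          then have "s i / 4 / 2 ^ l \<le> s i / 4 / 1" using s(1)[of i] by (intro divide_left_mono) auto
          moreover have "s j = s i / 4 / 2 ^ l" by (simp add: s_def j power_add)
          ultimately show ?thesis by simp
        qed
        then show False using rng[OF yi] rng[OF yj] s(1)[of i] by auto
      qed
    qed
    then show ?thesis using A by (simp add: ennreal_mult mult.assoc)
  qed
  have zero: "nq y (grad w y) = 0" if "y \<in> \<Omega>" "y \<notin> mball x0 \<epsilon>" for y
    using grad_zero_outside_ball[OF w that] by simp
  have "(\<Sum>i. P i) \<le> (\<Sum>i. ennreal C0 * (\<integral>\<^sup>+y. ennreal (nq y (grad w y)) * (k i * indicator (B i) y) \<partial>\<mu>))"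
    by (intro suminf_le Ple) auto
  also have "\<dots> = ennreal C0 * (\<integral>\<^sup>+y. (\<Sum>i. ennreal (nq y (grad w y)) * (k i * indicator (B i) y)) \<partial>\<mu>)"
    by (subst nn_integral_suminf) (auto simp: ennreal_suminf_cmult)
  also have "\<dots> \<le> ennreal C0 * (\<integral>\<^sup>+y. ennreal (2 * A ^ 3) * (ennreal (nq y (grad w y)) * ?K y * indicator (mball x0 \<epsilon>) y) \<partial>\<mu>)"
  proof (intro mult_left_mono nn_integral_mono)
    fix y assume y: "y \<in> space \<mu>"
    show "(\<Sum>i. ennreal (nq y (grad w y)) * (k i * indicator (B i) y)) \<le>
      ennreal (2 * A ^ 3) * (ennreal (nq y (grad w y)) * ?K y * indicator (mball x0 \<epsilon>) y)"
    proof (cases "y \<in> mball x0 \<epsilon>")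
      case True
      have "(\<Sum>i. ennreal (nq y (grad w y)) * (k i * indicator (B i) y)) = ennreal (nq y (grad w y)) * (\<Sum>i. k i * indicator (B i) y)"
        by (rule ennreal_suminf_cmult)
      also have "\<dots> \<le> ennreal (nq y (grad w y)) * (ennreal (2 * A ^ 3) * ?K y)" by (intro mult_left_mono ker True) auto
      finally show ?thesis using True by (simp add: mult.left_commute mult.assoc)
    qed (use y zero in auto)
  qed auto
  also have "\<dots> = ennreal C0 * (ennreal (2 * A ^ 3) * (\<integral>\<^sup>+y\<in>mball x0 \<epsilon>. ennreal (nq y (grad w y)) * ?K y \<partial>\<mu>))"
    using z\<Omega> by (subst nn_integral_cmult) auto
  finally have "ennreal (2 * A ^ 3) * (\<Sum>i. P i) \<le> ennreal (2 * A ^ 3) * (ennreal C0 * (ennreal (2 * A ^ 3) * (\<integral>\<^sup>+y\<in>mball x0 \<epsilon>. ennreal (nq y (grad w y)) * ?K y \<partial>\<mu>)))"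
    by (rule mult_left_mono) simp
  also have "\<dots> = ennreal (4 * C0 * A ^ 6) * (\<integral>\<^sup>+y\<in>mball x0 \<epsilon>. ennreal (nq y (grad w y)) * ?K y \<partial>\<mu>)"
  proof -
    have e: "4 * C0 * A ^ 6 = (2 * A ^ 3) * (C0 * (2 * A ^ 3))" by (simp add: algebra_simps flip: power_add)
    have f: "ennreal (X * (C0 * X)) = ennreal X * (ennreal C0 * ennreal X)" if "X \<ge> 0" for X
      using that C0 by (simp add: ennreal_mult)
    have "ennreal (4 * C0 * A ^ 6) = ennreal (2 * A ^ 3) * (ennreal C0 * ennreal (2 * A ^ 3))"
      unfolding e by (rule f) (use A in simp)
    then show ?thesis by (simp only: mult.assoc)
  qed
  finally show ?thesis using wz by (rule order.trans[rotated])
qed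

text \<open>
  Insert the potential bound for one factor \<open>\<bar>w\<bar>\<close> of
  \<open>\<bar>w\<bar>\<^sup>p\<close>, split the product \<open>\<bar>\<surd>Q \<nabla>w\<bar>
  \<bar>w\<bar>\<^sup>p\<^sup>-\<^sup>1\<close> by Young's inequality with a weight depending on
  \<open>y\<close>, and exchange the integrals. The weight is the potential \<open>N\<close> of
  \<open>V\<close>, to the power that makes the first term lose \<open>N\<close> altogether and
  makes the second term reproduce the modulus; the second term is then absorbed on the left.
\<close>

lemma fefferman:
  assumes x0: "x0 \<in> \<Omega>" and \<epsilon>: "\<epsilon> > 0" and comp: "mball x0 (32 * \<epsilon>) \<Subset> \<Omega>"
    and w: "w \<in> Lip_0 \<Omega> (mball x0 \<epsilon>)" and V: "V \<in> borel_measurable \<nu>"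
    and Vfin: "(\<integral>\<^sup>+z\<in>mball x0 \<epsilon>. ennreal \<bar>V z\<bar> \<partial>\<nu>) < top"
    and a: "a > 0" and \<Phi>: "enn_powr (SK_Phi \<Omega> \<rho> \<mu> \<nu> p V (2 * \<epsilon>)) (1 / (p - 1)) \<le> ennreal a"
  shows "(\<integral>\<^sup>+z. ennreal (\<bar>V z\<bar> * \<bar>w z\<bar> powr p) \<partial>\<nu>) \<le>
     ennreal ((2 * (4 * C0 * A ^ 6)) powr p * a powr (p - 1)) * energy (grad w)"
proof -
  define K where "K = 4 * C0 * A ^ 6"
  have K: "K > 0" using C0 A by (simp add: K_def)
  let ?B = "mball x0 \<epsilon>" and ?k = "SK_kernel \<Omega> \<rho> \<mu>"
  define n where "n y = nq y (grad w y)" for y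
  note wD = Lip_0_D[OF w]
  have n0: "n y \<ge> 0" for y by (simp add: n_def)
  have nm[measurable]: "n \<in> borel_measurable \<mu>" unfolding n_def[abs_def] by (rule nq_grad_measurable[OF wD(1)])
  note [measurable] = wD(3) V
  interpret P: pair_sigma_finite \<nu> \<mu> by standard
  interpret P': pair_sigma_finite \<mu> \<nu> by standard
  have km[measurable]: "(\<lambda>q. ?k (fst q) (snd q)) \<in> borel_measurable (\<nu> \<Otimes>\<^sub>M \<mu>)" by (rule SK_kernel_measurable)
  have km': "(\<lambda>q. ?k (snd q) (fst q)) \<in> borel_measurable (\<mu> \<Otimes>\<^sub>M \<nu>)"
    using measurable_compose[OF measurable_pair_swap' km] by (simp add: case_prod_beta')
  define N where "N y = (\<integral>\<^sup>+z\<in>?B. ennreal \<bar>V z\<bar> * ?k z y \<partial>\<nu>)" for y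
  have Nm[measurable]: "N \<in> borel_measurable \<mu>" unfolding N_def[abs_def]
    by (rule nu.borel_measurable_nn_integral) (use km' in \<open>simp add: case_prod_beta'\<close>)
  define q where "q = 1 / (p - 1)"
  have q: "q > 0" "(p - 1) * q = 1" using p by (auto simp: q_def)
  \<comment> \<open>Here the modulus enters. The ball with centre \<open>x0\<close> is contained in a ball with
      centre \<open>z\<close> and twice the radius.\<close>
  have pot: "(\<integral>\<^sup>+y\<in>?B. ?k z y * enn_powr (N y) q \<partial>\<mu>) \<le> ennreal a" if z: "z \<in> ?B" for z
  proof -
    have z\<Omega>: "z \<in> \<Omega>" using z by simp
    have sub: "?B \<subseteq> mball z (2 * \<epsilon>)"
      by (rule mball_sub_mball) (use z in \<open>auto simp: commute\<close>)
    let ?X = "\<integral>\<^sup>+y\<in>mball z (2 * \<epsilon>). ?k z y * enn_powr (\<integral>\<^sup>+z'\<in>mball z (2 * \<epsilon>). ennreal \<bar>V z'\<bar> * ?k z' y \<partial>\<nu>) q \<partial>\<mu>"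
    have "(\<integral>\<^sup>+y\<in>?B. ?k z y * enn_powr (N y) q \<partial>\<mu>) \<le> ?X"
    proof (rule nn_integral_mono)
      fix y
      have "N y \<le> (\<integral>\<^sup>+z'\<in>mball z (2 * \<epsilon>). ennreal \<bar>V z'\<bar> * ?k z' y \<partial>\<nu>)"
        unfolding N_def using subsetD[OF sub] by (intro nn_integral_mono mult_left_mono) (auto simp: indicator_def simp del: in_mball)
      from enn_powr_mono[OF this q(1)] subsetD[OF sub, of y]
      show "?k z y * enn_powr (N y) q * indicator ?B y \<le>
         ?k z y * enn_powr (\<integral>\<^sup>+z'\<in>mball z (2 * \<epsilon>). ennreal \<bar>V z'\<bar> * ?k z' y \<partial>\<nu>) q * indicator (mball z (2 * \<epsilon>)) y"
        by (cases "y \<in> ?B") (auto simp: mult_left_mono simp del: in_mball)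
    qed
    also have "?X = enn_powr (enn_powr ?X (p - 1)) q" by (simp add: enn_powr_powr q)
    also have "\<dots> \<le> enn_powr (SK_Phi \<Omega> \<rho> \<mu> \<nu> p V (2 * \<epsilon>)) q"
      unfolding SK_Phi_def q_def[symmetric] by (intro enn_powr_mono SUP_upper z\<Omega> q)
    also have "\<dots> \<le> ennreal a" using \<Phi> by (simp add: q_def)
    finally show ?thesis .
  qed
  define I where "I = (\<integral>\<^sup>+z. ennreal (\<bar>V z\<bar> * \<bar>w z\<bar> powr p) \<partial>\<nu>)"
  define J where "J = (\<integral>\<^sup>+y. ennreal (n y powr p) \<partial>\<mu>)"
  have w0: "w z = 0" if "z \<in> \<Omega>" "z \<notin> ?B" for z using wD(5)[OF that] .
  \<comment> \<open>Finiteness is what permits the absorption; it follows from the integrability of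
      \<open>V\<close> and the boundedness of \<open>w\<close>.\<close>
  have Ifin: "I < top"
  proof -
    obtain b where b: "b \<ge> 0" "\<And>x. x \<in> \<Omega> \<Longrightarrow> \<bar>w x\<bar> \<le> b" using wD(6) by blast
    have "I \<le> (\<integral>\<^sup>+z. ennreal (b powr p) * (ennreal \<bar>V z\<bar> * indicator ?B z) \<partial>\<nu>)"
      unfolding I_def
    proof (rule nn_integral_mono)
      fix z assume z: "z \<in> space \<nu>"
      show "ennreal (\<bar>V z\<bar> * \<bar>w z\<bar> powr p) \<le> ennreal (b powr p) * (ennreal \<bar>V z\<bar> * indicator ?B z)"
      proof (cases "z \<in> ?B")
        case True
        have "\<bar>V z\<bar> * \<bar>w z\<bar> powr p \<le> b powr p * \<bar>V z\<bar>"
          using b(2)[of z] z p by (subst mult.commute) (intro mult_right_mono powr_mono2; simp)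
        then show ?thesis using True by (simp add: ennreal_mult[symmetric] ennreal_leI del: in_mball)
      qed (use w0 z in \<open>auto simp del: in_mball\<close>)
    qed
    also have "\<dots> = ennreal (b powr p) * (\<integral>\<^sup>+z\<in>?B. ennreal \<bar>V z\<bar> \<partial>\<nu>)" by (rule nn_integral_cmult) measurable
    also have "\<dots> < top" using Vfin by (simp add: ennreal_mult_less_top)
    finally show ?thesis .
  qed
  \<comment> \<open>With this weight the second term becomes half of \<open>I\<close>.\<close>
  define \<theta> where "\<theta> = 1 / (2 * K * a)"
  have \<theta>: "\<theta> > 0" using K a by (simp add: \<theta>_def)
  define c where "c z y = ennreal \<bar>V z\<bar> * ?k z y * (indicator ?B z * indicator ?B y)" for z y
  define E1 where "E1 y = ennreal (\<theta> powr (1 - p) * n y powr p) / N y" for y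
  define E2 where "E2 z y = ennreal \<theta> * enn_powr (N y) q * ennreal (\<bar>w z\<bar> powr p)" for z y
  have [measurable]: "E1 \<in> borel_measurable \<mu>" unfolding E1_def[abs_def] by measurable
  have cm[measurable]: "(\<lambda>q. c (fst q) (snd q)) \<in> borel_measurable (\<nu> \<Otimes>\<^sub>M \<mu>)" unfolding c_def by measurable
  have cm1[measurable]: "c z \<in> borel_measurable \<mu>" if "z \<in> \<Omega>" for z
    using measurable_compose[OF measurable_Pair1' cm, of z] that by simp
  have cm2[measurable]: "(\<lambda>z. c z y) \<in> borel_measurable \<nu>" if "y \<in> \<Omega>" for y
    using measurable_compose[OF measurable_Pair2' cm, of y] that by simp
  \<comment> \<open>At points where \<open>N\<close> is \<open>0\<close> or infinite one of the two terms is
      infinite unless the left hand side vanishes.\<close>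
  have pt: "ennreal (n y * \<bar>w z\<bar> powr (p - 1)) \<le> E1 y + E2 z y" for z y
  proof (cases "N y" rule: ennreal_cases)
    case (real s)
    show ?thesis
    proof (cases "s = 0")
      case True
      then show ?thesis using n0[of y] real \<theta> by (cases "n y = 0") (auto simp: E1_def)
    next
      case False
      then have s: "s > 0" using real by simp
      have "n y * \<bar>w z\<bar> powr (p - 1) \<le> (\<theta> * s powr q) powr (1 - p) * n y powr p + \<theta> * s powr q * \<bar>w z\<bar> powr p"
        using n0 s \<theta> p by (intro young_split) auto
      also have "(\<theta> * s powr q) powr (1 - p) = \<theta> powr (1 - p) / s"
      proof -
        have "q * (1 - p) = - 1" using q by (simp add: algebra_simps)
        then show ?thesis using s \<theta> by (simp add: powr_mult powr_powr powr_minus_divide)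
      qed
      finally have "ennreal (n y * \<bar>w z\<bar> powr (p - 1)) \<le> ennreal (\<theta> powr (1 - p) * n y powr p / s + \<theta> * s powr q * \<bar>w z\<bar> powr p)"
        by (intro ennreal_leI) simp
      also have "\<dots> = E1 y + E2 z y"
        using s \<theta> real by (simp add: E1_def E2_def ennreal_plus ennreal_mult divide_ennreal[symmetric])
      finally show ?thesis .
    qed
  next
    case top
    then show ?thesis using \<theta> p by (cases "w z = 0") (auto simp: E2_def ennreal_mult_top ennreal_top_mult)
  qed
  have "I \<le> (\<integral>\<^sup>+z. (\<integral>\<^sup>+y. ennreal K * (c z y * E1 y + c z y * E2 z y) \<partial>\<mu>) \<partial>\<nu>)"
    unfolding I_def
  proof (rule nn_integral_mono)
    fix z assume z: "z \<in> space \<nu>"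
    then have z\<Omega>: "z \<in> \<Omega>" by simp
    show "ennreal (\<bar>V z\<bar> * \<bar>w z\<bar> powr p) \<le> (\<integral>\<^sup>+y. ennreal K * (c z y * E1 y + c z y * E2 z y) \<partial>\<mu>)"
    proof (cases "z \<in> ?B")
      case True
      have "ennreal (\<bar>V z\<bar> * \<bar>w z\<bar> powr p) = ennreal (\<bar>V z\<bar> * \<bar>w z\<bar> powr (p - 1)) * ennreal \<bar>w z\<bar>"
        by (cases "w z = 0") (auto simp: powr_mult_base mult.assoc mult.commute simp flip: ennreal_mult)
      also have "\<dots> \<le> ennreal (\<bar>V z\<bar> * \<bar>w z\<bar> powr (p - 1)) * (ennreal K * (\<integral>\<^sup>+y\<in>?B. ennreal (n y) * ?k z y \<partial>\<mu>))"
        unfolding K_def n_def by (intro mult_left_mono subrepresentation[OF x0 \<epsilon> comp w True]) auto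
      also have "\<dots> = (\<integral>\<^sup>+y. ennreal K * (c z y * ennreal (n y * \<bar>w z\<bar> powr (p - 1))) \<partial>\<mu>)"
        using z\<Omega> True n0
        by (simp add: nn_integral_cmult[symmetric] c_def ennreal_mult mult.assoc mult.left_commute del: in_mball)
           (simp add: mult.commute mult.left_commute)
      also have "\<dots> \<le> (\<integral>\<^sup>+y. ennreal K * (c z y * E1 y + c z y * E2 z y) \<partial>\<mu>)"
        unfolding distrib_left[symmetric] by (intro nn_integral_mono mult_left_mono pt) auto
      finally show ?thesis .
    qed (use w0 z\<Omega> in \<open>simp del: in_mball\<close>)
  qed
  also have "\<dots> = ennreal K * ((\<integral>\<^sup>+z. (\<integral>\<^sup>+y. c z y * E1 y \<partial>\<mu>) \<partial>\<nu>) + (\<integral>\<^sup>+z. (\<integral>\<^sup>+y. c z y * E2 z y \<partial>\<mu>) \<partial>\<nu>))"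
  proof -
    have m1: "(\<lambda>q. c (fst q) (snd q) * E1 (snd q)) \<in> borel_measurable (\<nu> \<Otimes>\<^sub>M \<mu>)" by measurable
    have m2: "(\<lambda>q. c (fst q) (snd q) * E2 (fst q) (snd q)) \<in> borel_measurable (\<nu> \<Otimes>\<^sub>M \<mu>)" unfolding E2_def by measurable
    have "(\<integral>\<^sup>+z. (\<integral>\<^sup>+y. ennreal K * (c z y * E1 y + c z y * E2 z y) \<partial>\<mu>) \<partial>\<nu>)
      = (\<integral>\<^sup>+z. ennreal K * ((\<integral>\<^sup>+y. c z y * E1 y \<partial>\<mu>) + (\<integral>\<^sup>+y. c z y * E2 z y \<partial>\<mu>)) \<partial>\<nu>)"
    proof (rule nn_integral_cong)
      fix z assume "z \<in> space \<nu>"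
      then have z\<Omega>: "z \<in> \<Omega>" by simp
      have [measurable]: "(\<lambda>y. c z y * E2 z y) \<in> borel_measurable \<mu>" "(\<lambda>y. c z y * E1 y) \<in> borel_measurable \<mu>"
        using z\<Omega> unfolding E2_def by measurable
      show "(\<integral>\<^sup>+y. ennreal K * (c z y * E1 y + c z y * E2 z y) \<partial>\<mu>) =
        ennreal K * ((\<integral>\<^sup>+y. c z y * E1 y \<partial>\<mu>) + (\<integral>\<^sup>+y. c z y * E2 z y \<partial>\<mu>))"
        by (subst nn_integral_cmult, measurable) (subst nn_integral_add, auto)
    qed
    also have "\<dots> = ennreal K * ((\<integral>\<^sup>+z. (\<integral>\<^sup>+y. c z y * E1 y \<partial>\<mu>) \<partial>\<nu>) + (\<integral>\<^sup>+z. (\<integral>\<^sup>+y. c z y * E2 z y \<partial>\<mu>) \<partial>\<nu>))"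
      using mu.borel_measurable_nn_integral[of "\<lambda>z y. c z y * E1 y" \<nu>] mu.borel_measurable_nn_integral[of "\<lambda>z y. c z y * E2 z y" \<nu>] m1 m2
      by (subst nn_integral_cmult) (auto simp: nn_integral_add case_prod_beta')
    finally show ?thesis .
  qed
  also have "(\<integral>\<^sup>+z. (\<integral>\<^sup>+y. c z y * E1 y \<partial>\<mu>) \<partial>\<nu>) = (\<integral>\<^sup>+y. (\<integral>\<^sup>+z. c z y * E1 y \<partial>\<nu>) \<partial>\<mu>)"
    by (rule P'.Fubini') (use measurable_compose[OF measurable_pair_swap' cm] in \<open>simp add: case_prod_beta'\<close>)
  also have "\<dots> \<le> (\<integral>\<^sup>+y. ennreal (\<theta> powr (1 - p)) * ennreal (n y powr p) \<partial>\<mu>)"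
  proof (rule nn_integral_mono)
    fix y assume "y \<in> space \<mu>"
    then have y: "y \<in> \<Omega>" by simp
    have "(\<integral>\<^sup>+z. c z y * E1 y \<partial>\<nu>) = (\<integral>\<^sup>+z. c z y \<partial>\<nu>) * E1 y" using y by (intro nn_integral_multc) auto
    also have "(\<integral>\<^sup>+z. c z y \<partial>\<nu>) \<le> N y"
      unfolding N_def c_def by (intro nn_integral_mono) (auto simp: indicator_def)
    also have "N y * E1 y \<le> ennreal (\<theta> powr (1 - p) * n y powr p)"
      unfolding E1_def
      by (cases "N y = 0 \<or> N y = top") (auto simp: ennreal_divide_mult_cancel mult.commute[of "N y"])
    finally show "(\<integral>\<^sup>+z. c z y * E1 y \<partial>\<nu>) \<le> ennreal (\<theta> powr (1 - p)) * ennreal (n y powr p)"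
      by (simp add: ennreal_mult mult_right_mono)
  qed
  also have "\<dots> = ennreal (\<theta> powr (1 - p)) * J" unfolding J_def by (rule nn_integral_cmult) measurable
  also have "(\<integral>\<^sup>+z. (\<integral>\<^sup>+y. c z y * E2 z y \<partial>\<mu>) \<partial>\<nu>) \<le> (\<integral>\<^sup>+z. ennreal (\<theta> * a) * ennreal (\<bar>V z\<bar> * \<bar>w z\<bar> powr p) \<partial>\<nu>)"
  proof (rule nn_integral_mono)
    fix z assume "z \<in> space \<nu>"
    then have z: "z \<in> \<Omega>" by simp
    show "(\<integral>\<^sup>+y. c z y * E2 z y \<partial>\<mu>) \<le> ennreal (\<theta> * a) * ennreal (\<bar>V z\<bar> * \<bar>w z\<bar> powr p)"
    proof (cases "z \<in> ?B")
      case True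
      have "(\<integral>\<^sup>+y. c z y * E2 z y \<partial>\<mu>) = (\<integral>\<^sup>+y. ennreal \<theta> * ennreal (\<bar>V z\<bar> * \<bar>w z\<bar> powr p) * (?k z y * enn_powr (N y) q * indicator ?B y) \<partial>\<mu>)"
        using True by (intro nn_integral_cong) (simp add: c_def E2_def ennreal_mult ac_simps del: in_mball)
      also have "\<dots> = ennreal \<theta> * ennreal (\<bar>V z\<bar> * \<bar>w z\<bar> powr p) * (\<integral>\<^sup>+y\<in>?B. ?k z y * enn_powr (N y) q \<partial>\<mu>)"
        using z by (intro nn_integral_cmult) auto
      also have "\<dots> \<le> ennreal \<theta> * ennreal (\<bar>V z\<bar> * \<bar>w z\<bar> powr p) * ennreal a" by (intro mult_left_mono pot True) auto
      finally show ?thesis using \<theta> a by (simp add: ennreal_mult ac_simps)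
    qed (simp add: c_def del: in_mball)
  qed
  also have "\<dots> = ennreal (\<theta> * a) * I" unfolding I_def by (rule nn_integral_cmult) measurable
  finally have main: "I \<le> ennreal K * (ennreal (\<theta> powr (1 - p)) * J + ennreal (\<theta> * a) * I)"
    by (simp add: add_mono mult_left_mono)
  have "I \<le> ennreal ((2 * K) powr p * a powr (p - 1)) * J"
  proof (cases J rule: ennreal_cases)
    case (real j)
    obtain i where i: "I = ennreal i" "i \<ge> 0" using Ifin by (cases I rule: ennreal_cases) auto
    have "i \<le> K * (\<theta> powr (1 - p) * j + \<theta> * a * i)"
      using main real i K \<theta> a by (simp add: ennreal_mult[symmetric] ennreal_plus[symmetric] del: ennreal_plus)
    moreover have "K * (\<theta> * a * i) = i / 2" using K a by (simp add: \<theta>_def field_simps)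
    ultimately have "i \<le> 2 * K * \<theta> powr (1 - p) * j" by (simp add: distrib_left)
    also have "\<theta> powr (1 - p) = (2 * K * a) powr (p - 1)"
      using K a powr_minus_divide[of "2 * K * a" "1 - p"] by (simp add: \<theta>_def powr_divide)
    also have "\<dots> = (2 * K) powr (p - 1) * a powr (p - 1)" using K a by (simp add: powr_mult)
    also have "2 * K * ((2 * K) powr (p - 1) * a powr (p - 1)) * j = ((2 * K) powr p * a powr (p - 1)) * j"
      using K powr_mult_base[of "2 * K" "p - 1"] by (simp add: mult.assoc[symmetric])
    finally show ?thesis using real i by (simp add: ennreal_mult[symmetric] ennreal_leI)
  next
    case top
    then show ?thesis using K a by (simp add: ennreal_mult_top)
  qed
  then show ?thesis by (simp add: I_def J_def K_def n_def)
qed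

end

section \<open>Localisation by cutoff functions\<close>

lemma Lip_loc_mult:
  assumes u: "u \<in> Lip_loc \<Omega>" and w: "w \<in> Lip_loc \<Omega>"
  shows "(\<lambda>x. u x * w x) \<in> Lip_loc \<Omega>"
  unfolding Lip_loc_def
proof (intro CollectI ballI)
  fix x assume x: "x \<in> \<Omega>"
  obtain d1 L1 where d1: "d1 > 0" "L1-lipschitz_on (ball x d1 \<inter> \<Omega>) u" using u x unfolding Lip_loc_def by blast
  obtain d2 L2 where d2: "d2 > 0" "L2-lipschitz_on (ball x d2 \<inter> \<Omega>) w" using w x unfolding Lip_loc_def by blast
  define d where "d = min d1 d2"
  let ?S = "ball x d \<inter> \<Omega>"
  have d: "d > 0" using d1 d2 by (simp add: d_def)
  have 1: "L1-lipschitz_on ?S u" by (rule lipschitz_on_subset[OF d1(2)]) (auto simp: d_def)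
  have 2: "L2-lipschitz_on ?S w" by (rule lipschitz_on_subset[OF d2(2)]) (auto simp: d_def)
  have xS: "x \<in> ?S" using x d by simp
  have nn: "L1 \<ge> 0" "L2 \<ge> 0" using lipschitz_on_nonneg 1 2 by auto
  have b: "\<bar>f y\<bar> \<le> \<bar>f x\<bar> + L * d" if f: "L-lipschitz_on ?S f" and y: "y \<in> ?S" for L y and f :: "real^'a \<Rightarrow> real"
  proof -
    have "dist (f y) (f x) \<le> L * dist y x" by (rule lipschitz_onD[OF f y xS])
    also have "\<dots> \<le> L * d" using y lipschitz_on_nonneg[OF f] by (intro mult_left_mono) (auto simp: dist_commute)
    finally show ?thesis by (simp add: dist_real_def)
  qed
  define M where "M = (\<bar>w x\<bar> + L2 * d) * L1 + (\<bar>u x\<bar> + L1 * d) * L2"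
  have "M-lipschitz_on ?S (\<lambda>x. u x * w x)"
  proof (rule lipschitz_onI)
    show "0 \<le> M" using nn d by (simp add: M_def)
    fix y z assume y: "y \<in> ?S" and z: "z \<in> ?S"
    have "u y * w y - u z * w z = w y * (u y - u z) + u z * (w y - w z)" by (simp add: algebra_simps)
    then have "\<bar>u y * w y - u z * w z\<bar> \<le> \<bar>w y\<bar> * \<bar>u y - u z\<bar> + \<bar>u z\<bar> * \<bar>w y - w z\<bar>"
      using abs_triangle_ineq[of "w y * (u y - u z)" "u z * (w y - w z)"] by (simp add: abs_mult)
    also have "\<dots> \<le> (\<bar>w x\<bar> + L2 * d) * (L1 * dist y z) + (\<bar>u x\<bar> + L1 * d) * (L2 * dist y z)"
      using lipschitz_onD[OF 1 y z] lipschitz_onD[OF 2 y z] b[OF 1 z] b[OF 2 y] nn d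
      by (intro add_mono mult_mono) (auto simp: dist_real_def)
    finally show "dist (u y * w y) (u z * w z) \<le> M * dist y z" by (simp add: M_def dist_real_def algebra_simps)
  qed
  then show "\<exists>d>0. \<exists>L. L-lipschitz_on (ball x d \<inter> \<Omega>) (\<lambda>x. u x * w x)" using d by blast
qed

lemma Lip_loc_compose:
  assumes u: "u \<in> Lip_loc \<Omega>" and F: "L-lipschitz_on S F" "\<And>x. x \<in> \<Omega> \<Longrightarrow> u x \<in> S"
  shows "(\<lambda>x. F (u x)) \<in> Lip_loc \<Omega>"
  unfolding Lip_loc_def
proof (intro CollectI ballI)
  fix x assume x: "x \<in> \<Omega>"
  obtain d M where d: "d > 0" "M-lipschitz_on (ball x d \<inter> \<Omega>) u" using u x unfolding Lip_loc_def by blast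
  have "(L * M)-lipschitz_on (ball x d \<inter> \<Omega>) (\<lambda>x. F (u x))"
    by (rule lipschitz_on_compose2[OF d(2) lipschitz_on_subset[OF F(1)]]) (use F(2) in auto)
  then show "\<exists>d>0. \<exists>L. L-lipschitz_on (ball x d \<inter> \<Omega>) (\<lambda>x. F (u x))" using d by blast
qed

text \<open>
  A locally Lipschitz function with compact support is Lipschitz: nearby points are treated by a
  Lebesgue number argument near the support, and points at a fixed distance by boundedness.
\<close>

lemma Lip_0_I:
  assumes w: "w \<in> Lip_loc \<Omega>" and o: "open \<Omega>" and S: "compact (support_in \<Omega> w)" "support_in \<Omega> w \<subseteq> S" "S \<subseteq> \<Omega>"
  shows "w \<in> Lip_0 \<Omega> S"
proof -
  define K where "K = support_in \<Omega> w"
  have K: "compact K" "K \<subseteq> \<Omega>" using S by (auto simp: K_def)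
  have zero: "w x = 0" if "x \<in> \<Omega>" "x \<notin> K" for x
  proof (rule ccontr)
    assume "w x \<noteq> 0"
    then have "x \<in> {x \<in> \<Omega>. w x \<noteq> 0}" using that by auto
    then have "x \<in> K" unfolding K_def support_in_def by (rule subsetD[OF closure_subset])
    then show False using that by auto
  qed
  have "\<forall>x\<in>K. \<exists>d L. d > 0 \<and> L-lipschitz_on (ball x d \<inter> \<Omega>) w" using w K(2) unfolding Lip_loc_def by blast
  then obtain d L where dL: "\<And>x. x \<in> K \<Longrightarrow> d x > 0" "\<And>x. x \<in> K \<Longrightarrow> (L x)-lipschitz_on (ball x (d x) \<inter> \<Omega>) w" by metis
  have "K \<subseteq> (\<Union>x\<in>K. ball x (d x / 2))" using dL(1) by auto
  then obtain F where F: "F \<subseteq> K" "finite F" "K \<subseteq> (\<Union>x\<in>F. ball x (d x / 2))"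
    using compactE_image[OF K(1), of K "\<lambda>x. ball x (d x / 2)"] by auto
  define \<delta> where "\<delta> = Min (insert 1 ((\<lambda>x. d x / 2) ` F))"
  have \<delta>: "\<delta> > 0" using F dL(1) by (auto simp: \<delta>_def)
  have \<delta>': "\<delta> \<le> d x / 2" if "x \<in> F" for x unfolding \<delta>_def using F(2) that by (intro Min_le) auto
  define M where "M = (\<Sum>x\<in>F. L x)"
  have Ln: "L x \<ge> 0" if "x \<in> F" for x using dL(2) F(1) that lipschitz_on_nonneg by blast
  have M: "L x \<le> M" if "x \<in> F" for x unfolding M_def using F(2) Ln that by (intro member_le_sum) auto
  have M0: "M \<ge> 0" unfolding M_def by (rule sum_nonneg) (rule Ln)
  have "continuous_on K w" by (rule continuous_on_subset[OF Lip_loc_continuous[OF o w] K(2)])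
  then have "bounded (w ` K)" by (intro compact_imp_bounded compact_continuous_image K(1))
  then obtain b where b: "b > 0" "\<And>x. x \<in> K \<Longrightarrow> \<bar>w x\<bar> \<le> b" unfolding bounded_pos by auto
  have b': "\<bar>w x\<bar> \<le> b" if "x \<in> \<Omega>" for x using b zero[OF that] by (cases "x \<in> K") auto
  define C where "C = M + 2 * b / \<delta>"
  have C: "M \<le> C" "2 * b / \<delta> \<le> C" "0 \<le> C" using M0 b \<delta> by (auto simp: C_def)
  have main: "\<bar>w x - w y\<bar> \<le> C * dist x y" if x: "x \<in> K" and y: "y \<in> \<Omega>" for x y
  proof (cases "dist x y < \<delta>")
    case True
    obtain z where z: "z \<in> F" "dist z x < d z / 2" using F(3) x by auto
    have zK: "z \<in> K" using z F by auto
    have "dist z y < d z" using dist_triangle[of z y x] z \<delta>'[OF z(1)] True by simp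
    then have "dist (w x) (w y) \<le> L z * dist x y"
      using z y x K(2) dL(1)[OF zK] by (intro lipschitz_onD[OF dL(2)[OF zK]]) auto
    also have "\<dots> \<le> C * dist x y" using M[OF z(1)] C by (intro mult_right_mono) auto
    finally show ?thesis by (simp add: dist_real_def)
  next
    case False
    have "\<bar>w x - w y\<bar> \<le> 2 * b" using b'[of x] b'[of y] x y K(2) by auto
    also have "\<dots> \<le> 2 * b / \<delta> * dist x y" using False b \<delta> by (simp add: field_simps mult_left_mono)
    also have "\<dots> \<le> C * dist x y" using C by (intro mult_right_mono) auto
    finally show ?thesis .
  qed
  have "C-lipschitz_on \<Omega> w"
  proof (rule lipschitz_onI[OF _ C(3)])
    fix x y assume xy: "x \<in> \<Omega>" "y \<in> \<Omega>"
    show "dist (w x) (w y) \<le> C * dist x y"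
      using main[of x y] main[of y x] zero[of x] zero[of y] xy C(3)
      by (cases "x \<in> K"; cases "y \<in> K") (auto simp: dist_real_def dist_commute abs_minus_commute)
  qed
  then show ?thesis using S by (auto simp: Lip_0_def)
qed

lemma support_in_mono: "(\<And>x. x \<in> \<Omega> \<Longrightarrow> u x \<noteq> 0 \<Longrightarrow> w x \<noteq> 0) \<Longrightarrow> support_in \<Omega> u \<subseteq> support_in \<Omega> w"
  unfolding support_in_def by (intro closure_mono) auto

lemma Lip_0_mult_left:
  assumes \<eta>: "\<eta> \<in> Lip_0 \<Omega> S" and u: "u \<in> Lip_loc \<Omega>" and o: "open \<Omega>" and S: "S \<subseteq> \<Omega>"
  shows "(\<lambda>x. \<eta> x * u x) \<in> Lip_0 \<Omega> S"
proof (rule Lip_0_I[OF Lip_loc_mult o _ _ S])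
  have sub: "support_in \<Omega> (\<lambda>x. \<eta> x * u x) \<subseteq> support_in \<Omega> \<eta>" by (rule support_in_mono) auto
  have c: "compact (support_in \<Omega> \<eta>)" "support_in \<Omega> \<eta> \<subseteq> S" using \<eta> by (auto simp: Lip_0_def)
  show "compact (support_in \<Omega> (\<lambda>x. \<eta> x * u x))"
    using compact_Int_closed[OF c(1), of "support_in \<Omega> (\<lambda>x. \<eta> x * u x)"] sub
    by (simp add: support_in_def Int_absorb1)
  show "support_in \<Omega> (\<lambda>x. \<eta> x * u x) \<subseteq> S" using sub c by blast
  show "\<eta> \<in> Lip_loc \<Omega>" using \<eta> lipschitz_on_imp_Lip_loc by (auto simp: Lip_0_def)
qed (rule u)

lemma powr_add_le: "a \<ge> 0 \<Longrightarrow> b \<ge> 0 \<Longrightarrow> p > 0 \<Longrightarrow> (a + b) powr p \<le> 2 powr p * (a powr p + b powr (p::real))"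
proof -
  assume ab: "a \<ge> 0" "b \<ge> 0" "p > 0"
  have "(a + b) powr p \<le> (2 * max a b) powr p" using ab by (intro powr_mono2) auto
  also have "\<dots> = 2 powr p * max a b powr p" using ab by (intro powr_mult)
  also have "max a b powr p \<le> a powr p + b powr p" by (auto simp: max_def)
  finally show ?thesis by (simp add: mult_left_mono)
qed

lemma power_of_two_between:
  fixes c :: real assumes "c \<ge> 1" obtains n :: nat where "c \<le> 2 ^ n" "2 ^ n \<le> 2 * c"
proof -
  define n where "n = (LEAST n. c \<le> 2 ^ n)"
  have ex: "\<exists>n. c \<le> 2 ^ n" using real_arch_pow[of 2 c] by (auto intro: less_imp_le)
  have 1: "c \<le> 2 ^ n" unfolding n_def using ex by (rule LeastI_ex)
  have "2 ^ n \<le> 2 * c"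
  proof (cases n)
    case (Suc k)
    then have "\<not> c \<le> 2 ^ k" using not_less_Least[of k "\<lambda>n. c \<le> 2 ^ n"] by (simp add: n_def)
    then show ?thesis using Suc by simp
  qed (use assms in simp)
  then show ?thesis using 1 that by blast
qed

locale setting_cutoff = setting_poincare \<Omega> \<rho> h m Q \<mu> \<nu> p A Cv C0
  for \<Omega> :: "(real^'n) set" and \<rho> h m Q \<mu> \<nu> p A Cv C0 +
  fixes \<gamma> \<tau> Cc T :: real
  assumes \<gamma>: "\<gamma> > 0" and \<tau>: "0 < \<tau>" "\<tau> < 1" and Cc: "Cc > 0" and T: "T \<ge> 1"
    and cutoff: "\<And>x r. x \<in> \<Omega> \<Longrightarrow> r > 0 \<Longrightarrow> mB \<Omega> \<rho> x r \<Subset> \<Omega> \<Longrightarrow>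
        (\<exists>\<phi> :: nat \<Rightarrow> real^'n \<Rightarrow> real. \<forall>j.
           \<phi> j \<in> Lip_0 \<Omega> (mB \<Omega> \<rho> x r) \<and>
           (\<forall>y\<in>\<Omega>. 0 \<le> \<phi> j y \<and> \<phi> j y \<le> 1) \<and>
           (\<forall>y\<in>mB \<Omega> \<rho> x (\<tau> * r). \<phi> j y = 1) \<and>
           support_in \<Omega> (\<phi> (Suc j)) \<subseteq> {y\<in>mB \<Omega> \<rho> x r. \<phi> j y = 1} \<and>
           esssup \<mu> (\<lambda>y. ennreal (norm (matrix_sqrt (Q y) *v grad (\<phi> j) y)
                                      / degen_weight p Q y powr (1 / p)))
             \<le> ennreal (Cc * T ^ j / r powr \<gamma>))"
begin

text \<open>
  The supremum bound on the quotient with the degenerate weight becomes a pointwise bound for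
  \<open>\<bar>\<surd>Q \<nabla>\<phi>\<bar>\<^sup>p\<close>. Where the weight vanishes the
  quotient carries no information, but there \<open>Q = 0\<close> and the bound is trivial.
\<close>

lemma cutoffs:
  assumes "x \<in> \<Omega>" "r > 0" "mball x r \<Subset> \<Omega>"
  obtains \<phi> :: "nat \<Rightarrow> real^'n \<Rightarrow> real" where
    "\<And>j. \<phi> j \<in> Lip_0 \<Omega> (mball x r)" "\<And>j y. y \<in> \<Omega> \<Longrightarrow> 0 \<le> \<phi> j y" "\<And>j y. y \<in> \<Omega> \<Longrightarrow> \<phi> j y \<le> 1"
    "\<And>j y. y \<in> mball x (\<tau> * r) \<Longrightarrow> \<phi> j y = 1"
    "\<And>j y. y \<in> \<Omega> \<Longrightarrow> y \<in> support_in \<Omega> (\<phi> (Suc j)) \<Longrightarrow> \<phi> j y = 1"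
    "\<And>j. AE y in \<mu>. nq y (grad (\<phi> j) y) powr p \<le> (Cc * T ^ j / r powr \<gamma>) powr p * degen_weight p Q y"
proof -
  obtain \<phi> :: "nat \<Rightarrow> real^'n \<Rightarrow> real" where \<phi>0: "\<And>j. \<phi> j \<in> Lip_0 \<Omega> (mball x r) \<and>
           (\<forall>y\<in>\<Omega>. 0 \<le> \<phi> j y \<and> \<phi> j y \<le> 1) \<and>
           (\<forall>y\<in>mball x (\<tau> * r). \<phi> j y = 1) \<and>
           support_in \<Omega> (\<phi> (Suc j)) \<subseteq> {y\<in>mball x r. \<phi> j y = 1} \<and>
           esssup \<mu> (\<lambda>y. ennreal (norm (matrix_sqrt (Q y) *v grad (\<phi> j) y)
                                      / degen_weight p Q y powr (1 / p)))
             \<le> ennreal (Cc * T ^ j / r powr \<gamma>)"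
    using cutoff[OF assms] by (elim exE) (erule meta_allE, erule meta_mp, erule allE, assumption)
  have \<phi>: "\<phi> j \<in> Lip_0 \<Omega> (mball x r)" "\<forall>y\<in>\<Omega>. 0 \<le> \<phi> j y \<and> \<phi> j y \<le> 1" "\<forall>y\<in>mball x (\<tau> * r). \<phi> j y = 1"
     "support_in \<Omega> (\<phi> (Suc j)) \<subseteq> {y\<in>mball x r. \<phi> j y = 1}"
     "esssup \<mu> (\<lambda>y. ennreal (norm (matrix_sqrt (Q y) *v grad (\<phi> j) y)
                                      / degen_weight p Q y powr (1 / p))) \<le> ennreal (Cc * T ^ j / r powr \<gamma>)" for j
    using \<phi>0[of j] by simp_all
  have "AE y in \<mu>. nq y (grad (\<phi> j) y) powr p \<le> (Cc * T ^ j / r powr \<gamma>) powr p * degen_weight p Q y" for j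
    using esssup_AE[of "\<lambda>y. ennreal (norm (matrix_sqrt (Q y) *v grad (\<phi> j) y) / degen_weight p Q y powr (1 / p))" \<mu>]
      AE_space[of \<mu>]
  proof eventually_elim
    case (elim y)
    let ?c = "Cc * T ^ j / r powr \<gamma>" and ?v = "degen_weight p Q y"
    have c: "?c \<ge> 0" using Cc T by simp
    have y: "y \<in> \<Omega>" using elim by simp
    have "ennreal (nq y (grad (\<phi> j) y) / ?v powr (1 / p)) \<le> ennreal ?c"
      using elim(1) \<phi>(5)[of j] unfolding nq_def by (rule order.trans)
    then have le: "nq y (grad (\<phi> j) y) / ?v powr (1 / p) \<le> ?c" using c by (simp add: ennreal_le_iff)
    show ?case
    proof (cases "?v = 0")
      case True
      have "nq y (grad (\<phi> j) y) powr p \<le> ?v * norm (grad (\<phi> j) y) powr p" by (rule nq_powr_le[OF y])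
      then show ?thesis using True by simp
    next
      case False
      then have v: "?v > 0" using degen_weight_nonneg[of y] by simp
      then have "nq y (grad (\<phi> j) y) \<le> ?c * ?v powr (1 / p)" using le by (simp add: pos_divide_le_eq)
      then have "nq y (grad (\<phi> j) y) powr p \<le> (?c * ?v powr (1 / p)) powr p" using p by (intro powr_mono2) auto
      also have "\<dots> = ?c powr p * (?v powr (1 / p)) powr p" using c by (intro powr_mult)
      also have "(?v powr (1 / p)) powr p = ?v" using v p by (simp add: powr_powr)
      finally show ?thesis .
    qed
  qed
  note AE = this
  have nested: "\<phi> j y = 1" if "y \<in> support_in \<Omega> (\<phi> (Suc j))" for j y
    using subsetD[OF \<phi>(4) that] by simp
  show ?thesis
    by (rule that[of \<phi>]) (use \<phi>(1-3) AE nested in \<open>auto simp del: in_mball\<close>)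
qed

text \<open>
  A separated subset of maximal cardinality; cardinalities are bounded because a compact set is
  covered by finitely many balls of half the radius.
\<close>

lemma separated_net:
  assumes x0: "x0 \<in> \<Omega>" and r: "mball x0 r \<Subset> \<Omega>" and d: "d > 0"
  obtains S where "finite S" "S \<subseteq> mball x0 r" "\<And>x y. x \<in> S \<Longrightarrow> y \<in> S \<Longrightarrow> x \<noteq> y \<Longrightarrow> d \<le> \<rho> x y"
    "\<And>z. z \<in> mball x0 r \<Longrightarrow> \<exists>x\<in>S. \<rho> x z < d"
proof -
  let ?sep = "\<lambda>S. S \<subseteq> mball x0 r \<and> (\<forall>x\<in>S. \<forall>y\<in>S. x \<noteq> y \<longrightarrow> d \<le> \<rho> x y)"
  define K where "K = closure (mball x0 r)"
  have K: "compact K" "K \<subseteq> \<Omega>" "mball x0 r \<subseteq> K" using r closure_subset by (auto simp: K_def compactly_in_def)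
  have "K \<subseteq> (\<Union>y\<in>K. mball y (d / 2))" using K(2) d by auto
  then obtain F where F: "F \<subseteq> K" "finite F" "K \<subseteq> (\<Union>y\<in>F. mball y (d / 2))"
    using compactE_image[OF K(1), of K "\<lambda>y. mball y (d / 2)"] mball_open by (metis (no_types, lifting))
  have bound: "finite S \<and> card S \<le> card F" if S: "?sep S" for S
  proof -
    have "\<forall>x\<in>S. \<exists>y. y \<in> F \<and> x \<in> mball y (d / 2)" using F(3) K(3) S by blast
    then obtain g where g: "\<And>x. x \<in> S \<Longrightarrow> g x \<in> F" "\<And>x. x \<in> S \<Longrightarrow> x \<in> mball (g x) (d / 2)" by metis
    have "inj_on g S"
    proof (rule inj_onI, rule ccontr)
      fix x y assume xy: "x \<in> S" "y \<in> S" "g x = g y" "x \<noteq> y"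
      have "\<rho> x y \<le> \<rho> (g x) x + \<rho> (g x) y"
        using triangle''[of x "g x" y] g(2)[OF xy(1)] g(2)[OF xy(2)] by auto
      also have "\<dots> < d" using g(2)[OF xy(1)] g(2)[OF xy(2)] xy(3) by auto
      finally show False using S xy by force
    qed
    moreover have "g ` S \<subseteq> F" using g(1) by auto
    ultimately show ?thesis using F(2) by (metis card_inj_on_le finite_imageD finite_subset)
  qed
  have "?sep {}" by simp
  then have "\<exists>S. ?sep S \<and> (\<forall>S'. ?sep S' \<longrightarrow> card S' \<le> card S)"
    by (rule ex_has_greatest_nat[of _ "{}" card "Suc (card F)"]) (use bound in \<open>auto simp: less_Suc_eq_le\<close>)
  then obtain S where S0: "?sep S \<and> (\<forall>S'. ?sep S' \<longrightarrow> card S' \<le> card S)" by (rule exE)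
  have S: "?sep S" "\<And>S'. ?sep S' \<Longrightarrow> card S' \<le> card S" using S0 by auto
  show ?thesis
  proof (rule that[of S])
    show "finite S" "S \<subseteq> mball x0 r" using S(1) bound by auto
    show "\<And>x y. x \<in> S \<Longrightarrow> y \<in> S \<Longrightarrow> x \<noteq> y \<Longrightarrow> d \<le> \<rho> x y" using S(1) by auto
    fix z assume z: "z \<in> mball x0 r"
    show "\<exists>x\<in>S. \<rho> x z < d"
    proof (rule ccontr)
      assume no: "\<not> ?thesis"
      then have zS: "z \<notin> S" using z d by force
      have "?sep (insert z S)" using S(1) z no by (auto simp: not_less commute)
      from S(2)[OF this] show False using zS \<open>finite S\<close> by simp
    qed
  qed
qed

text \<open>
  The number of doublings that lead from radius \<open>\<tau>\<epsilon>/2\<close> to a radius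
  between \<open>3\<epsilon>\<close> and \<open>6\<epsilon>\<close>.
\<close>

definition overlap_exp :: nat where "overlap_exp = (SOME n. 6 / \<tau> \<le> 2 ^ n \<and> 2 ^ n \<le> 12 / \<tau>)"

lemma overlap_exp: "6 / \<tau> \<le> 2 ^ overlap_exp" "2 ^ overlap_exp \<le> 12 / \<tau>"
proof -
  have "1 \<le> 6 / \<tau>" using \<tau> by (simp add: field_simps)
  then obtain n :: nat where "6 / \<tau> \<le> 2 ^ n" "2 ^ n \<le> 2 * (6 / \<tau>)" using power_of_two_between by blast
  then have "\<exists>n::nat. 6 / \<tau> \<le> 2 ^ n \<and> 2 ^ n \<le> 12 / \<tau>" by auto
  from someI_ex[OF this] show "6 / \<tau> \<le> 2 ^ overlap_exp" "2 ^ overlap_exp \<le> 12 / \<tau>" unfolding overlap_exp_def by auto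
qed

text \<open>
  The balls of radius \<open>\<tau>\<epsilon>/2\<close> around the points of the net near
  \<open>y\<close> are disjoint, and each fills a fixed portion of the ball of radius
  \<open>2\<epsilon>\<close> around \<open>y\<close>.
\<close>

lemma net_overlap:
  assumes x0: "x0 \<in> \<Omega>" and comp: "mball x0 (8 * r) \<Subset> \<Omega>" and \<epsilon>: "\<epsilon> > 0" "32 * \<epsilon> \<le> r"
    and S: "finite S" "S \<subseteq> mball x0 r" "\<And>x y. x \<in> S \<Longrightarrow> y \<in> S \<Longrightarrow> x \<noteq> y \<Longrightarrow> \<tau> * \<epsilon> \<le> \<rho> x y"
    and y: "y \<in> \<Omega>"
  shows "real (card {x\<in>S. y \<in> mball x \<epsilon>}) \<le> A ^ overlap_exp"
proof -
  let ?S = "{x\<in>S. y \<in> mball x \<epsilon>}" and ?U = "\<lambda>x. mball x (\<tau> * \<epsilon> / 2)"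
  have \<tau>\<epsilon>: "\<tau> * \<epsilon> > 0" "\<tau> * \<epsilon> \<le> \<epsilon>" using \<tau> \<epsilon> by auto
  have nv: "3 * \<epsilon> \<le> 2 ^ overlap_exp * (\<tau> * \<epsilon> / 2)" "2 ^ overlap_exp * (\<tau> * \<epsilon> / 2) \<le> 6 * \<epsilon>"
    using overlap_exp \<tau> \<epsilon> mult_right_mono[OF overlap_exp(1), of "\<tau> * \<epsilon>"] mult_right_mono[OF overlap_exp(2), of "\<tau> * \<epsilon>"] by (auto simp: field_simps)
  have each: "emeasure \<nu> (mball y (2 * \<epsilon>)) \<le> ennreal (A ^ overlap_exp) * emeasure \<nu> (?U x)" if x: "x \<in> ?S" for x
  proof -
    have x\<Omega>: "x \<in> \<Omega>" "\<rho> x0 x < r" "\<rho> x y < \<epsilon>" using x S(2) by auto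
    have "mball y (2 * \<epsilon>) \<subseteq> mball x (2 ^ overlap_exp * (\<tau> * \<epsilon> / 2))"
      by (rule mball_sub_mball) (use x\<Omega> nv in auto)
    moreover have "mball x (2 ^ overlap_exp * (\<tau> * \<epsilon> / 2)) \<subseteq> mball x0 (8 * r)"
      by (rule mball_sub_mball[OF _ x0]) (use x\<Omega> nv(2) \<epsilon> in linarith)
    then have "mball x (2 ^ overlap_exp * (\<tau> * \<epsilon> / 2)) \<Subset> \<Omega>" using comp by (rule compactly_in_mono)
    ultimately show ?thesis using ball_comparison(1)[OF y x\<Omega>(1)] \<tau>\<epsilon> by simp
  qed
  have disj: "disjoint_family_on ?U ?S"
    unfolding disjoint_family_on_def
  proof (intro ballI impI)
    fix x z assume xz: "x \<in> ?S" "z \<in> ?S" "x \<noteq> z"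
    have "disjnt (?U x) (?U z)" using S(3)[of x z] xz by (intro disjoint_mball) (auto simp: mult.commute)
    then show "?U x \<inter> ?U z = {}" by (simp add: disjnt_def)
  qed
  have sub: "?U x \<subseteq> mball y (2 * \<epsilon>)" if "x \<in> ?S" for x
  proof (rule mball_sub_mball[OF _ y])
    have "\<rho> y x < \<epsilon>" using that commute[of y x] by simp
    then show "\<rho> y x + \<tau> * \<epsilon> / 2 \<le> 2 * \<epsilon>" using \<tau>\<epsilon> \<epsilon> by linarith
  qed
  have fin: "finite ?S" using S(1) by simp
  have "ennreal (real (card ?S)) * emeasure \<nu> (mball y (2 * \<epsilon>)) = (\<Sum>x\<in>?S. emeasure \<nu> (mball y (2 * \<epsilon>)))"
    by (simp add: ennreal_of_nat_eq_real_of_nat)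
  also have "\<dots> \<le> (\<Sum>x\<in>?S. ennreal (A ^ overlap_exp) * emeasure \<nu> (?U x))" by (intro sum_mono each)
  also have "\<dots> = ennreal (A ^ overlap_exp) * emeasure \<nu> (\<Union>x\<in>?S. ?U x)"
    using disj fin by (simp add: sum_distrib_left[symmetric] sum_emeasure image_subset_iff)
  also have "\<dots> \<le> ennreal (A ^ overlap_exp) * emeasure \<nu> (mball y (2 * \<epsilon>))"
  proof (intro mult_left_mono emeasure_mono)
    show "(\<Union>x\<in>?S. ?U x) \<subseteq> mball y (2 * \<epsilon>)" by (intro UN_least sub)
  qed auto
  finally have "emeasure \<nu> (mball y (2 * \<epsilon>)) * ennreal (real (card ?S)) \<le> emeasure \<nu> (mball y (2 * \<epsilon>)) * ennreal (A ^ overlap_exp)"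
    by (simp add: mult.commute)
  then have "ennreal (real (card ?S)) \<le> ennreal (A ^ overlap_exp)"
    using nu_ball_pos[OF y, of "2 * \<epsilon>"] \<epsilon> by (subst (asm) ennreal_mult_le_mult_iff) auto
  then show ?thesis using A by (simp add: ennreal_le_iff)
qed

definition fefferman_const :: real where
  "fefferman_const = (2 * (4 * C0 * A ^ 6)) powr p * (2 powr p * A ^ overlap_exp * (1 + Cc powr p * Cv))"

lemma fefferman_const_pos: "fefferman_const > 0"
  unfolding fefferman_const_def using C0 A Cc Cv by (intro mult_pos_pos add_pos_pos) auto

lemma AE_grad_mult:
  assumes "u \<in> Lip_loc \<Omega>" "w \<in> Lip_loc \<Omega>"
  shows "AE y in \<mu>. grad (\<lambda>z. u z * w z) y = u y *\<^sub>R grad w y + w y *\<^sub>R grad u y"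
  using AE_grad[OF assms(1)] AE_grad[OF assms(2)]
  by eventually_elim (intro grad_eq GDERIV_mult)

text \<open>
  Multiply \<open>w\<close> by cutoffs of the balls of radius \<open>\<epsilon>\<close> around a
  net of mesh \<open>\<tau>\<epsilon>\<close>. At every point one of the cutoffs is
  \<open>1\<close>, and boundedly many are not \<open>0\<close>. The gradients of the cutoffs
  produce the term with the power of \<open>1/\<epsilon>\<close>, because the degenerate weight
  times \<open>\<mu>\<close> is dominated by \<open>\<nu>\<close>.
\<close>

lemma fefferman_error:
  assumes x0: "x0 \<in> \<Omega>" and comp: "mball x0 (8 * r) \<Subset> \<Omega>" and \<epsilon>: "\<epsilon> > 0" "32 * \<epsilon> \<le> r"
    and w: "w \<in> Lip_0 \<Omega> (mball x0 r)" and V: "V \<in> borel_measurable \<nu>"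
    and Vfin: "(\<integral>\<^sup>+z\<in>mball x0 (2 * r). ennreal \<bar>V z\<bar> \<partial>\<nu>) < top"
    and a: "a > 0" and \<Phi>: "enn_powr (SK_Phi \<Omega> \<rho> \<mu> \<nu> p V (2 * \<epsilon>)) (1 / (p - 1)) \<le> ennreal a"
  shows "(\<integral>\<^sup>+z. ennreal (\<bar>V z\<bar> * \<bar>w z\<bar> powr p) \<partial>\<nu>) \<le> ennreal (fefferman_const * a powr (p - 1)) *
     (energy (grad w) + ennreal (\<epsilon> powr (- \<gamma> * p)) * mass w)"
proof -
  note wD = Lip_0_D[OF w]
  note [measurable] = V wD(3) wD(4) nq_grad_measurable[OF wD(1)]
  have comp_r: "mball x0 r \<Subset> \<Omega>"
    using compactly_in_mono[OF mball_subset_concentric comp, of r] \<epsilon> by simp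
  obtain S where S: "finite S" "S \<subseteq> mball x0 r" "\<And>x y. x \<in> S \<Longrightarrow> y \<in> S \<Longrightarrow> x \<noteq> y \<Longrightarrow> \<tau> * \<epsilon> \<le> \<rho> x y"
    "\<And>z. z \<in> mball x0 r \<Longrightarrow> \<exists>x\<in>S. \<rho> x z < \<tau> * \<epsilon>"
    using separated_net[OF x0 comp_r, of "\<tau> * \<epsilon>"] \<tau> \<epsilon> by (metis mult_pos_pos)
  have xin: "x \<in> \<Omega>" "mball x (32 * \<epsilon>) \<subseteq> mball x0 (2 * r)" "mball x (32 * \<epsilon>) \<Subset> \<Omega>" "mball x \<epsilon> \<Subset> \<Omega>"
     "mball x \<epsilon> \<subseteq> mball x0 (2 * r)" if "x \<in> S" for x
  proof -
    show x: "x \<in> \<Omega>" using that S(2) by auto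
    have "\<rho> x0 x < r" using that S(2) by auto
    then show sub: "mball x (32 * \<epsilon>) \<subseteq> mball x0 (2 * r)" by (intro mball_sub_mball) (use x0 \<epsilon> in auto)
    have "mball x0 (2 * r) \<subseteq> mball x0 (8 * r)" by (rule mball_subset_concentric) (use \<epsilon> in auto)
    from compactly_in_mono[OF order.trans[OF sub this] comp]
    show c: "mball x (32 * \<epsilon>) \<Subset> \<Omega>" .
    have s: "mball x \<epsilon> \<subseteq> mball x (32 * \<epsilon>)" by (rule mball_subset_concentric) (use \<epsilon> in auto)
    then show "mball x \<epsilon> \<Subset> \<Omega>" using c by (rule compactly_in_mono)
    show "mball x \<epsilon> \<subseteq> mball x0 (2 * r)" using s sub by (rule order.trans)
  qed
  define cc where "cc = (Cc / \<epsilon> powr \<gamma>) powr p"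
  \<comment> \<open>For each point of the net the first cutoff of the ball around it, so that \<open>T\<close>
      enters with exponent \<open>0\<close>.\<close>
  define PP where "PP x \<psi> \<longleftrightarrow> \<psi> \<in> Lip_0 \<Omega> (mball x \<epsilon>) \<and> (\<forall>y\<in>\<Omega>. 0 \<le> \<psi> y \<and> \<psi> y \<le> 1) \<and> (\<forall>y\<in>mball x (\<tau> * \<epsilon>). \<psi> y = 1) \<and>
      (AE y in \<mu>. nq y (grad \<psi> y) powr p \<le> cc * degen_weight p Q y)" for x and \<psi> :: "real^'n \<Rightarrow> real"
  have ex\<psi>: "\<exists>\<psi>. PP x \<psi>" if x: "x \<in> S" for x
  proof -
    show ?thesis
    proof (rule cutoffs[OF xin(1)[OF x] \<epsilon>(1) xin(4)[OF x]])
      fix \<phi> :: "nat \<Rightarrow> real^'n \<Rightarrow> real"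
      assume \<phi>: "\<And>j. \<phi> j \<in> Lip_0 \<Omega> (mball x \<epsilon>)" "\<And>j y. y \<in> \<Omega> \<Longrightarrow> 0 \<le> \<phi> j y" "\<And>j y. y \<in> \<Omega> \<Longrightarrow> \<phi> j y \<le> 1"
      "\<And>j y. y \<in> mball x (\<tau> * \<epsilon>) \<Longrightarrow> \<phi> j y = 1"
      "\<And>j y. y \<in> \<Omega> \<Longrightarrow> y \<in> support_in \<Omega> (\<phi> (Suc j)) \<Longrightarrow> \<phi> j y = 1"
      "\<And>j. AE y in \<mu>. nq y (grad (\<phi> j) y) powr p \<le> (Cc * T ^ j / \<epsilon> powr \<gamma>) powr p * degen_weight p Q y"
      show ?thesis using \<phi>(1)[of 0] \<phi>(2)[of _ 0] \<phi>(3)[of _ 0] \<phi>(4)[of _ 0] \<phi>(6)[of 0]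
      unfolding PP_def by (intro exI[of _ "\<phi> 0"]) (auto simp: cc_def simp del: in_mball)
    qed
  qed
  define \<psi> where "\<psi> x = (SOME \<psi>. PP x \<psi>)" for x
  have "PP x (\<psi> x)" if "x \<in> S" for x unfolding \<psi>_def by (rule someI_ex[OF ex\<psi>[OF that]])
  then have \<psi>: "\<And>x. x \<in> S \<Longrightarrow> \<psi> x \<in> Lip_0 \<Omega> (mball x \<epsilon>)"
    "\<And>x y. x \<in> S \<Longrightarrow> y \<in> \<Omega> \<Longrightarrow> 0 \<le> \<psi> x y \<and> \<psi> x y \<le> 1" "\<And>x y. x \<in> S \<Longrightarrow> y \<in> mball x (\<tau> * \<epsilon>) \<Longrightarrow> \<psi> x y = 1"
    "\<And>x. x \<in> S \<Longrightarrow> AE y in \<mu>. nq y (grad (\<psi> x) y) powr p \<le> cc * degen_weight p Q y" by (simp_all add: PP_def del: in_mball)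
  define W where "W x = (\<lambda>z. \<psi> x z * w z)" for x
  have W: "W x \<in> Lip_0 \<Omega> (mball x \<epsilon>)" if "x \<in> S" for x
    unfolding W_def by (rule Lip_0_mult_left[OF \<psi>(1)[OF that] wD(1) domain(1) mball_sub])
  have Wm[measurable]: "W x \<in> borel_measurable \<nu>" if "x \<in> S" for x using Lip_0_D(3)[OF W[OF that]] .
  have Wnm[measurable]: "(\<lambda>y. nq y (grad (W x) y)) \<in> borel_measurable \<mu>" if "x \<in> S" for x
    using nq_grad_measurable[OF Lip_0_D(1)[OF W[OF that]]] .
  define G where "G y = ennreal (nq y (grad w y) powr p) + ennreal cc * (ennreal (degen_weight p Q y) * ennreal (\<bar>w y\<bar> powr p))" for y
  have Gm[measurable]: "G \<in> borel_measurable \<mu>" unfolding G_def[abs_def] by measurable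
  define CF where "CF = (2 * (4 * C0 * A ^ 6)) powr p * a powr (p - 1)"
  have CF: "CF \<ge> 0" by (simp add: CF_def)
  have cc: "cc \<ge> 0" by (simp add: cc_def)
  have "(\<integral>\<^sup>+z. ennreal (\<bar>V z\<bar> * \<bar>w z\<bar> powr p) \<partial>\<nu>) \<le> (\<integral>\<^sup>+z. (\<Sum>x\<in>S. ennreal (\<bar>V z\<bar> * \<bar>W x z\<bar> powr p)) \<partial>\<nu>)"
  proof (rule nn_integral_mono)
    fix z assume "z \<in> space \<nu>"
    then have z: "z \<in> \<Omega>" by simp
    show "ennreal (\<bar>V z\<bar> * \<bar>w z\<bar> powr p) \<le> (\<Sum>x\<in>S. ennreal (\<bar>V z\<bar> * \<bar>W x z\<bar> powr p))"
    proof (cases "w z = 0")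
      case False
      then have "z \<in> mball x0 r" using wD(5)[OF z] by blast
      then obtain x where x: "x \<in> S" "\<rho> x z < \<tau> * \<epsilon>" using S(4) by blast
      then have "\<psi> x z = 1" using xin(1)[OF x(1)] z by (intro \<psi>(3)) auto
      then have "ennreal (\<bar>V z\<bar> * \<bar>w z\<bar> powr p) = ennreal (\<bar>V z\<bar> * \<bar>W x z\<bar> powr p)" by (simp add: W_def)
      also have "\<dots> \<le> (\<Sum>x\<in>S. ennreal (\<bar>V z\<bar> * \<bar>W x z\<bar> powr p))" using S(1) x(1) by (intro member_le_sum) auto
      finally show ?thesis .
    qed simp
  qed
  also have "\<dots> = (\<Sum>x\<in>S. \<integral>\<^sup>+z. ennreal (\<bar>V z\<bar> * \<bar>W x z\<bar> powr p) \<partial>\<nu>)" by (rule nn_integral_sum) measurable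
  also have "\<dots> \<le> (\<Sum>x\<in>S. ennreal CF * energy (grad (W x)))"
  proof (rule sum_mono)
    fix x assume x: "x \<in> S"
    have "(\<integral>\<^sup>+z\<in>mball x \<epsilon>. ennreal \<bar>V z\<bar> \<partial>\<nu>) \<le> (\<integral>\<^sup>+z\<in>mball x0 (2 * r). ennreal \<bar>V z\<bar> \<partial>\<nu>)"
      using subsetD[OF xin(5)[OF x]] by (intro nn_integral_mono) (auto simp: indicator_def simp del: in_mball)
    then have "(\<integral>\<^sup>+z\<in>mball x \<epsilon>. ennreal \<bar>V z\<bar> \<partial>\<nu>) < top" using Vfin by (rule order.strict_trans1)
    then show "(\<integral>\<^sup>+z. ennreal (\<bar>V z\<bar> * \<bar>W x z\<bar> powr p) \<partial>\<nu>) \<le> ennreal CF * energy (grad (W x))"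
      unfolding CF_def by (rule fefferman[OF xin(1)[OF x] \<epsilon>(1) xin(3)[OF x] W[OF x] V _ a \<Phi>])
  qed
  also have "\<dots> \<le> (\<Sum>x\<in>S. ennreal CF * (\<integral>\<^sup>+y. ennreal (2 powr p) * (indicator (mball x \<epsilon>) y * G y) \<partial>\<mu>))"
  proof (intro sum_mono mult_left_mono)
    fix x assume x: "x \<in> S"
    have \<psi>l: "\<psi> x \<in> Lip_loc \<Omega>" using Lip_0_D(1)[OF \<psi>(1)[OF x]] .
    show "energy (grad (W x)) \<le> (\<integral>\<^sup>+y. ennreal (2 powr p) * (indicator (mball x \<epsilon>) y * G y) \<partial>\<mu>)"
    proof (rule nn_integral_mono_AE)
      show "AE y in \<mu>. ennreal (nq y (grad (W x) y) powr p) \<le> ennreal (2 powr p) * (indicator (mball x \<epsilon>) y * G y)"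
        using AE_grad_mult[OF \<psi>l wD(1)] \<psi>(4)[OF x] AE_space[of \<mu>]
      proof eventually_elim
        case (elim y)
        then have y: "y \<in> \<Omega>" by simp
        show ?case
        proof (cases "y \<in> mball x \<epsilon>")
          case True
          have "nq y (grad (W x) y) \<le> nq y (\<psi> x y *\<^sub>R grad w y) + nq y (w y *\<^sub>R grad (\<psi> x) y)"
            unfolding W_def elim(1) by (rule nq_add)
          also have "\<dots> \<le> nq y (grad w y) + \<bar>w y\<bar> * nq y (grad (\<psi> x) y)"
            using \<psi>(2)[OF x y] by (simp add: nq_scale mult_left_le_one_le)
          finally have "nq y (grad (W x) y) powr p \<le> (nq y (grad w y) + \<bar>w y\<bar> * nq y (grad (\<psi> x) y)) powr p"
            using p by (intro powr_mono2) auto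
          also have "\<dots> \<le> 2 powr p * (nq y (grad w y) powr p + (\<bar>w y\<bar> * nq y (grad (\<psi> x) y)) powr p)"
            using p by (intro powr_add_le) auto
          also have "(\<bar>w y\<bar> * nq y (grad (\<psi> x) y)) powr p = \<bar>w y\<bar> powr p * nq y (grad (\<psi> x) y) powr p"
            by (intro powr_mult)
          also have "\<dots> \<le> \<bar>w y\<bar> powr p * (cc * degen_weight p Q y)" using elim(2) by (intro mult_left_mono) auto
          finally have "ennreal (nq y (grad (W x) y) powr p) \<le> ennreal (2 powr p * (nq y (grad w y) powr p + \<bar>w y\<bar> powr p * (cc * degen_weight p Q y)))"
            by (intro ennreal_leI) (simp add: add_left_mono mult_left_mono)
          also have "\<dots> = ennreal (2 powr p) * G y"
            using cc degen_weight_nonneg[of y] by (simp add: G_def ennreal_mult ennreal_plus ac_simps)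
          finally show ?thesis using True by simp
        next
          case False
          then show ?thesis using grad_zero_outside_ball[OF W[OF x] y] p by simp
        qed
      qed
    qed
  qed auto
  also have "\<dots> = ennreal CF * (ennreal (2 powr p) * (\<integral>\<^sup>+y. (\<Sum>x\<in>S. indicator (mball x \<epsilon>) y) * G y \<partial>\<mu>))"
    by (simp add: nn_integral_cmult nn_integral_sum[symmetric] sum_distrib_left[symmetric] sum_distrib_right)
  also have "\<dots> \<le> ennreal CF * (ennreal (2 powr p) * (\<integral>\<^sup>+y. ennreal (A ^ overlap_exp) * G y \<partial>\<mu>))"
  proof (intro mult_left_mono nn_integral_mono mult_right_mono)
    fix y assume "y \<in> space \<mu>"
    then have y: "y \<in> \<Omega>" by simp
    have "(\<Sum>x\<in>S. indicator (mball x \<epsilon>) y :: ennreal) = (\<Sum>x\<in>{x\<in>S. y \<in> mball x \<epsilon>}. 1)"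
      using S(1) by (intro sum.mono_neutral_cong_right) (auto simp: indicator_def)
    also have "\<dots> = ennreal (real (card {x\<in>S. y \<in> mball x \<epsilon>}))" by (simp add: ennreal_of_nat_eq_real_of_nat del: in_mball)
    also have "\<dots> \<le> ennreal (A ^ overlap_exp)"
      by (intro ennreal_leI net_overlap[OF x0 comp \<epsilon> S(1-3) y])
    finally show "(\<Sum>x\<in>S. indicator (mball x \<epsilon>) y :: ennreal) \<le> ennreal (A ^ overlap_exp)" .
  qed auto
  also have "\<dots> = ennreal (CF * (2 powr p * A ^ overlap_exp)) * (\<integral>\<^sup>+y. G y \<partial>\<mu>)"
    using CF A by (simp add: nn_integral_cmult ennreal_mult mult.assoc)
  also have "\<dots> \<le> ennreal (CF * (2 powr p * A ^ overlap_exp)) * (ennreal (1 + Cc powr p * Cv) *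
      (energy (grad w) + ennreal (\<epsilon> powr (- \<gamma> * p)) * mass w))"
    (is "_ \<le> _ * (_ * (?D + ?e * ?W))")
  proof (intro mult_left_mono)
    have "(\<integral>\<^sup>+y. G y \<partial>\<mu>) = ?D + ennreal cc * (\<integral>\<^sup>+y. ennreal (degen_weight p Q y) * ennreal (\<bar>w y\<bar> powr p) \<partial>\<mu>)"
      unfolding G_def by (simp add: nn_integral_add nn_integral_cmult)
    also have "\<dots> \<le> ?D + ennreal cc * (ennreal Cv * ?W)"
      by (intro add_left_mono mult_left_mono weight_domination) measurable
    also have "ennreal cc * (ennreal Cv * ?W) = ennreal (Cc powr p * Cv) * (?e * ?W)"
    proof -
      have "cc = Cc powr p * \<epsilon> powr (- \<gamma> * p)"
        using Cc \<epsilon> by (simp add: cc_def powr_divide powr_powr powr_minus_divide)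
      then show ?thesis using Cv by (simp add: ennreal_mult ac_simps)
    qed
    also have "?D + ennreal (Cc powr p * Cv) * (?e * ?W) \<le> ennreal (1 + Cc powr p * Cv) * ?D + ennreal (1 + Cc powr p * Cv) * (?e * ?W)"
    proof (intro add_mono mult_right_mono)
      have "ennreal 1 * ?D \<le> ennreal (1 + Cc powr p * Cv) * ?D" using Cv by (intro mult_right_mono ennreal_leI) auto
      then show "?D \<le> ennreal (1 + Cc powr p * Cv) * ?D" by simp
    qed (auto intro: ennreal_leI)
    also have "\<dots> = ennreal (1 + Cc powr p * Cv) * (?D + ?e * ?W)" by (simp add: distrib_left)
    finally show "(\<integral>\<^sup>+y. G y \<partial>\<mu>) \<le> ennreal (1 + Cc powr p * Cv) * (?D + ?e * ?W)" .
  qed auto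
  also have "\<dots> = ennreal (fefferman_const * a powr (p - 1)) * (?D + ?e * ?W)"
  proof -
    have "fefferman_const * a powr (p - 1) = CF * (2 powr p * A ^ overlap_exp) * (1 + Cc powr p * Cv)" by (simp add: fefferman_const_def CF_def)
    moreover have "ennreal (CF * (2 powr p * A ^ overlap_exp) * (1 + Cc powr p * Cv)) = ennreal (CF * (2 powr p * A ^ overlap_exp)) * ennreal (1 + Cc powr p * Cv)"
      using CF A Cv by (intro ennreal_mult) auto
    ultimately show ?thesis by (simp only: mult.assoc)
  qed
  finally show ?thesis .
qed

end

section \<open>Limits of compactly supported Lipschitz functions\<close>

lemma enn_powr_tendsto_0:
  assumes X: "(X \<longlongrightarrow> 0) F" and a: "a > 0" shows "((\<lambda>j. enn_powr (X j) a) \<longlongrightarrow> 0) F"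
proof (rule order_tendstoI)
  fix e :: ennreal assume e: "0 < e"
  obtain d where d: "0 < d" "ennreal d < e" using e by (metis ennreal_0 ennreal_less_iff order_le_less less_imp_le dense ennreal_cases top_greatest less_top)
  have "0 < ennreal (d powr (1 / a))" using d by simp
  with X have "\<forall>\<^sub>F j in F. X j < ennreal (d powr (1 / a))" by (rule order_tendstoD)
  then show "\<forall>\<^sub>F j in F. enn_powr (X j) a < e"
  proof eventually_elim
    case (elim j)
    have "enn_powr (X j) a \<le> enn_powr (ennreal (d powr (1 / a))) a" using elim a by (intro enn_powr_mono) auto
    also have "\<dots> = ennreal d" using d a by (simp add: powr_powr)
    finally show ?case using d(2) by (rule order.strict_trans1)
  qed
qed simp

lemma powr_add3_le:
  fixes p :: real
  assumes "a \<ge> 0" "b \<ge> 0" "c \<ge> 0" "p > 0"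
  shows "(a + b + c) powr p \<le> 3 powr p * (a powr p + b powr p + c powr p)"
proof -
  have "(a + b + c) powr p \<le> (3 * max a (max b c)) powr p" using assms by (intro powr_mono2) auto
  also have "\<dots> = 3 powr p * max a (max b c) powr p" using assms by (intro powr_mult)
  also have "max a (max b c) powr p \<le> a powr p + b powr p + c powr p" by (auto simp: max_def)
  finally show ?thesis by (simp add: mult_left_mono)
qed

lemma tendsto_0_upto_subseq:
  assumes "(X::nat \<Rightarrow> ennreal) \<longlonglongrightarrow> 0" "strict_mono r" shows "(\<lambda>j. X (r j)) \<longlonglongrightarrow> 0"
  using LIMSEQ_subseq_LIMSEQ[OF assms] by (simp add: o_def)

lemma ennreal_tendsto_0_sandwich:
  assumes "\<And>j. X j \<le> (Y j :: ennreal)" "Y \<longlonglongrightarrow> 0" shows "X \<longlonglongrightarrow> 0"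
  by (rule tendsto_sandwich[OF _ _ tendsto_const assms(2)]) (use assms(1) in auto)

context setting
begin

lemma Lp_AE_subsequence:
  fixes w :: "nat \<Rightarrow> real^'n \<Rightarrow> real"
  assumes [measurable]: "\<And>j. w j \<in> borel_measurable \<nu>" "u \<in> borel_measurable \<nu>"
    and lim: "(\<lambda>j. mass (\<lambda>x. w j x - u x)) \<longlonglongrightarrow> 0"
  shows "\<exists>r. strict_mono r \<and> (AE x in \<nu>. (\<lambda>j. w (r j) x) \<longlonglongrightarrow> u x)"
proof -
  obtain j0 where j0: "\<And>j. j \<ge> j0 \<Longrightarrow> mass (\<lambda>x. w j x - u x) < 1"
    using order_tendstoD(2)[OF lim, of 1] by (auto simp: eventually_sequentially)
  define X where "X j x = \<bar>w (j + j0) x - u x\<bar> powr p" for j x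
  have nn: "(\<integral>\<^sup>+x. ennreal (norm (X j x)) \<partial>\<nu>) = mass (\<lambda>x. w (j + j0) x - u x)" for j
    by (simp add: X_def)
  have [measurable]: "X j \<in> borel_measurable \<nu>" for j unfolding X_def[abs_def] by measurable
  have int: "integrable \<nu> (X j)" for j
  proof (rule integrableI_bounded)
    have "(\<integral>\<^sup>+x. ennreal (norm (X j x)) \<partial>\<nu>) < 1" unfolding nn by (rule j0) simp
    then show "(\<integral>\<^sup>+x. ennreal (norm (X j x)) \<partial>\<nu>) < \<infinity>" by (rule order.strict_trans) simp
  qed measurable
  have "(\<lambda>j. \<integral>\<^sup>+x. ennreal (norm (X j x)) \<partial>\<nu>) \<longlonglongrightarrow> 0" unfolding nn by (rule LIMSEQ_ignore_initial_segment[OF lim])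
  moreover have "(\<integral>\<^sup>+x. ennreal (norm (X j x)) \<partial>\<nu>) = ennreal (\<integral>x. norm (X j x) \<partial>\<nu>)" for j
    using int by (intro nn_integral_eq_integral) auto
  ultimately have "(\<lambda>j. ennreal (\<integral>x. norm (X j x) \<partial>\<nu>)) \<longlonglongrightarrow> ennreal 0" by simp
  then have "(\<lambda>j. \<integral>x. norm (X j x) \<partial>\<nu>) \<longlonglongrightarrow> 0" by (subst (asm) tendsto_ennreal_iff) auto
  from tendsto_L1_AE_subseq[OF int this]
  obtain s where s: "strict_mono s" "AE x in \<nu>. (\<lambda>j. X (s j) x) \<longlonglongrightarrow> 0" by blast
  have "AE x in \<nu>. (\<lambda>j. w (s j + j0) x) \<longlonglongrightarrow> u x"
    using s(2)
  proof eventually_elim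
    case (elim x)
    have "(\<lambda>j. X (s j) x powr (1 / p)) \<longlonglongrightarrow> 0 powr (1 / p)"
      using p by (intro tendsto_powr' elim tendsto_const) (auto simp: X_def)
    moreover have "X (s j) x powr (1 / p) = \<bar>w (s j + j0) x - u x\<bar>" for j using p by (simp add: X_def powr_powr)
    ultimately have "(\<lambda>j. \<bar>w (s j + j0) x - u x\<bar>) \<longlonglongrightarrow> 0" by simp
    then have "(\<lambda>j. w (s j + j0) x - u x) \<longlonglongrightarrow> 0" by (simp add: tendsto_rabs_zero_iff)
    then show ?case by (simp add: LIM_zero_iff)
  qed
  moreover have "strict_mono (\<lambda>j. s j + j0)" using s(1) by (auto simp: strict_mono_def)
  ultimately show ?thesis by (intro exI[of _ "\<lambda>j. s j + j0"]) auto
qed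

text \<open>
  The approximating functions can be chosen convergent almost everywhere, after passage to a
  subsequence.
\<close>

lemma QW_approximation:
  assumes "(u, g) \<in> QW \<Omega> \<mu> \<nu> Q p"
  shows "u \<in> borel_measurable \<nu>" "g \<in> borel_measurable \<mu>"
    "mass u < top" "energy g < top"
    "\<exists>\<omega>. (\<forall>j. \<omega> j \<in> Lip_loc \<Omega>) \<and> (AE x in \<nu>. (\<lambda>j. \<omega> j x) \<longlonglongrightarrow> u x) \<and>
       (\<lambda>j. mass (\<lambda>x. \<omega> j x - u x)) \<longlonglongrightarrow> 0 \<and>
       (\<lambda>j. energy (\<lambda>x. grad (\<omega> j) x - g x)) \<longlonglongrightarrow> 0"
proof -
  obtain w where qw: "u \<in> borel_measurable \<nu>" "g \<in> borel_measurable \<mu>" "QW_norm \<mu> \<nu> Q p u g < top"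
     "\<And>j. w j \<in> Lip_loc \<Omega>" "(\<lambda>j. QW_norm \<mu> \<nu> Q p (\<lambda>x. w j x - u x) (\<lambda>x. grad (w j) x - g x)) \<longlonglongrightarrow> 0"
    using assms unfolding QW_def by blast
  show um: "u \<in> borel_measurable \<nu>" and "g \<in> borel_measurable \<mu>" using qw by auto
  have lt: "X < top" if "enn_powr X a < top" for X a using that by (auto simp: enn_powr_def less_top split: if_splits)
  show "mass u < top" "energy g < top"
    using qw(3) unfolding QW_norm_def nq_def by (auto intro: lt[of _ "1 / p"])
  have p0: "1 / p * p = 1" using p by simp
  have "(\<lambda>j. enn_powr (mass (\<lambda>x. w j x - u x)) (1 / p)) \<longlonglongrightarrow> 0"
    by (rule ennreal_tendsto_0_sandwich[OF _ qw(5)]) (simp add: QW_norm_def)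
  from enn_powr_tendsto_0[OF this, of p]
  have 1: "(\<lambda>j. mass (\<lambda>x. w j x - u x)) \<longlonglongrightarrow> 0" using p by (simp add: enn_powr_powr)
  have "(\<lambda>j. enn_powr (energy (\<lambda>x. grad (w j) x - g x)) (1 / p)) \<longlonglongrightarrow> 0"
    by (rule ennreal_tendsto_0_sandwich[OF _ qw(5)]) (simp add: QW_norm_def nq_def)
  from enn_powr_tendsto_0[OF this, of p]
  have 2: "(\<lambda>j. energy (\<lambda>x. grad (w j) x - g x)) \<longlonglongrightarrow> 0" using p by (simp add: enn_powr_powr)
  have wm: "w j \<in> borel_measurable \<nu>" for j
    by (intro continuous_measurable Lip_loc_continuous domain qw)
  obtain r where r: "strict_mono r" "AE x in \<nu>. (\<lambda>j. w (r j) x) \<longlonglongrightarrow> u x"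
    using Lp_AE_subsequence[OF wm um 1] by blast
  show "\<exists>\<omega>. (\<forall>j. \<omega> j \<in> Lip_loc \<Omega>) \<and> (AE x in \<nu>. (\<lambda>j. \<omega> j x) \<longlonglongrightarrow> u x) \<and>
       (\<lambda>j. mass (\<lambda>x. \<omega> j x - u x)) \<longlonglongrightarrow> 0 \<and>
       (\<lambda>j. energy (\<lambda>x. grad (\<omega> j) x - g x)) \<longlonglongrightarrow> 0"
    using qw(4) r(2) tendsto_0_upto_subseq[OF 1 r(1)] tendsto_0_upto_subseq[OF 2 r(1)]
    by (intro exI[of _ "\<lambda>j. w (r j)"]) auto
qed

text \<open>
  The pair \<open>(w, G)\<close> is the limit, in norm and almost everywhere, of functions in
  \<open>Lip_0\<close> together with their gradients. Such pairs stand for the elements of the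
  degenerate Sobolev space with zero boundary values, and \<open>G\<close> plays the role of the
  gradient of \<open>w\<close>; it need not be determined by \<open>w\<close>.
\<close>

definition limit_seq :: "(real^'n) set \<Rightarrow> (nat \<Rightarrow> real^'n \<Rightarrow> real) \<Rightarrow> (real^'n \<Rightarrow> real) \<Rightarrow> (real^'n \<Rightarrow> real^'n) \<Rightarrow> bool" where
  "limit_seq S \<omega> w G \<longleftrightarrow> w \<in> borel_measurable \<nu> \<and> G \<in> borel_measurable \<mu> \<and>
     mass w < top \<and> energy G < top \<and>
     (\<forall>j. \<omega> j \<in> Lip_0 \<Omega> S) \<and> (AE x in \<nu>. (\<lambda>j. \<omega> j x) \<longlonglongrightarrow> w x) \<and>
     (\<lambda>j. mass (\<lambda>x. \<omega> j x - w x)) \<longlonglongrightarrow> 0 \<and>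
     (\<lambda>j. energy (\<lambda>x. grad (\<omega> j) x - G x)) \<longlonglongrightarrow> 0"

lemma limit_seqD:
  assumes "limit_seq S \<omega> w G"
  shows "w \<in> borel_measurable \<nu>" "G \<in> borel_measurable \<mu>"
     "mass w < top" "energy G < top"
     "\<And>j. \<omega> j \<in> Lip_0 \<Omega> S" "AE x in \<nu>. (\<lambda>j. \<omega> j x) \<longlonglongrightarrow> w x"
     "(\<lambda>j. mass (\<lambda>x. \<omega> j x - w x)) \<longlonglongrightarrow> 0"
     "(\<lambda>j. energy (\<lambda>x. grad (\<omega> j) x - G x)) \<longlonglongrightarrow> 0"
  using assms unfolding limit_seq_def by auto

lemma AE_grad_compose_mult:
  assumes \<eta>: "\<eta> \<in> Lip_loc \<Omega>" and w: "w \<in> Lip_loc \<Omega>" and F: "\<And>t. (F has_real_derivative Fd t) (at t)"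
  shows "AE x in \<mu>. grad (\<lambda>y. \<eta> y * F (w y)) x = F (w x) *\<^sub>R grad \<eta> x + (\<eta> x * Fd (w x)) *\<^sub>R grad w x"
  using AE_grad[OF \<eta>] AE_grad[OF w]
proof eventually_elim
  case (elim x)
  have "GDERIV (\<lambda>y. F (w y)) x :> Fd (w x) *\<^sub>R grad w x" using elim(2) F by (rule GDERIV_DERIV_compose)
  from GDERIV_mult[OF elim(1) this] show ?case by (intro grad_eq) (simp add: add.commute)
qed

lemma lipschitz_of_derivative:
  fixes F :: "real \<Rightarrow> real"
  assumes F: "\<And>t. (F has_real_derivative Fd t) (at t)" and L: "\<And>t. \<bar>Fd t\<bar> \<le> L"
  shows "L-lipschitz_on UNIV F" "\<bar>F s - F t\<bar> \<le> L * \<bar>s - t\<bar>"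
proof -
  show *: "\<bar>F s - F t\<bar> \<le> L * \<bar>s - t\<bar>" for s t
    using field_differentiable_bound[of UNIV F Fd L s t] F L by (auto intro: has_field_derivative_at_within)
  show "L-lipschitz_on UNIV F"
    by (rule lipschitz_onI) (use * L[of 0] in \<open>auto simp: dist_real_def\<close>)
qed

text \<open>
  A cutoff gradient is dominated by the degenerate weight, whose product with \<open>\<mu>\<close>
  is dominated by \<open>\<nu>\<close>. This is how integrals of \<open>\<bar>w\<bar>\<^sup>p
  \<bar>\<surd>Q \<nabla>\<eta>\<bar>\<^sup>p\<close> against \<open>\<mu>\<close> become
  integrals of \<open>\<bar>w\<bar>\<^sup>p\<close> against \<open>\<nu>\<close>.
\<close>

lemma weighted_bound:
  assumes w: "w \<in> borel_measurable \<nu>" and ae: "AE x in \<mu>. nq x (\<xi> x) powr p \<le> c * degen_weight p Q x" and c: "c \<ge> 0"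
  shows "(\<integral>\<^sup>+x. ennreal (\<bar>w x\<bar> powr p * nq x (\<xi> x) powr p) \<partial>\<mu>) \<le> ennreal (c * Cv) * mass w"
proof -
  note [measurable] = w measurable_nu_mu[OF w]
  have "(\<integral>\<^sup>+x. ennreal (\<bar>w x\<bar> powr p * nq x (\<xi> x) powr p) \<partial>\<mu>)
     \<le> (\<integral>\<^sup>+x. ennreal c * (ennreal (degen_weight p Q x) * ennreal (\<bar>w x\<bar> powr p)) \<partial>\<mu>)"
  proof (rule nn_integral_mono_AE, use ae in eventually_elim)
    case (elim x)
    have "\<bar>w x\<bar> powr p * nq x (\<xi> x) powr p \<le> \<bar>w x\<bar> powr p * (c * degen_weight p Q x)" using elim by (intro mult_left_mono) auto
    then have "ennreal (\<bar>w x\<bar> powr p * nq x (\<xi> x) powr p) \<le> ennreal (c * (degen_weight p Q x * \<bar>w x\<bar> powr p))"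
      by (intro ennreal_leI) (simp add: ac_simps)
    then show ?case using c degen_weight_nonneg[of x] by (simp add: ennreal_mult)
  qed
  also have "\<dots> = ennreal c * (\<integral>\<^sup>+x. ennreal (degen_weight p Q x) * ennreal (\<bar>w x\<bar> powr p) \<partial>\<mu>)" by (rule nn_integral_cmult) measurable
  also have "\<dots> \<le> ennreal c * (ennreal Cv * mass w)" by (intro mult_left_mono weight_domination) auto
  finally show ?thesis using c Cv by (simp add: ennreal_mult mult.assoc)
qed

text \<open>
  Chain and product rule for limits. The difference of the gradients splits into three terms. Two
  of them are controlled by the convergence in norm; the third contains
  \<open>F'(\<omega>\<^sub>j) - F'(u)\<close> in front of the fixed function \<open>g\<close> and
  tends to \<open>0\<close> by dominated convergence, for which the convergence almost everywhere
  is needed.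
\<close>

lemma limit_seq_compose:
  assumes um: "u \<in> borel_measurable \<nu>" and gm: "g \<in> borel_measurable \<mu>"
    and ufin: "mass u < top" and gfin: "energy g < top"
    and \<omega>: "\<And>j. \<omega> j \<in> Lip_loc \<Omega>" and ae: "AE x in \<nu>. (\<lambda>j. \<omega> j x) \<longlonglongrightarrow> u x"
    and lim0: "(\<lambda>j. mass (\<lambda>x. \<omega> j x - u x)) \<longlonglongrightarrow> 0"
    and lim1: "(\<lambda>j. energy (\<lambda>x. grad (\<omega> j) x - g x)) \<longlonglongrightarrow> 0"
    and F: "\<And>t. (F has_real_derivative Fd t) (at t)" "continuous_on UNIV Fd" "\<And>t. \<bar>Fd t\<bar> \<le> L" "F 0 = 0"
    and \<eta>: "\<eta> \<in> Lip_0 \<Omega> S" "S \<subseteq> \<Omega>" "\<And>x. x \<in> \<Omega> \<Longrightarrow> 0 \<le> \<eta> x" "\<And>x. x \<in> \<Omega> \<Longrightarrow> \<eta> x \<le> 1"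
    and \<eta>g: "AE x in \<mu>. nq x (grad \<eta> x) powr p \<le> c * degen_weight p Q x" and c: "c \<ge> 0"
  shows "limit_seq S (\<lambda>j x. \<eta> x * F (\<omega> j x)) (\<lambda>x. \<eta> x * F (u x)) (\<lambda>x. F (u x) *\<^sub>R grad \<eta> x + (\<eta> x * Fd (u x)) *\<^sub>R g x)"
    (is "limit_seq S _ ?w ?G")
proof -
  note \<eta>D = Lip_0_D[OF \<eta>(1)]
  have L0: "L \<ge> 0" using F(3)[of 0] by simp
  have Flip: "\<bar>F s - F t\<bar> \<le> L * \<bar>s - t\<bar>" for s t using lipschitz_of_derivative(2)[OF F(1,3)] .
  have FL: "\<bar>F t\<bar> \<le> L * \<bar>t\<bar>" for t using Flip[of t 0] F(4) by simp
  have Fc: "continuous_on UNIV F" using lipschitz_on_continuous_on[OF lipschitz_of_derivative(1)[OF F(1,3)]] .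
  note [measurable] = \<eta>D(3,4) um measurable_nu_mu[OF um] gm borel_measurable_continuous_onI[OF Fc] borel_measurable_continuous_onI[OF F(2)]
    grad_measurable[OF \<eta>D(1)] nq_grad_measurable[OF \<eta>D(1)] nq_measurable[OF gm]
  have \<omega>m[measurable]: "\<omega> j \<in> borel_measurable \<nu>" "\<omega> j \<in> borel_measurable \<mu>" for j
    using continuous_measurable[OF Lip_loc_continuous[OF domain(1) \<omega>]] by auto
  have Gm: "?G \<in> borel_measurable \<mu>" by measurable
  have abs\<eta>: "\<bar>\<eta> x\<bar> \<le> 1" if "x \<in> \<Omega>" for x using \<eta>(3,4)[OF that] by simp
  have wfin: "mass ?w < top"
  proof -
    have "mass ?w \<le> (\<integral>\<^sup>+x. ennreal (L powr p) * ennreal (\<bar>u x\<bar> powr p) \<partial>\<nu>)"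
    proof (rule nn_integral_mono)
      fix x assume "x \<in> space \<nu>"
      then have "\<bar>?w x\<bar> \<le> 1 * (L * \<bar>u x\<bar>)" unfolding abs_mult by (intro mult_mono abs\<eta> FL) auto
      then have "\<bar>?w x\<bar> powr p \<le> (L * \<bar>u x\<bar>) powr p" using p by (intro powr_mono2) auto
      then show "ennreal (\<bar>?w x\<bar> powr p) \<le> ennreal (L powr p) * ennreal (\<bar>u x\<bar> powr p)"
        using L0 by (simp add: powr_mult ennreal_leI flip: ennreal_mult)
    qed
    also have "\<dots> = ennreal (L powr p) * mass u" by (rule nn_integral_cmult) measurable
    also have "\<dots> < top" using ufin by (simp add: ennreal_mult_less_top)
    finally show ?thesis .
  qed
  have Gfin: "energy ?G < top"
  proof -
    have "energy ?G \<le>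
       (\<integral>\<^sup>+x. ennreal (2 powr p) * (ennreal (\<bar>L * u x\<bar> powr p * nq x (grad \<eta> x) powr p) + ennreal (L powr p) * ennreal (nq x (g x) powr p)) \<partial>\<mu>)"
    proof (rule nn_integral_mono)
      fix x assume "x \<in> space \<mu>"
      then have x: "x \<in> \<Omega>" by simp
      have "nq x (?G x) \<le> \<bar>F (u x)\<bar> * nq x (grad \<eta> x) + \<bar>\<eta> x * Fd (u x)\<bar> * nq x (g x)"
        using nq_add[of x "F (u x) *\<^sub>R grad \<eta> x" "(\<eta> x * Fd (u x)) *\<^sub>R g x"] by (simp add: nq_scale)
      also have "\<dots> \<le> \<bar>L * u x\<bar> * nq x (grad \<eta> x) + (1 * L) * nq x (g x)"
        unfolding abs_mult[of "\<eta> x"] using FL[of "u x"] L0 by (intro add_mono mult_right_mono mult_mono abs\<eta> x F(3)) (auto simp: abs_mult)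
      finally have "nq x (?G x) powr p \<le> (\<bar>L * u x\<bar> * nq x (grad \<eta> x) + L * nq x (g x)) powr p" using p by (intro powr_mono2) auto
      also have "\<dots> \<le> 2 powr p * ((\<bar>L * u x\<bar> * nq x (grad \<eta> x)) powr p + (L * nq x (g x)) powr p)"
        using L0 p by (intro powr_add_le) auto
      finally show "ennreal (nq x (?G x) powr p) \<le> ennreal (2 powr p) * (ennreal (\<bar>L * u x\<bar> powr p * nq x (grad \<eta> x) powr p) + ennreal (L powr p) * ennreal (nq x (g x) powr p))"
        using L0 by (simp add: powr_mult ennreal_leI flip: ennreal_mult ennreal_plus)
    qed
    also have "\<dots> = ennreal (2 powr p) * ((\<integral>\<^sup>+x. ennreal (\<bar>L * u x\<bar> powr p * nq x (grad \<eta> x) powr p) \<partial>\<mu>) + ennreal (L powr p) * energy g)"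
      by (simp add: nn_integral_cmult nn_integral_add)
    also have "\<dots> \<le> ennreal (2 powr p) * (ennreal (c * Cv) * mass (\<lambda>x. L * u x) + ennreal (L powr p) * energy g)"
      by (intro mult_left_mono add_right_mono weighted_bound[OF _ \<eta>g c]) auto
    also have "mass (\<lambda>x. L * u x) = ennreal (L powr p) * mass u"
      using L0 by (subst nn_integral_cmult[symmetric]) (auto simp: abs_mult powr_mult ennreal_mult)
    also have "ennreal (2 powr p) * (ennreal (c * Cv) * (ennreal (L powr p) * mass u) + ennreal (L powr p) * energy g) < top"
      using ufin gfin by (simp add: ennreal_mult_less_top ennreal_add_less_top)
    finally show ?thesis .
  qed
  have wl: "(\<lambda>x. \<eta> x * F (\<omega> j x)) \<in> Lip_0 \<Omega> S" for j
    by (rule Lip_0_mult_left[OF \<eta>(1) Lip_loc_compose[OF \<omega> lipschitz_of_derivative(1)[OF F(1,3)]] domain(1) \<eta>(2)]) simp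
  have aew: "AE x in \<nu>. (\<lambda>j. \<eta> x * F (\<omega> j x)) \<longlonglongrightarrow> ?w x"
    using ae by eventually_elim (intro tendsto_mult tendsto_const continuous_on_tendsto_compose[OF Fc]; simp)
  have l0: "(\<lambda>j. mass (\<lambda>x. \<eta> x * F (\<omega> j x) - ?w x)) \<longlonglongrightarrow> 0"
  proof (rule ennreal_tendsto_0_sandwich)
    show "mass (\<lambda>x. \<eta> x * F (\<omega> j x) - ?w x) \<le> ennreal (L powr p) * mass (\<lambda>x. \<omega> j x - u x)" for j
    proof (subst nn_integral_cmult[symmetric], measurable, rule nn_integral_mono)
      fix x assume "x \<in> space \<nu>"
      then have "\<bar>\<eta> x\<bar> * \<bar>F (\<omega> j x) - F (u x)\<bar> \<le> 1 * (L * \<bar>\<omega> j x - u x\<bar>)" by (intro mult_mono abs\<eta> Flip) auto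
      then have "\<bar>\<eta> x * F (\<omega> j x) - ?w x\<bar> powr p \<le> (L * \<bar>\<omega> j x - u x\<bar>) powr p"
        using p by (intro powr_mono2) (auto simp: abs_mult[symmetric] right_diff_distrib)
      then show "ennreal (\<bar>\<eta> x * F (\<omega> j x) - ?w x\<bar> powr p) \<le> ennreal (L powr p) * ennreal (\<bar>\<omega> j x - u x\<bar> powr p)"
        using L0 by (simp add: powr_mult ennreal_leI flip: ennreal_mult)
    qed
    show "(\<lambda>j. ennreal (L powr p) * mass (\<lambda>x. \<omega> j x - u x)) \<longlonglongrightarrow> 0"
      using ennreal_tendsto_cmult[OF _ lim0, of "ennreal (L powr p)"] by simp
  qed
  have l1: "(\<lambda>j. energy (\<lambda>x. grad (\<lambda>y. \<eta> y * F (\<omega> j y)) x - ?G x)) \<longlonglongrightarrow> 0"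
  proof (rule ennreal_tendsto_0_sandwich)
    fix j
    let ?d0 = "mass (\<lambda>x. \<omega> j x - u x)" and ?d1 = "energy (\<lambda>x. grad (\<omega> j) x - g x)"
      and ?d2 = "\<integral>\<^sup>+x. ennreal (\<bar>Fd (\<omega> j x) - Fd (u x)\<bar> powr p * nq x (g x) powr p) \<partial>\<mu>"
    note [measurable] = grad_measurable[OF \<omega>, of j] nq_measurable[OF borel_measurable_diff[OF grad_measurable[OF \<omega>, of j] gm]]
    have "energy (\<lambda>x. grad (\<lambda>y. \<eta> y * F (\<omega> j y)) x - ?G x) \<le>
      (\<integral>\<^sup>+x. ennreal (3 powr p) * (ennreal (\<bar>L * (\<omega> j x - u x)\<bar> powr p * nq x (grad \<eta> x) powr p) +
         ennreal (L powr p) * ennreal (nq x (grad (\<omega> j) x - g x) powr p) + ennreal (\<bar>Fd (\<omega> j x) - Fd (u x)\<bar> powr p * nq x (g x) powr p)) \<partial>\<mu>)"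
    proof (rule nn_integral_mono_AE, use AE_grad_compose_mult[OF \<eta>D(1) \<omega>[of j] F(1)] AE_space[of \<mu>] in eventually_elim)
      case (elim x)
      then have x: "x \<in> \<Omega>" by simp
      have "grad (\<lambda>y. \<eta> y * F (\<omega> j y)) x - ?G x = (F (\<omega> j x) - F (u x)) *\<^sub>R grad \<eta> x +
          (\<eta> x * Fd (\<omega> j x)) *\<^sub>R (grad (\<omega> j) x - g x) + (\<eta> x * (Fd (\<omega> j x) - Fd (u x))) *\<^sub>R g x"
        unfolding elim(1) by (simp add: algebra_simps)
      then have "nq x (grad (\<lambda>y. \<eta> y * F (\<omega> j y)) x - ?G x) \<le> \<bar>F (\<omega> j x) - F (u x)\<bar> * nq x (grad \<eta> x) +
          \<bar>\<eta> x * Fd (\<omega> j x)\<bar> * nq x (grad (\<omega> j) x - g x) + \<bar>\<eta> x * (Fd (\<omega> j x) - Fd (u x))\<bar> * nq x (g x)"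
        by (simp only: nq_scale[symmetric]) (intro order.trans[OF nq_add] add_mono nq_add order_refl)
      also have "\<dots> \<le> \<bar>L * (\<omega> j x - u x)\<bar> * nq x (grad \<eta> x) + (1 * L) * nq x (grad (\<omega> j) x - g x) + (1 * \<bar>Fd (\<omega> j x) - Fd (u x)\<bar>) * nq x (g x)"
        unfolding abs_mult[of "\<eta> x"] using L0 Flip[of "\<omega> j x" "u x"]
        by (intro add_mono mult_right_mono mult_mono abs\<eta> x F(3)) (auto simp: abs_mult)
      finally have "nq x (grad (\<lambda>y. \<eta> y * F (\<omega> j y)) x - ?G x) powr p \<le> (\<bar>L * (\<omega> j x - u x)\<bar> * nq x (grad \<eta> x) + L * nq x (grad (\<omega> j) x - g x) + \<bar>Fd (\<omega> j x) - Fd (u x)\<bar> * nq x (g x)) powr p"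
        using p by (intro powr_mono2) auto
      also have "\<dots> \<le> 3 powr p * ((\<bar>L * (\<omega> j x - u x)\<bar> * nq x (grad \<eta> x)) powr p + (L * nq x (grad (\<omega> j) x - g x)) powr p + (\<bar>Fd (\<omega> j x) - Fd (u x)\<bar> * nq x (g x)) powr p)"
        using L0 p by (intro powr_add3_le) auto
      finally show ?case
        using L0 by (simp add: powr_mult ennreal_leI flip: ennreal_mult ennreal_plus)
    qed
    also have "\<dots> = ennreal (3 powr p) * ((\<integral>\<^sup>+x. ennreal (\<bar>L * (\<omega> j x - u x)\<bar> powr p * nq x (grad \<eta> x) powr p) \<partial>\<mu>) + ennreal (L powr p) * ?d1 + ?d2)"
      by (simp add: nn_integral_cmult nn_integral_add)
    also have "\<dots> \<le> ennreal (3 powr p) * (ennreal (c * Cv) * mass (\<lambda>x. L * (\<omega> j x - u x)) + ennreal (L powr p) * ?d1 + ?d2)"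
      by (intro mult_left_mono add_right_mono weighted_bound[OF _ \<eta>g c]) auto
    also have "mass (\<lambda>x. L * (\<omega> j x - u x)) = ennreal (L powr p) * ?d0"
      using L0 by (subst nn_integral_cmult[symmetric]) (auto simp: abs_mult powr_mult ennreal_mult)
    finally show "energy (\<lambda>x. grad (\<lambda>y. \<eta> y * F (\<omega> j y)) x - ?G x)
       \<le> ennreal (3 powr p) * (ennreal (c * Cv) * (ennreal (L powr p) * ?d0) + ennreal (L powr p) * ?d1 + ?d2)" .
  next
    have "(\<lambda>j. \<integral>\<^sup>+x. ennreal (\<bar>Fd (\<omega> j x) - Fd (u x)\<bar> powr p * nq x (g x) powr p) \<partial>\<mu>) \<longlonglongrightarrow> (\<integral>\<^sup>+x. 0 \<partial>\<mu>)"
    proof (rule nn_integral_dominated_convergence[where w = "\<lambda>x. ennreal ((2 * L) powr p) * ennreal (nq x (g x) powr p)"])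
      have "(\<integral>\<^sup>+x. ennreal ((2 * L) powr p) * ennreal (nq x (g x) powr p) \<partial>\<mu>) = ennreal ((2 * L) powr p) * energy g"
        by (rule nn_integral_cmult) measurable
      also have "\<dots> < top" using gfin by (simp add: ennreal_mult_less_top)
      finally show "(\<integral>\<^sup>+x. ennreal ((2 * L) powr p) * ennreal (nq x (g x) powr p) \<partial>\<mu>) < \<infinity>" by simp
      show "AE x in \<mu>. ennreal (\<bar>Fd (\<omega> j x) - Fd (u x)\<bar> powr p * nq x (g x) powr p) \<le> ennreal ((2 * L) powr p) * ennreal (nq x (g x) powr p)" for j
      proof (rule AE_I2)
        fix x
        have "\<bar>Fd (\<omega> j x) - Fd (u x)\<bar> powr p \<le> (2 * L) powr p" using F(3)[of "\<omega> j x"] F(3)[of "u x"] p by (intro powr_mono2) auto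
        then show "ennreal (\<bar>Fd (\<omega> j x) - Fd (u x)\<bar> powr p * nq x (g x) powr p) \<le> ennreal ((2 * L) powr p) * ennreal (nq x (g x) powr p)"
          by (simp add: mult_right_mono ennreal_leI flip: ennreal_mult)
      qed
      show "AE x in \<mu>. (\<lambda>j. ennreal (\<bar>Fd (\<omega> j x) - Fd (u x)\<bar> powr p * nq x (g x) powr p)) \<longlonglongrightarrow> 0"
        using AE_nu_mu[OF ae]
      proof eventually_elim
        case (elim x)
        have "(\<lambda>j. Fd (\<omega> j x)) \<longlonglongrightarrow> Fd (u x)" by (rule continuous_on_tendsto_compose[OF F(2) elim]) auto
        then have "(\<lambda>j. \<bar>Fd (\<omega> j x) - Fd (u x)\<bar>) \<longlonglongrightarrow> 0" using LIM_zero tendsto_rabs_zero by blast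
        then have "(\<lambda>j. \<bar>Fd (\<omega> j x) - Fd (u x)\<bar> powr p * nq x (g x) powr p) \<longlonglongrightarrow> 0 powr p * nq x (g x) powr p"
          using p by (intro tendsto_mult tendsto_const tendsto_powr') auto
        then show ?case using p tendsto_ennrealI by fastforce
      qed
    qed measurable
    then have d2: "(\<lambda>j. \<integral>\<^sup>+x. ennreal (\<bar>Fd (\<omega> j x) - Fd (u x)\<bar> powr p * nq x (g x) powr p) \<partial>\<mu>) \<longlonglongrightarrow> 0" by simp
    have t: "(\<lambda>j. ennreal a * X j) \<longlonglongrightarrow> 0" if "X \<longlonglongrightarrow> 0" for a X using ennreal_tendsto_cmult[OF _ that, of "ennreal a"] by simp
    have t2: "(\<lambda>j. X j + Y j) \<longlonglongrightarrow> (0::ennreal)" if "X \<longlonglongrightarrow> 0" "Y \<longlonglongrightarrow> 0" for X Y :: "nat \<Rightarrow> ennreal" using tendsto_add[OF that] by simp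
    show "(\<lambda>j. ennreal (3 powr p) * (ennreal (c * Cv) * (ennreal (L powr p) * mass (\<lambda>x. \<omega> j x - u x)) +
       ennreal (L powr p) * energy (\<lambda>x. grad (\<omega> j) x - g x) + (\<integral>\<^sup>+x. ennreal (\<bar>Fd (\<omega> j x) - Fd (u x)\<bar> powr p * nq x (g x) powr p) \<partial>\<mu>))) \<longlonglongrightarrow> 0"
      by (intro t t2 lim0 lim1 d2)
  qed
  show ?thesis
    unfolding limit_seq_def using Gm wfin Gfin wl aew l0 l1 by simp
qed

text \<open>
  Bounds on the approximating functions pass to the limit by Fatou's lemma.
\<close>

lemma fatou_eventually:
  assumes [measurable]: "\<And>j. \<omega> j \<in> borel_measurable \<nu>" "w \<in> borel_measurable \<nu>" "b \<in> borel_measurable \<nu>"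
    and ae: "AE x in \<nu>. (\<lambda>j. \<omega> j x) \<longlonglongrightarrow> (w x :: real)" and s: "s > 0"
    and le: "\<forall>\<^sub>F j in sequentially. (\<integral>\<^sup>+x. ennreal (b x * \<bar>\<omega> j x\<bar> powr s) \<partial>\<nu>) \<le> R"
  shows "(\<integral>\<^sup>+x. ennreal (b x * \<bar>w x\<bar> powr s) \<partial>\<nu>) \<le> R"
proof -
  have "(\<integral>\<^sup>+x. ennreal (b x * \<bar>w x\<bar> powr s) \<partial>\<nu>) \<le> (\<integral>\<^sup>+x. liminf (\<lambda>j. ennreal (b x * \<bar>\<omega> j x\<bar> powr s)) \<partial>\<nu>)"
  proof (rule nn_integral_mono_AE, use ae in eventually_elim)
    case (elim x)
    have "(\<lambda>j. b x * \<bar>\<omega> j x\<bar> powr s) \<longlonglongrightarrow> b x * \<bar>w x\<bar> powr s"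
      using elim s by (intro tendsto_mult tendsto_const tendsto_powr' tendsto_rabs) auto
    then have "(\<lambda>j. ennreal (b x * \<bar>\<omega> j x\<bar> powr s)) \<longlonglongrightarrow> ennreal (b x * \<bar>w x\<bar> powr s)" by (rule tendsto_ennrealI)
    then show ?case using lim_imp_Liminf[OF sequentially_bot] by (metis order_refl)
  qed
  also have "\<dots> \<le> liminf (\<lambda>j. \<integral>\<^sup>+x. ennreal (b x * \<bar>\<omega> j x\<bar> powr s) \<partial>\<nu>)" by (rule nn_integral_liminf) measurable
  also have "\<dots> \<le> limsup (\<lambda>j. \<integral>\<^sup>+x. ennreal (b x * \<bar>\<omega> j x\<bar> powr s) \<partial>\<nu>)" by (rule Liminf_le_Limsup) simp
  also have "\<dots> \<le> R" by (rule Limsup_bounded[OF le])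
  finally show ?thesis .
qed

lemma limit_seq_energy:
  assumes "limit_seq S \<omega> w G"
  shows "energy (grad (\<omega> j)) \<le> ennreal (2 powr p) * (energy G + energy (\<lambda>x. grad (\<omega> j) x - G x))"
    "mass (\<omega> j) \<le> ennreal (2 powr p) * (mass w + mass (\<lambda>x. \<omega> j x - w x))"
proof -
  note D = limit_seqD[OF assms] and \<omega>D = Lip_0_D[OF limit_seqD(5)[OF assms]]
  note [measurable] = D(1,2) nq_measurable[OF D(2)] grad_measurable[OF \<omega>D(1)] \<omega>D(3) nq_measurable[OF borel_measurable_diff[OF grad_measurable[OF \<omega>D(1)] D(2)]]
  have "energy (grad (\<omega> j)) \<le> (\<integral>\<^sup>+x. ennreal (2 powr p) * (ennreal (nq x (G x) powr p) + ennreal (nq x (grad (\<omega> j) x - G x) powr p)) \<partial>\<mu>)"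
  proof (rule nn_integral_mono)
    fix x
    have "nq x (grad (\<omega> j) x) powr p \<le> (nq x (G x) + nq x (grad (\<omega> j) x - G x)) powr p"
      using nq_add[of x "G x" "grad (\<omega> j) x - G x"] p by (intro powr_mono2) auto
    also have "\<dots> \<le> 2 powr p * (nq x (G x) powr p + nq x (grad (\<omega> j) x - G x) powr p)" using p by (intro powr_add_le) auto
    finally show "ennreal (nq x (grad (\<omega> j) x) powr p) \<le> ennreal (2 powr p) * (ennreal (nq x (G x) powr p) + ennreal (nq x (grad (\<omega> j) x - G x) powr p))"
      by (simp add: ennreal_leI flip: ennreal_mult ennreal_plus)
  qed
  also have "\<dots> = ennreal (2 powr p) * (energy G + energy (\<lambda>x. grad (\<omega> j) x - G x))"
    by (simp add: nn_integral_cmult nn_integral_add)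
  finally show "energy (grad (\<omega> j)) \<le> \<dots>" .
  have "mass (\<omega> j) \<le> (\<integral>\<^sup>+x. ennreal (2 powr p) * (ennreal (\<bar>w x\<bar> powr p) + ennreal (\<bar>\<omega> j x - w x\<bar> powr p)) \<partial>\<nu>)"
  proof (rule nn_integral_mono)
    fix x
    have "\<bar>\<omega> j x\<bar> powr p \<le> (\<bar>w x\<bar> + \<bar>\<omega> j x - w x\<bar>) powr p" using p by (intro powr_mono2) auto
    also have "\<dots> \<le> 2 powr p * (\<bar>w x\<bar> powr p + \<bar>\<omega> j x - w x\<bar> powr p)" using p by (intro powr_add_le) auto
    finally show "ennreal (\<bar>\<omega> j x\<bar> powr p) \<le> ennreal (2 powr p) * (ennreal (\<bar>w x\<bar> powr p) + ennreal (\<bar>\<omega> j x - w x\<bar> powr p))"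
      by (simp add: ennreal_leI flip: ennreal_mult ennreal_plus)
  qed
  also have "\<dots> = ennreal (2 powr p) * (mass w + mass (\<lambda>x. \<omega> j x - w x))"
    by (simp add: nn_integral_cmult nn_integral_add)
  finally show "mass (\<omega> j) \<le> \<dots>" .
qed

end

section \<open>The weak formulation for limits\<close>

lemma ennreal_tendsto_cmult_0:
  assumes "(X::nat \<Rightarrow> ennreal) \<longlonglongrightarrow> 0" "c < top" shows "(\<lambda>j. c * X j) \<longlonglongrightarrow> 0"
  using ennreal_tendsto_cmult[OF assms(2,1)] by simp

lemma ennreal_tendsto_add_0:
  assumes "(X::nat \<Rightarrow> ennreal) \<longlonglongrightarrow> 0" "Y \<longlonglongrightarrow> 0" shows "(\<lambda>j. X j + Y j) \<longlonglongrightarrow> 0"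
  using tendsto_add[OF assms] by simp

text \<open>
  Young's inequality bounds a product by a large multiple of a null sequence plus a small multiple
  of a constant.
\<close>

lemma tendsto_0_by_splitting:
  fixes X Y :: "nat \<Rightarrow> ennreal"
  assumes le: "\<And>s j. s > 0 \<Longrightarrow> X j \<le> ennreal (s powr a) * Y j + ennreal s * Z" and Y: "Y \<longlonglongrightarrow> 0" and Z: "Z < top"
  shows "X \<longlonglongrightarrow> 0"
proof (rule order_tendstoI)
  fix e :: ennreal assume "0 < e"
  then obtain d where d: "0 < d" "ennreal d < e"
    by (metis ennreal_0 ennreal_less_iff order_le_less less_imp_le dense ennreal_cases top_greatest less_top)
  obtain z where z: "Z = ennreal z" "z \<ge> 0" using Z by (cases Z rule: ennreal_cases) auto
  define s where "s = d / (2 * (z + 1))"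
  have s: "s > 0" using d z by (simp add: s_def)
  have "s * z \<le> d / 2" using d z by (simp add: s_def field_simps)
  then have sz: "ennreal s * Z \<le> ennreal (d / 2)" using s z by (simp add: ennreal_leI flip: ennreal_mult)
  have "\<forall>\<^sub>F j in sequentially. ennreal (s powr a) * Y j < ennreal (d / 2)"
    using d by (intro order_tendstoD(2)[OF ennreal_tendsto_cmult_0[OF Y]]) auto
  then show "\<forall>\<^sub>F j in sequentially. X j < e"
  proof eventually_elim
    case (elim j)
    have "X j \<le> ennreal (d / 2) + ennreal (d / 2)" using elim le[OF s, of j] sz by (meson add_mono less_imp_le order_trans)
    also have "\<dots> = ennreal d" using d by (simp flip: ennreal_plus)
    finally show ?case using d(2) by (rule order.strict_trans1)
  qed
qed simp

lemma Lip_0_diff: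
  assumes a: "a \<in> Lip_0 \<Omega> S" and b: "b \<in> Lip_0 \<Omega> S"
  shows "(\<lambda>x. a x - b x) \<in> Lip_0 \<Omega> S"
proof -
  obtain L M where L: "L-lipschitz_on \<Omega> a" "M-lipschitz_on \<Omega> b" using a b by (auto simp: Lip_0_def)
  have "(L + M)-lipschitz_on \<Omega> (\<lambda>x. a x - b x)" by (rule lipschitz_on_diff[OF L])
  moreover have sub: "support_in \<Omega> (\<lambda>x. a x - b x) \<subseteq> support_in \<Omega> a \<union> support_in \<Omega> b"
    unfolding support_in_def closure_Un[symmetric] by (intro closure_mono) auto
  moreover have c: "compact (support_in \<Omega> a \<union> support_in \<Omega> b)" "support_in \<Omega> a \<union> support_in \<Omega> b \<subseteq> S" using a b by (auto simp: Lip_0_def)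
  moreover have "compact (support_in \<Omega> (\<lambda>x. a x - b x))"
    using compact_Int_closed[OF c(1), of "support_in \<Omega> (\<lambda>x. a x - b x)"] sub by (simp add: support_in_def Int_absorb1)
  ultimately show ?thesis unfolding Lip_0_def by blast
qed

text \<open>
  The full setting with a weak solution \<open>(u, g)\<close> and the constants \<open>k\<close>,
  \<open>C1\<close> of the Sobolev inequality for the exponent \<open>p\<close>. The function
  \<open>f\<close> enters through the local integrability of
  \<open>\<bar>f\<bar>\<^sup>p\<^sup>-\<^sup>1\<close> and the finiteness of its modulus.
\<close>

locale setting_solution = setting_cutoff \<Omega> \<rho> h m Q \<mu> \<nu> p A Cv C0 \<gamma> \<tau> Cc T
  for \<Omega> :: "(real^'n) set" and \<rho> h m Q \<mu> \<nu> p A Cv C0 \<gamma> \<tau> Cc T +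
  fixes k C1 :: real and f u :: "real^'n \<Rightarrow> real" and g :: "real^'n \<Rightarrow> real^'n"
  assumes k: "k > 1" and C1: "C1 > 0" and sobolev: "sobolev_ineq \<Omega> \<rho> \<mu> \<nu> Q p k C1"
    and f: "f \<in> borel_measurable \<nu>"
    and Vfin: "\<And>x s. mB \<Omega> \<rho> x s \<Subset> \<Omega> \<Longrightarrow> (\<integral>\<^sup>+z\<in>mB \<Omega> \<rho> x s. ennreal \<bar>\<bar>f z\<bar> powr (p - 1)\<bar> \<partial>\<nu>) < top"
    and Phifin: "\<And>s. s > 0 \<Longrightarrow> SK_Phi \<Omega> \<rho> \<mu> \<nu> p (\<lambda>x. \<bar>f x\<bar> powr (p - 1)) s < top"
    and sol: "weak_solution \<Omega> \<mu> \<nu> Q p f u g"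
begin

definition V :: "real^'n \<Rightarrow> real" where "V x = \<bar>f x\<bar> powr (p - 1)"

definition Phi :: "real \<Rightarrow> ennreal" where
  "Phi s = enn_powr (SK_Phi \<Omega> \<rho> \<mu> \<nu> p V s) (1 / (p - 1))"

lemma V_nonneg[simp]: "0 \<le> V x" by (simp add: V_def)

lemma V_measurable[measurable]: "V \<in> borel_measurable \<nu>"
  using f unfolding V_def[abs_def] by measurable

lemma V_fin: "mball x s \<Subset> \<Omega> \<Longrightarrow> (\<integral>\<^sup>+z\<in>mball x s. ennreal \<bar>V z\<bar> \<partial>\<nu>) < top"
  using Vfin unfolding V_def .

lemma Phi_fin: "s > 0 \<Longrightarrow> Phi s < top"
  using Phifin[of s] unfolding Phi_def V_def[abs_def] by (intro enn_powr_lt_top) simp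

lemma sobolev_Lip0:
  assumes x0: "x0 \<in> \<Omega>" and r: "r > 0" and comp: "mball x0 r \<Subset> \<Omega>" and w: "w \<in> Lip_0 \<Omega> (mball x0 r)"
  shows "enn_powr ((\<integral>\<^sup>+z. ennreal (\<bar>w z\<bar> powr (k * p)) \<partial>\<nu>) / emeasure \<nu> (mball x0 r)) (1 / k) \<le>
     ennreal ((C1 * r) powr p) * (energy (grad w) / emeasure \<mu> (mball x0 r))"
proof -
  let ?B = "mball x0 r"
  have "(\<integral>\<^sup>+z. ennreal (\<bar>w z\<bar> powr (k * p)) \<partial>\<nu>) = (\<integral>\<^sup>+z\<in>?B. ennreal (\<bar>w z\<bar> powr (k * p)) \<partial>\<nu>)"
    using Lip_0_D(5)[OF w] by (intro nn_integral_cong) (auto simp: indicator_def simp del: in_mball)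
  then have "enn_powr ((\<integral>\<^sup>+z. ennreal (\<bar>w z\<bar> powr (k * p)) \<partial>\<nu>) / emeasure \<nu> ?B) (1 / k)
    = enn_powr (enn_powr ((\<integral>\<^sup>+z\<in>?B. ennreal (\<bar>w z\<bar> powr (k * p)) \<partial>\<nu>) / emeasure \<nu> ?B) (1 / (k * p))) p"
    using p k by (simp add: enn_powr_powr)
  also have "\<dots> \<le> enn_powr (ennreal (C1 * r) * enn_powr ((\<integral>\<^sup>+y\<in>?B. ennreal (nq y (grad w y) powr p) \<partial>\<mu>) / emeasure \<mu> ?B) (1 / p)) p"
    using sobolev x0 r comp w p unfolding sobolev_ineq_def nq_def by (intro enn_powr_mono) auto
  also have "\<dots> = ennreal ((C1 * r) powr p) * ((\<integral>\<^sup>+y\<in>?B. ennreal (nq y (grad w y) powr p) \<partial>\<mu>) / emeasure \<mu> ?B)"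
    using p C1 r by (simp add: enn_powr_mult enn_powr_powr)
  also have "\<dots> \<le> ennreal ((C1 * r) powr p) * (energy (grad w) / emeasure \<mu> ?B)"
    by (intro mult_left_mono divide_right_mono_ennreal nn_integral_mono) (auto simp: indicator_def)
  finally show ?thesis .
qed

text \<open>
  The left hand side passes to the limit by Fatou's lemma. Using the crude bound
  \<open>2\<^sup>p\<close> for the energy of the approximating functions avoids the triangle
  inequality for the norm.
\<close>

lemma sobolev_limit:
  assumes x0: "x0 \<in> \<Omega>" and r: "r > 0" and comp: "mball x0 r \<Subset> \<Omega>" and lim: "limit_seq (mball x0 r) \<omega> w G"
    and pos: "emeasure \<mu> (mball x0 r) > 0"
  shows "enn_powr ((\<integral>\<^sup>+z. ennreal (\<bar>w z\<bar> powr (k * p)) \<partial>\<nu>) / emeasure \<nu> (mball x0 r)) (1 / k) \<le>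
     ennreal ((C1 * r) powr p * 2 powr p) * (energy G / emeasure \<mu> (mball x0 r))"
    (is "enn_powr (?Y / ?n) _ \<le> _ * (?D / ?m)")
proof -
  note D = limit_seqD[OF lim] and \<omega>D = Lip_0_D[OF limit_seqD(5)[OF lim]]
  have n: "?n \<noteq> 0" "?n \<noteq> top" using nu_ball_pos[OF x0 r] by (auto simp: nu.emeasure_eq_measure)
  have m: "?m \<noteq> 0" "?m \<noteq> top" using pos by (auto simp: mu.emeasure_eq_measure)
  define K0 where "K0 = ennreal ((C1 * r) powr p * 2 powr p) / ?m"
  have "measure \<mu> (mball x0 r) > 0" using pos by (simp add: mu.emeasure_eq_measure)
  then have K0: "K0 < top" unfolding K0_def mu.emeasure_eq_measure by (simp add: divide_ennreal)
  define d where "d j = energy (\<lambda>x. grad (\<omega> j) x - G x)" for j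
  have d0: "(\<lambda>j. K0 * d j) \<longlonglongrightarrow> 0" unfolding d_def by (rule ennreal_tendsto_cmult_0[OF D(8) K0])
  have "enn_powr (?Y / ?n) (1 / k) \<le> K0 * ?D"
  proof (rule ennreal_le_epsilon)
    fix e :: real assume e: "0 < e"
    let ?R = "K0 * ?D + ennreal e"
    have "\<forall>\<^sub>F j in sequentially. K0 * d j < ennreal e" using e by (intro order_tendstoD(2)[OF d0]) auto
    then have ev: "\<forall>\<^sub>F j in sequentially. (\<integral>\<^sup>+z. ennreal (1 * \<bar>\<omega> j z\<bar> powr (k * p)) \<partial>\<nu>) \<le> enn_powr ?R k * ?n"
    proof eventually_elim
      case (elim j)
      let ?Yj = "\<integral>\<^sup>+z. ennreal (\<bar>\<omega> j z\<bar> powr (k * p)) \<partial>\<nu>"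
      have "enn_powr (?Yj / ?n) (1 / k) \<le> ennreal ((C1 * r) powr p) * (energy (grad (\<omega> j)) / ?m)"
        by (rule sobolev_Lip0[OF x0 r comp D(5)])
      also have "\<dots> \<le> ennreal ((C1 * r) powr p) * ((ennreal (2 powr p) * (?D + d j)) / ?m)"
        unfolding d_def by (intro mult_left_mono divide_right_mono_ennreal limit_seq_energy[OF lim]) auto
      also have "\<dots> = K0 * ?D + K0 * d j"
        unfolding K0_def by (simp add: ennreal_mult divide_ennreal_def distrib_left distrib_right ac_simps)
      also have "\<dots> \<le> ?R" using elim by (intro add_left_mono) auto
      finally have "enn_powr (enn_powr (?Yj / ?n) (1 / k)) k \<le> enn_powr ?R k" using k by (intro enn_powr_mono) auto
      then have "?Yj / ?n \<le> enn_powr ?R k" using k by (simp add: enn_powr_powr)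
      then have "?Yj / ?n * ?n \<le> enn_powr ?R k * ?n" by (rule mult_right_mono) simp
      then show ?case using n by (simp add: ennreal_divide_mult_cancel)
    qed
    have "(\<integral>\<^sup>+z. ennreal (1 * \<bar>w z\<bar> powr (k * p)) \<partial>\<nu>) \<le> enn_powr ?R k * ?n"
      by (rule fatou_eventually[OF \<omega>D(3) D(1) _ D(6) _ ev]) (use k p in auto)
    then have "?Y / ?n \<le> (enn_powr ?R k * ?n) / ?n" by (intro divide_right_mono_ennreal) simp
    also have "\<dots> = enn_powr ?R k" using n by (simp add: mult_divide_eq_ennreal)
    finally have "enn_powr (?Y / ?n) (1 / k) \<le> enn_powr (enn_powr ?R k) (1 / k)" using k by (intro enn_powr_mono) auto
    then show "enn_powr (?Y / ?n) (1 / k) \<le> ?R" using k by (simp add: enn_powr_powr)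
  qed
  then show ?thesis unfolding K0_def by (simp add: divide_ennreal_def ac_simps)
qed

lemma fefferman_limit:
  assumes x0: "x0 \<in> \<Omega>" and comp: "mball x0 (8 * r) \<Subset> \<Omega>" and \<epsilon>: "\<epsilon> > 0" "32 * \<epsilon> \<le> r"
    and lim: "limit_seq (mball x0 r) \<omega> w G" and a: "a > 0" and \<Phi>: "Phi (2 * \<epsilon>) \<le> ennreal a"
  shows "(\<integral>\<^sup>+z. ennreal (V z * \<bar>w z\<bar> powr p) \<partial>\<nu>) \<le> ennreal (fefferman_const * a powr (p - 1) * 2 powr p) *
     (energy G + ennreal (\<epsilon> powr (- \<gamma> * p)) * mass w)"
    (is "_ \<le> ?C * (?D + ?e * ?W)")
proof (rule ennreal_le_epsilon)
  fix e :: real assume e: "0 < e"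
  note D = limit_seqD[OF lim] and \<omega>D = Lip_0_D[OF limit_seqD(5)[OF lim]]
  have comp2: "mball x0 (2 * r) \<Subset> \<Omega>" by (rule compactly_in_mono[OF mball_subset_concentric comp]) (use \<epsilon> in auto)
  have CEp: "fefferman_const * a powr (p - 1) \<ge> 0" using fefferman_const_pos by simp
  define d where "d j = energy (\<lambda>x. grad (\<omega> j) x - G x)" for j
  define d' where "d' j = mass (\<lambda>x. \<omega> j x - w x)" for j
  have "(\<lambda>j. ?C * (d j + ?e * d' j)) \<longlonglongrightarrow> 0"
    unfolding d_def d'_def by (intro ennreal_tendsto_cmult_0 ennreal_tendsto_add_0 D(7,8)) auto
  then have "\<forall>\<^sub>F j in sequentially. ?C * (d j + ?e * d' j) < ennreal e" using e by (intro order_tendstoD(2)) auto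
  then have ev: "\<forall>\<^sub>F j in sequentially. (\<integral>\<^sup>+z. ennreal (V z * \<bar>\<omega> j z\<bar> powr p) \<partial>\<nu>) \<le> ?C * (?D + ?e * ?W) + ennreal e"
  proof eventually_elim
    case (elim j)
    have "(\<integral>\<^sup>+z. ennreal (V z * \<bar>\<omega> j z\<bar> powr p) \<partial>\<nu>) \<le> ennreal (fefferman_const * a powr (p - 1)) *
       (energy (grad (\<omega> j)) + ?e * mass (\<omega> j))"
      using fefferman_error[OF x0 comp \<epsilon> D(5) V_measurable V_fin[OF comp2] a] \<Phi> unfolding Phi_def by simp
    also have "\<dots> \<le> ennreal (fefferman_const * a powr (p - 1)) * (ennreal (2 powr p) * (?D + d j) + ?e * (ennreal (2 powr p) * (?W + d' j)))"
      unfolding d_def d'_def by (intro mult_left_mono add_mono limit_seq_energy[OF lim]) auto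
    also have "\<dots> = ?C * (?D + ?e * ?W) + ?C * (d j + ?e * d' j)"
    proof -
      have C: "?C = ennreal (fefferman_const * a powr (p - 1)) * ennreal (2 powr p)" using CEp by (intro ennreal_mult) auto
      show ?thesis unfolding C by (simp add: distrib_left distrib_right ac_simps)
    qed
    also have "\<dots> \<le> ?C * (?D + ?e * ?W) + ennreal e" using elim by (intro add_left_mono) auto
    finally show ?case .
  qed
  show "(\<integral>\<^sup>+z. ennreal (V z * \<bar>w z\<bar> powr p) \<partial>\<nu>) \<le> ?C * (?D + ?e * ?W) + ennreal e"
    by (rule fatou_eventually[OF \<omega>D(3) D(1) V_measurable D(6) _ ev]) (use p in auto)
qed

text \<open>
  Makes the limit version of Fefferman's inequality applicable to the error of the approximation.
\<close>

lemma limit_seq_difference: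
  assumes lim: "limit_seq S \<omega> w G"
    and fin: "mass (\<lambda>x. \<omega> j x - w x) < top" "energy (\<lambda>x. grad (\<omega> j) x - G x) < top"
  shows "limit_seq S (\<lambda>i x. \<omega> j x - \<omega> i x) (\<lambda>x. \<omega> j x - w x) (\<lambda>x. grad (\<omega> j) x - G x)"
proof -
  note D = limit_seqD[OF lim] and \<omega>D = Lip_0_D[OF limit_seqD(5)[OF lim]]
  note [measurable] = D(1,2) \<omega>D(3,4) grad_measurable[OF \<omega>D(1)]
  have 1: "mass (\<lambda>x. \<omega> j x - \<omega> i x - (\<omega> j x - w x)) = mass (\<lambda>x. \<omega> i x - w x)" for i
    by (simp add: abs_minus_commute)
  have 2: "energy (\<lambda>x. grad (\<lambda>x. \<omega> j x - \<omega> i x) x - (grad (\<omega> j) x - G x)) = energy (\<lambda>x. grad (\<omega> i) x - G x)" for i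
  proof (rule nn_integral_cong_AE, use AE_grad[OF \<omega>D(1)[of j]] AE_grad[OF \<omega>D(1)[of i]] in eventually_elim)
    case (elim x)
    have "grad (\<lambda>x. \<omega> j x - \<omega> i x) x - (grad (\<omega> j) x - G x) = - (grad (\<omega> i) x - G x)"
      using grad_eq[OF GDERIV_diff[OF elim]] by simp
    then show ?case by (simp only: nq_minus)
  qed
  have ae: "AE x in \<nu>. (\<lambda>i. \<omega> j x - \<omega> i x) \<longlonglongrightarrow> \<omega> j x - w x"
    using D(6) by eventually_elim (intro tendsto_intros)
  have "(\<lambda>x. grad (\<omega> j) x - G x) \<in> borel_measurable \<mu>" "(\<lambda>x. \<omega> j x - w x) \<in> borel_measurable \<nu>" by measurable
  then show ?thesis unfolding limit_seq_def 1 2 using fin D(7,8) ae Lip_0_diff[OF D(5) D(5)] by simp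
qed

lemma fefferman_limit_tendsto:
  assumes x0: "x0 \<in> \<Omega>" and r: "r > 0" and comp: "mball x0 (8 * r) \<Subset> \<Omega>" and lim: "limit_seq (mball x0 r) \<omega> w G"
  shows "(\<lambda>j. \<integral>\<^sup>+z. ennreal (V z * \<bar>\<omega> j z - w z\<bar> powr p) \<partial>\<nu>) \<longlonglongrightarrow> 0"
    "(\<integral>\<^sup>+z. ennreal (V z * \<bar>w z\<bar> powr p) \<partial>\<nu>) < top"
proof -
  note D = limit_seqD[OF lim]
  define \<epsilon> where "\<epsilon> = r / 32"
  have \<epsilon>: "\<epsilon> > 0" "32 * \<epsilon> \<le> r" using r by (auto simp: \<epsilon>_def)
  obtain a0 where a0: "Phi (2 * \<epsilon>) = ennreal a0" "a0 \<ge> 0" using Phi_fin[of "2 * \<epsilon>"] \<epsilon> by (cases "Phi (2 * \<epsilon>)" rule: ennreal_cases) auto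
  define a where "a = a0 + 1"
  have a: "a > 0" "Phi (2 * \<epsilon>) \<le> ennreal a" using a0 by (auto simp: a_def intro: ennreal_leI)
  note fl = fefferman_limit[OF x0 comp \<epsilon> _ a]
  show "(\<integral>\<^sup>+z. ennreal (V z * \<bar>w z\<bar> powr p) \<partial>\<nu>) < top"
    by (rule order.strict_trans1[OF fl[OF lim]]) (use D(3,4) in \<open>simp add: ennreal_mult_less_top ennreal_add_less_top\<close>)
  let ?C = "ennreal (fefferman_const * a powr (p - 1) * 2 powr p)" and ?e = "ennreal (\<epsilon> powr (- \<gamma> * p))"
  define d where "d j = energy (\<lambda>x. grad (\<omega> j) x - G x)" for j
  define d' where "d' j = mass (\<lambda>x. \<omega> j x - w x)" for j
  have lim0: "(\<lambda>j. ?C * (d j + ?e * d' j)) \<longlonglongrightarrow> 0"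
    unfolding d_def d'_def by (intro ennreal_tendsto_cmult_0 ennreal_tendsto_add_0 D(7,8)) auto
  have "\<forall>\<^sub>F j in sequentially. d j < 1" "\<forall>\<^sub>F j in sequentially. d' j < 1"
    unfolding d_def d'_def by (intro order_tendstoD(2)[OF D(8)] order_tendstoD(2)[OF D(7)]; simp)+
  then have ev: "\<forall>\<^sub>F j in sequentially. (\<integral>\<^sup>+z. ennreal (V z * \<bar>\<omega> j z - w z\<bar> powr p) \<partial>\<nu>) \<le> ?C * (d j + ?e * d' j)"
  proof eventually_elim
    case (elim j)
    have "d' j < top" "d j < top" using elim by (auto intro: order.strict_trans)
    then show ?case unfolding d_def d'_def by (intro fl[OF limit_seq_difference[OF lim]])
  qed
  show "(\<lambda>j. \<integral>\<^sup>+z. ennreal (V z * \<bar>\<omega> j z - w z\<bar> powr p) \<partial>\<nu>) \<longlonglongrightarrow> 0"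
    by (rule tendsto_sandwich[OF _ ev tendsto_const lim0]) simp
qed

text \<open>
  The integrand of the weak formulation, as a linear functional of the test gradient.
\<close>

definition flux :: "(real^'n \<Rightarrow> real^'n) \<Rightarrow> real^'n \<Rightarrow> real" where
  "flux \<xi> x = nq x (g x) powr (p - 2) * (\<xi> x \<bullet> (Q x *v g x))"

lemma flux_bound: "x \<in> \<Omega> \<Longrightarrow> \<bar>flux \<xi> x\<bar> \<le> nq x (\<xi> x) * nq x (g x) powr (p - 1)"
proof -
  assume x: "x \<in> \<Omega>"
  have "\<bar>flux \<xi> x\<bar> \<le> nq x (g x) powr (p - 2) * (nq x (\<xi> x) * nq x (g x))"
    unfolding flux_def abs_mult using nq_inner[OF x] by (simp add: mult_left_mono)
  also have "\<dots> = nq x (\<xi> x) * (nq x (g x) * nq x (g x) powr (p - 2))" by simp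
  also have "nq x (g x) * nq x (g x) powr (p - 2) = nq x (g x) powr (p - 1)"
    by (cases "nq x (g x) = 0") (auto simp: powr_mult_base)
  finally show ?thesis .
qed

lemma flux_self: "x \<in> \<Omega> \<Longrightarrow> flux (\<lambda>x. c x *\<^sub>R g x) x = c x * nq x (g x) powr p"
proof -
  assume x: "x \<in> \<Omega>"
  have "flux (\<lambda>x. c x *\<^sub>R g x) x = c x * (nq x (g x) powr (p - 2) * (nq x (g x))\<^sup>2)"
    unfolding flux_def using nq_self[OF x] by simp
  also have "nq x (g x) powr (p - 2) * (nq x (g x))\<^sup>2 = nq x (g x) powr p"
  proof (cases "nq x (g x) = 0")
    case False
    then have "nq x (g x) > 0" using nq_nonneg[of x "g x"] by linarith
    then have "(nq x (g x))\<^sup>2 = nq x (g x) powr 2" by simp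
    then show ?thesis using powr_add[of "nq x (g x)" "p - 2" 2] by simp
  qed simp
  finally show ?thesis .
qed

lemma flux_add: "flux (\<lambda>x. a x + b x) x = flux a x + flux b x"
  by (simp add: flux_def inner_add_left distrib_left)

lemma flux_diff: "flux (\<lambda>x. a x - b x) x = flux a x - flux b x"
  by (simp add: flux_def inner_diff_left right_diff_distrib)

lemma source_abs: "\<bar>\<bar>f x\<bar> powr (p - 2) * f x * t\<bar> = V x * \<bar>t\<bar>"
proof (cases "f x = 0")
  case True
  then show ?thesis using p by (simp add: V_def)
next
  case False
  then show ?thesis using powr_mult_base[of "\<bar>f x\<bar>" "p - 2"] by (simp add: V_def abs_mult mult.commute)
qed

lemma solution_data: "g \<in> borel_measurable \<mu>" "energy g < top"
  "u \<in> borel_measurable \<nu>" "mass u < top"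
  using QW_approximation sol unfolding weak_solution_def by blast+

lemma flux_measurable: "\<xi> \<in> borel_measurable \<mu> \<Longrightarrow> flux \<xi> \<in> borel_measurable \<mu>"
proof -
  assume [measurable]: "\<xi> \<in> borel_measurable \<mu>"
  note [measurable] = solution_data(1) nq_measurable[OF solution_data(1)] Qmult_measurable[OF solution_data(1)]
  show ?thesis unfolding flux_def[abs_def] by measurable
qed

text \<open>
  The weak formulation is tested with the approximating functions. The errors tend to
  \<open>0\<close>: for the flux by Young's inequality and convergence of the gradients, for the
  source by Fefferman's inequality applied to the error together with the local integrability of
  \<open>V\<close>.
\<close>

lemma weak_limit:
  assumes x0: "x0 \<in> \<Omega>" and r: "r > 0" and comp: "mball x0 (8 * r) \<Subset> \<Omega>" and lim: "limit_seq (mball x0 r) \<omega> w G"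
  shows "integrable \<mu> (flux G)" "integrable \<nu> (\<lambda>x. \<bar>f x\<bar> powr (p - 2) * f x * w x)"
    "(LINT x|\<mu>. flux G x) + (LINT x|\<nu>. \<bar>f x\<bar> powr (p - 2) * f x * w x) = 0"
    "(\<integral>\<^sup>+z. ennreal (V z * \<bar>w z\<bar>) \<partial>\<nu>) < top"
proof -
  note D = limit_seqD[OF lim] and \<omega>D = Lip_0_D[OF limit_seqD(5)[OF lim]]
  note fl = fefferman_limit_tendsto[OF x0 r comp lim]
  let ?B = "mball x0 r"
  have compr: "mball x0 r \<Subset> \<Omega>" by (rule compactly_in_mono[OF mball_subset_concentric comp]) (use r in auto)
  have mB\<Omega>: "?B \<subseteq> \<Omega>" by (rule mball_sub)
  note [measurable] = D(1,2) \<omega>D(3) grad_measurable[OF \<omega>D(1)] solution_data(1) nq_measurable[OF solution_data(1)] nq_measurable[OF D(2)] flux_measurable[OF D(2)] f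
    flux_measurable[OF grad_measurable[OF \<omega>D(1)]]
  have split: "n * W powr (p - 1) \<le> n powr p + W powr p" if "n \<ge> 0" "W \<ge> 0" for n W :: real
    using young_split[of n W 1 p] that p by simp
  show i1: "integrable \<mu> (flux G)"
  proof (rule integrableI_bounded)
    have "(\<integral>\<^sup>+x. ennreal (norm (flux G x)) \<partial>\<mu>) \<le> (\<integral>\<^sup>+x. ennreal (nq x (G x) powr p) + ennreal (nq x (g x) powr p) \<partial>\<mu>)"
    proof (rule nn_integral_mono)
      fix x assume "x \<in> space \<mu>"
      then have "norm (flux G x) \<le> nq x (G x) powr p + nq x (g x) powr p"
        using flux_bound[of x G] split[of "nq x (G x)" "nq x (g x)"] by simp
      then show "ennreal (norm (flux G x)) \<le> ennreal (nq x (G x) powr p) + ennreal (nq x (g x) powr p)"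
        by (simp add: ennreal_leI flip: ennreal_plus)
    qed
    also have "\<dots> = energy G + energy g" by (rule nn_integral_add) measurable
    also have "\<dots> < \<infinity>" using D(4) solution_data(2) by (simp add: ennreal_add_less_top)
    finally show "(\<integral>\<^sup>+x. ennreal (norm (flux G x)) \<partial>\<mu>) < \<infinity>" .
  qed measurable
  have w0: "AE x in \<nu>. x \<notin> ?B \<longrightarrow> w x = 0"
    using D(6) AE_space[of \<nu>]
  proof eventually_elim
    case (elim x)
    show ?case
    proof
      assume "x \<notin> ?B"
      then have "\<omega> j x = 0" for j using \<omega>D(5)[of x j] elim(2) by simp
      then have "(\<lambda>j. \<omega> j x) \<longlonglongrightarrow> 0" by simp
      with elim(1) show "w x = 0" by (rule LIMSEQ_unique)
    qed
  qed
  \<comment> \<open>Applied to \<open>w\<close>, for integrability, and to the errors \<open>\<omega> j -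
      w\<close>, with small \<open>s\<close>.\<close>
  have Vb: "(\<integral>\<^sup>+z. ennreal (V z * \<bar>t z\<bar>) \<partial>\<nu>) \<le> ennreal (s powr (1 - p)) * (\<integral>\<^sup>+z. ennreal (V z * \<bar>t z\<bar> powr p) \<partial>\<nu>) + ennreal s * (\<integral>\<^sup>+z\<in>?B. ennreal \<bar>V z\<bar> \<partial>\<nu>)"
    if s: "s > 0" and [measurable]: "t \<in> borel_measurable \<nu>" and t0: "AE x in \<nu>. x \<notin> ?B \<longrightarrow> t x = 0" for s :: real and t
  proof -
    have "(\<integral>\<^sup>+z. ennreal (V z * \<bar>t z\<bar>) \<partial>\<nu>) \<le> (\<integral>\<^sup>+z. ennreal (s powr (1 - p)) * ennreal (V z * \<bar>t z\<bar> powr p) + ennreal s * (ennreal \<bar>V z\<bar> * indicator ?B z) \<partial>\<nu>)"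
    proof (rule nn_integral_mono_AE, use t0 in eventually_elim)
      case (elim z)
      show ?case
      proof (cases "z \<in> ?B")
        case True
        have "V z * \<bar>t z\<bar> \<le> V z * (s powr (1 - p) * \<bar>t z\<bar> powr p + s)"
          using young_split[of "\<bar>t z\<bar>" 1 s p] s p by (intro mult_left_mono) auto
        then have "ennreal (V z * \<bar>t z\<bar>) \<le> ennreal (s powr (1 - p) * (V z * \<bar>t z\<bar> powr p) + s * V z)"
          by (intro ennreal_leI) (simp add: algebra_simps)
        then show ?thesis using True s by (simp add: ennreal_mult ennreal_plus del: in_mball)
      next
        case False
        then show ?thesis using elim by simp
      qed
    qed
    also have "\<dots> = ennreal (s powr (1 - p)) * (\<integral>\<^sup>+z. ennreal (V z * \<bar>t z\<bar> powr p) \<partial>\<nu>) + ennreal s * (\<integral>\<^sup>+z\<in>?B. ennreal \<bar>V z\<bar> \<partial>\<nu>)"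
      by (subst nn_integral_add) (auto simp: nn_integral_cmult)
    finally show ?thesis .
  qed
  show Vw: "(\<integral>\<^sup>+z. ennreal (V z * \<bar>w z\<bar>) \<partial>\<nu>) < top"
    by (rule order.strict_trans1[OF Vb[of 1, OF _ D(1) w0]])
      (use fl(2) V_fin[OF compr] in \<open>simp_all add: ennreal_mult_less_top ennreal_add_less_top\<close>)
  have src: "(\<integral>\<^sup>+z. ennreal (norm (\<bar>f z\<bar> powr (p - 2) * f z * t z)) \<partial>\<nu>) = (\<integral>\<^sup>+z. ennreal (V z * \<bar>t z\<bar>) \<partial>\<nu>)" for t
    by (simp only: real_norm_def source_abs)
  show i2: "integrable \<nu> (\<lambda>x. \<bar>f x\<bar> powr (p - 2) * f x * w x)"
    by (rule integrableI_bounded) (use Vw src[of w] in \<open>auto simp: less_top\<close>)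
  define e1 where "e1 j = (\<integral>\<^sup>+x. ennreal (norm (flux (\<lambda>x. grad (\<omega> j) x - G x) x)) \<partial>\<mu>)" for j
  define e2 where "e2 j = (\<integral>\<^sup>+z. ennreal (V z * \<bar>\<omega> j z - w z\<bar>) \<partial>\<nu>)" for j
  have "e1 \<longlonglongrightarrow> 0"
  proof (rule tendsto_0_by_splitting[OF _ D(8) solution_data(2)])
    fix s :: real and j assume s: "s > 0"
    note [measurable] = nq_measurable[OF borel_measurable_diff[OF grad_measurable[OF \<omega>D(1)[of j]] D(2)]]
    have "e1 j \<le> (\<integral>\<^sup>+x. ennreal (s powr (1 - p)) * ennreal (nq x (grad (\<omega> j) x - G x) powr p) + ennreal s * ennreal (nq x (g x) powr p) \<partial>\<mu>)"
      unfolding e1_def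
    proof (rule nn_integral_mono)
      fix x assume "x \<in> space \<mu>"
      then have "norm (flux (\<lambda>x. grad (\<omega> j) x - G x) x) \<le> s powr (1 - p) * nq x (grad (\<omega> j) x - G x) powr p + s * nq x (g x) powr p"
        using flux_bound[of x "\<lambda>x. grad (\<omega> j) x - G x"] young_split[of "nq x (grad (\<omega> j) x - G x)" "nq x (g x)" s p] s p by simp
      then show "ennreal (norm (flux (\<lambda>x. grad (\<omega> j) x - G x) x)) \<le> ennreal (s powr (1 - p)) * ennreal (nq x (grad (\<omega> j) x - G x) powr p) + ennreal s * ennreal (nq x (g x) powr p)"
        using s by (simp add: ennreal_leI flip: ennreal_plus ennreal_mult)
    qed
    also have "\<dots> = ennreal (s powr (1 - p)) * energy (\<lambda>x. grad (\<omega> j) x - G x) + ennreal s * energy g"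
      by (simp add: nn_integral_add nn_integral_cmult)
    finally show "e1 j \<le> \<dots>" .
  qed
  moreover have "e2 \<longlonglongrightarrow> 0"
  proof (rule tendsto_0_by_splitting[OF _ fl(1) V_fin[OF compr]])
    fix s :: real and j assume s: "s > 0"
    have "AE x in \<nu>. x \<notin> ?B \<longrightarrow> \<omega> j x - w x = 0" using w0 AE_space[of \<nu>] by eventually_elim (use \<omega>D(5) in auto)
    then show "e2 j \<le> ennreal (s powr (1 - p)) * (\<integral>\<^sup>+z. ennreal (V z * \<bar>\<omega> j z - w z\<bar> powr p) \<partial>\<nu>) + ennreal s * (\<integral>\<^sup>+z\<in>?B. ennreal \<bar>V z\<bar> \<partial>\<nu>)"
      unfolding e2_def using s by (intro Vb) auto
  qed
  ultimately have e: "(\<lambda>j. e1 j + e2 j) \<longlonglongrightarrow> 0" by (rule ennreal_tendsto_add_0)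
  let ?S = "(LINT x|\<mu>. flux G x) + (LINT x|\<nu>. \<bar>f x\<bar> powr (p - 2) * f x * w x)"
  have bound: "ennreal \<bar>?S\<bar> \<le> e1 j + e2 j" for j
  proof -
    have "\<omega> j \<in> Lip_0 \<Omega> \<Omega>" using Lip_0_mono[OF mB\<Omega> D(5)] .
    then have t: "integrable \<mu> (flux (grad (\<omega> j)))" "integrable \<nu> (\<lambda>x. \<bar>f x\<bar> powr (p - 2) * f x * \<omega> j x)"
       "(LINT x|\<mu>. flux (grad (\<omega> j)) x) + (LINT x|\<nu>. \<bar>f x\<bar> powr (p - 2) * f x * \<omega> j x) = 0"
      using sol unfolding weak_solution_def flux_def[abs_def] nq_def by auto
    let ?a = "LINT x|\<mu>. flux (\<lambda>x. grad (\<omega> j) x - G x) x" and ?b = "LINT x|\<nu>. \<bar>f x\<bar> powr (p - 2) * f x * (\<omega> j x - w x)"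
    have a: "?a = (LINT x|\<mu>. flux (grad (\<omega> j)) x) - (LINT x|\<mu>. flux G x)"
      unfolding flux_diff by (rule Bochner_Integration.integral_diff[OF t(1) i1])
    have b: "?b = (LINT x|\<nu>. \<bar>f x\<bar> powr (p - 2) * f x * \<omega> j x) - (LINT x|\<nu>. \<bar>f x\<bar> powr (p - 2) * f x * w x)"
      unfolding right_diff_distrib by (rule Bochner_Integration.integral_diff[OF t(2) i2])
    have ia: "integrable \<mu> (\<lambda>x. flux (\<lambda>x. grad (\<omega> j) x - G x) x)" unfolding flux_diff using t(1) i1 by auto
    have ib: "integrable \<nu> (\<lambda>x. \<bar>f x\<bar> powr (p - 2) * f x * (\<omega> j x - w x))" unfolding right_diff_distrib using t(2) i2 by auto
    have "ennreal \<bar>?S\<bar> \<le> ennreal (\<bar>?a\<bar> + \<bar>?b\<bar>)" using t(3) a b by (intro ennreal_leI) linarith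
    also have "\<dots> = ennreal \<bar>?a\<bar> + ennreal \<bar>?b\<bar>" by (simp add: ennreal_plus)
    also have "\<dots> \<le> e1 j + e2 j"
    proof (rule add_mono)
      show "ennreal \<bar>?a\<bar> \<le> e1 j" using integral_norm_bound_ennreal[OF ia] by (simp add: e1_def)
      show "ennreal \<bar>?b\<bar> \<le> e2 j" using integral_norm_bound_ennreal[OF ib] unfolding src e2_def by simp
    qed
    finally show ?thesis .
  qed
  have "ennreal \<bar>?S\<bar> \<le> 0" by (rule LIMSEQ_le_const[OF e]) (use bound in auto)
  then show "?S = 0" by simp
qed

end

section \<open>Powers of the solution\<close>

lemma continuous_antiderivative:
  fixes f :: "real \<Rightarrow> real"
  assumes c: "continuous_on UNIV f"
  shows "\<exists>F. F 0 = 0 \<and> (\<forall>t. (F has_real_derivative f t) (at t))"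
proof -
  define F where "F u = (LBINT y=ereal 0..ereal u. f y)" for u :: real
  have "(F has_real_derivative f t) (at t)" for t
  proof -
    define n where "n = \<bar>t\<bar> + 1"
    have "((\<lambda>u. LBINT y=ereal 0..ereal u. f y) has_vector_derivative f t) (at t within {-n..n})"
      using interval_integral_FTC2[of "-n" 0 n f t] continuous_on_subset[OF c]
      by (auto simp: n_def)
    moreover have "at t within {-n..n} = at t" by (rule at_within_interior) (auto simp: n_def)
    ultimately show ?thesis unfolding F_def
      by (simp add: has_real_derivative_iff_has_vector_derivative)
  qed
  moreover have "F 0 = 0" by (simp add: F_def)
  ultimately show ?thesis by blast
qed

text \<open>
  \<open>F\<close> is the odd primitive of \<open>\<alpha> (\<bar>t\<bar> +
  \<kappa>)\<^sup>\<alpha>\<^sup>-\<^sup>1\<close>, truncated at height \<open>N\<close> so that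
  its derivative is bounded, and \<open>G\<close> is the primitive of \<open>(F')\<^sup>p\<close>.
  Testing with \<open>G(u)\<close> then produces exactly the energy of \<open>F(u)\<close>. The
  bound of \<open>G\<close> in terms of \<open>F\<close> and \<open>F'\<close> holds because
  \<open>F'\<close> increases on the half-line, by Cauchy's mean value theorem; the bound for
  \<open>\<kappa> F'\<close> is what allows division of the source by
  \<open>\<kappa>\<^sup>p\<^sup>-\<^sup>1\<close>.
\<close>

lemma truncated_power:
  fixes \<alpha> \<kappa> N p :: real
  assumes \<alpha>: "\<alpha> \<ge> 1" and \<kappa>: "\<kappa> > 0" and N: "\<kappa> \<le> N" and p: "p > 1"
  defines "Fd \<equiv> \<lambda>t. \<alpha> * min (\<bar>t\<bar> + \<kappa>) N powr (\<alpha> - 1)"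
  obtains F G where "\<And>t. (F has_real_derivative Fd t) (at t)" "F 0 = 0"
    "\<And>t. (G has_real_derivative Fd t powr p) (at t)" "G 0 = 0"
    "continuous_on UNIV Fd" "continuous_on UNIV (\<lambda>t. Fd t powr p)" "\<And>t. 0 < Fd t" "\<And>t. Fd t \<le> \<alpha> * N powr (\<alpha> - 1)"
    "\<And>t. \<bar>G t\<bar> \<le> \<bar>F t\<bar> * Fd t powr (p - 1)"
    "\<And>t. \<kappa> * Fd t \<le> \<alpha> * (\<bar>F t\<bar> + \<kappa> powr \<alpha>)"
    "\<And>t. \<bar>F t\<bar> + \<kappa> powr \<alpha> \<le> (\<bar>t\<bar> + \<kappa>) powr \<alpha>"
    "\<And>t. \<bar>t\<bar> + \<kappa> \<le> N \<Longrightarrow> \<bar>F t\<bar> + \<kappa> powr \<alpha> = (\<bar>t\<bar> + \<kappa>) powr \<alpha>"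
proof -
  have pos: "0 < Fd t" for t unfolding Fd_def using \<alpha> \<kappa> N by (intro mult_pos_pos) auto
  have c: "continuous_on UNIV Fd" unfolding Fd_def
    using \<kappa> N by (intro continuous_intros) (auto simp: min_def)
  have cp: "continuous_on UNIV (\<lambda>t. Fd t powr p)"
    by (intro continuous_on_powr c continuous_intros) (use pos in \<open>auto simp: less_imp_neq[symmetric]\<close>)
  have le: "Fd t \<le> \<alpha> * N powr (\<alpha> - 1)" for t
    unfolding Fd_def using \<alpha> \<kappa> N by (intro mult_left_mono powr_mono2) auto
  have mono: "Fd s \<le> Fd t" if "0 \<le> s" "s \<le> t" for s t
    unfolding Fd_def using \<alpha> \<kappa> N that by (intro mult_left_mono powr_mono2) auto
  have even: "Fd (- t) = Fd t" for t by (simp add: Fd_def)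
  obtain F where F: "F 0 = 0" "\<And>t. (F has_real_derivative Fd t) (at t)" using continuous_antiderivative[OF c] by blast
  obtain G where G: "G 0 = 0" "\<And>t. (G has_real_derivative Fd t powr p) (at t)" using continuous_antiderivative[OF cp] by blast
  have odd: "H (- t) = - H t" if H: "H 0 = 0" "\<And>t. (H has_real_derivative h t) (at t)" and h: "\<And>t. h (- t) = h t" for H h and t :: real
  proof -
    have "((\<lambda>t. H t + H (- t)) has_real_derivative 0) (at t)" for t
      using DERIV_add[OF H(2)[of t] DERIV_mirror[THEN iffD1, OF H(2)[of "- t"]]] h by simp
    then have "H t + H (- t) = H 0 + H (- 0)" by (intro DERIV_isconst_all) auto
    then show ?thesis using H(1) by simp
  qed
  have oddF: "F (- t) = - F t" for t using odd[OF F even] .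
  have oddG: "G (- t) = - G t" for t using odd[OF G] even by simp
  have F0: "F t \<ge> 0" if "t \<ge> 0" for t
    using DERIV_nonneg_imp_nondecreasing[of 0 t F] that F pos by (metis less_imp_le)
  have G0: "G t \<ge> 0" if "t \<ge> 0" for t
    using DERIV_nonneg_imp_nondecreasing[of 0 t G] that G by (metis powr_ge_zero)
  have GF: "G t \<le> F t * Fd t powr (p - 1)" if t: "t \<ge> 0" for t
  proof (cases "t = 0")
    case False
    then have t0: "0 < t" using t by simp
    have "\<exists>x>0. x < t \<and> (F t - F 0) * (Fd x powr p) = (G t - G 0) * Fd x"
      by (rule GMVT'[where f = F and g = G and f' = Fd and g' = "\<lambda>x. Fd x powr p", simplified, OF t0])
        (use F(2) G(2) DERIV_isCont in blast)+
    then obtain x where x: "0 < x" "x < t" "F t * (Fd x powr p) = G t * Fd x" using F(1) G(1) by auto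
    have "G t * Fd x = F t * Fd x powr (p - 1) * Fd x"
      using x(3) pos[of x] powr_mult_base[of "Fd x" "p - 1"] by (simp add: mult.commute mult.left_commute)
    then have "G t = F t * Fd x powr (p - 1)" using pos[of x] by simp
    also have "\<dots> \<le> F t * Fd t powr (p - 1)"
      using mono[of x t] x F0[OF t] pos[of x] p by (intro mult_left_mono powr_mono2) auto
    finally show ?thesis .
  qed (simp add: F(1) G(1))
  define D where "D t = (t + \<kappa>) powr \<alpha> - \<kappa> powr \<alpha> - F t" for t
  have Dd: "(D has_real_derivative (\<alpha> * (t + \<kappa>) powr (\<alpha> - 1) - Fd t)) (at t)" if "t \<ge> 0" for t
    unfolding D_def using that \<kappa> F(2) by (auto intro!: derivative_eq_intros)
  have D0: "D 0 = 0" by (simp add: D_def F(1))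
  have up: "D t \<ge> 0" if t: "t \<ge> 0" for t
  proof -
    have "D 0 \<le> D t"
    proof (rule DERIV_nonneg_imp_nondecreasing[OF t])
      fix x assume x: "0 \<le> x" "x \<le> t"
      have "0 \<le> \<alpha> * (x + \<kappa>) powr (\<alpha> - 1) - Fd x"
        unfolding Fd_def using x \<alpha> \<kappa> N by (simp, intro mult_left_mono powr_mono2) auto
      then show "\<exists>y. (D has_real_derivative y) (at x) \<and> 0 \<le> y" using Dd[OF x(1)] by blast
    qed
    then show ?thesis using D0 by simp
  qed
  have eq: "F t = (t + \<kappa>) powr \<alpha> - \<kappa> powr \<alpha>" if t: "t \<ge> 0" "t + \<kappa> \<le> N" for t
  proof -
    have "D t \<le> D 0"
    proof (rule DERIV_nonpos_imp_nonincreasing[OF t(1)])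
      fix x assume x: "0 \<le> x" "x \<le> t"
      have "\<alpha> * (x + \<kappa>) powr (\<alpha> - 1) - Fd x \<le> 0" unfolding Fd_def using x t by simp
      then show "\<exists>y. (D has_real_derivative y) (at x) \<and> y \<le> 0" using Dd[OF x(1)] by blast
    qed
    then show ?thesis using up[OF t(1)] D0 by (simp add: D_def)
  qed
  have k: "\<kappa> * Fd t \<le> \<alpha> * (F t + \<kappa> powr \<alpha>)" if t: "t \<ge> 0" for t
  proof -
    define z where "z = min (t + \<kappa>) N"
    have z: "\<kappa> \<le> z" "z > 0" "z - \<kappa> \<le> t" using t N \<kappa> by (auto simp: z_def)
    have "\<kappa> * z powr (\<alpha> - 1) \<le> z * z powr (\<alpha> - 1)" using z by (intro mult_right_mono) auto
    also have "\<dots> = z powr \<alpha>" using z by (simp add: powr_mult_base)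
    also have "\<dots> = F (z - \<kappa>) + \<kappa> powr \<alpha>" using eq[of "z - \<kappa>"] z by (simp add: z_def)
    also have "F (z - \<kappa>) \<le> F t"
      by (rule DERIV_nonneg_imp_nondecreasing[OF z(3)]) (use F(2) pos less_imp_le in blast)
    finally have "\<alpha> * (\<kappa> * z powr (\<alpha> - 1)) \<le> \<alpha> * (F t + \<kappa> powr \<alpha>)" using \<alpha> by (intro mult_left_mono) auto
    then show ?thesis using t by (simp add: Fd_def z_def mult.left_commute)
  qed
  have absF: "\<bar>F t\<bar> = F \<bar>t\<bar>" for t using F0[of t] F0[of "- t"] oddF[of t] by (cases "t \<ge> 0") auto
  have absG: "\<bar>G t\<bar> = G \<bar>t\<bar>" for t using G0[of t] G0[of "- t"] oddG[of t] by (cases "t \<ge> 0") auto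
  have absFd: "Fd \<bar>t\<bar> = Fd t" for t by (simp add: Fd_def)
  show ?thesis
  proof (rule that[OF F(2,1) G(2,1) c cp pos le])
    show "\<bar>G t\<bar> \<le> \<bar>F t\<bar> * Fd t powr (p - 1)" for t using GF[of "\<bar>t\<bar>"] by (simp add: absF absG absFd)
    show "\<kappa> * Fd t \<le> \<alpha> * (\<bar>F t\<bar> + \<kappa> powr \<alpha>)" for t using k[of "\<bar>t\<bar>"] by (simp add: absF absFd)
    show "\<bar>F t\<bar> + \<kappa> powr \<alpha> \<le> (\<bar>t\<bar> + \<kappa>) powr \<alpha>" for t using up[of "\<bar>t\<bar>"] by (simp add: absF D_def)
    show "\<bar>t\<bar> + \<kappa> \<le> N \<Longrightarrow> \<bar>F t\<bar> + \<kappa> powr \<alpha> = (\<bar>t\<bar> + \<kappa>) powr \<alpha>" for t using eq[of "\<bar>t\<bar>"] by (simp add: absF)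
  qed
qed

text \<open>
  The positive part makes the power continuously differentiable on the whole line, so that powers
  of cutoff functions are Lipschitz.
\<close>

lemma DERIV_positive_part_powr:
  fixes p :: real assumes p: "p > 1"
  shows "((\<lambda>t. max t 0 powr p) has_real_derivative p * max t 0 powr (p - 1)) (at t)"
proof -
  consider "t > 0" | "t < 0" | "t = 0" by linarith
  then show ?thesis
  proof cases
    case 1
    have "((\<lambda>t. t powr p) has_real_derivative p * max t 0 powr (p - 1)) (at t)"
      using has_real_derivative_powr[OF 1, of p] 1 by simp
    then show ?thesis
      by (rule has_field_derivative_transform_within_open[where S = "{0<..}"]) (use 1 in auto)
  next
    case 2
    have "((\<lambda>t::real. 0) has_real_derivative p * max t 0 powr (p - 1)) (at t)" using 2 by simp
    then show ?thesis
      by (rule has_field_derivative_transform_within_open[where S = "{..<0}"]) (use 2 in auto)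
  next
    case 3
    have "((\<lambda>h. (max h 0 powr p - max 0 0 powr p) / h) \<longlongrightarrow> 0) (at 0)"
    proof (rule Lim_null_comparison)
      have "\<bar>max h 0 powr p / h\<bar> \<le> \<bar>h\<bar> powr (p - 1)" if "h \<noteq> 0" for h :: real
      proof (cases "h > 0")
        case True
        then have "h powr p = h * h powr (p - 1)" by (simp add: powr_mult_base)
        then show ?thesis using True by simp
      qed simp
      then show "\<forall>\<^sub>F h in at 0. norm ((max h 0 powr p - max 0 0 powr p) / h) \<le> \<bar>h\<bar> powr (p - 1)"
        by (auto simp: eventually_at_filter)
      have "((\<lambda>h::real. \<bar>h\<bar> powr (p - 1)) \<longlongrightarrow> \<bar>0\<bar> powr (p - 1)) (at 0)"
        using p by (intro tendsto_powr' tendsto_rabs tendsto_ident_at tendsto_const) auto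
      then show "((\<lambda>h::real. \<bar>h\<bar> powr (p - 1)) \<longlongrightarrow> 0) (at 0)" by simp
    qed
    then show ?thesis using 3 by (simp add: has_field_derivative_iff)
  qed
qed

lemma enn_powr_add_le:
  assumes "0 < b" "b \<le> 1" shows "enn_powr (x + y) b \<le> 2 * (enn_powr x b + enn_powr y b)"
proof -
  have "x + y \<le> 2 * max x y" unfolding mult_2 by (intro add_mono) auto
  then have "enn_powr (x + y) b \<le> enn_powr (2 * max x y) b" using assms by (intro enn_powr_mono)
  also have "\<dots> = enn_powr 2 b * enn_powr (max x y) b" using assms by (intro enn_powr_mult)
  also have "\<dots> \<le> 2 * (enn_powr x b + enn_powr y b)"
  proof (rule mult_mono)
    have "2 powr b \<le> 2 powr 1" using assms by (intro powr_mono) auto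
    then have "ennreal (2 powr b) \<le> ennreal 2" by (intro ennreal_leI) simp
    then show "enn_powr 2 b \<le> 2" using enn_powr_ennreal[of 2 b] by simp
    show "enn_powr (max x y) b \<le> enn_powr x b + enn_powr y b" by (auto simp: max_def)
  qed auto
  finally show ?thesis .
qed

text \<open>
  The algebra of the absorption, with the energy \<open>X\<close> on both sides. All constants
  multiplying \<open>X\<close> on the right add up to at most \<open>3/4\<close>.
\<close>

lemma absorb_energy:
  fixes X M :: ennreal
  assumes fin: "X < top" and A: "A \<ge> 0" and b: "b \<ge> 0" and q: "q \<ge> 0" and cc: "cc \<ge> 0" and e: "e > 0" and P: "P \<ge> 1"
    and small: "b * q * (P * P * P) \<le> 1 / 4"
    and X: "X \<le> ennreal A * (ennreal cc * M) + ennreal (1 / 2) * X +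
         ennreal (b * P) * (ennreal (q * P) * (ennreal P * (ennreal cc * M + X) + ennreal e * M) + ennreal q * (ennreal cc * M + ennreal e * M))"
  shows "X \<le> ennreal (2 * ((2 * A + 1) * cc + e)) * M"
proof (cases M rule: ennreal_cases)
  case (real m)
  obtain x where x: "X = ennreal x" "x \<ge> 0" using fin by (cases X rule: ennreal_cases) auto
  define s where "s = b * q"
  have s: "s \<ge> 0" "s * (P * P * P) \<le> 1 / 4" using b q small by (auto simp: s_def)
  have nn: "0 \<le> A * (cc * m)" "0 \<le> 1 / 2 * x" "0 \<le> cc * m" "0 \<le> cc * m + x" "0 \<le> e * m" "0 \<le> P * (cc * m + x)" "0 \<le> P * (cc * m + x) + e * m"
     "0 \<le> cc * m + e * m" "0 \<le> q * P" "0 \<le> b * P" "0 \<le> q * P * (P * (cc * m + x) + e * m)" "0 \<le> q * (cc * m + e * m)"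
    using A cc real x e P q b by auto
  have "ennreal A * (ennreal cc * ennreal m) + ennreal (1 / 2) * ennreal x +
         ennreal (b * P) * (ennreal (q * P) * (ennreal P * (ennreal cc * ennreal m + ennreal x) + ennreal e * ennreal m) + ennreal q * (ennreal cc * ennreal m + ennreal e * ennreal m))
     = ennreal (A * (cc * m) + 1 / 2 * x + b * P * (q * P * (P * (cc * m + x) + e * m) + q * (cc * m + e * m)))" (is "_ = ennreal ?r")
    using nn A cc real x e P q b
    by (simp only: ennreal_mult[symmetric] ennreal_plus[symmetric] add_nonneg_nonneg mult_nonneg_nonneg less_imp_le)
  then have "ennreal x \<le> ennreal ?r" using X x real by simp
  moreover have "0 \<le> ?r" using nn P q real x A b cc e by (intro add_nonneg_nonneg mult_nonneg_nonneg) auto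
  ultimately have "x \<le> ?r" by (simp only: ennreal_le_iff)
  also have "?r = A * (cc * m) + 1 / 2 * x + (s * (P * P * P) * (cc * m + x) + s * (P * P) * (e * m) + s * P * (cc * m + e * m))"
    by (simp add: s_def algebra_simps)
  also have "\<dots> \<le> A * (cc * m) + 1 / 2 * x + (1 / 4 * (cc * m + x) + 1 / 4 * (e * m) + 1 / 4 * (cc * m + e * m))"
  proof (intro add_mono mult_right_mono s(2) order_refl)
    have PP: "P * P \<ge> 1" using P mult_mono[of 1 P 1 P] by simp
    have "s * (P * P) * 1 \<le> s * (P * P) * P" using s P PP by (intro mult_left_mono) auto
    then show "s * (P * P) \<le> 1 / 4" using s by (simp add: mult.assoc)
    have "s * P * 1 \<le> s * P * (P * P)" using s P PP by (intro mult_left_mono) auto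
    then show "s * P \<le> 1 / 4" using s by (simp add: mult.assoc)
  qed (use nn in auto)
  finally have "x \<le> 4 * (A * (cc * m)) + 2 * (cc * m) + 2 * (e * m)" by argo
  then have "x \<le> 2 * ((2 * A + 1) * cc + e) * m" by (simp add: algebra_simps)
  then have "ennreal x \<le> ennreal (2 * ((2 * A + 1) * cc + e) * m)" by (rule ennreal_leI)
  also have "\<dots> = ennreal (2 * ((2 * A + 1) * cc + e)) * ennreal m"
    using real cc e A by (intro ennreal_mult) auto
  finally show ?thesis using x real by simp
next
  case top
  have "2 * ((2 * A + 1) * cc + e) > 0" using A cc e by (intro mult_pos_pos add_nonneg_pos) auto
  then show ?thesis using top by (simp add: ennreal_mult_top)
qed

text \<open>
  Adds the Sobolev bounds for \<open>\<eta> F(u)\<close> and for \<open>\<eta>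
  \<kappa>\<^sup>\<alpha>\<close> and collects the constants. Here \<open>P = 2\<^sup>p\<close>
  and \<open>s\<close> is the p-th power of the Sobolev constant times the radius.
\<close>

lemma combine_sobolev_bounds:
  fixes M m :: ennreal
  assumes c: "c \<ge> 0" and Cv: "Cv \<ge> 0" and e: "e \<ge> 0" and z: "z \<ge> 1" and P: "P \<ge> 1" and s: "s \<ge> 0"
  shows "ennreal P * (2 * (ennreal (s * P) * ((ennreal P * (ennreal (c * Cv) * M + ennreal (2 * (z * (c * Cv) + e)) * M)) / m)
        + ennreal s * ((ennreal (c * Cv) * M) / m))) \<le> ennreal (P * 2 * (s * (P * P) * (2 * Cv + 2 * z * Cv + 2)) * (c + e)) * (M / m)"
proof -
  let ?x = "c * Cv" and ?y = "2 * (z * (c * Cv) + e)"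
  have xy: "?x \<ge> 0" "?y \<ge> 0" "P \<ge> 0" "s * P \<ge> 0" using c Cv e z P s by auto
  have i: "ennreal ?x * M + ennreal ?y * M = ennreal (?x + ?y) * M" using xy by (simp add: distrib_right)
  have ii: "ennreal t * (ennreal q * M / m) = ennreal (t * q) * (M / m)" if "t \<ge> 0" "q \<ge> 0" for t q
    using that by (simp add: ennreal_mult divide_ennreal_def mult.assoc)
  have iii: "ennreal t * (ennreal q * M) = ennreal (t * q) * M" if "t \<ge> 0" "q \<ge> 0" for t q
    using that by (simp add: ennreal_mult mult.assoc)
  have iv: "ennreal P * (2 * (ennreal q * (M / m) + ennreal t * (M / m))) = ennreal (P * 2 * (q + t)) * (M / m)" if "t \<ge> 0" "q \<ge> 0" for t q
  proof -
    have "ennreal q * (M / m) + ennreal t * (M / m) = ennreal (q + t) * (M / m)" using that by (simp add: distrib_right)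
    moreover have "ennreal (P * 2 * (q + t)) = ennreal P * (2 * ennreal (q + t))"
      using xy that by (simp add: ennreal_mult mult.assoc)
    ultimately show ?thesis by (simp add: mult.assoc)
  qed
  have "ennreal P * (2 * (ennreal (s * P) * ((ennreal P * (ennreal ?x * M + ennreal ?y * M)) / m) + ennreal s * ((ennreal ?x * M) / m)))
     = ennreal (P * 2 * (s * P * (P * (?x + ?y)) + s * ?x)) * (M / m)"
    unfolding i iii[OF xy(3) add_nonneg_nonneg[OF xy(1,2)]] ii[OF xy(4) mult_nonneg_nonneg[OF xy(3) add_nonneg_nonneg[OF xy(1,2)]]] ii[OF s xy(1)]
    by (rule iv) (use xy s in \<open>auto intro!: mult_nonneg_nonneg add_nonneg_nonneg\<close>)
  also have "\<dots> \<le> ennreal (P * 2 * (s * (P * P) * (2 * Cv + 2 * z * Cv + 2)) * (c + e)) * (M / m)"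
  proof (intro mult_right_mono ennreal_leI)
    have PP: "P * P \<ge> 1" using P mult_mono[of 1 P 1 P] by simp
    have "1 * ?x \<le> (P * P) * ?x" using PP xy by (intro mult_right_mono) auto
    then have "P * P * (?x + ?y) + ?x \<le> P * P * (2 * ?x + ?y)" by (simp add: algebra_simps)
    also have "\<dots> \<le> P * P * ((2 * Cv + 2 * z * Cv + 2) * (c + e))"
    proof (rule mult_left_mono)
      have "(2 * Cv + 2 * z * Cv + 2) * (c + e) - (2 * ?x + ?y) = 2 * Cv * e + 2 * z * Cv * e + 2 * c" by (simp add: algebra_simps)
      moreover have "0 \<le> 2 * Cv * e + 2 * z * Cv * e + 2 * c" using Cv e c z by (intro add_nonneg_nonneg mult_nonneg_nonneg) auto
      ultimately show "2 * ?x + ?y \<le> (2 * Cv + 2 * z * Cv + 2) * (c + e)" by linarith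
    qed simp
    finally have "P * 2 * s * (P * P * (?x + ?y) + ?x) \<le> P * 2 * s * (P * P * ((2 * Cv + 2 * z * Cv + 2) * (c + e)))"
      by (rule mult_left_mono) (use P s in auto)
    then show "P * 2 * (s * P * (P * (?x + ?y)) + s * ?x) \<le> P * 2 * (s * (P * P) * (2 * Cv + 2 * z * Cv + 2)) * (c + e)"
      by (simp add: algebra_simps)
  qed simp
  finally show ?thesis .
qed

context setting_solution
begin

text \<open>
  Truncated powers of the solution are limits of Lipschitz functions with the expected gradients.
\<close>

lemma compose_limit:
  assumes F: "\<And>t. (F has_real_derivative Fd t) (at t)" "continuous_on UNIV Fd" "\<And>t. \<bar>Fd t\<bar> \<le> L" "F 0 = 0"
    and \<eta>: "\<eta> \<in> Lip_0 \<Omega> S" "S \<subseteq> \<Omega>" "\<And>x. x \<in> \<Omega> \<Longrightarrow> 0 \<le> \<eta> x" "\<And>x. x \<in> \<Omega> \<Longrightarrow> \<eta> x \<le> 1"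
    and \<eta>g: "AE x in \<mu>. nq x (grad \<eta> x) powr p \<le> c * degen_weight p Q x" and c: "c \<ge> 0"
  shows "\<exists>\<omega>. limit_seq S \<omega> (\<lambda>x. \<eta> x * F (u x)) (\<lambda>x. F (u x) *\<^sub>R grad \<eta> x + (\<eta> x * Fd (u x)) *\<^sub>R g x)"
proof -
  have "(u, g) \<in> QW \<Omega> \<mu> \<nu> Q p" using sol unfolding weak_solution_def by blast
  from QW_approximation(5)[OF this] obtain \<omega> where \<omega>: "\<And>j. \<omega> j \<in> Lip_loc \<Omega>" "AE x in \<nu>. (\<lambda>j. \<omega> j x) \<longlonglongrightarrow> u x"
     "(\<lambda>j. mass (\<lambda>x. \<omega> j x - u x)) \<longlonglongrightarrow> 0"
     "(\<lambda>j. energy (\<lambda>x. grad (\<omega> j) x - g x)) \<longlonglongrightarrow> 0" by auto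
  show ?thesis
    by (rule exI, rule limit_seq_compose[OF solution_data(3,1,4,2) \<omega> F \<eta> \<eta>g c])
qed

text \<open>
  The weight \<open>\<eta>\<^sup>p\<close> in the test function has a gradient controlled by that
  of \<open>\<eta>\<close>. The maximum with \<open>0\<close> only concerns points outside the
  domain.
\<close>

lemma power_cutoff:
  assumes \<eta>: "\<eta> \<in> Lip_0 \<Omega> S" "S \<subseteq> \<Omega>" "\<And>x. x \<in> \<Omega> \<Longrightarrow> 0 \<le> \<eta> x" "\<And>x. x \<in> \<Omega> \<Longrightarrow> \<eta> x \<le> 1"
    and \<eta>g: "AE x in \<mu>. nq x (grad \<eta> x) powr p \<le> c * degen_weight p Q x"
  defines "\<zeta> \<equiv> \<lambda>x. max (\<eta> x) 0 powr p"
  shows "\<zeta> \<in> Lip_0 \<Omega> S" "\<And>x. x \<in> \<Omega> \<Longrightarrow> \<zeta> x = \<eta> x powr p" "\<And>x. 0 \<le> \<zeta> x" "\<And>x. x \<in> \<Omega> \<Longrightarrow> \<zeta> x \<le> 1"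
    "AE x in \<mu>. grad \<zeta> x = (p * \<eta> x powr (p - 1)) *\<^sub>R grad \<eta> x"
    "AE x in \<mu>. nq x (grad \<zeta> x) powr p \<le> (p powr p * c) * degen_weight p Q x"
proof -
  note D = Lip_0_D[OF \<eta>(1)]
  let ?P = "\<lambda>t::real. max t 0 powr p"
  show eq: "\<zeta> x = \<eta> x powr p" if "x \<in> \<Omega>" for x using \<eta>(3)[OF that] by (simp add: \<zeta>_def)
  show "0 \<le> \<zeta> x" for x by (simp add: \<zeta>_def)
  show "\<zeta> x \<le> 1" if "x \<in> \<Omega>" for x
    using powr_mono2[of p "\<eta> x" 1] \<eta>(3,4)[OF that] p by (simp add: eq[OF that])
  have lip: "p-lipschitz_on {0..1} ?P"
  proof (rule lipschitz_onI)
    fix s t :: real assume st: "s \<in> {0..1}" "t \<in> {0..1}"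
    have "norm (?P s - ?P t) \<le> p * norm (s - t)"
    proof (rule field_differentiable_bound[of "{0..1}"])
      fix z :: real assume z: "z \<in> {0..1}"
      show "(?P has_real_derivative p * max z 0 powr (p - 1)) (at z within {0..1})"
        using DERIV_positive_part_powr[OF p] by (rule has_field_derivative_at_within)
      have "z powr (p - 1) \<le> 1 powr (p - 1)" using z p by (intro powr_mono2) auto
      then show "norm (p * max z 0 powr (p - 1)) \<le> p" using z p by (simp add: abs_mult)
    qed (use st in auto)
    then show "dist (?P s) (?P t) \<le> p * dist s t" by (simp add: dist_real_def)
  qed (use p in simp)
  have ll: "\<zeta> \<in> Lip_loc \<Omega>" unfolding \<zeta>_def by (rule Lip_loc_compose[OF D(1) lip]) (use \<eta> in auto)
  have sup: "support_in \<Omega> \<zeta> \<subseteq> support_in \<Omega> \<eta>" by (rule support_in_mono) (auto simp: \<zeta>_def)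
  have c: "compact (support_in \<Omega> \<eta>)" "support_in \<Omega> \<eta> \<subseteq> S" using \<eta> by (auto simp: Lip_0_def)
  show "\<zeta> \<in> Lip_0 \<Omega> S"
  proof (rule Lip_0_I[OF ll domain(1) _ _ \<eta>(2)])
    show "compact (support_in \<Omega> \<zeta>)"
      using compact_Int_closed[OF c(1), of "support_in \<Omega> \<zeta>"] sup by (simp add: support_in_def Int_absorb1)
    show "support_in \<Omega> \<zeta> \<subseteq> S" using sup c(2) by (rule order.trans)
  qed
  show gr: "AE x in \<mu>. grad \<zeta> x = (p * \<eta> x powr (p - 1)) *\<^sub>R grad \<eta> x"
    using AE_grad[OF D(1)] AE_space[of \<mu>]
  proof eventually_elim
    case (elim x)
    have "GDERIV \<zeta> x :> (p * max (\<eta> x) 0 powr (p - 1)) *\<^sub>R grad \<eta> x"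
      unfolding \<zeta>_def by (rule GDERIV_DERIV_compose[OF elim(1) DERIV_positive_part_powr[OF p]])
    then show ?case using \<eta>(3)[of x] elim(2) by (simp add: grad_eq)
  qed
  show "AE x in \<mu>. nq x (grad \<zeta> x) powr p \<le> (p powr p * c) * degen_weight p Q x"
    using gr \<eta>g AE_space[of \<mu>]
  proof eventually_elim
    case (elim x)
    have "\<eta> x powr (p - 1) \<le> 1 powr (p - 1)" using \<eta>(3,4)[of x] elim(3) p by (intro powr_mono2) auto
    then have "nq x (grad \<zeta> x) \<le> p * nq x (grad \<eta> x)"
      unfolding elim(1) nq_scale using p by (intro mult_right_mono) (auto simp: abs_mult)
    then have "nq x (grad \<zeta> x) powr p \<le> (p * nq x (grad \<eta> x)) powr p" using p by (intro powr_mono2) auto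
    also have "\<dots> = p powr p * nq x (grad \<eta> x) powr p" using p by (intro powr_mult)
    also have "\<dots> \<le> p powr p * (c * degen_weight p Q x)" using elim(2) by (intro mult_left_mono) auto
    finally show ?case by simp
  qed
qed

end

section \<open>One step of Moser's iteration\<close>

context setting_solution
begin

text \<open>
  Let \<open>F\<close>, \<open>G\<close> be the truncated powers and test the equation with
  \<open>\<eta>\<^sup>p G(u)\<close>. The principal term is the energy \<open>X = \<integral>
  (\<eta> F'(u) \<bar>\<surd>Q g\<bar>)\<^sup>p d\<mu>\<close>; the term with the gradient of the
  cutoff is absorbed by Young's inequality up to the integral of \<open>\<bar>F(u)\<bar>\<^sup>p
  \<bar>\<surd>Q \<nabla>\<eta>\<bar>\<^sup>p\<close>. The source is at most \<open>V
  \<eta>\<^sup>p \<bar>F(u)\<bar> F'(u)\<^sup>p\<^sup>-\<^sup>1\<close>, and since \<open>\<kappa>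
  F' \<le> \<alpha> (\<bar>F\<bar> + \<kappa>\<^sup>\<alpha>)\<close>, it is at most a multiple of
  \<open>(\<alpha>/\<kappa>)\<^sup>p\<^sup>-\<^sup>1 V (\<eta> (\<bar>F(u)\<bar> +
  \<kappa>\<^sup>\<alpha>))\<^sup>p\<close>, to which Fefferman's inequality applies at scale
  \<open>\<epsilon>\<close>. The smallness assumption says that the energy produced in this way is
  absorbed. The Sobolev inequality for \<open>\<eta> F(u)\<close> and for \<open>\<eta>
  \<kappa>\<^sup>\<alpha>\<close> then raises the exponent, and the truncation is removed by
  Fatou's lemma.
\<close>

lemma moser_step:
  assumes x0: "x0 \<in> \<Omega>" and r: "r > 0" and comp: "mball x0 (8 * r) \<Subset> \<Omega>" and pos: "emeasure \<mu> (mball x0 r) > 0"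
    and \<eta>: "\<eta> \<in> Lip_0 \<Omega> (mball x0 r)" "\<And>x. x \<in> \<Omega> \<Longrightarrow> 0 \<le> \<eta> x" "\<And>x. x \<in> \<Omega> \<Longrightarrow> \<eta> x \<le> 1"
    and \<eta>g: "AE x in \<mu>. nq x (grad \<eta> x) powr p \<le> c * degen_weight p Q x" and c: "c \<ge> 0"
    and \<alpha>: "\<alpha> \<ge> 1" and \<kappa>: "\<kappa> > 0" and \<epsilon>: "\<epsilon> > 0" "32 * \<epsilon> \<le> r" and a: "a > 0" and \<Phi>: "Phi (2 * \<epsilon>) \<le> ennreal a"
    and small: "fefferman_const * (\<alpha> * a / \<kappa>) powr (p - 1) * (2 powr p * 4 powr p) \<le> 1 / 4"
    and E: "E \<in> sets \<nu>" "\<And>x. x \<in> E \<Longrightarrow> \<eta> x = 1"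
    and e_def: "e = \<epsilon> powr (- \<gamma> * p)"
  shows "enn_powr ((\<integral>\<^sup>+x\<in>E. ennreal ((\<bar>u x\<bar> + \<kappa>) powr (\<alpha> * (k * p))) \<partial>\<nu>) / emeasure \<nu> (mball x0 r)) (1 / k) \<le>
    ennreal (2 powr p * 2 * (C1 powr p * 4 powr p * (2 * Cv + 2 * (2 powr p * p powr p + 1) * Cv + 2)) * ((c + e) * r powr p)) *
      ((\<integral>\<^sup>+x\<in>support_in \<Omega> \<eta>. ennreal ((\<bar>u x\<bar> + \<kappa>) powr (\<alpha> * p)) \<partial>\<nu>) / emeasure \<mu> (mball x0 r))"
proof -
  let ?B = "mball x0 r" and ?D = "support_in \<Omega> \<eta>"
  have compr: "?B \<Subset> \<Omega>" by (rule compactly_in_mono[OF mball_subset_concentric comp]) (use r in auto)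
  have B\<Omega>: "?B \<subseteq> \<Omega>" by (rule mball_sub)
  note \<eta>D = Lip_0_D[OF \<eta>(1)]
  define K1 where "K1 = \<kappa> powr \<alpha>"
  have K1: "K1 > 0" using \<kappa> by (simp add: K1_def)
  have Dsub: "?D \<subseteq> \<Omega>" using \<eta>(1) B\<Omega> by (auto simp: Lip_0_def)
  have Dm[measurable]: "?D \<in> sets \<nu>" "?D \<in> sets \<mu>"
    using borel_subset_sets[of ?D] Dsub by (auto simp: support_in_def)
  note [measurable] = solution_data(1,3) measurable_nu_mu[OF solution_data(3)] \<eta>D(3,4) grad_measurable[OF \<eta>D(1)] nq_grad_measurable[OF \<eta>D(1)] nq_measurable[OF solution_data(1)] E(1)
  have offD: "\<eta> x = 0" "grad \<eta> x = 0" if "x \<in> \<Omega>" "x \<notin> ?D" for x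
  proof -
    show "grad \<eta> x = 0" using grad_zero_outside[OF \<eta>(1) that] .
    show "\<eta> x = 0"
    proof (rule ccontr)
      assume "\<eta> x \<noteq> 0"
      then have "x \<in> {x \<in> \<Omega>. \<eta> x \<noteq> 0}" using that by auto
      then have "x \<in> ?D" unfolding support_in_def by (rule subsetD[OF closure_subset])
      then show False using that by auto
    qed
  qed
  define M where "M = (\<integral>\<^sup>+x\<in>?D. ennreal ((\<bar>u x\<bar> + \<kappa>) powr (\<alpha> * p)) \<partial>\<nu>)"
  define n where "n = emeasure \<nu> ?B"
  define m' where "m' = emeasure \<mu> ?B"
  have n: "n \<noteq> 0" "n \<noteq> top" using nu_ball_pos[OF x0 r] by (auto simp: n_def nu.emeasure_eq_measure)
  define Cm where "Cm = C1 powr p * 4 powr p * (2 * Cv + 2 * (2 powr p * p powr p + 1) * Cv + 2)"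
  have Cm: "Cm \<ge> 0" using Cv by (simp add: Cm_def)
  have e: "e \<ge> 0" by (simp add: e_def)
  \<comment> \<open>The estimate for the truncated powers, uniformly in the truncation.\<close>
  have main: "enn_powr ((\<integral>\<^sup>+x\<in>E. ennreal ((\<bar>F (u x)\<bar> + K1) powr (k * p)) \<partial>\<nu>) / n) (1 / k) \<le> ennreal (2 powr p * 2 * Cm * ((c + e) * r powr p)) * (M / m')"
    if FG: "\<And>t. (F has_real_derivative Fd t) (at t)" "F 0 = 0"
    "\<And>t. (G has_real_derivative Fd t powr p) (at t)" "G 0 = 0"
    "continuous_on UNIV Fd" "continuous_on UNIV (\<lambda>t. Fd t powr p)" "\<And>t. 0 < Fd t" "\<And>t. Fd t \<le> L"
    "\<And>t. \<bar>G t\<bar> \<le> \<bar>F t\<bar> * Fd t powr (p - 1)"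
    "\<And>t. \<kappa> * Fd t \<le> \<alpha> * (\<bar>F t\<bar> + \<kappa> powr \<alpha>)"
    "\<And>t. \<bar>F t\<bar> + \<kappa> powr \<alpha> \<le> (\<bar>t\<bar> + \<kappa>) powr \<alpha>"
    for F G Fd :: "real \<Rightarrow> real" and L
  proof -
    have L0: "L \<ge> 0" using FG(7)[of 0] FG(8)[of 0] by simp
    have cF: "continuous_on UNIV F" "continuous_on UNIV G"
      by (rule continuous_at_imp_continuous_on, rule ballI, rule DERIV_isCont, rule FG(1))
        (rule continuous_at_imp_continuous_on, rule ballI, rule DERIV_isCont, rule FG(3))
    note [measurable] = borel_measurable_continuous_onI[OF cF(1)] borel_measurable_continuous_onI[OF cF(2)] borel_measurable_continuous_onI[OF FG(5)]
    define \<zeta> where "\<zeta> = (\<lambda>x. max (\<eta> x) 0 powr p)"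
    have \<zeta>: "\<zeta> \<in> Lip_0 \<Omega> ?B" "\<And>x. x \<in> \<Omega> \<Longrightarrow> \<zeta> x = \<eta> x powr p" "\<And>x. 0 \<le> \<zeta> x"
      "\<And>x. x \<in> \<Omega> \<Longrightarrow> \<zeta> x \<le> 1" "AE x in \<mu>. grad \<zeta> x = (p * \<eta> x powr (p - 1)) *\<^sub>R grad \<eta> x"
      "AE x in \<mu>. nq x (grad \<zeta> x) powr p \<le> (p powr p * c) * degen_weight p Q x"
      unfolding \<zeta>_def
      by (rule power_cutoff[where S = ?B and c = c]; (rule \<eta>(1) B\<Omega> \<eta>g | (rule \<eta>(2,3); assumption) | assumption))+
    have [measurable]: "\<zeta> \<in> borel_measurable \<mu>" "\<zeta> \<in> borel_measurable \<nu>" using Lip_0_D(3,4)[OF \<zeta>(1)] by auto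
    note [measurable] = grad_measurable[OF Lip_0_D(1)[OF \<zeta>(1)]]
    have Fdb: "\<bar>Fd t\<bar> \<le> L" "\<bar>Fd t powr p\<bar> \<le> L powr p" for t
      using FG(7)[of t] FG(8)[of t] p by (auto intro!: powr_mono2)
    obtain \<omega> where \<omega>: "limit_seq ?B \<omega> (\<lambda>x. \<eta> x * F (u x)) (\<lambda>x. F (u x) *\<^sub>R grad \<eta> x + (\<eta> x * Fd (u x)) *\<^sub>R g x)"
    proof -
      have "\<exists>\<omega>. limit_seq ?B \<omega> (\<lambda>x. \<eta> x * F (u x)) (\<lambda>x. F (u x) *\<^sub>R grad \<eta> x + (\<eta> x * Fd (u x)) *\<^sub>R g x)"
        by (rule compose_limit[where c = c and L = L]) (use FG Fdb(1) \<eta> B\<Omega> \<eta>g c in simp_all)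
      then show ?thesis using that by (elim exE)
    qed
    obtain \<omega>' where \<omega>': "limit_seq ?B \<omega>' (\<lambda>x. \<zeta> x * G (u x)) (\<lambda>x. G (u x) *\<^sub>R grad \<zeta> x + (\<zeta> x * Fd (u x) powr p) *\<^sub>R g x)"
    proof -
      have "\<exists>\<omega>. limit_seq ?B \<omega> (\<lambda>x. \<zeta> x * G (u x)) (\<lambda>x. G (u x) *\<^sub>R grad \<zeta> x + (\<zeta> x * Fd (u x) powr p) *\<^sub>R g x)"
        by (rule compose_limit[where c = "p powr p * c" and L = "L powr p"]) (use FG Fdb(2) \<zeta>(1,3,4,6) B\<Omega> c in simp_all)
      then show ?thesis using that by (elim exE)
    qed
    let ?GG = "\<lambda>x. G (u x) *\<^sub>R grad \<zeta> x + (\<zeta> x * Fd (u x) powr p) *\<^sub>R g x"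
    note wl = weak_limit[OF x0 r comp \<omega>']
    \<comment> \<open>The energy to be estimated, the cutoff term and the source term.\<close>
    define X where "X = (\<integral>\<^sup>+x. ennreal ((\<eta> x * Fd (u x) * nq x (g x)) powr p) \<partial>\<mu>)"
    define I1 where "I1 = (\<integral>\<^sup>+x. ennreal (\<bar>F (u x)\<bar> powr p * nq x (grad \<eta> x) powr p) \<partial>\<mu>)"
    define VG where "VG = (\<integral>\<^sup>+x. ennreal (V x * \<bar>\<zeta> x * G (u x)\<bar>) \<partial>\<nu>)"
    have FM: "(\<integral>\<^sup>+x. ennreal ((indicator ?D x * (\<bar>F (u x)\<bar> + K1)) powr p) \<partial>\<nu>) \<le> M"
      unfolding M_def
    proof (rule nn_integral_mono)
      fix x
      have "(\<bar>F (u x)\<bar> + K1) powr p \<le> ((\<bar>u x\<bar> + \<kappa>) powr \<alpha>) powr p"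
        using FG(11)[of "u x"] K1 p by (intro powr_mono2) (auto simp: K1_def)
      then show "ennreal ((indicator ?D x * (\<bar>F (u x)\<bar> + K1)) powr p) \<le> ennreal ((\<bar>u x\<bar> + \<kappa>) powr (\<alpha> * p)) * indicator ?D x"
        by (cases "x \<in> ?D") (auto simp: powr_powr intro: ennreal_leI)
    qed
    have wM: "mass w \<le> M" if "\<And>x. x \<in> \<Omega> \<Longrightarrow> \<bar>w x\<bar> \<le> indicator ?D x * (\<bar>F (u x)\<bar> + K1)" for w :: "real^'n \<Rightarrow> real"
      by (rule order.trans[OF _ FM]) (use that p in \<open>auto intro!: nn_integral_mono ennreal_leI powr_mono2\<close>)
    have gw: "(\<integral>\<^sup>+x. ennreal (\<bar>w x\<bar> powr p * nq x (grad \<eta> x) powr p) \<partial>\<mu>) \<le> ennreal (c * Cv) * M"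
      if w: "\<And>x. x \<in> \<Omega> \<Longrightarrow> \<bar>w x\<bar> \<le> \<bar>F (u x)\<bar> + K1" and wm: "w \<in> borel_measurable \<nu>" for w :: "real^'n \<Rightarrow> real"
    proof -
      note [measurable] = wm
      have "(\<integral>\<^sup>+x. ennreal (\<bar>w x\<bar> powr p * nq x (grad \<eta> x) powr p) \<partial>\<mu>) = (\<integral>\<^sup>+x. ennreal (\<bar>indicator ?D x * w x\<bar> powr p * nq x (grad \<eta> x) powr p) \<partial>\<mu>)"
        by (intro nn_integral_cong) (use offD(2) p in \<open>auto simp: indicator_def\<close>)
      also have "\<dots> \<le> ennreal (c * Cv) * mass (\<lambda>x. indicator ?D x * w x)"
        by (rule weighted_bound[OF _ \<eta>g c]) measurable
      also have "\<dots> \<le> ennreal (c * Cv) * M" by (intro mult_left_mono wM) (use w in \<open>auto simp: indicator_def abs_mult\<close>)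
      finally show ?thesis .
    qed
    have I1M: "I1 \<le> ennreal (c * Cv) * M" unfolding I1_def by (rule gw) (use K1 in auto)
    have nqm: "(\<lambda>x. nq x (grad \<zeta> x)) \<in> borel_measurable \<mu>" by (rule nq_measurable) measurable
    note [measurable] = nqm
    \<comment> \<open>Here the boundedness of \<open>F'\<close> is used; without it the energy could not be
        absorbed.\<close>
    have Xfin: "X < top"
    proof -
      have "X \<le> (\<integral>\<^sup>+x. ennreal (L powr p) * ennreal (nq x (g x) powr p) \<partial>\<mu>)" unfolding X_def
      proof (rule nn_integral_mono)
        fix x assume "x \<in> space \<mu>"
        then have x: "x \<in> \<Omega>" by simp
        have "\<eta> x * Fd (u x) * nq x (g x) \<le> 1 * L * nq x (g x)"
          using \<eta>(2,3)[OF x] FG(8)[of "u x"] FG(7)[of "u x"] L0 by (intro mult_right_mono mult_mono) auto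
        then have "(\<eta> x * Fd (u x) * nq x (g x)) powr p \<le> (L * nq x (g x)) powr p"
          using \<eta>(2)[OF x] FG(7)[of "u x"] p by (intro powr_mono2) (auto intro!: mult_nonneg_nonneg)
        then show "ennreal ((\<eta> x * Fd (u x) * nq x (g x)) powr p) \<le> ennreal (L powr p) * ennreal (nq x (g x) powr p)"
          using L0 by (simp add: powr_mult ennreal_leI flip: ennreal_mult)
      qed
      also have "\<dots> = ennreal (L powr p) * energy g" by (rule nn_integral_cmult) measurable
      also have "\<dots> < top" using solution_data(2) by (simp add: ennreal_mult_less_top)
      finally show ?thesis .
    qed
    have X1: "X \<le> ennreal (2 powr (p - 1) * p powr p) * I1 + ennreal (1 / 2) * X + VG"
    proof -
      define h1 where "h1 x = \<zeta> x * Fd (u x) powr p * nq x (g x) powr p" for x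
      define h2 where "h2 = flux (\<lambda>x. G (u x) *\<^sub>R grad \<zeta> x)"
      have hX: "h1 x = (\<eta> x * Fd (u x) * nq x (g x)) powr p" if "x \<in> \<Omega>" for x
        using \<eta>(2)[OF that] FG(7)[of "u x"] by (simp add: h1_def \<zeta>(2)[OF that] powr_mult less_imp_le)
      have h1X: "(\<integral>\<^sup>+x. ennreal (h1 x) \<partial>\<mu>) = X" unfolding X_def by (intro nn_integral_cong) (simp add: hX)
      have h10: "0 \<le> h1 x" for x using \<zeta>(3) by (simp add: h1_def)
      have [measurable]: "h1 \<in> borel_measurable \<mu>" unfolding h1_def[abs_def] by measurable
      have h1i: "integrable \<mu> h1" by (rule integrableI_nonneg) (use h10 h1X Xfin in auto)
      have fl: "flux ?GG x = h2 x + h1 x" if "x \<in> \<Omega>" for x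
        unfolding flux_add h2_def using flux_self[OF that, of "\<lambda>x. \<zeta> x * Fd (u x) powr p"] by (simp add: h1_def)
      have h2i: "integrable \<mu> h2"
      proof -
        have "integrable \<mu> (\<lambda>x. flux ?GG x - h1 x)" using wl(1) h1i by (intro Bochner_Integration.integrable_diff) auto
        then show ?thesis by (rule Bochner_Integration.integrable_cong[THEN iffD1, rotated 2]) (auto simp: fl)
      qed
      have "(LINT x|\<mu>. flux ?GG x) = (LINT x|\<mu>. h2 x + h1 x)" by (intro Bochner_Integration.integral_cong) (auto simp: fl)
      then have s: "(LINT x|\<mu>. h1 x) = - (LINT x|\<mu>. h2 x) - (LINT x|\<nu>. \<bar>f x\<bar> powr (p - 2) * f x * (\<zeta> x * G (u x)))"
        using wl(3) h1i h2i by simp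
      have "X = ennreal (LINT x|\<mu>. h1 x)" unfolding h1X[symmetric] using h1i h10 by (intro nn_integral_eq_integral) auto
      also have "\<dots> \<le> ennreal (\<bar>LINT x|\<mu>. h2 x\<bar> + \<bar>LINT x|\<nu>. \<bar>f x\<bar> powr (p - 2) * f x * (\<zeta> x * G (u x))\<bar>)"
        unfolding s by (intro ennreal_leI) linarith
      also have "\<dots> = ennreal \<bar>LINT x|\<mu>. h2 x\<bar> + ennreal \<bar>LINT x|\<nu>. \<bar>f x\<bar> powr (p - 2) * f x * (\<zeta> x * G (u x))\<bar>" by (simp add: ennreal_plus)
      also have "\<dots> \<le> (\<integral>\<^sup>+x. ennreal \<bar>h2 x\<bar> \<partial>\<mu>) + VG"
        using integral_norm_bound_ennreal[OF h2i] integral_norm_bound_ennreal[OF wl(2)]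
        unfolding VG_def real_norm_def source_abs by (rule add_mono)
      also have "(\<integral>\<^sup>+x. ennreal \<bar>h2 x\<bar> \<partial>\<mu>) \<le> (\<integral>\<^sup>+x. ennreal (2 powr (p - 1) * p powr p) * ennreal (\<bar>F (u x)\<bar> powr p * nq x (grad \<eta> x) powr p) + ennreal (1 / 2) * ennreal ((\<eta> x * Fd (u x) * nq x (g x)) powr p) \<partial>\<mu>)"
      proof (rule nn_integral_mono_AE, use \<zeta>(5) AE_space[of \<mu>] in eventually_elim)
        case (elim x)
        then have x: "x \<in> \<Omega>" by simp
        have "\<bar>h2 x\<bar> \<le> nq x (G (u x) *\<^sub>R grad \<zeta> x) * nq x (g x) powr (p - 1)" unfolding h2_def by (rule flux_bound[OF x])
        also have "\<dots> = \<bar>G (u x)\<bar> * (p * \<eta> x powr (p - 1) * nq x (grad \<eta> x)) * nq x (g x) powr (p - 1)"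
          unfolding nq_scale elim(1) using p by (simp add: abs_mult)
        also have "\<dots> \<le> (\<bar>F (u x)\<bar> * Fd (u x) powr (p - 1)) * (p * \<eta> x powr (p - 1) * nq x (grad \<eta> x)) * nq x (g x) powr (p - 1)"
          using FG(9)[of "u x"] p by (intro mult_right_mono) auto
        also have "\<dots> = (p * \<bar>F (u x)\<bar> * nq x (grad \<eta> x)) * (\<eta> x * Fd (u x) * nq x (g x)) powr (p - 1)"
          using \<eta>(2)[OF x] FG(7)[of "u x"] by (simp add: powr_mult less_imp_le)
        also have "\<dots> \<le> (1 / 2) powr (1 - p) * (p * \<bar>F (u x)\<bar> * nq x (grad \<eta> x)) powr p + 1 / 2 * (\<eta> x * Fd (u x) * nq x (g x)) powr p"
          using \<eta>(2)[OF x] FG(7)[of "u x"] p by (intro young_split) (auto simp: less_imp_le)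
        also have "(1 / 2) powr (1 - p) = 2 powr (p - 1)" using powr_minus_divide[of 2 "1 - p"] by (simp add: powr_divide)
        also have "(p * \<bar>F (u x)\<bar> * nq x (grad \<eta> x)) powr p = p powr p * (\<bar>F (u x)\<bar> powr p * nq x (grad \<eta> x) powr p)"
          using p by (simp add: powr_mult)
        finally have "\<bar>h2 x\<bar> \<le> 2 powr (p - 1) * p powr p * (\<bar>F (u x)\<bar> powr p * nq x (grad \<eta> x) powr p) + 1 / 2 * (\<eta> x * Fd (u x) * nq x (g x)) powr p" by (simp only: mult.assoc)
        then have "ennreal \<bar>h2 x\<bar> \<le> ennreal (2 powr (p - 1) * p powr p * (\<bar>F (u x)\<bar> powr p * nq x (grad \<eta> x) powr p) + 1 / 2 * (\<eta> x * Fd (u x) * nq x (g x)) powr p)"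
          by (rule ennreal_leI)
        also have "\<dots> = ennreal (2 powr (p - 1) * p powr p) * ennreal (\<bar>F (u x)\<bar> powr p * nq x (grad \<eta> x) powr p) + ennreal (1 / 2) * ennreal ((\<eta> x * Fd (u x) * nq x (g x)) powr p)"
          by (subst ennreal_plus) (auto simp only: ennreal_mult powr_ge_zero mult_nonneg_nonneg nq_nonneg zero_le_divide_1_iff zero_le_numeral)
        finally show ?case .
      qed
      also have "\<dots> = ennreal (2 powr (p - 1) * p powr p) * I1 + ennreal (1 / 2) * X"
        unfolding I1_def X_def by (subst nn_integral_add) (auto simp: nn_integral_cmult)
      finally show ?thesis by (simp add: add_right_mono)
    qed
    define EF where "EF = energy (\<lambda>x. F (u x) *\<^sub>R grad \<eta> x + (\<eta> x * Fd (u x)) *\<^sub>R g x)"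
    have EFb: "EF \<le> ennreal (2 powr p) * (ennreal (c * Cv) * M + X)"
    proof -
      have "EF \<le> (\<integral>\<^sup>+x. ennreal (2 powr p) * (ennreal (\<bar>F (u x)\<bar> powr p * nq x (grad \<eta> x) powr p) + ennreal ((\<eta> x * Fd (u x) * nq x (g x)) powr p)) \<partial>\<mu>)"
        unfolding EF_def
      proof (rule nn_integral_mono)
        fix x assume "x \<in> space \<mu>"
        then have x: "x \<in> \<Omega>" by simp
        have "nq x (F (u x) *\<^sub>R grad \<eta> x + (\<eta> x * Fd (u x)) *\<^sub>R g x) \<le> \<bar>F (u x)\<bar> * nq x (grad \<eta> x) + \<eta> x * Fd (u x) * nq x (g x)"
          using nq_add[of x "F (u x) *\<^sub>R grad \<eta> x" "(\<eta> x * Fd (u x)) *\<^sub>R g x"] \<eta>(2)[OF x] FG(7)[of "u x"] by (simp add: nq_scale abs_mult)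
        then have "nq x (F (u x) *\<^sub>R grad \<eta> x + (\<eta> x * Fd (u x)) *\<^sub>R g x) powr p \<le> (\<bar>F (u x)\<bar> * nq x (grad \<eta> x) + \<eta> x * Fd (u x) * nq x (g x)) powr p"
          using p by (intro powr_mono2) auto
        also have "\<dots> \<le> 2 powr p * ((\<bar>F (u x)\<bar> * nq x (grad \<eta> x)) powr p + (\<eta> x * Fd (u x) * nq x (g x)) powr p)"
          using p \<eta>(2)[OF x] FG(7)[of "u x"] by (intro powr_add_le) (auto simp: less_imp_le)
        finally show "ennreal (nq x (F (u x) *\<^sub>R grad \<eta> x + (\<eta> x * Fd (u x)) *\<^sub>R g x) powr p) \<le>
           ennreal (2 powr p) * (ennreal (\<bar>F (u x)\<bar> powr p * nq x (grad \<eta> x) powr p) + ennreal ((\<eta> x * Fd (u x) * nq x (g x)) powr p))"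
          by (simp add: ennreal_leI powr_mult[of "\<bar>F (u x)\<bar>" "nq x (grad \<eta> x)"] flip: ennreal_mult ennreal_plus)
      qed
      also have "\<dots> = ennreal (2 powr p) * (I1 + X)" unfolding I1_def X_def by (simp add: nn_integral_cmult nn_integral_add)
      also have "\<dots> \<le> ennreal (2 powr p) * (ennreal (c * Cv) * M + X)" by (intro mult_left_mono add_right_mono I1M) auto
      finally show ?thesis .
    qed
    have etaF: "\<bar>\<eta> x * F (u x)\<bar> \<le> indicator ?D x * (\<bar>F (u x)\<bar> + K1)" "\<bar>\<eta> x * K1\<bar> \<le> indicator ?D x * (\<bar>F (u x)\<bar> + K1)" if x: "x \<in> \<Omega>" for x
    proof -
      have "\<bar>\<eta> x\<bar> * \<bar>F (u x)\<bar> \<le> 1 * \<bar>F (u x)\<bar>" "\<bar>\<eta> x\<bar> * \<bar>K1\<bar> \<le> 1 * \<bar>K1\<bar>" using \<eta>(2,3)[OF x] by (intro mult_right_mono; simp)+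
      then have b: "\<bar>\<eta> x * F (u x)\<bar> \<le> \<bar>F (u x)\<bar> + K1" "\<bar>\<eta> x * K1\<bar> \<le> \<bar>F (u x)\<bar> + K1"
        unfolding abs_mult using K1 by linarith+
      show "\<bar>\<eta> x * F (u x)\<bar> \<le> indicator ?D x * (\<bar>F (u x)\<bar> + K1)"
        by (cases "x \<in> ?D") (use b(1) offD(1)[OF x] in auto)
      show "\<bar>\<eta> x * K1\<bar> \<le> indicator ?D x * (\<bar>F (u x)\<bar> + K1)"
        by (cases "x \<in> ?D") (use b(2) offD(1)[OF x] in auto)
    qed
    \<comment> \<open>The constant \<open>\<kappa>\<^sup>\<alpha>\<close> has to be included separately, because
        \<open>F(0) = 0\<close>.\<close>
    define w1 where "w1 = (\<lambda>x. \<eta> x * K1)"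
    have w1: "w1 \<in> Lip_0 \<Omega> ?B" unfolding w1_def
      by (rule Lip_0_mult_left[OF \<eta>(1) lipschitz_on_imp_Lip_loc[of 0] domain(1) B\<Omega>]) (auto simp: lipschitz_on_def)
    have gw1: "energy (grad w1) \<le> ennreal (c * Cv) * M"
    proof -
      have "energy (grad w1) = (\<integral>\<^sup>+x. ennreal (\<bar>K1\<bar> powr p * nq x (grad \<eta> x) powr p) \<partial>\<mu>)"
      proof (rule nn_integral_cong_AE, use AE_grad[OF \<eta>D(1)] in eventually_elim)
        case (elim x)
        have "grad w1 x = K1 *\<^sub>R grad \<eta> x" unfolding w1_def
          using GDERIV_mult[OF elim GDERIV_const[of K1 x]] by (intro grad_eq) simp
        then show ?case by (simp add: nq_scale powr_mult)
      qed
      also have "\<dots> \<le> ennreal (c * Cv) * M" by (rule gw) (use K1 in auto)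
      finally show ?thesis .
    qed
    have VGb: "VG \<le> ennreal ((\<alpha> / \<kappa>) powr (p - 1) * 2 powr p) * ((\<integral>\<^sup>+x. ennreal (V x * \<bar>\<eta> x * F (u x)\<bar> powr p) \<partial>\<nu>) + (\<integral>\<^sup>+x. ennreal (\<bar>V x\<bar> * \<bar>w1 x\<bar> powr p) \<partial>\<nu>))"
    proof -
      have [measurable]: "w1 \<in> borel_measurable \<nu>" unfolding w1_def by measurable
      have "VG \<le> (\<integral>\<^sup>+x. ennreal ((\<alpha> / \<kappa>) powr (p - 1) * 2 powr p) * (ennreal (V x * \<bar>\<eta> x * F (u x)\<bar> powr p) + ennreal (\<bar>V x\<bar> * \<bar>w1 x\<bar> powr p)) \<partial>\<nu>)"
        unfolding VG_def
      proof (rule nn_integral_mono)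
        fix x assume "x \<in> space \<nu>"
        then have x: "x \<in> \<Omega>" by simp
        let ?S = "\<bar>F (u x)\<bar> + K1"
        have S0: "?S > 0" using K1 by (simp add: add_nonneg_pos)
        have "Fd (u x) \<le> \<alpha> / \<kappa> * ?S" using FG(10)[of "u x"] \<kappa> by (simp add: K1_def field_simps)
        then have "Fd (u x) powr (p - 1) \<le> (\<alpha> / \<kappa> * ?S) powr (p - 1)" using FG(7)[of "u x"] p by (intro powr_mono2) auto
        also have "\<dots> = (\<alpha> / \<kappa>) powr (p - 1) * ?S powr (p - 1)" using \<alpha> \<kappa> S0 by (intro powr_mult)
        finally have "\<bar>G (u x)\<bar> \<le> ?S * ((\<alpha> / \<kappa>) powr (p - 1) * ?S powr (p - 1))"
          using FG(9)[of "u x"] K1 by (elim order.trans) (intro mult_mono, auto)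
        also have "\<dots> = (\<alpha> / \<kappa>) powr (p - 1) * ?S powr p" using S0 powr_mult_base[of ?S "p - 1"] by simp
        also have "\<dots> \<le> (\<alpha> / \<kappa>) powr (p - 1) * (2 powr p * (\<bar>F (u x)\<bar> powr p + K1 powr p))"
          using K1 p by (intro mult_left_mono powr_add_le) auto
        finally have "\<eta> x powr p * \<bar>G (u x)\<bar> \<le> \<eta> x powr p * ((\<alpha> / \<kappa>) powr (p - 1) * (2 powr p * (\<bar>F (u x)\<bar> powr p + K1 powr p)))"
          by (intro mult_left_mono) auto
        also have "\<dots> = (\<alpha> / \<kappa>) powr (p - 1) * 2 powr p * (\<bar>\<eta> x * F (u x)\<bar> powr p + \<bar>w1 x\<bar> powr p)"
          using \<eta>(2)[OF x] K1 by (simp add: w1_def abs_mult powr_mult algebra_simps)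
        finally have "\<bar>\<zeta> x * G (u x)\<bar> \<le> (\<alpha> / \<kappa>) powr (p - 1) * 2 powr p * (\<bar>\<eta> x * F (u x)\<bar> powr p + \<bar>w1 x\<bar> powr p)"
          using \<zeta>(2)[OF x] \<zeta>(3)[of x] by (simp add: abs_mult)
        then have "V x * \<bar>\<zeta> x * G (u x)\<bar> \<le> V x * ((\<alpha> / \<kappa>) powr (p - 1) * 2 powr p * (\<bar>\<eta> x * F (u x)\<bar> powr p + \<bar>w1 x\<bar> powr p))"
          by (intro mult_left_mono) auto
        then have "ennreal (V x * \<bar>\<zeta> x * G (u x)\<bar>) \<le> ennreal ((\<alpha> / \<kappa>) powr (p - 1) * 2 powr p * (V x * \<bar>\<eta> x * F (u x)\<bar> powr p + V x * \<bar>w1 x\<bar> powr p))"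
          by (intro ennreal_leI) (simp add: algebra_simps)
        then show "ennreal (V x * \<bar>\<zeta> x * G (u x)\<bar>) \<le> ennreal ((\<alpha> / \<kappa>) powr (p - 1) * 2 powr p) * (ennreal (V x * \<bar>\<eta> x * F (u x)\<bar> powr p) + ennreal (\<bar>V x\<bar> * \<bar>w1 x\<bar> powr p))"
          by (simp flip: ennreal_mult ennreal_plus)
      qed
      also have "\<dots> = ennreal ((\<alpha> / \<kappa>) powr (p - 1) * 2 powr p) * ((\<integral>\<^sup>+x. ennreal (V x * \<bar>\<eta> x * F (u x)\<bar> powr p) \<partial>\<nu>) + (\<integral>\<^sup>+x. ennreal (\<bar>V x\<bar> * \<bar>w1 x\<bar> powr p) \<partial>\<nu>))"
        by (simp add: nn_integral_cmult nn_integral_add)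
      finally show ?thesis .
    qed
    have CEa: "fefferman_const * a powr (p - 1) \<ge> 0" using fefferman_const_pos by simp
    have V1: "(\<integral>\<^sup>+x. ennreal (V x * \<bar>\<eta> x * F (u x)\<bar> powr p) \<partial>\<nu>) \<le> ennreal (fefferman_const * a powr (p - 1) * 2 powr p) * (ennreal (2 powr p) * (ennreal (c * Cv) * M + X) + ennreal e * M)"
      by (rule order.trans[OF fefferman_limit[OF x0 comp \<epsilon> \<omega> a \<Phi>]])
        (use EFb etaF(1) in \<open>auto simp: EF_def e_def intro!: mult_left_mono add_mono wM\<close>)
    have comp2: "mball x0 (2 * r) \<Subset> \<Omega>" by (rule compactly_in_mono[OF mball_subset_concentric comp]) (use r in auto)
    have V2: "(\<integral>\<^sup>+x. ennreal (\<bar>V x\<bar> * \<bar>w1 x\<bar> powr p) \<partial>\<nu>) \<le> ennreal (fefferman_const * a powr (p - 1)) * (ennreal (c * Cv) * M + ennreal e * M)"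
    proof -
      have f1: "(\<integral>\<^sup>+x. ennreal (\<bar>V x\<bar> * \<bar>w1 x\<bar> powr p) \<partial>\<nu>) \<le> ennreal (fefferman_const * a powr (p - 1)) *
         (energy (grad w1) + ennreal (\<epsilon> powr (- \<gamma> * p)) * mass w1)"
        by (rule fefferman_error[OF x0 comp \<epsilon> w1 V_measurable _ a \<Phi>[unfolded Phi_def]])
          (use V_fin[OF comp2] in simp)
      have "mass w1 \<le> M" unfolding w1_def by (rule wM) (rule etaF(2))
      then show ?thesis unfolding e_def by (intro order.trans[OF f1] mult_left_mono add_mono gw1) simp_all
    qed
    have Xb: "X \<le> ennreal (2 * ((2 powr p * p powr p + 1) * (c * Cv) + e)) * M"
    proof -
      define b where "b = (\<alpha> / \<kappa>) powr (p - 1)"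
      define q where "q = fefferman_const * a powr (p - 1)"
      have bq: "b * q = fefferman_const * (\<alpha> * a / \<kappa>) powr (p - 1)"
        using \<alpha> \<kappa> a powr_mult[of "\<alpha> / \<kappa>" a "p - 1"] by (simp add: b_def q_def)
      have p4: "(4::real) powr p = 2 powr p * 2 powr p" using powr_mult[of 2 2 p] by simp
      have "X \<le> ennreal (2 * ((2 * (2 powr (p - 1) * p powr p) + 1) * (c * Cv) + e)) * M"
      proof (rule absorb_energy[OF Xfin, where b = b and q = q and P = "2 powr p"])
        show "b * q * (2 powr p * 2 powr p * 2 powr p) \<le> 1 / 4" unfolding bq using small p4 by (simp add: mult.assoc)
        show "X \<le> ennreal (2 powr (p - 1) * p powr p) * (ennreal (c * Cv) * M) + ennreal (1 / 2) * X +
          ennreal (b * 2 powr p) * (ennreal (q * 2 powr p) * (ennreal (2 powr p) * (ennreal (c * Cv) * M + X) + ennreal e * M)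
            + ennreal q * (ennreal (c * Cv) * M + ennreal e * M))"
        proof (rule order.trans[OF X1], rule add_mono, rule add_right_mono)
          show "ennreal (2 powr (p - 1) * p powr p) * I1 \<le> ennreal (2 powr (p - 1) * p powr p) * (ennreal (c * Cv) * M)"
            by (rule mult_left_mono[OF I1M]) simp
          show "VG \<le> ennreal (b * 2 powr p) * (ennreal (q * 2 powr p) * (ennreal (2 powr p) * (ennreal (c * Cv) * M + X) + ennreal e * M)
              + ennreal q * (ennreal (c * Cv) * M + ennreal e * M))"
            unfolding b_def q_def by (rule order.trans[OF VGb], rule mult_left_mono[OF add_mono[OF V1 V2]]) simp
        qed
      qed (use p c Cv \<epsilon> fefferman_const_pos in \<open>auto simp: e_def b_def q_def ge_one_powr_ge_zero\<close>)
      moreover have "2 * (2 powr (p - 1) * p powr p) = 2 powr p * p powr p"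
        using powr_mult_base[of 2 "p - 1"] by simp
      ultimately show ?thesis by simp
    qed
    define Y1 where "Y1 = (\<integral>\<^sup>+z. ennreal (\<bar>\<eta> z * F (u z)\<bar> powr (k * p)) \<partial>\<nu>)"
    define Y2 where "Y2 = (\<integral>\<^sup>+z. ennreal (\<bar>w1 z\<bar> powr (k * p)) \<partial>\<nu>)"
    have s1: "enn_powr (Y1 / n) (1 / k) \<le> ennreal ((C1 * r) powr p * 2 powr p) * ((ennreal (2 powr p) * (ennreal (c * Cv) * M + X)) / m')"
      unfolding Y1_def n_def m'_def
      by (rule order.trans[OF sobolev_limit[OF x0 r compr \<omega> pos]]) (intro mult_left_mono divide_right_mono_ennreal EFb[unfolded EF_def]; simp)
    have s2: "enn_powr (Y2 / n) (1 / k) \<le> ennreal ((C1 * r) powr p) * ((ennreal (c * Cv) * M) / m')"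
      unfolding Y2_def n_def m'_def
      by (rule order.trans[OF sobolev_Lip0[OF x0 r compr w1]]) (intro mult_left_mono divide_right_mono_ennreal gw1; simp)
    have [measurable]: "w1 \<in> borel_measurable \<nu>" unfolding w1_def by measurable
    have kp: "k * p > 0" using k p by simp
    have "(\<integral>\<^sup>+x\<in>E. ennreal ((\<bar>F (u x)\<bar> + K1) powr (k * p)) \<partial>\<nu>) \<le> (\<integral>\<^sup>+x. ennreal (2 powr (k * p)) * (ennreal (\<bar>\<eta> x * F (u x)\<bar> powr (k * p)) + ennreal (\<bar>w1 x\<bar> powr (k * p))) \<partial>\<nu>)"
    proof (rule nn_integral_mono)
      fix x
      show "ennreal ((\<bar>F (u x)\<bar> + K1) powr (k * p)) * indicator E x \<le> ennreal (2 powr (k * p)) * (ennreal (\<bar>\<eta> x * F (u x)\<bar> powr (k * p)) + ennreal (\<bar>w1 x\<bar> powr (k * p)))"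
      proof (cases "x \<in> E")
        case True
        have "(\<bar>F (u x)\<bar> + K1) powr (k * p) \<le> 2 powr (k * p) * (\<bar>F (u x)\<bar> powr (k * p) + K1 powr (k * p))"
          using K1 kp by (intro powr_add_le) auto
        then show ?thesis using E(2)[OF True] True K1 by (simp add: w1_def ennreal_leI flip: ennreal_mult ennreal_plus)
      qed simp
    qed
    also have "\<dots> = ennreal (2 powr (k * p)) * (Y1 + Y2)" unfolding Y1_def Y2_def by (simp add: nn_integral_cmult nn_integral_add)
    finally have "enn_powr ((\<integral>\<^sup>+x\<in>E. ennreal ((\<bar>F (u x)\<bar> + K1) powr (k * p)) \<partial>\<nu>) / n) (1 / k) \<le> enn_powr ((ennreal (2 powr (k * p)) * (Y1 + Y2)) / n) (1 / k)"
      using k by (intro enn_powr_mono divide_right_mono_ennreal) auto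
    also have "(ennreal (2 powr (k * p)) * (Y1 + Y2)) / n = ennreal (2 powr (k * p)) * (Y1 / n + Y2 / n)"
      by (simp add: divide_ennreal_def distrib_left distrib_right mult.assoc)
    also have "enn_powr \<dots> (1 / k) = ennreal (2 powr p) * enn_powr (Y1 / n + Y2 / n) (1 / k)"
      using k by (simp add: enn_powr_mult powr_powr)
    also have "\<dots> \<le> ennreal (2 powr p) * (2 * (enn_powr (Y1 / n) (1 / k) + enn_powr (Y2 / n) (1 / k)))"
      using k by (intro mult_left_mono enn_powr_add_le) auto
    also have "\<dots> \<le> ennreal (2 powr p) * (2 * (ennreal ((C1 * r) powr p * 2 powr p) * ((ennreal (2 powr p) * (ennreal (c * Cv) * M + ennreal (2 * ((2 powr p * p powr p + 1) * (c * Cv) + e)) * M)) / m')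
        + ennreal ((C1 * r) powr p) * ((ennreal (c * Cv) * M) / m')))"
      by (intro mult_left_mono add_mono order.trans[OF s1] s2 divide_right_mono_ennreal add_left_mono Xb order_refl; simp)
    also have "\<dots> \<le> ennreal (2 powr p * 2 * ((C1 * r) powr p * (2 powr p * 2 powr p) * (2 * Cv + 2 * (2 powr p * p powr p + 1) * Cv + 2)) * (c + e)) * (M / m')"
      using p c Cv e by (intro combine_sobolev_bounds) (auto simp: ge_one_powr_ge_zero)
    also have "2 powr p * 2 * ((C1 * r) powr p * (2 powr p * 2 powr p) * (2 * Cv + 2 * (2 powr p * p powr p + 1) * Cv + 2)) * (c + e)
       = 2 powr p * 2 * Cm * ((c + e) * r powr p)"
    proof -
      have "(C1 * r) powr p = C1 powr p * r powr p" using C1 r by (intro powr_mult)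
      moreover have "(4::real) powr p = 2 powr p * 2 powr p" using powr_mult[of 2 2 p] by simp
      ultimately show ?thesis unfolding Cm_def by simp
    qed
    finally show ?thesis .
  qed
  have kp: "k * p > 0" using k p by simp
  define R where "R = ennreal (2 powr p * 2 * Cm * ((c + e) * r powr p)) * (M / m')"
  \<comment> \<open>On the set where the truncation at height \<open>N\<close> is not active, the truncated
      power is the power itself.\<close>
  define W where "W N x = (if \<bar>u x\<bar> + \<kappa> \<le> N then (\<bar>u x\<bar> + \<kappa>) powr (\<alpha> * (k * p)) else 0)" for N :: real and x
  have WN: "(\<integral>\<^sup>+x\<in>E. ennreal (W (real N) x) \<partial>\<nu>) \<le> enn_powr R k * n" for N :: nat
  proof (cases "\<kappa> \<le> real N")
    case True
    show ?thesis
    proof (rule truncated_power[OF \<alpha> \<kappa> True p], goal_cases)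
    case (1 F G)
    note FG = this
    have "(\<integral>\<^sup>+x\<in>E. ennreal (W (real N) x) \<partial>\<nu>) \<le> (\<integral>\<^sup>+x\<in>E. ennreal ((\<bar>F (u x)\<bar> + K1) powr (k * p)) \<partial>\<nu>)"
      by (intro nn_integral_mono mult_right_mono ennreal_leI) (use FG(12) in \<open>auto simp: W_def K1_def powr_powr\<close>)
    then have "enn_powr ((\<integral>\<^sup>+x\<in>E. ennreal (W (real N) x) \<partial>\<nu>) / n) (1 / k) \<le> enn_powr ((\<integral>\<^sup>+x\<in>E. ennreal ((\<bar>F (u x)\<bar> + K1) powr (k * p)) \<partial>\<nu>) / n) (1 / k)"
      using k by (intro enn_powr_mono divide_right_mono_ennreal) auto
    also have "\<dots> \<le> R" unfolding R_def by (rule main[OF FG(1-11)])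
    finally have "enn_powr (enn_powr ((\<integral>\<^sup>+x\<in>E. ennreal (W (real N) x) \<partial>\<nu>) / n) (1 / k)) k \<le> enn_powr R k" using k by (intro enn_powr_mono) auto
    then have "(\<integral>\<^sup>+x\<in>E. ennreal (W (real N) x) \<partial>\<nu>) / n \<le> enn_powr R k" using k by (simp add: enn_powr_powr)
    then have "(\<integral>\<^sup>+x\<in>E. ennreal (W (real N) x) \<partial>\<nu>) / n * n \<le> enn_powr R k * n" by (rule mult_right_mono) simp
    then show ?case using n by (simp add: ennreal_divide_mult_cancel)
    qed
  next
    case False
    then have "W (real N) x = 0" for x by (auto simp: W_def)
    then show ?thesis by simp
  qed
  have "(\<integral>\<^sup>+x\<in>E. ennreal ((\<bar>u x\<bar> + \<kappa>) powr (\<alpha> * (k * p))) \<partial>\<nu>) \<le> (\<integral>\<^sup>+x. liminf (\<lambda>N. ennreal (W (real N) x) * indicator E x) \<partial>\<nu>)"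
  proof (rule nn_integral_mono)
    fix x
    obtain N0 :: nat where N0: "\<bar>u x\<bar> + \<kappa> \<le> real N0" using real_arch_simple by blast
    have "\<forall>\<^sub>F N in sequentially. ennreal ((\<bar>u x\<bar> + \<kappa>) powr (\<alpha> * (k * p))) * indicator E x \<le> ennreal (W (real N) x) * indicator E x"
      using N0 by (intro eventually_sequentiallyI[of N0]) (auto simp: W_def)
    then show "ennreal ((\<bar>u x\<bar> + \<kappa>) powr (\<alpha> * (k * p))) * indicator E x \<le> liminf (\<lambda>N. ennreal (W (real N) x) * indicator E x)"
      by (rule Liminf_bounded)
  qed
  also have "\<dots> \<le> liminf (\<lambda>N. \<integral>\<^sup>+x\<in>E. ennreal (W (real N) x) \<partial>\<nu>)"
    by (rule nn_integral_liminf) (unfold W_def, measurable)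
  also have "\<dots> \<le> limsup (\<lambda>N. \<integral>\<^sup>+x\<in>E. ennreal (W (real N) x) \<partial>\<nu>)" by (rule Liminf_le_Limsup) simp
  also have "\<dots> \<le> enn_powr R k * n" by (rule Limsup_bounded) (use WN in auto)
  finally have "(\<integral>\<^sup>+x\<in>E. ennreal ((\<bar>u x\<bar> + \<kappa>) powr (\<alpha> * (k * p))) \<partial>\<nu>) / n \<le> (enn_powr R k * n) / n" by (rule divide_right_mono_ennreal)
  also have "\<dots> = enn_powr R k" using n by (simp add: mult_divide_eq_ennreal)
  finally have "enn_powr ((\<integral>\<^sup>+x\<in>E. ennreal ((\<bar>u x\<bar> + \<kappa>) powr (\<alpha> * (k * p))) \<partial>\<nu>) / n) (1 / k) \<le> enn_powr (enn_powr R k) (1 / k)"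
    using k by (intro enn_powr_mono) auto
  then show ?thesis using k by (simp add: enn_powr_powr R_def n_def m'_def M_def Cm_def)
qed

end

section \<open>Summation over scales\<close>

lemma sum_geometric_tail_le:
  fixes q :: real assumes q: "0 \<le> q" "q < 1"
  shows "(\<Sum>j\<in>{i..<J}. q ^ j) \<le> q ^ i / (1 - q)"
proof (cases "i \<le> J")
  case True
  then have "(\<Sum>j\<in>{i..<J}. q ^ j) * (1 - q) = q ^ i - q ^ J"
  proof (induction J)
    case (Suc J)
    show ?case
    proof (cases "i = Suc J")
      case False
      then have "i \<le> J" using Suc.prems by simp
      have "((\<Sum>j\<in>{i..<J}. q ^ j) + q ^ J) * (1 - q) = (\<Sum>j\<in>{i..<J}. q ^ j) * (1 - q) + q ^ J * (1 - q)" by (rule distrib_right)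
      also have "\<dots> = q ^ i - q ^ Suc J" unfolding Suc.IH[OF \<open>i \<le> J\<close>] by (simp add: algebra_simps)
      finally show ?thesis using \<open>i \<le> J\<close> by simp
    qed simp
  qed simp
  also have "\<dots> \<le> q ^ i" using q by simp
  finally show ?thesis using q by (simp add: field_simps)
qed (use q in simp)

lemma nn_integral_inverse:
  assumes "0 < a" "a \<le> b"
  shows "(\<integral>\<^sup>+s. ennreal (1 / s) * indicator {a<..<b} s \<partial>lborel) = ennreal (ln (b / a))"
proof -
  have "(\<integral>\<^sup>+s. ennreal (1 / s) * indicator {a<..<b} s \<partial>lborel) = (\<integral>\<^sup>+s. ennreal (1 / s) * indicator {a..b} s \<partial>lborel)"
  proof (rule nn_integral_cong_AE)
    show "AE s in lborel. ennreal (1 / s) * indicator {a<..<b} s = ennreal (1 / s) * indicator {a..b} s"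
      using AE_lborel_singleton[of a] AE_lborel_singleton[of b] by eventually_elim (auto simp: indicator_def)
  qed
  also have "\<dots> = ennreal (ln b - ln a)"
    by (rule nn_integral_FTC_Icc) (use assms in \<open>auto intro!: derivative_eq_intros\<close>)
  also have "ln b - ln a = ln (b / a)" using assms by (simp add: ln_div)
  finally show ?thesis .
qed

text \<open>
  Let \<open>t j\<close> be the largest scale at which \<open>\<Phi> \<le> q\<^sup>j
  \<phi>\<close>. The sum of the numbers \<open>q\<^sup>j ln (r / t j)\<close> is the integral of
  \<open>1/s\<close> times the sum of those \<open>q\<^sup>j\<close> with \<open>t j < s\<close>.
  For each \<open>s\<close> this inner sum is a geometric tail, whose first term is smaller than
  \<open>\<Phi> s / \<phi>\<close> because \<open>s\<close> exceeds the corresponding scale. So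
  the whole sum is at most the Dini integral divided by \<open>(1 - q) \<phi>\<close>. If
  \<open>\<phi> = 0\<close>, all scales equal \<open>r\<close>.
\<close>

lemma dini_scales:
  fixes \<Phi> :: "real \<Rightarrow> ennreal"
  assumes mono: "\<And>s t. 0 < s \<Longrightarrow> s \<le> t \<Longrightarrow> \<Phi> s \<le> \<Phi> t" and lim: "(\<Phi> \<longlongrightarrow> 0) (at_right 0)"
    and r: "r > 0" and \<phi>: "\<Phi> r = ennreal \<phi>" "\<phi> \<ge> 0" and q: "0 < q" "q < 1" and M1: "M1 \<ge> 0"
    and dini: "(\<integral>\<^sup>+s\<in>{0<..<r}. \<Phi> s / ennreal s \<partial>lborel) \<le> ennreal (M1 * \<phi>)"
  obtains t :: "nat \<Rightarrow> real" where "\<And>j. 0 < t j" "\<And>j. t j \<le> r" "\<And>j s. 0 < s \<Longrightarrow> s < t j \<Longrightarrow> \<Phi> s \<le> ennreal (q ^ j * \<phi>)"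
    "\<And>J. (\<Sum>j<J. q ^ j * ln (r / t j)) \<le> M1 / (1 - q)"
proof -
  define S where "S j = {s. 0 < s \<and> s \<le> r \<and> \<Phi> s \<le> ennreal (q ^ j * \<phi>)}" for j :: nat
  define t where "t j = Sup (S j)" for j
  have ne: "\<exists>s. s \<in> S j" for j
  proof (cases "\<phi> = 0")
    case True
    then show ?thesis using r \<phi> by (intro exI[of _ r]) (simp add: S_def)
  next
    case False
    then have "0 < ennreal (q ^ j * \<phi>)" using q \<phi> by simp
    then have "\<forall>\<^sub>F s in at_right 0. \<Phi> s < ennreal (q ^ j * \<phi>)" by (rule order_tendstoD(2)[OF lim])
    moreover have "\<forall>\<^sub>F s in at_right 0. s \<in> {0<..<r}" using r by (rule eventually_at_right_real)
    ultimately have "\<forall>\<^sub>F s in at_right (0::real). s \<in> S j" by eventually_elim (auto simp: S_def)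
    then show ?thesis by (rule eventually_happens'[rotated]) simp
  qed
  have bdd: "bdd_above (S j)" for j by (auto simp: S_def bdd_above_def)
  have t0: "0 < t j" "t j \<le> r" for j
  proof -
    obtain s where s: "s \<in> S j" using ne by blast
    then have "0 < s" by (simp add: S_def)
    also have "s \<le> t j" unfolding t_def by (rule cSup_upper[OF s bdd])
    finally show "0 < t j" .
    show "t j \<le> r" unfolding t_def by (rule cSup_least) (use s in \<open>auto simp: S_def\<close>)
  qed
  have small: "\<Phi> s \<le> ennreal (q ^ j * \<phi>)" if "0 < s" "s < t j" for s j
  proof -
    have "S j \<noteq> {}" using ne[of j] by blast
    then have "\<exists>s'\<in>S j. s < s'" using that(2) less_cSup_iff[OF _ bdd, of j s] unfolding t_def by blast
    then obtain s' where s': "s' \<in> S j" "s < s'" by (elim bexE)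
    have "\<Phi> s \<le> \<Phi> s'" by (rule mono[OF that(1)]) (use s' in simp)
    also have "\<dots> \<le> ennreal (q ^ j * \<phi>)" using s'(1) by (simp add: S_def)
    finally show ?thesis .
  qed
  have large: "q ^ j * \<phi> < x" if "t j < s" "s < r" "\<Phi> s = ennreal x" for j s x
  proof (rule ccontr)
    assume "\<not> q ^ j * \<phi> < x"
    then have "\<Phi> s \<le> ennreal (q ^ j * \<phi>)" unfolding that(3) by (intro ennreal_leI) simp
    then have "s \<in> S j" using that t0(1)[of j] by (simp add: S_def)
    then have "s \<le> t j" unfolding t_def by (rule cSup_upper[OF _ bdd])
    then show False using that by simp
  qed
  have main: "(\<Sum>j<J. q ^ j * ln (r / t j)) \<le> M1 / (1 - q)" for J
  proof (cases "\<phi> = 0")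
    case True
    then have "r \<in> S j" for j using r \<phi> by (simp add: S_def)
    then have "r \<le> t j" for j unfolding t_def by (rule cSup_upper[OF _ bdd])
    then have "t j = r" for j using t0(2)[of j] by (rule order.antisym[OF _ _, rotated])
    then show ?thesis using r q M1 by simp
  next
    case False
    then have \<phi>0: "\<phi> > 0" using \<phi> by simp
    \<comment> \<open>The factor \<open>1 - q\<close> stands on the left, where it can be moved out of the
        integrals of step functions.\<close>
    have pt: "(\<Sum>j<J. ennreal ((1 - q) * q ^ j * \<phi>) * (ennreal (1 / s) * indicator {t j<..<r} s)) \<le> \<Phi> s / ennreal s * indicator {0<..<r} s" for s
    proof (cases "0 < s \<and> s < r")
      case s: True
      obtain x where x: "\<Phi> s = ennreal x" "x \<ge> 0" using mono[of s r] s \<phi> by (cases "\<Phi> s" rule: ennreal_cases) (auto simp: top_unique)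
      let ?I = "{j\<in>{..<J}. t j < s}"
      have "(\<Sum>j<J. ennreal ((1 - q) * q ^ j * \<phi>) * (ennreal (1 / s) * indicator {t j<..<r} s)) = (\<Sum>j<J. ennreal (if t j < s then (1 - q) * q ^ j * \<phi> / s else 0))"
        using s q \<phi> by (intro sum.cong) (auto simp: ennreal_mult[symmetric] simp del: ennreal_mult')
      also have "\<dots> = ennreal (\<Sum>j<J. if t j < s then (1 - q) * q ^ j * \<phi> / s else 0)"
        using s q \<phi> by (intro sum_ennreal) auto
      also have "(\<Sum>j<J. if t j < s then (1 - q) * q ^ j * \<phi> / s else 0) = (\<Sum>j\<in>?I. (1 - q) * q ^ j * \<phi> / s)"
        by (rule sum.inter_filter[symmetric]) simp
      also have "\<dots> \<le> x / s"
      proof (cases "?I = {}")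
        case False
        define i where "i = Min ?I"
        have i: "i \<in> ?I" unfolding i_def using False by (intro Min_in) auto
        have "(\<Sum>j\<in>?I. (1 - q) * q ^ j * \<phi> / s) \<le> (\<Sum>j\<in>{i..<J}. (1 - q) * q ^ j * \<phi> / s)"
          using s q \<phi> by (intro sum_mono2) (auto simp: i_def)
        also have "\<dots> = (1 - q) * \<phi> / s * (\<Sum>j\<in>{i..<J}. q ^ j)"
          unfolding sum_distrib_left by (intro sum.cong) auto
        also have "\<dots> \<le> (1 - q) * \<phi> / s * (q ^ i / (1 - q))"
          using s q \<phi> by (intro mult_left_mono sum_geometric_tail_le) auto
        also have "\<dots> = q ^ i * \<phi> / s" using q by simp
        also have "\<dots> \<le> x / s" using large[of i s x] i s x by (intro divide_right_mono) auto
        finally show ?thesis .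
      next
        case True
        show ?thesis unfolding True using x s by simp
      qed
      finally have "(\<Sum>j<J. ennreal ((1 - q) * q ^ j * \<phi>) * (ennreal (1 / s) * indicator {t j<..<r} s)) \<le> ennreal (x / s)"
        by (simp add: ennreal_leI)
      also have "\<dots> = \<Phi> s / ennreal s * indicator {0<..<r} s" using s x by (simp add: divide_ennreal)
      finally show ?thesis .
    next
      case False
      then have "s \<notin> {t j<..<r}" for j using t0(1)[of j] by auto
      then show ?thesis by simp
    qed
    have "ennreal (\<Sum>j<J. (1 - q) * q ^ j * \<phi> * ln (r / t j)) = (\<Sum>j<J. ennreal ((1 - q) * q ^ j * \<phi>) * ennreal (ln (r / t j)))"
      using q \<phi> t0 r by (subst sum_ennreal[symmetric]) (auto simp: ennreal_mult[symmetric] simp del: ennreal_mult')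
    also have "\<dots> = (\<Sum>j<J. ennreal ((1 - q) * q ^ j * \<phi>) * (\<integral>\<^sup>+s. ennreal (1 / s) * indicator {t j<..<r} s \<partial>lborel))"
      using t0 by (intro sum.cong refl) (simp add: nn_integral_inverse)
    also have "\<dots> = (\<integral>\<^sup>+s. (\<Sum>j<J. ennreal ((1 - q) * q ^ j * \<phi>) * (ennreal (1 / s) * indicator {t j<..<r} s)) \<partial>lborel)"
      by (subst nn_integral_sum) (auto simp: nn_integral_cmult)
    also have "\<dots> \<le> (\<integral>\<^sup>+s\<in>{0<..<r}. \<Phi> s / ennreal s \<partial>lborel)" by (intro nn_integral_mono pt)
    also have "\<dots> \<le> ennreal (M1 * \<phi>)" by (rule dini)
    finally have "(\<Sum>j<J. (1 - q) * q ^ j * \<phi> * ln (r / t j)) \<le> M1 * \<phi>"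
      using M1 \<phi> by (subst (asm) ennreal_le_iff) auto
    moreover have "(\<Sum>j<J. (1 - q) * q ^ j * \<phi> * ln (r / t j)) = \<phi> * ((1 - q) * (\<Sum>j<J. q ^ j * ln (r / t j)))"
      by (simp add: sum_distrib_left mult.assoc mult.left_commute)
    ultimately have "(1 - q) * (\<Sum>j<J. q ^ j * ln (r / t j)) \<le> M1" using \<phi>0 by (simp add: mult.commute)
    then show ?thesis using q by (simp add: pos_le_divide_eq mult.commute)
  qed
  show ?thesis by (rule that[of t, OF t0 small main])
qed

text \<open>
  Each step is raised to the power \<open>1 / (p k\<^sup>j)\<close>, which turns the product of
  the constants into a convergent one.
\<close>

lemma iterate_reverse_hoelder:
  fixes Y :: "nat \<Rightarrow> ennreal"
  assumes k: "k > 1" and p: "p > 0" and s: "s > 0" and G: "\<And>j. G j > 0"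
    and step: "\<And>j. enn_powr (Y (Suc j)) (1 / k) \<le> ennreal (G j) * (ennreal s * Y j)"
  shows "enn_powr (Y J) (1 / (p * k ^ J)) \<le> ennreal ((\<Prod>j<J. G j powr ((1 / k) ^ j / p)) * s powr (\<Sum>j<J. (1 / k) ^ j / p)) * enn_powr (Y 0) (1 / p)"
proof (induction J)
  case (Suc J)
  let ?a = "(1 / k) ^ J / p"
  have a: "?a > 0" using k p by simp
  have P0: "(\<Prod>j<J. G j powr ((1 / k) ^ j / p)) \<ge> 0" by (intro prod_nonneg) simp
  have "enn_powr (Y (Suc J)) (1 / (p * k ^ Suc J)) = enn_powr (enn_powr (Y (Suc J)) (1 / k)) ?a"
    using k p by (simp add: enn_powr_powr power_one_over field_simps)
  also have "\<dots> \<le> enn_powr (ennreal (G J) * (ennreal s * Y J)) ?a" by (rule enn_powr_mono[OF step a])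
  also have "\<dots> = ennreal (G J powr ?a) * (ennreal (s powr ?a) * enn_powr (Y J) ?a)"
    using a s G[of J] by (simp add: enn_powr_mult less_imp_le)
  also have "enn_powr (Y J) ?a = enn_powr (Y J) (1 / (p * k ^ J))" using k p by (simp add: power_one_over mult.commute)
  also have "ennreal (G J powr ?a) * (ennreal (s powr ?a) * enn_powr (Y J) (1 / (p * k ^ J)))
    \<le> ennreal (G J powr ?a) * (ennreal (s powr ?a) * (ennreal ((\<Prod>j<J. G j powr ((1 / k) ^ j / p)) * s powr (\<Sum>j<J. (1 / k) ^ j / p)) * enn_powr (Y 0) (1 / p)))"
    by (intro mult_left_mono Suc.IH) auto
  also have "\<dots> = ennreal ((\<Prod>j<Suc J. G j powr ((1 / k) ^ j / p)) * s powr (\<Sum>j<Suc J. (1 / k) ^ j / p)) * enn_powr (Y 0) (1 / p)"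
    unfolding mult.assoc[symmetric] using P0 s
    by (simp add: powr_add mult.assoc mult.left_commute mult.commute flip: ennreal_mult)
  finally show ?case .
qed (use s in simp)

lemma powr_eq_exp: "x > 0 \<Longrightarrow> x powr a = exp (a * ln x)" for x a :: real
  by (simp add: powr_def)

text \<open>
  After taking logarithms the constant \<open>c\<close>, the growth \<open>T\<^sup>j\<close> of
  the cutoffs and the ratios of scales contribute a geometric series, an arithmetico-geometric
  series and the Dini sum.
\<close>

lemma iteration_constant_bound:
  fixes t :: "nat \<Rightarrow> real"
  assumes k: "k > 1" and p: "p > 0" and c: "c > 0" and T: "T \<ge> 1" and \<gamma>: "\<gamma> > 0" and t: "\<And>j. 0 < t j" "\<And>j. t j \<le> r"
    and dini: "(\<Sum>j<J. (1 / k) ^ j * ln (r / t j)) \<le> M1 / (1 - 1 / k)"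
  shows "(\<Prod>j<J. (c * (T ^ j) powr p * (r / t j) powr (\<gamma> * p)) powr ((1 / k) ^ j / p))
    \<le> exp (\<bar>ln c\<bar> / p / (1 - 1 / k) + ln T * (\<Sum>j. real j * (1 / k) ^ j)) * exp (\<gamma> * k / (k - 1) * M1)"
proof -
  define q where "q = 1 / k"
  have q: "0 < q" "q < 1" using k by (auto simp: q_def)
  have r: "r > 0" using t(1,2)[of 0] by linarith
  have ln0: "ln T \<ge> 0" using T by simp
  have factor: "(c * (T ^ j) powr p * (r / t j) powr (\<gamma> * p)) powr (q ^ j / p) = exp (ln c / p * q ^ j + ln T * (real j * q ^ j) + \<gamma> * (q ^ j * ln (r / t j)))" for j
  proof -
    have T0: "T > 0" using T by simp
    have Tj: "T ^ j > 0" "r / t j > 0" using T t r by auto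
    have pos: "c * (T ^ j) powr p * (r / t j) powr (\<gamma> * p) > 0" using c Tj T0 by (intro mult_pos_pos) auto
    have lneq: "ln (c * (T ^ j) powr p * (r / t j) powr (\<gamma> * p)) = ln c + p * (real j * ln T) + \<gamma> * p * ln (r / t j)"
    proof -
      have "(T ^ j) powr p > 0" "(r / t j) powr (\<gamma> * p) > 0" using Tj T0 by auto
      then have "ln (c * (T ^ j) powr p * (r / t j) powr (\<gamma> * p)) = ln c + ln ((T ^ j) powr p) + ln ((r / t j) powr (\<gamma> * p))"
        using c by (simp only: ln_mult_pos mult_pos_pos)
      then show ?thesis using Tj T0 by (simp only: ln_powr ln_realpow)
    qed
    have "(c * (T ^ j) powr p * (r / t j) powr (\<gamma> * p)) powr (q ^ j / p) = exp (q ^ j / p * (ln c + p * (real j * ln T) + \<gamma> * p * ln (r / t j)))"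
      unfolding lneq[symmetric] by (rule powr_eq_exp[OF pos])
    also have "q ^ j / p * (ln c + p * (real j * ln T) + \<gamma> * p * ln (r / t j)) = ln c / p * q ^ j + ln T * (real j * q ^ j) + \<gamma> * (q ^ j * ln (r / t j))"
      using p by (simp add: field_simps)
    finally show ?thesis .
  qed
  have "(\<Prod>j<J. (c * (T ^ j) powr p * (r / t j) powr (\<gamma> * p)) powr (q ^ j / p))
    = exp (ln c / p * (\<Sum>j<J. q ^ j) + ln T * (\<Sum>j<J. real j * q ^ j) + \<gamma> * (\<Sum>j<J. q ^ j * ln (r / t j)))"
    unfolding factor by (simp add: exp_sum[symmetric] sum.distrib sum_distrib_left)
  also have "\<dots> \<le> exp (\<bar>ln c\<bar> / p * (1 / (1 - q)) + ln T * (\<Sum>j. real j * q ^ j) + \<gamma> * (M1 / (1 - q)))"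
  proof (subst exp_le_cancel_iff, intro add_mono mult_left_mono)
    have "(\<Sum>j<J. q ^ j) \<le> 1 / (1 - q)" using sum_geometric_tail_le[of q 0 J] q by (simp add: lessThan_atLeast0)
    moreover have "0 \<le> (\<Sum>j<J. q ^ j)" using q by (intro sum_nonneg) auto
    ultimately show "ln c / p * (\<Sum>j<J. q ^ j) \<le> \<bar>ln c\<bar> / p * (1 / (1 - q))" using p by (intro mult_mono divide_right_mono) auto
    have "summable (\<lambda>j. real (Suc j) * q ^ j)" using geometric_deriv_sums[of q] q by (auto simp: sums_iff)
    then have "summable (\<lambda>j. real j * q ^ j)"
      by (rule summable_comparison_test'[where N = 0]) (use q in \<open>auto intro!: mult_right_mono\<close>)
    then show "(\<Sum>j<J. real j * q ^ j) \<le> (\<Sum>j. real j * q ^ j)" using q by (intro sum_le_suminf) auto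
    show "(\<Sum>j<J. q ^ j * ln (r / t j)) \<le> M1 / (1 - q)" using dini by (simp add: q_def)
  qed (use ln0 \<gamma> in auto)
  also have "\<dots> = exp (\<bar>ln c\<bar> / p / (1 - q) + ln T * (\<Sum>j. real j * q ^ j)) * exp (\<gamma> * k / (k - 1) * M1)"
  proof -
    have "\<gamma> * (M1 / (1 - q)) = \<gamma> * k / (k - 1) * M1" using k by (simp add: q_def field_simps)
    then show ?thesis by (simp add: exp_add)
  qed
  finally show ?thesis unfolding q_def .
qed

text \<open>
  If \<open>\<bar>u\<bar> > l\<close> on a subset of \<open>B\<close> of positive measure
  \<open>d\<close>, the moments are at least \<open>l (d/n)\<^sup>1\<^sup>/\<^sup>a\<close>, which
  tends to \<open>l\<close> as the exponent \<open>a\<close> grows.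
\<close>

lemma esssup_le_limit_of_moments:
  fixes u :: "'a \<Rightarrow> real" and a b :: "nat \<Rightarrow> real"
  assumes [measurable]: "u \<in> borel_measurable M" "B \<in> sets M" and Bfin: "emeasure M B < top"
    and n: "0 < n" and a: "\<And>J. a J > 0" "(\<lambda>J. 1 / a J) \<longlonglongrightarrow> 0"
    and mom: "\<And>J. enn_powr ((\<integral>\<^sup>+x\<in>B. ennreal (\<bar>u x\<bar> powr a J) \<partial>M) / ennreal n) (1 / a J) \<le> ennreal (b J)"
    and b: "b \<longlonglongrightarrow> \<beta>" "\<And>J. b J \<ge> 0"
  shows "esssup (restrict_space M B) (\<lambda>x. ennreal \<bar>u x\<bar>) \<le> ennreal \<beta>"
proof -
  have "emeasure M {x\<in>B. \<bar>u x\<bar> > l} = 0" if l: "l > \<beta>" "l > 0" for l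
  proof (rule ccontr)
    define A where "A = {x\<in>B. \<bar>u x\<bar> > l}"
    have [measurable]: "A \<in> sets M" unfolding A_def by measurable
    assume "emeasure M {x\<in>B. \<bar>u x\<bar> > l} \<noteq> 0"
    moreover have "emeasure M A \<le> emeasure M B" by (rule emeasure_mono) (auto simp: A_def)
    ultimately obtain d where d: "emeasure M A = ennreal d" "d > 0"
      using Bfin by (cases "emeasure M A" rule: ennreal_cases) (auto simp: A_def less_le top_unique)
    have lower: "l * (d / n) powr (1 / a J) \<le> b J" for J
    proof -
      have "ennreal (l powr a J * (d / n)) = (\<integral>\<^sup>+x. ennreal (l powr a J) * indicator A x \<partial>M) / ennreal n"
        using d n by (simp add: nn_integral_cmult_indicator divide_ennreal flip: ennreal_mult)
      also have "\<dots> \<le> (\<integral>\<^sup>+x\<in>B. ennreal (\<bar>u x\<bar> powr a J) \<partial>M) / ennreal n"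
        using l a(1)[of J] by (intro divide_right_mono_ennreal nn_integral_mono) (auto simp: A_def indicator_def less_imp_le intro!: ennreal_leI powr_mono2)
      finally have "enn_powr (ennreal (l powr a J * (d / n))) (1 / a J) \<le> ennreal (b J)"
        using enn_powr_mono[of _ _ "1 / a J"] mom[of J] a(1)[of J] by (meson order.trans zero_less_divide_1_iff)
      then have "(l powr a J * (d / n)) powr (1 / a J) \<le> b J" using l d n b(2)[of J] by simp
      moreover have "(l powr a J * (d / n)) powr (1 / a J) = (l powr a J) powr (1 / a J) * (d / n) powr (1 / a J)"
        using l d n by (intro powr_mult)
      moreover have "(l powr a J) powr (1 / a J) = l" using l a(1)[of J] by (simp add: powr_powr)
      ultimately show ?thesis by simp
    qed
    have "(\<lambda>J. l * (d / n) powr (1 / a J)) \<longlonglongrightarrow> l * (d / n) powr 0"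
      using d n by (intro tendsto_intros a(2)) auto
    then have "l * (d / n) powr 0 \<le> \<beta>" by (rule LIMSEQ_le[OF _ b(1)]) (use lower in auto)
    then show False using l d n by simp
  qed
  note null = this
  have \<beta>0: "\<beta> \<ge> 0" using b by (intro LIMSEQ_le_const) auto
  have AE: "AE x in M. x \<in> B \<longrightarrow> \<bar>u x\<bar> \<le> \<beta> + 1 / real (Suc i)" for i
  proof -
    have "{x\<in>B. \<bar>u x\<bar> > \<beta> + 1 / real (Suc i)} \<in> null_sets M"
      using null[of "\<beta> + 1 / real (Suc i)"] \<beta>0 by (auto simp: null_sets_def add_nonneg_pos)
    then show ?thesis by (rule AE_I') (use sets.sets_into_space[of B M] in \<open>auto simp: not_le\<close>)
  qed
  then have "AE x in M. \<forall>i. x \<in> B \<longrightarrow> \<bar>u x\<bar> \<le> \<beta> + 1 / real (Suc i)" by (subst AE_all_countable) (intro allI)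
  then have "AE x in M. x \<in> B \<longrightarrow> ennreal \<bar>u x\<bar> \<le> ennreal \<beta>"
  proof eventually_elim
    case (elim x)
    show ?case
    proof
      assume "x \<in> B"
      have "(\<lambda>i. \<beta> + 1 / real (Suc i)) \<longlonglongrightarrow> \<beta> + 0"
        by (intro tendsto_intros LIMSEQ_Suc[OF lim_1_over_n])
      then have "\<bar>u x\<bar> \<le> \<beta> + 0" using elim \<open>x \<in> B\<close> by (intro LIMSEQ_le_const) auto
      then show "ennreal \<bar>u x\<bar> \<le> ennreal \<beta>" by (intro ennreal_leI) simp
    qed
  qed
  then have "AE x in restrict_space M B. ennreal \<bar>u x\<bar> \<le> ennreal \<beta>"
    by (subst AE_restrict_space_iff) auto
  moreover have "u \<in> borel_measurable (restrict_space M B)" by (rule measurable_restrict_space1) measurable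
  ultimately show ?thesis by (intro esssup_I) auto
qed

context setting_solution
begin

lemma SK_Phi_mono:
  assumes "s \<le> t" shows "SK_Phi \<Omega> \<rho> \<mu> \<nu> p V s \<le> SK_Phi \<Omega> \<rho> \<mu> \<nu> p V t"
proof -
  have sub: "mball x s \<subseteq> mball x t" for x by (rule mball_subset_concentric[OF assms])
  have ind: "indicator (mball x s) y \<le> (indicator (mball x t) y :: ennreal)" for x y
    using sub[of x] by (auto simp: indicator_def simp del: in_mball)
  show ?thesis unfolding SK_Phi_def
    by (intro SUP_mono' enn_powr_mono nn_integral_mono mult_mono ind order_refl) (use p in auto)
qed

lemma Phi_mono: "s \<le> t \<Longrightarrow> Phi s \<le> Phi t"
  unfolding Phi_def using p by (intro enn_powr_mono SK_Phi_mono) auto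

end

section \<open>The local bound\<close>

context setting_solution
begin

text \<open>
  The constant of one step: the factor from \<open>moser_step\<close> times the factor from
  \<open>cutoff_cost\<close>.
\<close>

definition step_const :: real where
  "step_const = 2 powr p * 2 * (C1 powr p * 4 powr p * (2 * Cv + 2 * (2 powr p * p powr p + 1) * Cv + 2)) * ((Cc powr p + 1) * 128 powr (\<gamma> * p))"

definition limit_const :: real where
  "limit_const = exp (\<bar>ln step_const\<bar> / p / (1 - 1 / k) + ln T * (\<Sum>j. real j * (1 / k) ^ j))"

text \<open>
  The ratio of \<open>\<kappa>\<close> to \<open>\<Phi>(r)\<close>, chosen so that the smallness
  assumption of \<open>moser_step\<close> holds in every step.
\<close>

definition lift_const :: real where
  "lift_const = (4 * fefferman_const * (2 powr p * 4 powr p)) powr (1 / (p - 1)) + 1"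

lemma step_const_pos: "step_const > 0"
  unfolding step_const_def using C1 Cv Cc by (intro mult_pos_pos add_pos_pos add_nonneg_pos) auto

lemma lift_const: "lift_const \<ge> 1" "fefferman_const * (1 / lift_const) powr (p - 1) * (2 powr p * 4 powr p) \<le> 1 / 4"
proof -
  let ?X = "4 * fefferman_const * (2 powr p * 4 powr p)"
  show K: "lift_const \<ge> 1" by (simp add: lift_const_def)
  have "?X = (?X powr (1 / (p - 1))) powr (p - 1)" using fefferman_const_pos p by (simp add: powr_powr)
  also have "\<dots> \<le> lift_const powr (p - 1)" unfolding lift_const_def using p by (intro powr_mono2) auto
  finally have X: "?X \<le> lift_const powr (p - 1)" .
  have "(1 / lift_const) powr (p - 1) = 1 / lift_const powr (p - 1)" using K by (simp add: powr_divide)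
  then have "fefferman_const * (1 / lift_const) powr (p - 1) * (2 powr p * 4 powr p) = (?X / 4) / lift_const powr (p - 1)" by simp
  also have "\<dots> \<le> (lift_const powr (p - 1) / 4) / lift_const powr (p - 1)" by (intro divide_right_mono X) auto
  also have "\<dots> \<le> 1 / 4" using K by simp
  finally show "fefferman_const * (1 / lift_const) powr (p - 1) * (2 powr p * 4 powr p) \<le> 1 / 4" .
qed

text \<open>
  The cutoff on the ball of radius \<open>r\<close> and the cutoffs at the smaller scale \<open>t
  / 128\<close> are both measured against the smaller scale; the common factor
  \<open>r\<^sup>p\<^sup>(\<^sup>1\<^sup>-\<^sup>\<gamma>\<^sup>)\<close> is what remains of the
  scaling.
\<close>

lemma cutoff_cost:
  assumes r: "r > 0" and t: "0 < t" "t \<le> r"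
  shows "((Cc * T ^ j / r powr \<gamma>) powr p + (t / 128) powr (- \<gamma> * p)) * r powr p
    \<le> (Cc powr p + 1) * 128 powr (\<gamma> * p) * (T ^ j) powr p * (r / t) powr (\<gamma> * p) * r powr (p * (1 - \<gamma>))"
proof -
  let ?a = "\<gamma> * p" and ?R = "r powr (- (\<gamma> * p))"
  have a: "?a > 0" using \<gamma> p by simp
  have Tj: "T ^ j \<ge> 1" "(T ^ j) powr p \<ge> 1" using T p by (auto simp: one_le_power ge_one_powr_ge_zero)
  have D: "128 powr ?a * (r / t) powr ?a \<ge> 1"
  proof -
    have "(1::real) \<le> 128 powr ?a" using a by (simp add: ge_one_powr_ge_zero)
    moreover have "1 \<le> (r / t) powr ?a" using a r t by (intro ge_one_powr_ge_zero) auto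
    ultimately show ?thesis using mult_mono[of 1 "128 powr ?a" 1 "(r / t) powr ?a"] by simp
  qed
  have "(Cc * T ^ j / r powr \<gamma>) powr p = Cc powr p * (T ^ j) powr p / (r powr \<gamma>) powr p"
    using Cc Tj r by (simp add: powr_divide powr_mult)
  also have "\<dots> = Cc powr p * (T ^ j) powr p * ?R * 1" using r by (simp add: powr_powr powr_minus_divide)
  also have "\<dots> \<le> Cc powr p * (T ^ j) powr p * ?R * (128 powr ?a * (r / t) powr ?a)" by (intro mult_left_mono D) auto
  finally have 1: "(Cc * T ^ j / r powr \<gamma>) powr p \<le> Cc powr p * ((T ^ j) powr p * ?R * (128 powr ?a * (r / t) powr ?a))" by (simp only: mult.assoc)
  have "(t / 128) powr (- \<gamma> * p) = 128 powr ?a * (r / t) powr ?a * ?R"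
    using r t by (simp add: powr_divide powr_minus_divide)
  also have "\<dots> = 1 * (?R * (128 powr ?a * (r / t) powr ?a))" by simp
  also have "\<dots> \<le> (T ^ j) powr p * (?R * (128 powr ?a * (r / t) powr ?a))" using Tj by (intro mult_right_mono) auto
  finally have 2: "(t / 128) powr (- \<gamma> * p) \<le> 1 * ((T ^ j) powr p * ?R * (128 powr ?a * (r / t) powr ?a))" by (simp only: mult.assoc mult_1_left)
  have "((Cc * T ^ j / r powr \<gamma>) powr p + (t / 128) powr (- \<gamma> * p)) * r powr p
    \<le> ((Cc powr p + 1) * ((T ^ j) powr p * ?R * (128 powr ?a * (r / t) powr ?a))) * r powr p"
    unfolding distrib_right by (intro add_mono mult_right_mono 1[unfolded distrib_right] 2) auto
  also have "\<dots> = (Cc powr p + 1) * 128 powr ?a * (T ^ j) powr p * (r / t) powr ?a * (?R * r powr p)" by (simp only: ac_simps)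
  also have "?R * r powr p = r powr (p * (1 - \<gamma>))" using r by (simp add: powr_add[symmetric] algebra_simps)
  finally show ?thesis .
qed

text \<open>
  The iteration with the exponents \<open>\<alpha> = k\<^sup>j\<close>, the cutoffs \<open>\<eta>
  j\<close> and the scales of \<open>dini_scales\<close>. The number \<open>d\<close> keeps
  \<open>\<kappa>\<close> positive when the modulus vanishes.
\<close>

lemma ball_estimate:
  assumes x0: "x0 \<in> \<Omega>" and r: "r > 0" and comp: "mball x0 (8 * r) \<Subset> \<Omega>" and pos: "emeasure \<mu> (mball x0 r) > 0"
    and lim: "(Phi \<longlongrightarrow> 0) (at_right 0)" and \<phi>: "Phi r = ennreal \<phi>" "\<phi> \<ge> 0" and M1: "M1 \<ge> 0"
    and dini: "(\<integral>\<^sup>+s\<in>{0<..<r}. Phi s / ennreal s \<partial>lborel) \<le> ennreal (M1 * \<phi>)"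
    and d: "d > 0" and \<kappa>_def: "\<kappa> = lift_const * (\<phi> + d)" and z: "z \<ge> 0"
    and Z0: "enn_powr ((\<integral>\<^sup>+x\<in>mball x0 r. ennreal ((\<bar>u x\<bar> + \<kappa>) powr p) \<partial>\<nu>) / emeasure \<nu> (mball x0 r)) (1 / p) \<le> ennreal z"
  shows "esssup (restrict_space \<nu> (mball x0 (\<tau> * r))) (\<lambda>x. ennreal \<bar>u x\<bar>) \<le>
    ennreal (limit_const * exp (\<gamma> * k / (k - 1) * M1) * (r powr (p * (1 - \<gamma>)) * (measure \<nu> (mball x0 r) / measure \<mu> (mball x0 r))) powr (k / (p * (k - 1))) * z)"
proof -
  let ?B = "mball x0 r"
  define q where "q = 1 / k"
  have q: "0 < q" "q < 1" using k by (auto simp: q_def)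
  have \<kappa>: "\<kappa> > 0" using lift_const(1) \<phi>(2) d by (simp add: \<kappa>_def)
  have compr: "?B \<Subset> \<Omega>" by (rule compactly_in_mono[OF mball_subset_concentric comp]) (use r in auto)
  define n where "n = measure \<nu> ?B"
  define m' where "m' = measure \<mu> ?B"
  have n: "n > 0" "emeasure \<nu> ?B = ennreal n" using nu_ball_pos[OF x0 r] by (auto simp: n_def nu.emeasure_eq_measure)
  have m': "m' > 0" "emeasure \<mu> ?B = ennreal m'" using pos by (auto simp: m'_def mu.emeasure_eq_measure)
  define s where "s = r powr (p * (1 - \<gamma>)) * (n / m')"
  have s: "s > 0" using r n m' by (simp add: s_def)
  obtain t :: "nat \<Rightarrow> real" where t: "\<And>j. 0 < t j" "\<And>j. t j \<le> r" "\<And>j s. 0 < s \<Longrightarrow> s < t j \<Longrightarrow> Phi s \<le> ennreal (q ^ j * \<phi>)"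
    "\<And>J. (\<Sum>j<J. q ^ j * ln (r / t j)) \<le> M1 / (1 - q)"
    by (rule dini_scales[OF _ lim r \<phi> q M1 dini]) (erule Phi_mono, (rule that; assumption))
  obtain \<eta> :: "nat \<Rightarrow> real^'n \<Rightarrow> real" where \<eta>: "\<And>j. \<eta> j \<in> Lip_0 \<Omega> ?B" "\<And>j y. y \<in> \<Omega> \<Longrightarrow> 0 \<le> \<eta> j y" "\<And>j y. y \<in> \<Omega> \<Longrightarrow> \<eta> j y \<le> 1"
    "\<And>j y. y \<in> mball x0 (\<tau> * r) \<Longrightarrow> \<eta> j y = 1"
    "\<And>j y. y \<in> \<Omega> \<Longrightarrow> y \<in> support_in \<Omega> (\<eta> (Suc j)) \<Longrightarrow> \<eta> j y = 1"
    "\<And>j. AE y in \<mu>. nq y (grad (\<eta> j) y) powr p \<le> (Cc * T ^ j / r powr \<gamma>) powr p * degen_weight p Q y"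
    by (rule cutoffs[OF x0 r compr]) (rule that; assumption)
  define D where "D j = support_in \<Omega> (\<eta> j)" for j
  have DB: "D j \<subseteq> ?B" for j using \<eta>(1)[of j] by (auto simp: D_def Lip_0_def)
  have D\<Omega>: "D j \<subseteq> \<Omega>" for j using DB mball_sub by (rule order.trans)
  have Dm[measurable]: "D j \<in> sets \<nu>" for j
    using borel_subset_sets[of "D j"] D\<Omega> by (auto simp: D_def support_in_def)
  have \<tau>D: "mball x0 (\<tau> * r) \<subseteq> D j" for j
  proof
    fix y assume y: "y \<in> mball x0 (\<tau> * r)"
    then have "y \<in> {x \<in> \<Omega>. \<eta> j x \<noteq> 0}" using \<eta>(4)[OF y, of j] mball_sub by (auto simp del: in_mball)
    then show "y \<in> D j" unfolding D_def support_in_def by (rule subsetD[OF closure_subset])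
  qed
  define Y where "Y j = (\<integral>\<^sup>+x\<in>D j. ennreal ((\<bar>u x\<bar> + \<kappa>) powr (k ^ j * p)) \<partial>\<nu>) / ennreal n" for j
  define G where "G j = step_const * (T ^ j) powr p * (r / t j) powr (\<gamma> * p)" for j
  have G: "G j > 0" for j unfolding G_def using step_const_pos T r t(1)[of j] by (intro mult_pos_pos) auto
  have step: "enn_powr (Y (Suc j)) (1 / k) \<le> ennreal (G j) * (ennreal s * Y j)" for j
  proof -
    \<comment> \<open>Comparable to \<open>t j\<close>, and small enough for \<open>2\<epsilon> < t j\<close>
        and \<open>32\<epsilon> \<le> r\<close>.\<close>
    define \<epsilon> where "\<epsilon> = t j / 128"
    have \<epsilon>: "\<epsilon> > 0" "32 * \<epsilon> \<le> r" using t(1,2)[of j] r by (auto simp: \<epsilon>_def)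
    \<comment> \<open>With this bound for the modulus the ratio \<open>k\<^sup>j a / \<kappa>\<close> does not
        depend on \<open>j\<close>.\<close>
    define a where "a = q ^ j * (\<phi> + d)"
    have a: "a > 0" using q \<phi> d by (simp add: a_def)
    have "Phi (2 * \<epsilon>) \<le> ennreal (q ^ j * \<phi>)" by (rule t(3)) (use \<epsilon> t(1)[of j] in \<open>auto simp: \<epsilon>_def\<close>)
    also have "\<dots> \<le> ennreal a" unfolding a_def using q d by (intro ennreal_leI mult_left_mono) auto
    finally have \<Phi>: "Phi (2 * \<epsilon>) \<le> ennreal a" .
    have kj: "k ^ j \<ge> 1" using k by (simp add: one_le_power)
    have "k ^ j * a / \<kappa> = 1 / lift_const"
      using k \<phi> d by (simp add: a_def \<kappa>_def q_def power_one_over)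
    then have small: "fefferman_const * (k ^ j * a / \<kappa>) powr (p - 1) * (2 powr p * 4 powr p) \<le> 1 / 4" using lift_const(2) by simp
    define c where "c = (Cc * T ^ j / r powr \<gamma>) powr p"
    define e where "e = \<epsilon> powr (- \<gamma> * p)"
    define Cm where "Cm = 2 powr p * 2 * (C1 powr p * 4 powr p * (2 * Cv + 2 * (2 powr p * p powr p + 1) * Cv + 2))"
    have Cm: "Cm \<ge> 0" using Cv by (simp add: Cm_def)
    have \<eta>1: "\<eta> j x = 1" if "x \<in> D (Suc j)" for x using \<eta>(5)[of x j] that D\<Omega>[of "Suc j"] by (auto simp: D_def)
    have c0: "c \<ge> 0" by (simp add: c_def)
    have \<eta>6: "AE y in \<mu>. nq y (grad (\<eta> j) y) powr p \<le> c * degen_weight p Q y" unfolding c_def by (rule \<eta>(6))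
    have "enn_powr ((\<integral>\<^sup>+x\<in>D (Suc j). ennreal ((\<bar>u x\<bar> + \<kappa>) powr (k ^ j * (k * p))) \<partial>\<nu>) / emeasure \<nu> ?B) (1 / k) \<le>
      ennreal (Cm * ((c + e) * r powr p)) * ((\<integral>\<^sup>+x\<in>D j. ennreal ((\<bar>u x\<bar> + \<kappa>) powr (k ^ j * p)) \<partial>\<nu>) / emeasure \<mu> ?B)"
      unfolding Cm_def D_def
      by (rule moser_step[where c = c and \<epsilon> = \<epsilon> and e = e and a = a and \<eta> = "\<eta> j"];
        (rule x0 r comp pos \<eta>(1) \<eta>6 c0 kj \<kappa> \<epsilon> a \<Phi> small Dm[unfolded D_def] e_def
          | (rule \<eta>(2) \<eta>(3) \<eta>1[unfolded D_def]; assumption)))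
    also have "(\<lambda>x. (\<bar>u x\<bar> + \<kappa>) powr (k ^ j * (k * p))) = (\<lambda>x. (\<bar>u x\<bar> + \<kappa>) powr (k ^ Suc j * p))" by (simp add: ac_simps)
    finally have "enn_powr (Y (Suc j)) (1 / k) \<le> ennreal (Cm * ((c + e) * r powr p)) * ((\<integral>\<^sup>+x\<in>D j. ennreal ((\<bar>u x\<bar> + \<kappa>) powr (k ^ j * p)) \<partial>\<nu>) / ennreal m')"
      by (simp add: Y_def n(2) m'(2) ac_simps)
    also have "(\<integral>\<^sup>+x\<in>D j. ennreal ((\<bar>u x\<bar> + \<kappa>) powr (k ^ j * p)) \<partial>\<nu>) / ennreal m' = ennreal (n / m') * Y j"
    proof -
      have "(\<integral>\<^sup>+x\<in>D j. ennreal ((\<bar>u x\<bar> + \<kappa>) powr (k ^ j * p)) \<partial>\<nu>) = Y j * ennreal n"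
        unfolding Y_def using n by (intro ennreal_divide_mult_cancel[symmetric]) auto
      then show ?thesis using n m' by (simp add: divide_ennreal[symmetric] divide_ennreal_def ac_simps)
    qed
    also have "ennreal (Cm * ((c + e) * r powr p)) * (ennreal (n / m') * Y j) \<le> ennreal (G j * r powr (p * (1 - \<gamma>))) * (ennreal (n / m') * Y j)"
    proof (intro mult_right_mono ennreal_leI)
      have "Cm * ((c + e) * r powr p) \<le> Cm * ((Cc powr p + 1) * 128 powr (\<gamma> * p) * (T ^ j) powr p * (r / t j) powr (\<gamma> * p) * r powr (p * (1 - \<gamma>)))"
        unfolding c_def e_def \<epsilon>_def by (intro mult_left_mono cutoff_cost r t Cm)
      then show "Cm * ((c + e) * r powr p) \<le> G j * r powr (p * (1 - \<gamma>))" unfolding G_def step_const_def Cm_def by (simp only: mult.assoc)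
    qed simp
    also have "\<dots> = ennreal (G j) * (ennreal s * Y j)"
    proof -
      have "ennreal s = ennreal (r powr (p * (1 - \<gamma>))) * ennreal (n / m')" unfolding s_def using n m' by (intro ennreal_mult) auto
      moreover have "ennreal (G j * r powr (p * (1 - \<gamma>))) = ennreal (G j) * ennreal (r powr (p * (1 - \<gamma>)))" using G[of j] by (intro ennreal_mult) auto
      ultimately show ?thesis by (simp only: mult.assoc)
    qed
    finally show ?thesis .
  qed
  define E where "E = limit_const * exp (\<gamma> * k / (k - 1) * M1)"
  have E: "E \<ge> 0" by (simp add: E_def limit_const_def)
  have Y0: "enn_powr (Y 0) (1 / p) \<le> ennreal z"
  proof (rule order.trans[OF _ Z0], rule enn_powr_mono)
    show "Y 0 \<le> (\<integral>\<^sup>+x\<in>?B. ennreal ((\<bar>u x\<bar> + \<kappa>) powr p) \<partial>\<nu>) / emeasure \<nu> ?B"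
      unfolding Y_def n(2) using DB[of 0] by (intro divide_right_mono_ennreal nn_integral_mono) (auto simp: indicator_def simp del: in_mball)
  qed (use p in simp)
  define \<sigma> where "\<sigma> J = (\<Sum>j<J. q ^ j / p)" for J
  have "(\<lambda>J. \<Sum>j<J. q ^ j) \<longlonglongrightarrow> 1 / (1 - q)" using geometric_sums[of q] q by (simp add: sums_def)
  then have "(\<lambda>J. (\<Sum>j<J. q ^ j) / p) \<longlonglongrightarrow> 1 / (1 - q) / p" using p by (intro tendsto_divide tendsto_const) auto
  moreover have "1 / (1 - q) / p = k / (p * (k - 1))" using k p by (simp add: q_def field_simps)
  ultimately have \<sigma>: "\<sigma> \<longlonglongrightarrow> k / (p * (k - 1))" by (simp add: \<sigma>_def[abs_def] sum_divide_distrib)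
  have ZJ: "enn_powr (Y J) (1 / (p * k ^ J)) \<le> ennreal (E * s powr \<sigma> J * z)" for J
  proof -
    have p0: "p > 0" using p by simp
    have P0: "(\<Prod>j<J. G j powr ((1 / k) ^ j / p)) \<ge> 0" by (intro prod_nonneg) simp
    have "enn_powr (Y J) (1 / (p * k ^ J)) \<le> ennreal ((\<Prod>j<J. G j powr ((1 / k) ^ j / p)) * s powr (\<Sum>j<J. (1 / k) ^ j / p)) * enn_powr (Y 0) (1 / p)"
      by (rule iterate_reverse_hoelder[where G = G and Y = Y, OF k p0 s G step])
    also have "\<dots> \<le> ennreal ((\<Prod>j<J. G j powr ((1 / k) ^ j / p)) * s powr (\<Sum>j<J. (1 / k) ^ j / p)) * ennreal z"
      by (intro mult_left_mono Y0) simp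
    also have "\<dots> \<le> ennreal (E * s powr \<sigma> J) * ennreal z"
    proof (intro mult_right_mono ennreal_leI)
      have "(\<Prod>j<J. G j powr ((1 / k) ^ j / p)) \<le> E"
        unfolding G_def E_def limit_const_def
        by (rule iteration_constant_bound[OF k p0 step_const_pos T \<gamma> t(1) t(2)]) (use t(4)[of J] in \<open>simp add: q_def\<close>)
      then show "(\<Prod>j<J. G j powr ((1 / k) ^ j / p)) * s powr (\<Sum>j<J. (1 / k) ^ j / p) \<le> E * s powr \<sigma> J"
        unfolding \<sigma>_def q_def by (intro mult_right_mono) auto
    qed simp
    also have "\<dots> = ennreal (E * s powr \<sigma> J * z)" using E z by (simp add: ennreal_mult)
    finally show ?thesis .
  qed
  have "esssup (restrict_space \<nu> (mball x0 (\<tau> * r))) (\<lambda>x. ennreal \<bar>u x\<bar>) \<le> ennreal (E * s powr (k / (p * (k - 1))) * z)"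
  proof (rule esssup_le_limit_of_moments[where n = n and a = "\<lambda>J. p * k ^ J" and b = "\<lambda>J. E * s powr \<sigma> J * z"])
    show "u \<in> borel_measurable \<nu>" by (rule solution_data(3))
    show "mball x0 (\<tau> * r) \<in> sets \<nu>" by simp
    show "emeasure \<nu> (mball x0 (\<tau> * r)) < top" by (simp add: nu.emeasure_eq_measure)
    show "p * k ^ J > 0" for J using p k by simp
    show "0 < n" by (rule n(1))
    have "(\<lambda>J. 1 / p * q ^ J) \<longlonglongrightarrow> 1 / p * 0" using q by (intro tendsto_mult tendsto_const LIMSEQ_power_zero) auto
    then show "(\<lambda>J. 1 / (p * k ^ J)) \<longlonglongrightarrow> 0" by (simp add: q_def power_one_over)
    show "(\<lambda>J. E * s powr \<sigma> J * z) \<longlonglongrightarrow> E * s powr (k / (p * (k - 1))) * z"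
      using s by (intro tendsto_intros \<sigma>) auto
    show "E * s powr \<sigma> J * z \<ge> 0" for J using E z by simp
    show "enn_powr ((\<integral>\<^sup>+x\<in>mball x0 (\<tau> * r). ennreal (\<bar>u x\<bar> powr (p * k ^ J)) \<partial>\<nu>) / ennreal n) (1 / (p * k ^ J)) \<le> ennreal (E * s powr \<sigma> J * z)" for J
    proof (rule order.trans[OF enn_powr_mono ZJ])
      have kJ: "p * k ^ J > 0" using p k by simp
      show "(\<integral>\<^sup>+x\<in>mball x0 (\<tau> * r). ennreal (\<bar>u x\<bar> powr (p * k ^ J)) \<partial>\<nu>) / ennreal n \<le> Y J"
        unfolding Y_def
      proof (intro divide_right_mono_ennreal nn_integral_mono mult_mono ennreal_leI)
        show "\<bar>u x\<bar> powr (p * k ^ J) \<le> (\<bar>u x\<bar> + \<kappa>) powr (k ^ J * p)" for x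
          unfolding mult.commute[of "k ^ J" p] using \<kappa> kJ by (intro powr_mono2) auto
        show "indicator (mball x0 (\<tau> * r)) x \<le> (indicator (D J) x :: ennreal)" for x
          using \<tau>D[of J] by (auto simp: indicator_def simp del: in_mball)
      qed auto
      show "0 < 1 / (p * k ^ J)" using kJ by simp
    qed
  qed
  then show ?thesis by (simp only: E_def s_def n_def m'_def)
qed

text \<open>
  The average of \<open>(\<bar>u\<bar> + \<kappa>)\<^sup>p\<close> is split into the average of
  \<open>\<bar>u\<bar>\<^sup>p\<close> and \<open>\<kappa>\<close>, and the auxiliary number tends
  to \<open>0\<close>. If \<open>\<mu>\<close> vanishes on the ball, the right hand side is
  infinite unless \<open>u\<close> vanishes there as well.
\<close>

lemma local_bound:
  assumes x0: "x0 \<in> \<Omega>" and r: "r > 0" and comp: "mball x0 (8 * r) \<Subset> \<Omega>"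
    and lim: "(Phi \<longlongrightarrow> 0) (at_right 0)" and M1: "M1 > 0"
    and dini: "(\<integral>\<^sup>+s\<in>{0<..<r}. Phi s / ennreal s \<partial>lborel) \<le> ennreal M1 * Phi r"
  shows "esssup (restrict_space \<nu> (mball x0 (\<tau> * r))) (\<lambda>y. ennreal \<bar>u y\<bar>)
    \<le> ennreal (4 * limit_const * lift_const * exp (\<gamma> * k / (k - 1) * M1)) *
       enn_powr (ennreal (r powr (p * (1 - \<gamma>))) * (emeasure \<nu> (mball x0 r) / emeasure \<mu> (mball x0 r))) (k / (p * (k - 1))) *
       (enn_powr ((\<integral>\<^sup>+y\<in>mball x0 r. ennreal (\<bar>u y\<bar> powr p) \<partial>\<nu>) / emeasure \<nu> (mball x0 r)) (1 / p) + Phi r)"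
    (is "?L \<le> ennreal ?C * enn_powr (?R * (?n / ?m)) ?s * (enn_powr (?I / ?n) (1 / p) + Phi r)")
proof -
  have um[measurable]: "u \<in> borel_measurable \<nu>" by (rule solution_data(3))
  have p0: "p > 0" "1 / p \<le> 1" using p by auto
  define n where "n = measure \<nu> (mball x0 r)"
  have n: "n > 0" "?n = ennreal n" using nu_ball_pos[OF x0 r] by (auto simp: n_def nu.emeasure_eq_measure)
  have C0: "limit_const > 0" "limit_const * exp (\<gamma> * k / (k - 1) * M1) > 0" by (auto simp: limit_const_def)
  have K1: "lift_const \<ge> 1" by (rule lift_const(1))
  have Cpos: "?C > 0" using C0 K1 by simp
  obtain \<phi> where \<phi>: "Phi r = ennreal \<phi>" "\<phi> \<ge> 0" using Phi_fin[OF r] by (cases "Phi r" rule: ennreal_cases) auto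
  have "?I \<le> mass u" by (intro nn_integral_mono) (auto simp: indicator_def)
  then have "?I < top" using solution_data(4) by (rule order.strict_trans1)
  then obtain i where i: "?I = ennreal i" "i \<ge> 0" by (cases ?I rule: ennreal_cases) auto
  define U where "U = (i / n) powr (1 / p)"
  have U: "U \<ge> 0" "enn_powr (?I / ?n) (1 / p) = ennreal U" using i n by (auto simp: U_def divide_ennreal)
  show ?thesis
  proof (cases "?m = 0")
    case False
    define m' where "m' = measure \<mu> (mball x0 r)"
    have m': "m' > 0" "?m = ennreal m'" using False by (auto simp: m'_def mu.emeasure_eq_measure zero_less_measure_iff)
    have pos: "?m > 0" using m' by simp
    define s where "s = r powr (p * (1 - \<gamma>)) * (n / m')"
    define F where "F = limit_const * exp (\<gamma> * k / (k - 1) * M1) * s powr ?s"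
    have F: "F \<ge> 0" using C0 by (simp add: F_def)
    have sn: "s > 0" "?R * (?n / ?m) = ennreal s"
    proof -
      show "s > 0" using n m' r by (simp add: s_def)
      have "?n / ?m = ennreal (n / m')" using n m' by (simp add: divide_ennreal)
      then show "?R * (?n / ?m) = ennreal s" unfolding s_def using n m' by (simp only: ennreal_mult[symmetric] powr_ge_zero divide_nonneg_nonneg less_imp_le)
    qed
    have dini': "(\<integral>\<^sup>+s\<in>{0<..<r}. Phi s / ennreal s \<partial>lborel) \<le> ennreal (M1 * \<phi>)"
      using dini M1 \<phi> by (simp add: ennreal_mult)
    have bound: "?L \<le> ennreal (F * (4 * (U + lift_const * (\<phi> + d))))" if d: "d > 0" for d
    proof -
      define \<kappa> where "\<kappa> = lift_const * (\<phi> + d)"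
      have \<kappa>: "\<kappa> \<ge> 0" using K1 \<phi> d by (simp add: \<kappa>_def)
      have "(\<integral>\<^sup>+x\<in>mball x0 r. ennreal ((\<bar>u x\<bar> + \<kappa>) powr p) \<partial>\<nu>)
        \<le> (\<integral>\<^sup>+x. ennreal (2 powr p) * (ennreal (\<bar>u x\<bar> powr p) * indicator (mball x0 r) x + ennreal (\<kappa> powr p) * indicator (mball x0 r) x) \<partial>\<nu>)"
      proof (rule nn_integral_mono)
        fix x
        have "(\<bar>u x\<bar> + \<kappa>) powr p \<le> 2 powr p * (\<bar>u x\<bar> powr p + \<kappa> powr p)" using \<kappa> p0 by (intro powr_add_le) auto
        then have "ennreal ((\<bar>u x\<bar> + \<kappa>) powr p) \<le> ennreal (2 powr p) * (ennreal (\<bar>u x\<bar> powr p) + ennreal (\<kappa> powr p))"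
          by (simp add: ennreal_leI flip: ennreal_mult ennreal_plus)
        then show "ennreal ((\<bar>u x\<bar> + \<kappa>) powr p) * indicator (mball x0 r) x \<le> ennreal (2 powr p) * (ennreal (\<bar>u x\<bar> powr p) * indicator (mball x0 r) x + ennreal (\<kappa> powr p) * indicator (mball x0 r) x)"
          by (auto simp: indicator_def simp del: in_mball)
      qed
      also have "\<dots> = ennreal (2 powr p) * (?I + ennreal (\<kappa> powr p) * ?n)"
        by (simp add: nn_integral_cmult nn_integral_add nn_integral_cmult_indicator)
      finally have "(\<integral>\<^sup>+x\<in>mball x0 r. ennreal ((\<bar>u x\<bar> + \<kappa>) powr p) \<partial>\<nu>) / ?n \<le> (ennreal (2 powr p) * (?I + ennreal (\<kappa> powr p) * ?n)) / ?n"
        by (rule divide_right_mono_ennreal)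
      also have "\<dots> = ennreal (2 powr p) * (?I / ?n + ennreal (\<kappa> powr p))"
        unfolding i(1) n(2) using i(2) n(1) by (simp add: divide_ennreal field_simps flip: ennreal_mult ennreal_plus)
      finally have "enn_powr ((\<integral>\<^sup>+x\<in>mball x0 r. ennreal ((\<bar>u x\<bar> + \<kappa>) powr p) \<partial>\<nu>) / ?n) (1 / p)
        \<le> enn_powr (ennreal (2 powr p) * (?I / ?n + ennreal (\<kappa> powr p))) (1 / p)" using p0 by (intro enn_powr_mono) auto
      also have "\<dots> = ennreal 2 * enn_powr (?I / ?n + ennreal (\<kappa> powr p)) (1 / p)" using p0 by (simp add: enn_powr_mult powr_powr)
      also have "\<dots> \<le> ennreal 2 * (2 * (enn_powr (?I / ?n) (1 / p) + enn_powr (ennreal (\<kappa> powr p)) (1 / p)))"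
        using p0 by (intro mult_left_mono enn_powr_add_le) auto
      also have "\<dots> = ennreal 2 * (ennreal 2 * (ennreal U + ennreal \<kappa>))" using p0 \<kappa> by (simp add: U(2) powr_powr)
      also have "\<dots> = ennreal (4 * (U + \<kappa>))" using U(1) \<kappa> by (simp only: ennreal_mult[symmetric] ennreal_plus[symmetric] add_nonneg_nonneg mult_nonneg_nonneg zero_le_numeral) simp
      finally have Z0: "enn_powr ((\<integral>\<^sup>+x\<in>mball x0 r. ennreal ((\<bar>u x\<bar> + \<kappa>) powr p) \<partial>\<nu>) / ?n) (1 / p) \<le> ennreal (4 * (U + \<kappa>))" .
      have z: "4 * (U + \<kappa>) \<ge> 0" using U \<kappa> by simp
      show ?thesis
        using ball_estimate[OF x0 r comp pos lim \<phi> less_imp_le[OF M1] dini' d \<kappa>_def z Z0]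
        by (simp only: F_def s_def n_def m'_def \<kappa>_def)
    qed
    have "(\<lambda>j. F * (4 * (U + lift_const * (\<phi> + 1 / real (Suc j))))) \<longlonglongrightarrow> F * (4 * (U + lift_const * (\<phi> + 0)))"
      by (intro tendsto_intros LIMSEQ_Suc[OF lim_1_over_n])
    then have "(\<lambda>j. ennreal (F * (4 * (U + lift_const * (\<phi> + 1 / real (Suc j)))))) \<longlonglongrightarrow> ennreal (F * (4 * (U + lift_const * (\<phi> + 0))))"
      by (rule tendsto_ennrealI)
    then have "?L \<le> ennreal (F * (4 * (U + lift_const * (\<phi> + 0))))"
      by (rule LIMSEQ_le_const) (use bound in auto)
    also have "\<dots> \<le> ennreal (?C * s powr ?s * (U + \<phi>))"
    proof (rule ennreal_leI)
      have "U \<le> lift_const * U" using K1 U(1) by (simp add: mult_le_cancel_right1)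
      then have le: "F * 4 * (U + lift_const * \<phi>) \<le> F * 4 * (lift_const * (U + \<phi>))" using F by (intro mult_left_mono) (auto simp: distrib_left)
      have "F * (4 * (U + lift_const * (\<phi> + 0))) = F * 4 * (U + lift_const * \<phi>)" by simp
      also note le
      also have "F * 4 * (lift_const * (U + \<phi>)) = ?C * s powr ?s * (U + \<phi>)" unfolding F_def by (simp only: ac_simps)
      finally show "F * (4 * (U + lift_const * (\<phi> + 0))) \<le> ?C * s powr ?s * (U + \<phi>)" .
    qed
    also have "\<dots> = ennreal ?C * ennreal (s powr ?s) * (ennreal U + ennreal \<phi>)"
      using Cpos U(1) \<phi>(2) by (simp only: ennreal_mult[symmetric] ennreal_plus[symmetric] less_imp_le powr_ge_zero add_nonneg_nonneg mult_nonneg_nonneg)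
    also have "\<dots> = ennreal ?C * enn_powr (?R * (?n / ?m)) ?s * (enn_powr (?I / ?n) (1 / p) + Phi r)"
      unfolding sn(2) U(2) \<phi>(1) using sn(1) by (simp add: less_imp_le)
    finally show ?thesis .
  next
    case True
    have "?R > 0" using r by simp
    then have top: "ennreal ?C * enn_powr (?R * (?n / ?m)) ?s = top"
    proof -
      have c: "ennreal ?C \<noteq> 0" using Cpos by (simp only: ennreal_eq_0_iff not_le simp_thms)
      have "?R * (?n / ?m) = top" unfolding True using n r by (simp add: ennreal_divide_zero ennreal_mult_top)
      then show ?thesis using c by (simp only: enn_powr_top ennreal_mult_top if_False)
    qed
    show ?thesis
    proof (cases "ennreal U + Phi r = 0")
      case False
      then show ?thesis unfolding top U(2) by (simp only: ennreal_top_mult if_False top_greatest)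
    next
      case zero: True
      then have "U = 0" using U(1) by simp
      then have "?I = 0" using i n by (simp add: U_def)
      then have z: "AE y in \<nu>. ennreal (\<bar>u y\<bar> powr p) * indicator (mball x0 r) y = 0"
        by (subst (asm) nn_integral_0_iff_AE) auto
      have sub: "mball x0 (\<tau> * r) \<subseteq> mball x0 r" by (rule mball_subset_concentric) (use \<tau> r in simp)
      from z have "AE y in \<nu>. y \<in> mball x0 (\<tau> * r) \<longrightarrow> ennreal \<bar>u y\<bar> \<le> 0"
        by (rule eventually_mono) (use subsetD[OF sub] in \<open>auto simp: indicator_def simp del: in_mball split: if_splits\<close>)
      moreover have "mball x0 (\<tau> * r) \<inter> space \<nu> \<in> sets \<nu>" by (intro sets.Int mball_sets sets.top)
      ultimately have "AE y in restrict_space \<nu> (mball x0 (\<tau> * r)). ennreal \<bar>u y\<bar> \<le> 0"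
        by (simp only: AE_restrict_space_iff)
      moreover have "u \<in> borel_measurable (restrict_space \<nu> (mball x0 (\<tau> * r)))" by (rule measurable_restrict_space1) measurable
      ultimately have "?L \<le> 0" by (intro esssup_I) auto
      then show ?thesis by (rule order.trans) simp
    qed
  qed
qed

end

text \<open>
  Used with \<open>a = p - 1\<close>: the exponent of local integrability of \<open>f\<close> is
  at least \<open>p - 1\<close>, so that the source is locally integrable.
\<close>

lemma (in setting) Lp_loc_powr_finite:
  assumes f: "Lp_loc \<nu> \<Omega> \<sigma> f" and a: "0 < a" "a \<le> \<sigma>" and B: "B \<Subset> \<Omega>"
  shows "(\<integral>\<^sup>+z\<in>B. ennreal \<bar>\<bar>f z\<bar> powr a\<bar> \<partial>\<nu>) < top"
proof -
  let ?K = "closure B"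
  have K: "compact ?K" "?K \<subseteq> \<Omega>" using B by (auto simp: compactly_in_def)
  have [measurable]: "f \<in> borel_measurable \<nu>" using f by (simp add: Lp_loc_def)
  have [measurable]: "?K \<in> sets \<nu>" by (rule borel_subset_sets) (use K in auto)
  have int: "integrable \<nu> (\<lambda>x. indicator ?K x *\<^sub>R \<bar>f x\<bar> powr \<sigma>)"
    using f K unfolding Lp_loc_def set_integrable_def by blast
  have "(\<integral>\<^sup>+z\<in>B. ennreal \<bar>\<bar>f z\<bar> powr a\<bar> \<partial>\<nu>) \<le> (\<integral>\<^sup>+z. indicator ?K z + ennreal (indicator ?K z *\<^sub>R \<bar>f z\<bar> powr \<sigma>) \<partial>\<nu>)"
  proof (rule nn_integral_mono)
    fix z
    have "\<bar>f z\<bar> powr a \<le> 1 + \<bar>f z\<bar> powr \<sigma>"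
    proof (cases "\<bar>f z\<bar> \<le> 1")
      case True
      then have "\<bar>f z\<bar> powr a \<le> 1 powr a" using a by (intro powr_mono2) auto
      then show ?thesis by (simp add: add_increasing2)
    next
      case False
      then have "\<bar>f z\<bar> powr a \<le> \<bar>f z\<bar> powr \<sigma>" using a by (intro powr_mono) auto
      then show ?thesis by simp
    qed
    then have le: "ennreal (\<bar>f z\<bar> powr a) \<le> 1 + ennreal (\<bar>f z\<bar> powr \<sigma>)" by (metis ennreal_1 ennreal_leI ennreal_plus powr_ge_zero zero_le_one)
    show "ennreal \<bar>\<bar>f z\<bar> powr a\<bar> * indicator B z \<le> indicator ?K z + ennreal (indicator ?K z *\<^sub>R \<bar>f z\<bar> powr \<sigma>)"
    proof (cases "z \<in> B")
      case True
      then have "z \<in> ?K" by (rule subsetD[OF closure_subset])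
      then show ?thesis using True le by simp
    qed simp
  qed
  also have "\<dots> = emeasure \<nu> ?K + (\<integral>\<^sup>+z. ennreal (indicator ?K z *\<^sub>R \<bar>f z\<bar> powr \<sigma>) \<partial>\<nu>)"
    by (subst nn_integral_add) auto
  also have "\<dots> < top"
  proof -
    have "(\<integral>\<^sup>+z. ennreal (norm (indicator ?K z *\<^sub>R \<bar>f z\<bar> powr \<sigma>)) \<partial>\<nu>) < top"
      using int by (simp add: integrable_iff_bounded)
    then show ?thesis by (simp add: nu.emeasure_eq_measure)
  qed
  finally show ?thesis .
qed

theorem theorem5p4:
  fixes \<Omega> :: "(real^'n) set"
    and \<rho> :: "real^'n \<Rightarrow> real^'n \<Rightarrow> real"
    and h m f u :: "real^'n \<Rightarrow> real"
    and g :: "real^'n \<Rightarrow> real^'n"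
    and Q :: "real^'n \<Rightarrow> real^'n^'n"
    and \<mu> \<nu> :: "(real^'n) measure"
    and p k \<gamma> \<tau> :: real
  assumes p: "1 < p"
    and domain: "open \<Omega>" "connected \<Omega>" "bounded \<Omega>" "\<Omega> \<noteq> {}"
    and metric: "Metric_space \<Omega> \<rho>" "Metric_space.mtopology \<Omega> \<rho> = top_of_set \<Omega>"
    and weights: "\<And>x. 0 \<le> h x" "\<And>x. 0 \<le> m x" "L1_loc lebesgue UNIV h" "L1_loc lebesgue UNIV m"
    and measures: "\<mu> = weighted_measure \<Omega> h" "\<nu> = weighted_measure \<Omega> m"
    and Q: "Q \<in> borel_measurable \<mu>" "\<And>x. x \<in> \<Omega> \<Longrightarrow> psd_matrix (Q x)"
    and v: "L1_loc \<mu> \<Omega> (degen_weight p Q)"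
    and H1: "geodesic_hyp \<Omega> \<rho>"
    and H2: "doubling_hyp \<Omega> \<rho> \<mu> \<nu>"
    and H3: "weights_hyp \<Omega> \<mu> \<nu> Q p"
    and H4: "poincare_hyp \<Omega> \<rho> \<mu> \<nu> Q"
    and H5: "sobolev_hyp \<Omega> \<rho> \<mu> \<nu> Q"
    and k: "k > 1" "\<exists>C1>0. sobolev_ineq \<Omega> \<rho> \<mu> \<nu> Q p k C1"
    and H6: "cutoff_hyp \<Omega> \<rho> \<mu> Q p \<gamma> \<tau>"
    and f: "(\<lambda>x. \<bar>f x\<bar> powr (p - 1)) \<in> SK_M' \<Omega> \<rho> \<mu> \<nu> p"
           "Lp_loc \<nu> \<Omega> (p - p * (k - 1) / (p * k - 1)) f"
    and sol: "weak_solution \<Omega> \<mu> \<nu> Q p f u g"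
  shows "\<exists>C>0. \<forall>x\<in>\<Omega>. \<forall>r>0. mB \<Omega> \<rho> x (8 * r) \<Subset> \<Omega> \<longrightarrow>
    (\<forall>M1>0.
       SK_Dini \<Omega> \<rho> \<mu> \<nu> p (\<lambda>x. \<bar>f x\<bar> powr (p - 1)) r
         \<le> ennreal M1 * enn_powr (SK_Phi \<Omega> \<rho> \<mu> \<nu> p (\<lambda>x. \<bar>f x\<bar> powr (p - 1)) r) (1 / (p - 1)) \<longrightarrow>
       esssup (restrict_space \<nu> (mB \<Omega> \<rho> x (\<tau> * r))) (\<lambda>y. ennreal \<bar>u y\<bar>)
         \<le> ennreal (C * exp (\<gamma> * k / (k - 1) * M1)) *
            enn_powr (ennreal (r powr (p * (1 - \<gamma>))) *
                        (emeasure \<nu> (mB \<Omega> \<rho> x r) / emeasure \<mu> (mB \<Omega> \<rho> x r))) (k / (p * (k - 1))) *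
            (enn_powr ((\<integral>\<^sup>+y\<in>mB \<Omega> \<rho> x r. ennreal (\<bar>u y\<bar> powr p) \<partial>\<nu>) / emeasure \<nu> (mB \<Omega> \<rho> x r)) (1 / p) +
             enn_powr (SK_Phi \<Omega> \<rho> \<mu> \<nu> p (\<lambda>x. \<bar>f x\<bar> powr (p - 1)) r) (1 / (p - 1))))"
proof -
  let ?V = "\<lambda>x. \<bar>f x\<bar> powr (p - 1)"
  obtain A1 A2 where A12: "A1 > 0" "A2 > 0" "\<forall>x\<in>\<Omega>. \<forall>r>0. mB \<Omega> \<rho> x (2 * r) \<Subset> \<Omega> \<longrightarrow>
        emeasure \<nu> (mB \<Omega> \<rho> x (2 * r)) \<le> ennreal A1 * emeasure \<nu> (mB \<Omega> \<rho> x r) \<and>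
        emeasure \<mu> (mB \<Omega> \<rho> x (2 * r)) \<le> ennreal A2 * emeasure \<mu> (mB \<Omega> \<rho> x r)"
    using H2 unfolding doubling_hyp_def by (elim conjE exE) (rule that; assumption)
  define A where "A = max 1 (max A1 A2)"
  have doubling: "emeasure \<nu> (mB \<Omega> \<rho> x (2 * r)) \<le> ennreal A * emeasure \<nu> (mB \<Omega> \<rho> x r)"
    "emeasure \<mu> (mB \<Omega> \<rho> x (2 * r)) \<le> ennreal A * emeasure \<mu> (mB \<Omega> \<rho> x r)"
    if x: "x \<in> \<Omega>" "r > 0" "mB \<Omega> \<rho> x (2 * r) \<Subset> \<Omega>" for x r
  proof -
    have d: "emeasure \<nu> (mB \<Omega> \<rho> x (2 * r)) \<le> ennreal A1 * emeasure \<nu> (mB \<Omega> \<rho> x r) \<and>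
        emeasure \<mu> (mB \<Omega> \<rho> x (2 * r)) \<le> ennreal A2 * emeasure \<mu> (mB \<Omega> \<rho> x r)"
      using A12(3)[rule_format, OF x] .
    have "ennreal A1 * emeasure \<nu> (mB \<Omega> \<rho> x r) \<le> ennreal A * emeasure \<nu> (mB \<Omega> \<rho> x r)"
      "ennreal A2 * emeasure \<mu> (mB \<Omega> \<rho> x r) \<le> ennreal A * emeasure \<mu> (mB \<Omega> \<rho> x r)"
      by (intro mult_right_mono ennreal_leI; simp add: A_def)+
    with d show "emeasure \<nu> (mB \<Omega> \<rho> x (2 * r)) \<le> ennreal A * emeasure \<nu> (mB \<Omega> \<rho> x r)"
      "emeasure \<mu> (mB \<Omega> \<rho> x (2 * r)) \<le> ennreal A * emeasure \<mu> (mB \<Omega> \<rho> x r)" by (auto intro: order.trans)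
  qed
  have ac: "absolutely_continuous \<nu> \<mu>"
    and nupos: "\<And>E. E \<in> sets lebesgue \<Longrightarrow> E \<subseteq> \<Omega> \<Longrightarrow> emeasure lebesgue E > 0 \<Longrightarrow> emeasure \<nu> E > 0"
    using H3 unfolding weights_hyp_def by simp_all
  obtain Cv where Cv: "Cv > 0" "\<forall>E. compact E \<and> E \<subseteq> \<Omega> \<longrightarrow> (\<integral>\<^sup>+x\<in>E. ennreal (degen_weight p Q x) \<partial>\<mu>) \<le> ennreal Cv * emeasure \<nu> E"
    using H3 unfolding weights_hyp_def by (elim conjE exE) (rule that; assumption)
  obtain C0 where C0: "C0 > 0" "\<forall>x\<in>\<Omega>. \<forall>r>0. mB \<Omega> \<rho> x r \<Subset> \<Omega> \<longrightarrow> (\<forall>u\<in>Lip_loc \<Omega>.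
        (\<integral>\<^sup>+y\<in>mB \<Omega> \<rho> x r. ennreal \<bar>u y - average \<nu> (mB \<Omega> \<rho> x r) u\<bar> \<partial>\<nu>) / emeasure \<nu> (mB \<Omega> \<rho> x r)
        \<le> ennreal C0 * (ennreal r / emeasure \<mu> (mB \<Omega> \<rho> x r)) *
           (\<integral>\<^sup>+y\<in>mB \<Omega> \<rho> x r. ennreal (norm (matrix_sqrt (Q y) *v grad u y)) \<partial>\<mu>))"
    using H4 unfolding poincare_hyp_def by (elim conjE exE) (rule that; assumption)
  obtain C1 where C1: "C1 > 0" "sobolev_ineq \<Omega> \<rho> \<mu> \<nu> Q p k C1" using k(2) by blast
  have \<gamma>\<tau>: "\<gamma> > 0" "0 < \<tau>" "\<tau> < 1" using H6 unfolding cutoff_hyp_def by simp_all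
  obtain Cc T where CcT: "Cc > 0" "T \<ge> 1" "\<forall>x\<in>\<Omega>. \<forall>r>0. mB \<Omega> \<rho> x r \<Subset> \<Omega> \<longrightarrow>
        (\<exists>\<phi> :: nat \<Rightarrow> real^'n \<Rightarrow> real. \<forall>j.
           \<phi> j \<in> Lip_0 \<Omega> (mB \<Omega> \<rho> x r) \<and>
           (\<forall>y\<in>\<Omega>. 0 \<le> \<phi> j y \<and> \<phi> j y \<le> 1) \<and>
           (\<forall>y\<in>mB \<Omega> \<rho> x (\<tau> * r). \<phi> j y = 1) \<and>
           support_in \<Omega> (\<phi> (Suc j)) \<subseteq> {y\<in>mB \<Omega> \<rho> x r. \<phi> j y = 1} \<and>
           esssup \<mu> (\<lambda>y. ennreal (norm (matrix_sqrt (Q y) *v grad (\<phi> j) y)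
                                      / degen_weight p Q y powr (1 / p)))
             \<le> ennreal (Cc * T ^ j / r powr \<gamma>))"
    using H6 unfolding cutoff_hyp_def by (elim conjE exE) (rule that; assumption)
  interpret base: setting \<Omega> \<rho> h m Q \<mu> \<nu> p A Cv
    by (rule setting.intro; ((rule p domain metric weights measures Q v Cv(1) ac doubling nupos; assumption)
      | (rule Cv(2)[rule_format, OF conjI]; assumption) | (simp add: A_def; fail)))
  define \<sigma> where "\<sigma> = p - p * (k - 1) / (p * k - 1)"
  \<comment> \<open>The fraction in the exponent is at most \<open>1\<close>, since \<open>p \<ge> 1\<close>.\<close>
  have "p * k > 1" using p k(1) mult_strict_mono[of 1 p 1 k] by simp
  then have \<sigma>: "p - 1 \<le> \<sigma>" using p by (simp add: \<sigma>_def pos_divide_le_eq algebra_simps)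
  have Vfin: "(\<integral>\<^sup>+z\<in>mB \<Omega> \<rho> x s. ennreal \<bar>?V z\<bar> \<partial>\<nu>) < top" if "mB \<Omega> \<rho> x s \<Subset> \<Omega>" for x s
    by (rule base.Lp_loc_powr_finite[OF f(2)[folded \<sigma>_def] _ \<sigma> that]) (use p in simp)
  have fm: "f \<in> borel_measurable \<nu>" using f(2) by (simp add: Lp_loc_def)
  have Phifin: "SK_Phi \<Omega> \<rho> \<mu> \<nu> p ?V s < top" if "s > 0" for s
    using f(1) that by (simp add: SK_M'_def SK_M_def SK_M_tilde_def)
  have Phi0: "(SK_Phi \<Omega> \<rho> \<mu> \<nu> p ?V \<longlongrightarrow> 0) (at_right 0)"
    using f(1) by (simp add: SK_M'_def SK_M_def)
  interpret sol: setting_solution \<Omega> \<rho> h m Q \<mu> \<nu> p A Cv C0 \<gamma> \<tau> Cc T k C1 f u g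
  proof (unfold_locales, goal_cases)
    case (3 x r u)
    then show ?case using C0(2) by (simp only: Ball_def)
  next
    case (9 x r)
    then show ?case using CcT(3) by (simp only: Ball_def)
  qed (rule H1 C0(1) \<gamma>\<tau> CcT(1,2) k(1) C1 fm sol | (rule Vfin Phifin; assumption))+
  have V: "sol.V = ?V" by (rule ext) (rule sol.V_def)
  have Phi: "sol.Phi s = enn_powr (SK_Phi \<Omega> \<rho> \<mu> \<nu> p ?V s) (1 / (p - 1))" for s
    unfolding sol.Phi_def V ..
  have lim: "(sol.Phi \<longlongrightarrow> 0) (at_right 0)"
    unfolding Phi[abs_def] by (rule enn_powr_tendsto_0[OF Phi0]) (use p in simp)
  let ?C = "4 * sol.limit_const * sol.lift_const"
  show ?thesis
  proof (intro exI[of _ ?C] conjI ballI allI impI)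
    show "?C > 0" using sol.lift_const(1) by (simp add: sol.limit_const_def)
    fix x r M1 :: _
    assume x: "x \<in> \<Omega>" and r: "0 < (r::real)" and comp: "mB \<Omega> \<rho> x (8 * r) \<Subset> \<Omega>" and M1: "0 < (M1::real)"
      and dini: "SK_Dini \<Omega> \<rho> \<mu> \<nu> p ?V r \<le> ennreal M1 * enn_powr (SK_Phi \<Omega> \<rho> \<mu> \<nu> p ?V r) (1 / (p - 1))"
    have dini': "(\<integral>\<^sup>+s\<in>{0<..<r}. sol.Phi s / ennreal s \<partial>lborel) \<le> ennreal M1 * sol.Phi r"
      using dini unfolding SK_Dini_def Phi .
    show "esssup (restrict_space \<nu> (mB \<Omega> \<rho> x (\<tau> * r))) (\<lambda>y. ennreal \<bar>u y\<bar>)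
         \<le> ennreal (?C * exp (\<gamma> * k / (k - 1) * M1)) *
            enn_powr (ennreal (r powr (p * (1 - \<gamma>))) *
                        (emeasure \<nu> (mB \<Omega> \<rho> x r) / emeasure \<mu> (mB \<Omega> \<rho> x r))) (k / (p * (k - 1))) *
            (enn_powr ((\<integral>\<^sup>+y\<in>mB \<Omega> \<rho> x r. ennreal (\<bar>u y\<bar> powr p) \<partial>\<nu>) / emeasure \<nu> (mB \<Omega> \<rho> x r)) (1 / p) +
             enn_powr (SK_Phi \<Omega> \<rho> \<mu> \<nu> p ?V r) (1 / (p - 1)))"
      using sol.local_bound[OF x r comp lim M1 dini'] unfolding Phi .
  qed
qed

end
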